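(* Let $\mathrm{Cyl}\colon \mathrm{dgCat}_s\to\mathrm{dgCat}_s$ be the assignment $\mathcal{C}\mapsto \mathrm{Cyl}(\mathcal{C})$, $F\mapsto \mathrm{Cyl}(F)$ described in the context, together with $i_1,i_2\colon 1_{\mathrm{dgCat}_s}\Rightarrow \mathrm{Cyl}$ and $p\colon \mathrm{Cyl}\Rightarrow 1_{\mathrm{dgCat}_s}$ described in the context. Let $\mathrm{dgCat}$ carry any one of the Dwyer--Kan, quasi-equiconic or Morita model structures. Then $\mathrm{Cyl}$ is a functor, $i_1,i_2,p$ are natural transformations, and $\mathrm{Cyl}$ is a cylinder functor; that is, for every $\mathcal{C}\in\mathrm{dgCat}_s$: (1) the composition $p\circ(i_1\amalg i_2)\colon \mathcal{C}\amalg\mathcal{C}\to\mathrm{Cyl}(\mathcal{C})\to\mathcal{C}$ is the codiagonal of $\mathcal{C}$; (2) $i_1\amalg i_2\colon\mathcal{C}\amalg\mathcal{C}\to\mathrm{Cyl}(\mathcal{C})$ is a cofibration; (3) $p\colon\mathrm{Cyl}(\mathcal{C})\to\mathcal{C}$ is a weak equivalence and a fibration.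
   Context: Fix a commutative ring $k$. A dg category is a small category enriched in cochain complexes of $k$-modules (differential $d$ of degree $+1$, $d(x\circ y)=dx\circ y+(-1)^{|x|}x\circ dy$); $\mathrm{dgCat}$ is the category of dg categories and dg functors. Morphisms whose degree is mentioned are homogeneous. Semifree: a dg category $\mathcal{C}$ is semifree if its morphisms, as an algebra (under composition and $k$-linear combinations, with identities), are freely generated by a set $\{f_i\}$ of homogeneous morphisms indexed by an ordinal, such that $df_i$ is generated by $\{f_j\mid j<i\}$ (and identities); $\{f_i\}$ is a set of generating morphisms. A dg functor $F\colon\mathcal{C}\to\mathcal{D}$ is a semifree extension by a set of objects $R$ and a set of morphisms $\{f_i\}$ if $F$ is an inclusion, the objects of $\mathcal{D}$ are those of $F(\mathcal{C})$ together with $R$, and the morphisms of $\mathcal{D}$, as an algebra, are the free extension of the morphisms of $F(\mathcal{C})$ by $\{f_i\}$ (indexed by an ordinal) with $df_i$ generated by the morphisms of $F(\mathcal{C})$ and $\{f_j\mid j<i\}$. $\mathrm{dgCat}_s$ is the full subcategory of $\mathrm{dgCat}$ of semifree dg categories. For every semifree dg category a set of generating morphisms is fixed. Model structures: in the Dwyer--Kan, quasi-equiconic, Morita model structure the weak equivalences are respectively the quasi-equivalences, the dg functors inducing a quasi-equivalence $\mathrm{Tw}\,\mathcal{C}\to\mathrm{Tw}\,\mathcal{D}$ (twisted complexes, i.e. pretriangulated envelopes), and the dg functors inducing a quasi-equivalence $\mathrm{Perf}\,\mathcal{C}\to\mathrm{Perf}\,\mathcal{D}$ (idempotent completions of $\mathrm{Tw}$).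 In all three, cofibrations are the retracts of semifree extensions, and fibrations are the dg functors with the right lifting property against cofibrations that are weak equivalences. Cylinder object: for semifree $\mathcal{C}$, let $i_1,i_2\colon\mathcal{C}\to\mathcal{C}\amalg\mathcal{C}$ be the two inclusions. $\mathrm{Cyl}(\mathcal{C})$ is the semifree extension of $\mathcal{C}\amalg\mathcal{C}$ by: for each object $C\in\mathcal{C}$, morphisms $t_C\colon i_1(C)\to i_2(C)$, $t'_C\colon i_2(C)\to i_1(C)$, $\hat t_C\colon i_1(C)\to i_1(C)$, $\check t_C\colon i_2(C)\to i_2(C)$, $\bar t_C\colon i_1(C)\to i_2(C)$ with $|t_C|=|t'_C|=0$, $|\hat t_C|=|\check t_C|=-1$, $|\bar t_C|=-2$, $$dt_C=dt'_C=0,\quad d\hat t_C=1_{i_1(C)}-t'_C\circ t_C,\quad d\check t_C=1_{i_2(C)}-t_C\circ t'_C,\quad d\bar t_C=t_C\circ\hat t_C-\check t_C\circ t_C;$$ and for each generating morphism $f\colon A\to B$ of $\mathcal{C}$ a morphism $t_f\colon i_1(A)\to i_2(B)$ of degree $|f|-1$ with $$dt_f=(-1)^{|f|}(i_2(f)\circ t_A-t_B\circ i_1(f))+t_{df}.$$ Here, for any morphism $\theta=c1_A+\sum_{i=1}^m c_i f_{i,n_i}\circ\cdots\circ f_{i,1}\in\hom^*_{\mathcal{C}}(A,B)$ with $f_{i,j}$ generating morphisms and $c,c_i\in k$ ($c=0$ if $A\ne B$), $$t_\theta:=\sum_{i=1}^m c_i\sum_{j=1}^{n_i}(-1)^{|f_{i,j-1}|+\cdots+|f_{i,1}|}i_2(f_{i,n_i})\circ\cdots\circ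 i_2(f_{i,j+1})\circ t_{f_{i,j}}\circ i_1(f_{i,j-1})\circ\cdots\circ i_1(f_{i,1}).$$ $i_1,i_2$ also denote the resulting dg functors $\mathcal{C}\to\mathrm{Cyl}(\mathcal{C})$. The dg functor $p\colon\mathrm{Cyl}(\mathcal{C})\to\mathcal{C}$ is given by $i_1(C),i_2(C)\mapsto C$; $t_C,t'_C\mapsto 1_C$; $\hat t_C,\check t_C,\bar t_C\mapsto 0$; $i_1(f),i_2(f)\mapsto f$; $t_f\mapsto 0$. Cylinder on morphisms: for a dg functor $F\colon\mathcal{C}\to\mathcal{D}$ in $\mathrm{dgCat}_s$, $\mathrm{Cyl}(F)\colon\mathrm{Cyl}(\mathcal{C})\to\mathrm{Cyl}(\mathcal{D})$ extends $F\amalg F\colon\mathcal{C}\amalg\mathcal{C}\to\mathcal{D}\amalg\mathcal{D}$ by $t_C,t'_C,\hat t_C,\check t_C,\bar t_C\mapsto t_{F(C)},t'_{F(C)},\hat t_{F(C)},\check t_{F(C)},\bar t_{F(C)}$ for objects $C$ and $t_f\mapsto t_{F(f)}$ for generating morphisms $f$ of $\mathcal{C}$. *)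

theory Defs
  imports Main "HOL-Library.Poly_Mapping" "HOL-Library.Function_Algebras"
begin

section \<open>Dg categories and dg functors\<close>

text \<open>The base ring has sort \<open>{comm_ring, comm_monoid_mult}\<close>, i.e. it is a commutative ring with
  unit; unlike \<open>comm_ring_1\<close> this sort does not exclude the zero ring.

  The morphisms of a dg category live in an ambient abelian group \<open>'m\<close>, and \<open>Hom C A B n\<close> is the
  subset of morphisms \<open>A \<rightarrow> B\<close> of degree \<open>n\<close>. Different hom sets may overlap; source, target and
  degree are therefore always passed explicitly. Every small dg category is isomorphic to one of
  this form (let \<open>'m\<close> be the direct sum of all hom modules).
  \<open>Comp C X Y Z g f\<close> is the composite of \<open>f : X \<rightarrow> Y\<close> and \<open>g : Y \<rightarrow> Z\<close>, and \<open>Diff C A B n\<close> is the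
  differential \<open>hom\<^sup>n(A,B) \<rightarrow> hom\<^sup>n\<^sup>+\<^sup>1(A,B)\<close>.\<close>

record ('k, 'o, 'm) dgcat =
  Ob :: "'o set"
  Hom :: "'o \<Rightarrow> 'o \<Rightarrow> int \<Rightarrow> 'm set"
  Scale :: "'k \<Rightarrow> 'm \<Rightarrow> 'm"
  Comp :: "'o \<Rightarrow> 'o \<Rightarrow> 'o \<Rightarrow> 'm \<Rightarrow> 'm \<Rightarrow> 'm"
  Ident :: "'o \<Rightarrow> 'm"
  Diff :: "'o \<Rightarrow> 'o \<Rightarrow> int \<Rightarrow> 'm \<Rightarrow> 'm"

definition ksign :: "int \<Rightarrow> 'a::ab_group_add \<Rightarrow> 'a" where
  "ksign n x = (if even n then x else - x)"

locale dg_category =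
  fixes C :: "('k::{comm_ring,comm_monoid_mult}, 'o, 'm::ab_group_add) dgcat"
  assumes zero_Hom: "\<lbrakk>X \<in> Ob C; Y \<in> Ob C\<rbrakk> \<Longrightarrow> 0 \<in> Hom C X Y n"
    and add_Hom: "\<lbrakk>X \<in> Ob C; Y \<in> Ob C; f \<in> Hom C X Y n; g \<in> Hom C X Y n\<rbrakk> \<Longrightarrow> f + g \<in> Hom C X Y n"
    and Scale_Hom: "\<lbrakk>X \<in> Ob C; Y \<in> Ob C; f \<in> Hom C X Y n\<rbrakk> \<Longrightarrow> Scale C a f \<in> Hom C X Y n"
    and Scale_add_right: "\<lbrakk>X \<in> Ob C; Y \<in> Ob C; f \<in> Hom C X Y n; g \<in> Hom C X Y n\<rbrakk>
          \<Longrightarrow> Scale C a (f + g) = Scale C a f + Scale C a g"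
    and Scale_add_left: "\<lbrakk>X \<in> Ob C; Y \<in> Ob C; f \<in> Hom C X Y n\<rbrakk>
          \<Longrightarrow> Scale C (a + b) f = Scale C a f + Scale C b f"
    and Scale_Scale: "\<lbrakk>X \<in> Ob C; Y \<in> Ob C; f \<in> Hom C X Y n\<rbrakk>
          \<Longrightarrow> Scale C a (Scale C b f) = Scale C (a * b) f"
    and Scale_one: "\<lbrakk>X \<in> Ob C; Y \<in> Ob C; f \<in> Hom C X Y n\<rbrakk> \<Longrightarrow> Scale C 1 f = f"
    and Comp_Hom: "\<lbrakk>X \<in> Ob C; Y \<in> Ob C; Z \<in> Ob C; g \<in> Hom C Y Z m; f \<in> Hom C X Y n\<rbrakk>
          \<Longrightarrow> Comp C X Y Z g f \<in> Hom C X Z (m + n)"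
    and Comp_add_left: "\<lbrakk>X \<in> Ob C; Y \<in> Ob C; Z \<in> Ob C; g \<in> Hom C Y Z m; g' \<in> Hom C Y Z m;
          f \<in> Hom C X Y n\<rbrakk> \<Longrightarrow> Comp C X Y Z (g + g') f = Comp C X Y Z g f + Comp C X Y Z g' f"
    and Comp_add_right: "\<lbrakk>X \<in> Ob C; Y \<in> Ob C; Z \<in> Ob C; g \<in> Hom C Y Z m; f \<in> Hom C X Y n;
          f' \<in> Hom C X Y n\<rbrakk> \<Longrightarrow> Comp C X Y Z g (f + f') = Comp C X Y Z g f + Comp C X Y Z g f'"
    and Comp_Scale_left: "\<lbrakk>X \<in> Ob C; Y \<in> Ob C; Z \<in> Ob C; g \<in> Hom C Y Z m; f \<in> Hom C X Y n\<rbrakk>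
          \<Longrightarrow> Comp C X Y Z (Scale C a g) f = Scale C a (Comp C X Y Z g f)"
    and Comp_Scale_right: "\<lbrakk>X \<in> Ob C; Y \<in> Ob C; Z \<in> Ob C; g \<in> Hom C Y Z m; f \<in> Hom C X Y n\<rbrakk>
          \<Longrightarrow> Comp C X Y Z g (Scale C a f) = Scale C a (Comp C X Y Z g f)"
    and Comp_assoc: "\<lbrakk>W \<in> Ob C; X \<in> Ob C; Y \<in> Ob C; Z \<in> Ob C;
          h \<in> Hom C Y Z l; g \<in> Hom C X Y m; f \<in> Hom C W X n\<rbrakk>
          \<Longrightarrow> Comp C W X Z (Comp C X Y Z h g) f = Comp C W Y Z h (Comp C W X Y g f)"
    and Ident_Hom: "X \<in> Ob C \<Longrightarrow> Ident C X \<in> Hom C X X 0"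
    and Comp_Ident_left: "\<lbrakk>X \<in> Ob C; Y \<in> Ob C; f \<in> Hom C X Y n\<rbrakk>
          \<Longrightarrow> Comp C X Y Y (Ident C Y) f = f"
    and Comp_Ident_right: "\<lbrakk>X \<in> Ob C; Y \<in> Ob C; f \<in> Hom C X Y n\<rbrakk>
          \<Longrightarrow> Comp C X X Y f (Ident C X) = f"
    and Diff_Hom: "\<lbrakk>X \<in> Ob C; Y \<in> Ob C; f \<in> Hom C X Y n\<rbrakk> \<Longrightarrow> Diff C X Y n f \<in> Hom C X Y (n + 1)"
    and Diff_add: "\<lbrakk>X \<in> Ob C; Y \<in> Ob C; f \<in> Hom C X Y n; g \<in> Hom C X Y n\<rbrakk>
          \<Longrightarrow> Diff C X Y n (f + g) = Diff C X Y n f + Diff C X Y n g"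
    and Diff_Scale: "\<lbrakk>X \<in> Ob C; Y \<in> Ob C; f \<in> Hom C X Y n\<rbrakk>
          \<Longrightarrow> Diff C X Y n (Scale C a f) = Scale C a (Diff C X Y n f)"
    and Diff_Diff: "\<lbrakk>X \<in> Ob C; Y \<in> Ob C; f \<in> Hom C X Y n\<rbrakk>
          \<Longrightarrow> Diff C X Y (n + 1) (Diff C X Y n f) = 0"
    and Diff_Comp: "\<lbrakk>X \<in> Ob C; Y \<in> Ob C; Z \<in> Ob C; g \<in> Hom C Y Z m; f \<in> Hom C X Y n\<rbrakk>
          \<Longrightarrow> Diff C X Z (m + n) (Comp C X Y Z g f)
            = Comp C X Y Z (Diff C Y Z m g) f + ksign m (Comp C X Y Z g (Diff C X Y n f))"

record ('o, 'm, 'p, 'n) dgfun =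
  FOb :: "'o \<Rightarrow> 'p"
  FMor :: "'o \<Rightarrow> 'o \<Rightarrow> int \<Rightarrow> 'm \<Rightarrow> 'n"

locale dg_functor = source: dg_category C + target: dg_category D
  for C :: "('k::{comm_ring,comm_monoid_mult}, 'o, 'm::ab_group_add) dgcat"
    and D :: "('k, 'p, 'n::ab_group_add) dgcat" +
  fixes F :: "('o, 'm, 'p, 'n) dgfun"
  assumes FOb_Ob: "X \<in> Ob C \<Longrightarrow> FOb F X \<in> Ob D"
    and FMor_Hom: "\<lbrakk>X \<in> Ob C; Y \<in> Ob C; f \<in> Hom C X Y n\<rbrakk>
          \<Longrightarrow> FMor F X Y n f \<in> Hom D (FOb F X) (FOb F Y) n"
    and FMor_add: "\<lbrakk>X \<in> Ob C; Y \<in> Ob C; f \<in> Hom C X Y n; g \<in> Hom C X Y n\<rbrakk>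
          \<Longrightarrow> FMor F X Y n (f + g) = FMor F X Y n f + FMor F X Y n g"
    and FMor_Scale: "\<lbrakk>X \<in> Ob C; Y \<in> Ob C; f \<in> Hom C X Y n\<rbrakk>
          \<Longrightarrow> FMor F X Y n (Scale C a f) = Scale D a (FMor F X Y n f)"
    and FMor_Comp: "\<lbrakk>X \<in> Ob C; Y \<in> Ob C; Z \<in> Ob C; g \<in> Hom C Y Z m; f \<in> Hom C X Y n\<rbrakk>
          \<Longrightarrow> FMor F X Z (m + n) (Comp C X Y Z g f)
            = Comp D (FOb F X) (FOb F Y) (FOb F Z) (FMor F Y Z m g) (FMor F X Y n f)"
    and FMor_Ident: "X \<in> Ob C \<Longrightarrow> FMor F X X 0 (Ident C X) = Ident D (FOb F X)"
    and FMor_Diff: "\<lbrakk>X \<in> Ob C; Y \<in> Ob C; f \<in> Hom C X Y n\<rbrakk>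
          \<Longrightarrow> FMor F X Y (n + 1) (Diff C X Y n f) = Diff D (FOb F X) (FOb F Y) n (FMor F X Y n f)"

text \<open>Equality of dg functors with domain \<open>C\<close>; values outside the carriers are irrelevant.\<close>

definition dgfun_eq ::
  "('k, 'o, 'm) dgcat \<Rightarrow> ('o, 'm, 'p, 'n) dgfun \<Rightarrow> ('o, 'm, 'p, 'n) dgfun \<Rightarrow> bool" where
  "dgfun_eq C F G \<longleftrightarrow>
     (\<forall>X \<in> Ob C. FOb F X = FOb G X) \<and>
     (\<forall>X \<in> Ob C. \<forall>Y \<in> Ob C. \<forall>n. \<forall>f \<in> Hom C X Y n. FMor F X Y n f = FMor G X Y n f)"

definition id_dgfun :: "('o, 'm, 'o, 'm) dgfun" where
  "id_dgfun = \<lparr>FOb = (\<lambda>X. X), FMor = (\<lambda>X Y n f. f)\<rparr>"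

definition comp_dgfun :: "('p, 'n, 'q, 'r) dgfun \<Rightarrow> ('o, 'm, 'p, 'n) dgfun \<Rightarrow> ('o, 'm, 'q, 'r) dgfun"
    (infixl \<open>\<circ>\<^sub>d\<^sub>g\<close> 55) where
  "G \<circ>\<^sub>d\<^sub>g F = \<lparr>FOb = (\<lambda>X. FOb G (FOb F X)),
     FMor = (\<lambda>X Y n f. FMor G (FOb F X) (FOb F Y) n (FMor F X Y n f))\<rparr>"


section \<open>The coproduct of a dg category with itself\<close>

definition untag :: "'o + 'o \<Rightarrow> 'o" where
  "untag = case_sum (\<lambda>X. X) (\<lambda>X. X)"

definition double :: "('k, 'o, 'm::zero) dgcat \<Rightarrow> ('k, 'o + 'o, 'm) dgcat" where
  "double C = \<lparr>
     Ob = Ob C <+> Ob C,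
     Hom = (\<lambda>X Y n. if isl X = isl Y then Hom C (untag X) (untag Y) n else {0}),
     Scale = Scale C,
     Comp = (\<lambda>X Y Z. Comp C (untag X) (untag Y) (untag Z)),
     Ident = (\<lambda>X. Ident C (untag X)),
     Diff = (\<lambda>X Y. Diff C (untag X) (untag Y))\<rparr>"

definition copair :: "('o, 'm, 'p, 'n::zero) dgfun \<Rightarrow> ('o, 'm, 'p, 'n) dgfun
    \<Rightarrow> ('o + 'o, 'm, 'p, 'n) dgfun" where
  "copair F G = \<lparr>
     FOb = case_sum (FOb F) (FOb G),
     FMor = (\<lambda>X Y n f. case (X, Y) of
        (Inl A, Inl B) \<Rightarrow> FMor F A B n f
      | (Inr A, Inr B) \<Rightarrow> FMor G A B n f
      | _ \<Rightarrow> 0)\<rparr>"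

definition codiagonal :: "('o + 'o, 'm::zero, 'o, 'm) dgfun" where
  "codiagonal = copair id_dgfun id_dgfun"


section \<open>Words and linear combinations\<close>

text \<open>A homogeneous morphism together with its source, target and degree.\<close>

datatype ('o, 'm) arrow = Arrow (asrc: 'o) (atgt: 'o) (adeg: int) (amor: 'm)

definition arrows :: "('k, 'o, 'm) dgcat \<Rightarrow> ('o, 'm) arrow set" where
  "arrows C = {e. asrc e \<in> Ob C \<and> atgt e \<in> Ob C \<and> amor e \<in> Hom C (asrc e) (atgt e) (adeg e)}"

text \<open>Words are written in composition order: \<open>[f\<^sub>n, \<dots>, f\<^sub>1]\<close> stands for \<open>f\<^sub>n \<circ> \<dots> \<circ> f\<^sub>1\<close>.
  The predicate says that a word is a path from \<open>X\<close> to \<open>Y\<close> in letters from \<open>L\<close>.\<close>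

primrec is_path :: "'e set \<Rightarrow> ('e \<Rightarrow> 'o) \<Rightarrow> ('e \<Rightarrow> 'o) \<Rightarrow> 'o \<Rightarrow> 'o \<Rightarrow> 'e list \<Rightarrow> bool" where
  "is_path L s t X Y [] \<longleftrightarrow> X = Y"
| "is_path L s t X Y (e # w) \<longleftrightarrow> e \<in> L \<and> t e = Y \<and> is_path L s t X (s e) w"

text \<open>Finitely supported formal linear combinations of paths of degree \<open>n\<close>.\<close>

definition path_combs :: "'e set \<Rightarrow> ('e \<Rightarrow> 'o) \<Rightarrow> ('e \<Rightarrow> 'o) \<Rightarrow> ('e \<Rightarrow> int) \<Rightarrow> 'o \<Rightarrow> 'o \<Rightarrow> int
    \<Rightarrow> ('e list \<Rightarrow>\<^sub>0 'k::zero) set" where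
  "path_combs L s t dg X Y n =
     {p. \<forall>w \<in> Poly_Mapping.keys p. is_path L s t X Y w \<and> sum_list (map dg w) = n}"

definition lin_ext :: "('k::zero \<Rightarrow> 'm \<Rightarrow> 'm::comm_monoid_add) \<Rightarrow> ('w \<Rightarrow> 'm) \<Rightarrow> ('w \<Rightarrow>\<^sub>0 'k) \<Rightarrow> 'm" where
  "lin_ext sc val p = (\<Sum>w \<in> Poly_Mapping.keys p. sc (Poly_Mapping.lookup p w) (val w))"

primrec word_val :: "('k, 'o, 'm) dgcat \<Rightarrow> 'o \<Rightarrow> ('o, 'm) arrow list \<Rightarrow> 'm" where
  "word_val C X [] = Ident C X"
| "word_val C X (e # w) = Comp C X (asrc e) (atgt e) (amor e) (word_val C X w)"

abbreviation arrow_combs :: "('o, 'm) arrow set \<Rightarrow> 'o \<Rightarrow> 'o \<Rightarrow> int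
    \<Rightarrow> (('o, 'm) arrow list \<Rightarrow>\<^sub>0 'k::zero) set" where
  "arrow_combs G \<equiv> path_combs G asrc atgt adeg"

definition comb_val :: "('k::zero, 'o, 'm::comm_monoid_add) dgcat \<Rightarrow> 'o
    \<Rightarrow> (('o, 'm) arrow list \<Rightarrow>\<^sub>0 'k) \<Rightarrow> 'm" where
  "comb_val C X = lin_ext (Scale C) (word_val C X)"


section \<open>Semifree dg categories and semifree extensions\<close>

definition freely_generated ::
  "('k::zero, 'o, 'm::comm_monoid_add) dgcat \<Rightarrow> ('o, 'm) arrow set \<Rightarrow> bool" where
  "freely_generated C G \<longleftrightarrow> G \<subseteq> arrows C \<and>
     (\<forall>X \<in> Ob C. \<forall>Y \<in> Ob C. \<forall>n. bij_betw (comb_val C X) (arrow_combs G X Y n) (Hom C X Y n))"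

text \<open>\<open>semifree C G\<close>: the dg category \<open>C\<close> is semifree with set of generating morphisms \<open>G\<close>.
  The indexing by an ordinal is a well-order on \<open>G\<close>; \<open>underS r e\<close> is the set of generators
  strictly below \<open>e\<close>.\<close>

definition semifree :: "('k::{comm_ring,comm_monoid_mult}, 'o, 'm::ab_group_add) dgcat
    \<Rightarrow> ('o, 'm) arrow set \<Rightarrow> bool" where
  "semifree C G \<longleftrightarrow> dg_category C \<and> freely_generated C G \<and>
     (\<exists>r. well_order_on G r \<and>
        (\<forall>e \<in> G. Diff C (asrc e) (atgt e) (adeg e) (amor e)
           \<in> comb_val C (asrc e) ` arrow_combs (underS r e) (asrc e) (atgt e) (adeg e + 1)))"

text \<open>The expansion of \<open>f \<in> Hom C X Y n\<close> as a linear combination of words in the generators.\<close>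

definition expand :: "('k::zero, 'o, 'm::comm_monoid_add) dgcat \<Rightarrow> ('o, 'm) arrow set
    \<Rightarrow> 'o \<Rightarrow> 'o \<Rightarrow> int \<Rightarrow> 'm \<Rightarrow> (('o, 'm) arrow list \<Rightarrow>\<^sub>0 'k)" where
  "expand C G X Y n = the_inv_into (arrow_combs G X Y n) (comb_val C X)"

text \<open>For a dg functor \<open>F : C \<rightarrow> D\<close> and a set \<open>G\<close> of homogeneous morphisms of \<open>D\<close>, mixed words have
  letters \<open>Inl e\<close> with \<open>e\<close> a homogeneous morphism of \<open>C\<close> (standing for its image in \<open>D\<close>) and
  \<open>Inr g\<close> with \<open>g \<in> G\<close>.\<close>

type_synonym ('o, 'm, 'p, 'n) letter = "('o, 'm) arrow + ('p, 'n) arrow"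

definition image_arrow :: "('o, 'm, 'p, 'n) dgfun \<Rightarrow> ('o, 'm) arrow \<Rightarrow> ('p, 'n) arrow" where
  "image_arrow F e = Arrow (FOb F (asrc e)) (FOb F (atgt e)) (adeg e)
     (FMor F (asrc e) (atgt e) (adeg e) (amor e))"

definition letter_arrow :: "('o, 'm, 'p, 'n) dgfun \<Rightarrow> ('o, 'm, 'p, 'n) letter \<Rightarrow> ('p, 'n) arrow" where
  "letter_arrow F = case_sum (image_arrow F) (\<lambda>g. g)"

definition letters :: "('k, 'o, 'm) dgcat \<Rightarrow> ('p, 'n) arrow set \<Rightarrow> ('o, 'm, 'p, 'n) letter set" where
  "letters C G = arrows C <+> G"

abbreviation mixed_path :: "('k, 'o, 'm) dgcat \<Rightarrow> ('o, 'm, 'p, 'n) dgfun \<Rightarrow> ('p, 'n) arrow set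
    \<Rightarrow> 'p \<Rightarrow> 'p \<Rightarrow> ('o, 'm, 'p, 'n) letter list \<Rightarrow> bool" where
  "mixed_path C F G \<equiv> is_path (letters C G) (asrc \<circ> letter_arrow F) (atgt \<circ> letter_arrow F)"

abbreviation mixed_combs :: "('k::zero, 'o, 'm) dgcat \<Rightarrow> ('o, 'm, 'p, 'n) dgfun \<Rightarrow> ('p, 'n) arrow set
    \<Rightarrow> 'p \<Rightarrow> 'p \<Rightarrow> int \<Rightarrow> (('o, 'm, 'p, 'n) letter list \<Rightarrow>\<^sub>0 'k) set" where
  "mixed_combs C F G \<equiv> path_combs (letters C G) (asrc \<circ> letter_arrow F) (atgt \<circ> letter_arrow F)
     (adeg \<circ> letter_arrow F)"

definition mixed_val :: "('k::zero, 'p, 'n::comm_monoid_add) dgcat \<Rightarrow> ('o, 'm, 'p, 'n) dgfun \<Rightarrow> 'p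
    \<Rightarrow> (('o, 'm, 'p, 'n) letter list \<Rightarrow>\<^sub>0 'k) \<Rightarrow> 'n" where
  "mixed_val D F X = lin_ext (Scale D) (\<lambda>w. word_val D X (map (letter_arrow F) w))"

definition pm_scale :: "'k::mult_zero \<Rightarrow> ('w \<Rightarrow>\<^sub>0 'k) \<Rightarrow> ('w \<Rightarrow>\<^sub>0 'k)" where
  "pm_scale c p = Poly_Mapping.map (\<lambda>x. c * x) p"

text \<open>The submodule of relations between mixed words from \<open>X\<close> to \<open>Y\<close> that come from the algebra
  structure of \<open>C\<close>: linearity in each letter from \<open>C\<close>, composition in \<open>C\<close>, identities of \<open>C\<close>.\<close>

inductive_set mixed_relations ::
  "('k::{comm_ring,comm_monoid_mult}, 'o, 'm::ab_group_add) dgcat \<Rightarrow> ('o, 'm, 'p, 'n) dgfun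
    \<Rightarrow> ('p, 'n) arrow set \<Rightarrow> 'p \<Rightarrow> 'p \<Rightarrow> (('o, 'm, 'p, 'n) letter list \<Rightarrow>\<^sub>0 'k) set"
  for C F G X Y where
  zero: "0 \<in> mixed_relations C F G X Y"
| add: "\<lbrakk>p \<in> mixed_relations C F G X Y; q \<in> mixed_relations C F G X Y\<rbrakk>
    \<Longrightarrow> p + q \<in> mixed_relations C F G X Y"
| scale: "p \<in> mixed_relations C F G X Y \<Longrightarrow> pm_scale c p \<in> mixed_relations C F G X Y"
| letter_add: "\<lbrakk>A \<in> Ob C; B \<in> Ob C; f \<in> Hom C A B n; g \<in> Hom C A B n;
    mixed_path C F G X Y (u @ Inl (Arrow A B n (f + g)) # v)\<rbrakk>
    \<Longrightarrow> Poly_Mapping.single (u @ Inl (Arrow A B n (f + g)) # v) 1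
        - Poly_Mapping.single (u @ Inl (Arrow A B n f) # v) 1
        - Poly_Mapping.single (u @ Inl (Arrow A B n g) # v) 1 \<in> mixed_relations C F G X Y"
| letter_scale: "\<lbrakk>A \<in> Ob C; B \<in> Ob C; f \<in> Hom C A B n;
    mixed_path C F G X Y (u @ Inl (Arrow A B n (Scale C c f)) # v)\<rbrakk>
    \<Longrightarrow> Poly_Mapping.single (u @ Inl (Arrow A B n (Scale C c f)) # v) 1
        - Poly_Mapping.single (u @ Inl (Arrow A B n f) # v) c \<in> mixed_relations C F G X Y"
| letter_Comp: "\<lbrakk>A \<in> Ob C; B \<in> Ob C; B' \<in> Ob C; g \<in> Hom C B B' m; f \<in> Hom C A B n;
    mixed_path C F G X Y (u @ Inl (Arrow A B' (m + n) (Comp C A B B' g f)) # v)\<rbrakk>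
    \<Longrightarrow> Poly_Mapping.single (u @ Inl (Arrow A B' (m + n) (Comp C A B B' g f)) # v) 1
        - Poly_Mapping.single (u @ Inl (Arrow B B' m g) # Inl (Arrow A B n f) # v) 1
          \<in> mixed_relations C F G X Y"
| letter_Ident: "\<lbrakk>A \<in> Ob C; mixed_path C F G X Y (u @ Inl (Arrow A A 0 (Ident C A)) # v)\<rbrakk>
    \<Longrightarrow> Poly_Mapping.single (u @ Inl (Arrow A A 0 (Ident C A)) # v) 1
        - Poly_Mapping.single (u @ v) 1 \<in> mixed_relations C F G X Y"

text \<open>The morphisms of \<open>D\<close> are the free extension, as an algebra, of those of \<open>F(C)\<close> by \<open>G\<close>:
  \<open>D\<close> is presented by the morphisms of \<open>C\<close> and the elements of \<open>G\<close>, subject only to the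
  relations holding in \<open>C\<close>.\<close>

definition free_extension :: "('k::{comm_ring,comm_monoid_mult}, 'o, 'm::ab_group_add) dgcat
    \<Rightarrow> ('k, 'p, 'n::ab_group_add) dgcat \<Rightarrow> ('o, 'm, 'p, 'n) dgfun \<Rightarrow> ('p, 'n) arrow set \<Rightarrow> bool" where
  "free_extension C D F G \<longleftrightarrow> G \<subseteq> arrows D \<and>
     (\<forall>X \<in> Ob D. \<forall>Y \<in> Ob D. \<forall>n.
        mixed_val D F X ` mixed_combs C F G X Y n = Hom D X Y n \<and>
        (\<forall>p \<in> mixed_combs C F G X Y n. mixed_val D F X p = 0 \<longrightarrow> p \<in> mixed_relations C F G X Y))"

definition semifree_extension_by :: "('k::{comm_ring,comm_monoid_mult}, 'o, 'm::ab_group_add) dgcat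
    \<Rightarrow> ('k, 'p, 'n::ab_group_add) dgcat \<Rightarrow> ('o, 'm, 'p, 'n) dgfun
    \<Rightarrow> 'p set \<Rightarrow> ('p, 'n) arrow set \<Rightarrow> bool" where
  "semifree_extension_by C D F R G \<longleftrightarrow> dg_functor C D F \<and>
     inj_on (FOb F) (Ob C) \<and>
     (\<forall>X \<in> Ob C. \<forall>Y \<in> Ob C. \<forall>n. inj_on (FMor F X Y n) (Hom C X Y n)) \<and>
     Ob D = FOb F ` Ob C \<union> R \<and> FOb F ` Ob C \<inter> R = {} \<and>
     free_extension C D F G \<and>
     (\<exists>r. well_order_on G r \<and>
        (\<forall>e \<in> G. Diff D (asrc e) (atgt e) (adeg e) (amor e)
           \<in> mixed_val D F (asrc e) ` mixed_combs C F (underS r e) (asrc e) (atgt e) (adeg e + 1)))"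

definition semifree_extension where
  "semifree_extension C D F \<longleftrightarrow> (\<exists>R G. semifree_extension_by C D F R G)"


section \<open>Quasi-equivalences\<close>

definition cocycles :: "('k, 'o, 'm::zero) dgcat \<Rightarrow> 'o \<Rightarrow> 'o \<Rightarrow> int \<Rightarrow> 'm set" where
  "cocycles C X Y n = {f \<in> Hom C X Y n. Diff C X Y n f = 0}"

definition cohomologous :: "('k, 'o, 'm::ab_group_add) dgcat \<Rightarrow> 'o \<Rightarrow> 'o \<Rightarrow> int \<Rightarrow> 'm rel" where
  "cohomologous C X Y n = {(f, g). f \<in> cocycles C X Y n \<and> g \<in> cocycles C X Y n \<and>
     (\<exists>h \<in> Hom C X Y (n - 1). f - g = Diff C X Y (n - 1) h)}"

definition cohomology :: "('k, 'o, 'm::ab_group_add) dgcat \<Rightarrow> 'o \<Rightarrow> 'o \<Rightarrow> int \<Rightarrow> 'm set set" where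
  "cohomology C X Y n = cocycles C X Y n // cohomologous C X Y n"

definition cohomology_map :: "('k, 'p, 'n::ab_group_add) dgcat \<Rightarrow> ('o, 'm, 'p, 'n) dgfun
    \<Rightarrow> 'o \<Rightarrow> 'o \<Rightarrow> int \<Rightarrow> 'm set \<Rightarrow> 'n set" where
  "cohomology_map D F X Y n c = cohomologous D (FOb F X) (FOb F Y) n `` (FMor F X Y n ` c)"

definition H0_retract :: "('k, 'o, 'm::ab_group_add) dgcat \<Rightarrow> 'o \<Rightarrow> 'o \<Rightarrow> bool" where
  "H0_retract C X Y \<longleftrightarrow> (\<exists>s \<in> cocycles C X Y 0. \<exists>r \<in> cocycles C Y X 0.
     (Comp C X Y X r s, Ident C X) \<in> cohomologous C X X 0)"

definition H0_isomorphic :: "('k, 'o, 'm::ab_group_add) dgcat \<Rightarrow> 'o \<Rightarrow> 'o \<Rightarrow> bool" where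
  "H0_isomorphic C X Y \<longleftrightarrow> (\<exists>f \<in> cocycles C X Y 0. \<exists>g \<in> cocycles C Y X 0.
     (Comp C X Y X g f, Ident C X) \<in> cohomologous C X X 0 \<and>
     (Comp C Y X Y f g, Ident C Y) \<in> cohomologous C Y Y 0)"

definition quasi_equivalence :: "('k::{comm_ring,comm_monoid_mult}, 'o, 'm::ab_group_add) dgcat
    \<Rightarrow> ('k, 'p, 'n::ab_group_add) dgcat \<Rightarrow> ('o, 'm, 'p, 'n) dgfun \<Rightarrow> bool" where
  "quasi_equivalence C D F \<longleftrightarrow> dg_functor C D F \<and>
     (\<forall>X \<in> Ob C. \<forall>Y \<in> Ob C. \<forall>n.
        bij_betw (cohomology_map D F X Y n) (cohomology C X Y n)
          (cohomology D (FOb F X) (FOb F Y) n)) \<and>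
     (\<forall>Y \<in> Ob D. \<exists>X \<in> Ob C. H0_isomorphic D (FOb F X) Y)"


section \<open>Twisted complexes and perfect objects\<close>

text \<open>A formal direct sum of shifts \<open>\<Oplus>\<^sub>i A\<^sub>i[s\<^sub>i]\<close>, \<open>i\<close> ranging over a set of natural numbers, is a
  partial map \<open>i \<mapsto> (A\<^sub>i, s\<^sub>i)\<close>. A degree \<open>n\<close> morphism \<open>A[s] \<rightarrow> B[t]\<close> is a degree \<open>n + t - s\<close> morphism
  \<open>A \<rightarrow> B\<close>, its differential being \<open>(-1)\<^sup>t\<close> times that of \<open>C\<close>. Morphisms between formal sums are
  matrices (row index first) with finitely many nonzero entries in each column.\<close>

type_synonym 'o shifted_sum = "nat \<rightharpoonup> 'o \<times> int"
type_synonym 'm mat = "nat \<Rightarrow> nat \<Rightarrow> 'm"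

definition mat_Hom :: "('k, 'o, 'm::zero) dgcat \<Rightarrow> 'o shifted_sum \<Rightarrow> 'o shifted_sum \<Rightarrow> int
    \<Rightarrow> 'm mat set" where
  "mat_Hom C a b n = {f. (\<forall>i j. case (a j, b i) of
       (Some (A, s), Some (B, t)) \<Rightarrow> f i j \<in> Hom C A B (n + t - s)
     | _ \<Rightarrow> f i j = 0) \<and> (\<forall>j. finite {i. f i j \<noteq> 0})}"

definition mat_Comp :: "('k, 'o, 'm::comm_monoid_add) dgcat \<Rightarrow> 'o shifted_sum \<Rightarrow> 'o shifted_sum
    \<Rightarrow> 'o shifted_sum \<Rightarrow> 'm mat \<Rightarrow> 'm mat \<Rightarrow> 'm mat" where
  "mat_Comp C a b c g f = (\<lambda>i j. case (a j, c i) of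
       (Some (A, _), Some (A', _)) \<Rightarrow>
          (\<Sum>l \<in> {l \<in> dom b. f l j \<noteq> 0}. Comp C A (fst (the (b l))) A' (g i l) (f l j))
     | _ \<Rightarrow> 0)"

definition mat_Diff :: "('k, 'o, 'm::ab_group_add) dgcat \<Rightarrow> 'o shifted_sum \<Rightarrow> 'o shifted_sum \<Rightarrow> int
    \<Rightarrow> 'm mat \<Rightarrow> 'm mat" where
  "mat_Diff C a b n f = (\<lambda>i j. case (a j, b i) of
       (Some (A, s), Some (B, t)) \<Rightarrow> ksign t (Diff C A B (n + t - s) (f i j))
     | _ \<Rightarrow> 0)"

definition mat_Ident :: "('k, 'o, 'm::zero) dgcat \<Rightarrow> 'o shifted_sum \<Rightarrow> 'm mat" where
  "mat_Ident C a = (\<lambda>i j. case a i of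
       Some (A, _) \<Rightarrow> if i = j then Ident C A else 0
     | None \<Rightarrow> 0)"

text \<open>\<open>Scale C c 0\<close> is unspecified if \<open>C\<close> has no objects, whence the case distinction.\<close>

definition mat_Scale :: "('k, 'o, 'm::zero) dgcat \<Rightarrow> 'k \<Rightarrow> 'm mat \<Rightarrow> 'm mat" where
  "mat_Scale C c f = (\<lambda>i j. if f i j = 0 then 0 else Scale C c (f i j))"

datatype ('o, 'm) twc = Twc (tw_sum: "'o shifted_sum") (tw_q: "'m mat")

text \<open>One-sided twisted complexes: \<open>q\<close> is a strictly upper triangular matrix of degree \<open>1\<close> with
  \<open>d q + q \<circ> q = 0\<close>.\<close>

definition twisted_complexes :: "('k, 'o, 'm::ab_group_add) dgcat \<Rightarrow> ('o, 'm) twc set" where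
  "twisted_complexes C = {Twc a q |a q.
     fst ` ran a \<subseteq> Ob C \<and> q \<in> mat_Hom C a a 1 \<and> (\<forall>i j. q i j \<noteq> 0 \<longrightarrow> i < j) \<and>
     mat_Diff C a a 1 q + mat_Comp C a a a q q = 0}"

definition all_twisted :: "('k, 'o, 'm::ab_group_add) dgcat \<Rightarrow> ('k, ('o, 'm) twc, 'm mat) dgcat" where
  "all_twisted C = \<lparr>
     Ob = twisted_complexes C,
     Hom = (\<lambda>X Y n. mat_Hom C (tw_sum X) (tw_sum Y) n),
     Scale = mat_Scale C,
     Comp = (\<lambda>X Y Z. mat_Comp C (tw_sum X) (tw_sum Y) (tw_sum Z)),
     Ident = (\<lambda>X. mat_Ident C (tw_sum X)),
     Diff = (\<lambda>X Y n f. mat_Diff C (tw_sum X) (tw_sum Y) n f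
        + mat_Comp C (tw_sum X) (tw_sum Y) (tw_sum Y) (tw_q Y) f
        - ksign n (mat_Comp C (tw_sum X) (tw_sum X) (tw_sum Y) f (tw_q X)))\<rparr>"

text \<open>\<open>Tw C\<close> consists of the finite twisted complexes. Homotopy idempotents of these split among the
  countable twisted complexes (by mapping telescopes), so the closure of \<open>Tw C\<close> under
  \<open>H\<^sup>0\<close>-retracts inside the latter is a dg model of its idempotent completion \<open>Perf C\<close>. Idempotents
  have to be split up to homotopy; the Karoubi envelope formed from strict idempotents of \<open>Tw C\<close>
  would in general be too small.\<close>

definition Tw :: "('k, 'o, 'm::ab_group_add) dgcat \<Rightarrow> ('k, ('o, 'm) twc, 'm mat) dgcat" where
  "Tw C = all_twisted C \<lparr>Ob := {X \<in> twisted_complexes C. finite (dom (tw_sum X))}\<rparr>"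

definition Perf :: "('k, 'o, 'm::ab_group_add) dgcat \<Rightarrow> ('k, ('o, 'm) twc, 'm mat) dgcat" where
  "Perf C = all_twisted C \<lparr>Ob := {P \<in> twisted_complexes C.
     \<exists>X \<in> Ob (Tw C). H0_retract (all_twisted C) P X}\<rparr>"

definition mat_fun :: "('o, 'm, 'p, 'n::zero) dgfun \<Rightarrow> 'o shifted_sum \<Rightarrow> 'o shifted_sum \<Rightarrow> int
    \<Rightarrow> 'm mat \<Rightarrow> 'n mat" where
  "mat_fun F a b n f = (\<lambda>i j. case (a j, b i) of
       (Some (A, s), Some (B, t)) \<Rightarrow> FMor F A B (n + t - s) (f i j)
     | _ \<Rightarrow> 0)"

text \<open>The dg functors \<open>Tw C \<rightarrow> Tw D\<close> and \<open>Perf C \<rightarrow> Perf D\<close> induced by \<open>F : C \<rightarrow> D\<close>.\<close>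

definition tw_fun :: "('o, 'm, 'p, 'n::zero) dgfun
    \<Rightarrow> (('o, 'm) twc, 'm mat, ('p, 'n) twc, 'n mat) dgfun" where
  "tw_fun F = \<lparr>
     FOb = (\<lambda>X. Twc (map_option (apfst (FOb F)) \<circ> tw_sum X)
                    (mat_fun F (tw_sum X) (tw_sum X) 1 (tw_q X))),
     FMor = (\<lambda>X Y. mat_fun F (tw_sum X) (tw_sum Y))\<rparr>"


section \<open>The three model structures\<close>

datatype model_structure = Dwyer_Kan | Quasi_equiconic | Morita

definition weak_equivalence :: "model_structure
    \<Rightarrow> ('k::{comm_ring,comm_monoid_mult}, 'o, 'm::ab_group_add) dgcat
    \<Rightarrow> ('k, 'p, 'n::ab_group_add) dgcat \<Rightarrow> ('o, 'm, 'p, 'n) dgfun \<Rightarrow> bool" where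
  "weak_equivalence M C D F \<longleftrightarrow> dg_functor C D F \<and> (case M of
       Dwyer_Kan \<Rightarrow> quasi_equivalence C D F
     | Quasi_equiconic \<Rightarrow> quasi_equivalence (Tw C) (Tw D) (tw_fun F)
     | Morita \<Rightarrow> quasi_equivalence (Perf C) (Perf D) (tw_fun F))"

text \<open>\<open>F : A \<rightarrow> B\<close> is a retract of \<open>J : X \<rightarrow> Y\<close> in the category of arrows.\<close>

definition retract_of :: "('k::{comm_ring,comm_monoid_mult}, 'o, 'm::ab_group_add) dgcat
    \<Rightarrow> ('k, 'p, 'n::ab_group_add) dgcat \<Rightarrow> ('o, 'm, 'p, 'n) dgfun
    \<Rightarrow> ('k, 'q, 'r::ab_group_add) dgcat \<Rightarrow> ('k, 's, 't::ab_group_add) dgcat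
    \<Rightarrow> ('q, 'r, 's, 't) dgfun \<Rightarrow> bool" where
  "retract_of A B F X Y J \<longleftrightarrow> dg_functor A B F \<and> dg_functor X Y J \<and>
     (\<exists>s s' t t'. dg_functor A X s \<and> dg_functor X A s' \<and> dg_functor B Y t \<and> dg_functor Y B t' \<and>
        dgfun_eq A (s' \<circ>\<^sub>d\<^sub>g s) id_dgfun \<and> dgfun_eq B (t' \<circ>\<^sub>d\<^sub>g t) id_dgfun \<and>
        dgfun_eq A (J \<circ>\<^sub>d\<^sub>g s) (t \<circ>\<^sub>d\<^sub>g F) \<and> dgfun_eq X (F \<circ>\<^sub>d\<^sub>g s') (t' \<circ>\<^sub>d\<^sub>g J))"

text \<open>The types of \<open>A\<close> and \<open>B\<close> bound the size of the dg categories \<open>X\<close> and \<open>Y\<close>.\<close>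

definition cofibration :: "('k::{comm_ring,comm_monoid_mult}, 'o, 'm::ab_group_add) dgcat
    \<Rightarrow> ('k, 'p, 'n::ab_group_add) dgcat \<Rightarrow> ('o, 'm, 'p, 'n) dgfun \<Rightarrow> bool" where
  "cofibration A B F \<longleftrightarrow>
     (\<exists>(X :: ('k, 'o, 'm) dgcat) (Y :: ('k, 'p, 'n) dgcat) J.
        semifree_extension X Y J \<and> retract_of A B F X Y J)"

definition has_rlp :: "('k::{comm_ring,comm_monoid_mult}, 'o, 'm::ab_group_add) dgcat
    \<Rightarrow> ('k, 'p, 'n::ab_group_add) dgcat \<Rightarrow> ('o, 'm, 'p, 'n) dgfun
    \<Rightarrow> ('k, 'q, 'r::ab_group_add) dgcat \<Rightarrow> ('k, 's, 't::ab_group_add) dgcat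
    \<Rightarrow> ('q, 'r, 's, 't) dgfun \<Rightarrow> bool" where
  "has_rlp C D P A B J \<longleftrightarrow>
     (\<forall>u v. dg_functor A C u \<and> dg_functor B D v \<and> dgfun_eq A (P \<circ>\<^sub>d\<^sub>g u) (v \<circ>\<^sub>d\<^sub>g J) \<longrightarrow>
        (\<exists>h. dg_functor B C h \<and> dgfun_eq A (h \<circ>\<^sub>d\<^sub>g J) u \<and> dgfun_eq B (P \<circ>\<^sub>d\<^sub>g h) v))"

text \<open>HOL cannot quantify over types within a formula, so the universe (type \<open>'u\<close> of objects, type
  \<open>'v\<close> of morphisms) of the dg categories that are tested against is a parameter. A dg functor is a
  fibration if this holds for all types \<open>'u\<close>, \<open>'v\<close>; the types of the dg categories \<open>X\<close>, \<open>Y\<close> in the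
  definition of cofibrations are then no restriction, as \<open>A\<close>, \<open>B\<close>, \<open>X\<close>, \<open>Y\<close> can be transported to
  common, sufficiently large types.\<close>

definition fibration :: "('u \<times> 'v::ab_group_add) itself \<Rightarrow> model_structure
    \<Rightarrow> ('k::{comm_ring,comm_monoid_mult}, 'o, 'm::ab_group_add) dgcat
    \<Rightarrow> ('k, 'p, 'n::ab_group_add) dgcat \<Rightarrow> ('o, 'm, 'p, 'n) dgfun \<Rightarrow> bool" where
  "fibration U M C D P \<longleftrightarrow> dg_functor C D P \<and>
     (\<forall>(A :: ('k, 'u, 'v) dgcat) (B :: ('k, 'u, 'v) dgcat) J.
        cofibration A B J \<and> weak_equivalence M A B J \<longrightarrow> has_rlp C D P A B J)"


section \<open>Free dg categories on a graded quiver with prescribed differential\<close>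

record (overloaded) ('k, 'o, 'e) dgquiver =
  verts :: "'o set"
  edges :: "'e set"
  esrc :: "'e \<Rightarrow> 'o"
  etgt :: "'e \<Rightarrow> 'o"
  edeg :: "'e \<Rightarrow> int"
  ediff :: "'e \<Rightarrow> ('e list \<Rightarrow>\<^sub>0 'k)"

abbreviation word :: "'e list \<Rightarrow> ('e list \<Rightarrow>\<^sub>0 'k::{comm_ring,comm_monoid_mult})" where
  "word w \<equiv> Poly_Mapping.single w 1"

definition word_mult :: "('e list \<Rightarrow>\<^sub>0 'k::{comm_ring,comm_monoid_mult}) \<Rightarrow> ('e list \<Rightarrow>\<^sub>0 'k)
    \<Rightarrow> ('e list \<Rightarrow>\<^sub>0 'k)" where
  "word_mult p q = lin_ext pm_scale (\<lambda>u. lin_ext pm_scale (\<lambda>v. word (u @ v)) q) p"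

primrec word_diff :: "('k::{comm_ring,comm_monoid_mult}, 'o, 'e) dgquiver \<Rightarrow> 'e list
    \<Rightarrow> ('e list \<Rightarrow>\<^sub>0 'k)" where
  "word_diff Q [] = 0"
| "word_diff Q (e # w) = word_mult (ediff Q e) (word w)
     + ksign (edeg Q e) (word_mult (word [e]) (word_diff Q w))"

definition free_dgcat :: "('k::{comm_ring,comm_monoid_mult}, 'o, 'e) dgquiver
    \<Rightarrow> ('k, 'o, 'e list \<Rightarrow>\<^sub>0 'k) dgcat" where
  "free_dgcat Q = \<lparr>
     Ob = verts Q,
     Hom = path_combs (edges Q) (esrc Q) (etgt Q) (edeg Q),
     Scale = pm_scale,
     Comp = (\<lambda>X Y Z. word_mult),
     Ident = (\<lambda>X. word []),
     Diff = (\<lambda>X Y n. lin_ext pm_scale (word_diff Q))\<rparr>"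

definition edge_arrow :: "('k::{comm_ring,comm_monoid_mult}, 'o, 'e) dgquiver \<Rightarrow> 'e
    \<Rightarrow> ('o, 'e list \<Rightarrow>\<^sub>0 'k) arrow" where
  "edge_arrow Q e = Arrow (esrc Q e) (etgt Q e) (edeg Q e) (word [e])"

text \<open>The functor from a free dg category to \<open>D\<close> with given values on objects and on edges.\<close>

definition free_dgfun :: "('k::{comm_ring,comm_monoid_mult}, 'o, 'e) dgquiver
    \<Rightarrow> ('k, 'p, 'n::ab_group_add) dgcat \<Rightarrow> ('o \<Rightarrow> 'p) \<Rightarrow> ('e \<Rightarrow> 'n)
    \<Rightarrow> ('o, 'e list \<Rightarrow>\<^sub>0 'k, 'p, 'n) dgfun" where
  "free_dgfun Q D fo fe = \<lparr>
     FOb = fo,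
     FMor = (\<lambda>X Y n. lin_ext (Scale D) (\<lambda>w. word_val D (fo X)
        (map (\<lambda>e. Arrow (fo (esrc Q e)) (fo (etgt Q e)) (edeg Q e) (fe e)) w)))\<rparr>"


section \<open>The cylinder\<close>

text \<open>For \<open>C\<close> semifree on \<open>G\<close>, \<open>Cyl C G\<close> is the semifree extension of \<open>double C\<close> by the morphisms
  \<open>t\<^sub>C\<close>, \<open>t'\<^sub>C\<close>, \<open>t\<close>-hat, \<open>t\<close>-check, \<open>t\<close>-bar (constructors \<open>T\<close>, \<open>T'\<close>, \<open>That\<close>, \<open>Tcheck\<close>, \<open>Tbar\<close>) and
  \<open>t\<^sub>f\<close> (constructor \<open>TGen\<close>). As \<open>double C\<close> is itself free on the two copies \<open>In1 f\<close>, \<open>In2 f\<close> of the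
  generators, \<open>Cyl C G\<close> is realised on the words in all of these symbols.\<close>

datatype ('o, 'e) cylgen =
    In1 'e | In2 'e | T 'o | T' 'o | That 'o | Tcheck 'o | Tbar 'o | TGen 'e

primrec cyl_src :: "('o, ('o, 'm) arrow) cylgen \<Rightarrow> 'o + 'o" where
  "cyl_src (In1 e) = Inl (asrc e)"
| "cyl_src (In2 e) = Inr (asrc e)"
| "cyl_src (T X) = Inl X"
| "cyl_src (T' X) = Inr X"
| "cyl_src (That X) = Inl X"
| "cyl_src (Tcheck X) = Inr X"
| "cyl_src (Tbar X) = Inl X"
| "cyl_src (TGen e) = Inl (asrc e)"

primrec cyl_tgt :: "('o, ('o, 'm) arrow) cylgen \<Rightarrow> 'o + 'o" where
  "cyl_tgt (In1 e) = Inl (atgt e)"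
| "cyl_tgt (In2 e) = Inr (atgt e)"
| "cyl_tgt (T X) = Inr X"
| "cyl_tgt (T' X) = Inl X"
| "cyl_tgt (That X) = Inl X"
| "cyl_tgt (Tcheck X) = Inr X"
| "cyl_tgt (Tbar X) = Inr X"
| "cyl_tgt (TGen e) = Inr (atgt e)"

primrec cyl_deg :: "('o, ('o, 'm) arrow) cylgen \<Rightarrow> int" where
  "cyl_deg (In1 e) = adeg e"
| "cyl_deg (In2 e) = adeg e"
| "cyl_deg (T X) = 0"
| "cyl_deg (T' X) = 0"
| "cyl_deg (That X) = -1"
| "cyl_deg (Tcheck X) = -1"
| "cyl_deg (Tbar X) = -2"
| "cyl_deg (TGen e) = adeg e - 1"

text \<open>\<open>t\<^sub>\<theta>\<close> for \<open>\<theta>\<close> a word \<open>w = [f\<^sub>n, \<dots>, f\<^sub>1]\<close>, resp. a linear combination of words. In the summand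
  with index \<open>l\<close> the letter \<open>w ! l\<close> is \<open>f\<^sub>j\<close> with \<open>j = n - l\<close>, and \<open>drop (Suc l) w\<close> is
  \<open>[f\<^sub>j\<^sub>-\<^sub>1, \<dots>, f\<^sub>1]\<close>.\<close>

definition t_word :: "('o, 'm) arrow list
    \<Rightarrow> (('o, ('o, 'm) arrow) cylgen list \<Rightarrow>\<^sub>0 'k::{comm_ring,comm_monoid_mult})" where
  "t_word w = (\<Sum>l<length w. ksign (sum_list (map adeg (drop (Suc l) w)))
     (word (map In2 (take l w) @ TGen (w ! l) # map In1 (drop (Suc l) w))))"

definition t_comb :: "(('o, 'm) arrow list \<Rightarrow>\<^sub>0 'k)
    \<Rightarrow> (('o, ('o, 'm) arrow) cylgen list \<Rightarrow>\<^sub>0 'k::{comm_ring,comm_monoid_mult})" where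
  "t_comb = lin_ext pm_scale t_word"

definition in1_comb :: "(('o, 'm) arrow list \<Rightarrow>\<^sub>0 'k)
    \<Rightarrow> (('o, ('o, 'm) arrow) cylgen list \<Rightarrow>\<^sub>0 'k::{comm_ring,comm_monoid_mult})" where
  "in1_comb = lin_ext pm_scale (\<lambda>w. word (map In1 w))"

definition in2_comb :: "(('o, 'm) arrow list \<Rightarrow>\<^sub>0 'k)
    \<Rightarrow> (('o, ('o, 'm) arrow) cylgen list \<Rightarrow>\<^sub>0 'k::{comm_ring,comm_monoid_mult})" where
  "in2_comb = lin_ext pm_scale (\<lambda>w. word (map In2 w))"

definition expand_diff :: "('k::{comm_ring,comm_monoid_mult}, 'o, 'm::ab_group_add) dgcat
    \<Rightarrow> ('o, 'm) arrow set \<Rightarrow> ('o, 'm) arrow \<Rightarrow> (('o, 'm) arrow list \<Rightarrow>\<^sub>0 'k)" where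
  "expand_diff C G e = expand C G (asrc e) (atgt e) (adeg e + 1)
     (Diff C (asrc e) (atgt e) (adeg e) (amor e))"

primrec cyl_diff :: "('k::{comm_ring,comm_monoid_mult}, 'o, 'm::ab_group_add) dgcat
    \<Rightarrow> ('o, 'm) arrow set \<Rightarrow> ('o, ('o, 'm) arrow) cylgen
    \<Rightarrow> (('o, ('o, 'm) arrow) cylgen list \<Rightarrow>\<^sub>0 'k)" where
  "cyl_diff C G (In1 e) = in1_comb (expand_diff C G e)"
| "cyl_diff C G (In2 e) = in2_comb (expand_diff C G e)"
| "cyl_diff C G (T X) = 0"
| "cyl_diff C G (T' X) = 0"
| "cyl_diff C G (That X) = word [] - word [T' X, T X]"
| "cyl_diff C G (Tcheck X) = word [] - word [T X, T' X]"
| "cyl_diff C G (Tbar X) = word [T X, That X] - word [Tcheck X, T X]"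
| "cyl_diff C G (TGen e) =
     ksign (adeg e) (word [In2 e, T (asrc e)] - word [T (atgt e), In1 e])
       + t_comb (expand_diff C G e)"

definition cyl_quiver :: "('k::{comm_ring,comm_monoid_mult}, 'o, 'm::ab_group_add) dgcat
    \<Rightarrow> ('o, 'm) arrow set \<Rightarrow> ('k, 'o + 'o, ('o, ('o, 'm) arrow) cylgen) dgquiver" where
  "cyl_quiver C G = \<lparr>
     verts = Ob C <+> Ob C,
     edges = In1 ` G \<union> In2 ` G \<union> T ` Ob C \<union> T' ` Ob C \<union> That ` Ob C \<union> Tcheck ` Ob C
       \<union> Tbar ` Ob C \<union> TGen ` G,
     esrc = cyl_src, etgt = cyl_tgt, edeg = cyl_deg, ediff = cyl_diff C G\<rparr>"

type_synonym ('k, 'o, 'm) cylmor = "('o, ('o, 'm) arrow) cylgen list \<Rightarrow>\<^sub>0 'k"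

definition Cyl :: "('k::{comm_ring,comm_monoid_mult}, 'o, 'm::ab_group_add) dgcat
    \<Rightarrow> ('o, 'm) arrow set \<Rightarrow> ('k, 'o + 'o, ('k, 'o, 'm) cylmor) dgcat" where
  "Cyl C G = free_dgcat (cyl_quiver C G)"

definition cyl_gens :: "('k::{comm_ring,comm_monoid_mult}, 'o, 'm::ab_group_add) dgcat
    \<Rightarrow> ('o, 'm) arrow set \<Rightarrow> ('o + 'o, ('k, 'o, 'm) cylmor) arrow set" where
  "cyl_gens C G = edge_arrow (cyl_quiver C G) ` edges (cyl_quiver C G)"

definition cyl_in1 :: "('k::{comm_ring,comm_monoid_mult}, 'o, 'm::ab_group_add) dgcat
    \<Rightarrow> ('o, 'm) arrow set \<Rightarrow> ('o, 'm, 'o + 'o, ('k, 'o, 'm) cylmor) dgfun" where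
  "cyl_in1 C G = \<lparr>FOb = Inl, FMor = (\<lambda>X Y n f. in1_comb (expand C G X Y n f))\<rparr>"

definition cyl_in2 :: "('k::{comm_ring,comm_monoid_mult}, 'o, 'm::ab_group_add) dgcat
    \<Rightarrow> ('o, 'm) arrow set \<Rightarrow> ('o, 'm, 'o + 'o, ('k, 'o, 'm) cylmor) dgfun" where
  "cyl_in2 C G = \<lparr>FOb = Inr, FMor = (\<lambda>X Y n f. in2_comb (expand C G X Y n f))\<rparr>"

primrec cyl_proj_gen :: "('k, 'o, 'm::ab_group_add) dgcat \<Rightarrow> ('o, ('o, 'm) arrow) cylgen \<Rightarrow> 'm" where
  "cyl_proj_gen C (In1 e) = amor e"
| "cyl_proj_gen C (In2 e) = amor e"
| "cyl_proj_gen C (T X) = Ident C X"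
| "cyl_proj_gen C (T' X) = Ident C X"
| "cyl_proj_gen C (That X) = 0"
| "cyl_proj_gen C (Tcheck X) = 0"
| "cyl_proj_gen C (Tbar X) = 0"
| "cyl_proj_gen C (TGen e) = 0"

definition cyl_proj :: "('k::{comm_ring,comm_monoid_mult}, 'o, 'm::ab_group_add) dgcat
    \<Rightarrow> ('o, 'm) arrow set \<Rightarrow> ('o + 'o, ('k, 'o, 'm) cylmor, 'o, 'm) dgfun" where
  "cyl_proj C G = free_dgfun (cyl_quiver C G) C untag (cyl_proj_gen C)"

text \<open>\<open>Cyl(F)\<close> for \<open>F : C \<rightarrow> D\<close>, where \<open>D\<close> is semifree on \<open>H\<close>.\<close>

definition expand_image :: "('k::{comm_ring,comm_monoid_mult}, 'p, 'n::ab_group_add) dgcat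
    \<Rightarrow> ('p, 'n) arrow set \<Rightarrow> ('o, 'm, 'p, 'n) dgfun \<Rightarrow> ('o, 'm) arrow
    \<Rightarrow> (('p, 'n) arrow list \<Rightarrow>\<^sub>0 'k)" where
  "expand_image D H F e = expand D H (FOb F (asrc e)) (FOb F (atgt e)) (adeg e)
     (FMor F (asrc e) (atgt e) (adeg e) (amor e))"

primrec cyl_map_gen :: "('k::{comm_ring,comm_monoid_mult}, 'p, 'n::ab_group_add) dgcat
    \<Rightarrow> ('p, 'n) arrow set \<Rightarrow> ('o, 'm, 'p, 'n) dgfun \<Rightarrow> ('o, ('o, 'm) arrow) cylgen
    \<Rightarrow> ('k, 'p, 'n) cylmor" where
  "cyl_map_gen D H F (In1 e) = in1_comb (expand_image D H F e)"
| "cyl_map_gen D H F (In2 e) = in2_comb (expand_image D H F e)"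
| "cyl_map_gen D H F (T X) = word [T (FOb F X)]"
| "cyl_map_gen D H F (T' X) = word [T' (FOb F X)]"
| "cyl_map_gen D H F (That X) = word [That (FOb F X)]"
| "cyl_map_gen D H F (Tcheck X) = word [Tcheck (FOb F X)]"
| "cyl_map_gen D H F (Tbar X) = word [Tbar (FOb F X)]"
| "cyl_map_gen D H F (TGen e) = t_comb (expand_image D H F e)"

definition Cyl_map :: "('k::{comm_ring,comm_monoid_mult}, 'o, 'm::ab_group_add) dgcat
    \<Rightarrow> ('o, 'm) arrow set \<Rightarrow> ('k, 'p, 'n::ab_group_add) dgcat \<Rightarrow> ('p, 'n) arrow set
    \<Rightarrow> ('o, 'm, 'p, 'n) dgfun
    \<Rightarrow> ('o + 'o, ('k, 'o, 'm) cylmor, 'p + 'p, ('k, 'p, 'n) cylmor) dgfun" where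
  "Cyl_map C G D H F = free_dgfun (cyl_quiver C G) (Cyl D H) (map_sum (FOb F) (FOb F))
     (cyl_map_gen D H F)"

end

(* The cylinder projection p is a trivial fibration: surjective on objects and on morphisms, with
   acyclic kernel. To see the latter, let tau be the (id, i_1 p)-derivation on the words of the
   cylinder with tau(i_2(f)) = t_f, tau(t') = - t-hat, tau(t-check) = t-bar and tau = 0 on all other
   generators, and let eta be 1 on i_1(C) and t_C on i_2(C). Then
     d tau(x) = (-1)^|x| (x eta - eta i_1(p(x))) + tau(dx),
   so a cocycle x with p(x) = 0 becomes a boundary after composition with eta, which is invertible
   up to homotopy. Acyclicity of the kernel passes to twisted complexes, column by column and in
   each column from the last row upwards; as i_1 is a section of p, this gives the weak equivalence
   in all three model structures. Trivial fibrations lift against every semifree extension, one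
   generator at a time, hence against all cofibrations. *)

theory Submission
  imports Defs
begin

section \<open>Formal linear combinations of words and their linear and multiplicative
  extensions\<close>

section \<open>Signs\<close>

text \<open>\<open>Tbar\<close> is what lets the derivation exist: once tau(t) = 0 and tau(t') = -
  t-hat, the value on \<open>Tcheck X\<close> must be a primitive of
  \<open>word [T X, That X] - word [Tcheck X, T X]\<close>. As tau moves every source to the first
  end, a primitive for a morphism starting at the second end is brought back by t' and corrected by
  t-check. Lifting is delicate because a free extension is only a presentation: the formal
  differential on mixed words squares to zero merely modulo relations. So prescribed values are
  evaluated on formal combinations, and freeness enters as one statement: a combination with value 0
  in the extension evaluates to 0. Objects of twisted complexes must be lifted on the nose.
  Entrywise preimages of a twisting matrix would satisfy the Maurer-Cartan equation only up to the
  kernel of p, whereas i_1 lifts it exactly. Perf involves infinite sums, with matrices that have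
  finite columns but possibly infinite rows; hence primitives are built by columns, each finished
  after finitely many corrections.\<close>

lemma ksign_zero [simp]: "ksign n 0 = 0"
  and ksign_uminus: "ksign n (- x) = - ksign n x"
  and ksign_add: "ksign n (x + y) = ksign n x + ksign n y"
  and ksign_ksign [simp]: "ksign n (ksign m x) = ksign (n + m) x"
  and ksign_at_zero [simp]: "ksign 0 x = x"
  and ksign_eq_zero_iff [simp]: "ksign n x = 0 \<longleftrightarrow> x = 0"
  by (auto simp: ksign_def)

lemma ksign_double [simp]: "ksign (n + n) x = x"
  by (simp add: ksign_def)

lemma ksign_sum: "ksign n (sum f A) = (\<Sum>x\<in>A. ksign n (f x))"
  by (simp add: ksign_def sum_negf)

lemma ksign_cong: "even (n - m) \<Longrightarrow> ksign n x = ksign m x"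
  by (auto simp: ksign_def)

section \<open>Linear extension\<close>

text \<open>Hom sets are subsets of an ambient group, and \<open>Scale\<close> obeys the module laws
  only on them; a carrier \<open>M\<close> therefore accompanies the scalar action. The choice
  \<open>M = UNIV\<close> covers formal combinations.\<close>

locale kmodule =
  fixes sc :: "'k::{comm_ring,comm_monoid_mult} \<Rightarrow> 'm::ab_group_add \<Rightarrow> 'm" and M :: "'m set"
  assumes zero_mem: "0 \<in> M"
    and add_mem: "x \<in> M \<Longrightarrow> y \<in> M \<Longrightarrow> x + y \<in> M"
    and sc_mem: "x \<in> M \<Longrightarrow> sc a x \<in> M"
    and sc_add_right: "x \<in> M \<Longrightarrow> y \<in> M \<Longrightarrow> sc a (x + y) = sc a x + sc a y"
    and sc_add_left: "x \<in> M \<Longrightarrow> sc (a + b) x = sc a x + sc b x"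
    and sc_sc: "x \<in> M \<Longrightarrow> sc a (sc b x) = sc (a * b) x"
    and sc_one: "x \<in> M \<Longrightarrow> sc 1 x = x"
begin

lemma sc_zero_left: "x \<in> M \<Longrightarrow> sc 0 x = 0"
  using sc_add_left[of x 0 0] by simp

lemma sc_zero_right: "sc a 0 = 0"
  using sc_add_right[of 0 0 a] zero_mem by simp

lemma sc_minus_one: "x \<in> M \<Longrightarrow> sc (- 1) x = - x"
  using sc_add_left[of x 1 "- 1"] by (simp add: sc_one sc_zero_left minus_unique)

lemma uminus_mem: "x \<in> M \<Longrightarrow> - x \<in> M"
  using sc_mem[of x "- 1"] by (simp add: sc_minus_one)

lemma diff_mem: "x \<in> M \<Longrightarrow> y \<in> M \<Longrightarrow> x - y \<in> M"
  using add_mem[of x "- y"] uminus_mem by simp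

lemma ksign_mem: "x \<in> M \<Longrightarrow> ksign n x \<in> M"
  by (simp add: ksign_def uminus_mem)

lemma sum_mem: "(\<And>i. i \<in> I \<Longrightarrow> f i \<in> M) \<Longrightarrow> sum f I \<in> M"
  by (induction I rule: infinite_finite_induct) (auto simp: zero_mem add_mem)

lemma sc_sum: "(\<And>i. i \<in> I \<Longrightarrow> f i \<in> M) \<Longrightarrow> sc a (sum f I) = (\<Sum>i\<in>I. sc a (f i))"
  by (induction I rule: infinite_finite_induct) (auto simp: sc_zero_right sc_add_right sum_mem)

text \<open>\<open>lin_ext\<close> sums over the support of \<open>p\<close>, which shrinks under
  cancellation; summing over a common finite superset makes several combinations comparable, notably
  in \<open>lin_ext_add\<close>.\<close>

lemma lin_ext_superset:
  assumes "finite S" "Poly_Mapping.keys p \<subseteq> S" "\<And>w. w \<in> S \<Longrightarrow> val w \<in> M"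
  shows "lin_ext sc val p = (\<Sum>w\<in>S. sc (Poly_Mapping.lookup p w) (val w))"
  unfolding lin_ext_def using assms
  by (intro sum.mono_neutral_left) (auto simp: sc_zero_left in_keys_iff)

lemma lin_ext_mem: "(\<And>w. w \<in> Poly_Mapping.keys p \<Longrightarrow> val w \<in> M) \<Longrightarrow> lin_ext sc val p \<in> M"
  unfolding lin_ext_def by (intro sum_mem sc_mem)

lemma lin_ext_add:
  assumes "\<And>w. w \<in> Poly_Mapping.keys p \<Longrightarrow> val w \<in> M" "\<And>w. w \<in> Poly_Mapping.keys q \<Longrightarrow> val w \<in> M"
  shows "lin_ext sc val (p + q) = lin_ext sc val p + lin_ext sc val q"
proof -
  let ?S = "Poly_Mapping.keys p \<union> Poly_Mapping.keys q"
  have S: "finite ?S" "\<And>w. w \<in> ?S \<Longrightarrow> val w \<in> M" using assms by auto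
  show ?thesis
    using S lin_ext_superset[of ?S p val] lin_ext_superset[of ?S q val]
      lin_ext_superset[of ?S "p + q" val] keys_add[of p q]
    by (simp add: lookup_add sc_add_left sum.distrib)
qed

lemma lin_ext_single: "val w \<in> M \<Longrightarrow> lin_ext sc val (Poly_Mapping.single w c) = sc c (val w)"
  using lin_ext_superset[of "{w}" "Poly_Mapping.single w c" val] by (simp add: lookup_single)

end

lemma lin_ext_zero [simp]: "lin_ext sc val 0 = 0"
  by (simp add: lin_ext_def)

lemma lin_ext_cong:
  "(\<And>w. w \<in> Poly_Mapping.keys p \<Longrightarrow> f w = g w) \<Longrightarrow> lin_ext sc f p = lin_ext sc g p"
  by (simp add: lin_ext_def)

lemma lookup_pm_scale [simp]:
  "Poly_Mapping.lookup (pm_scale c p) w = (c::'k::mult_zero) * Poly_Mapping.lookup p w"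
  by (auto simp: pm_scale_def Poly_Mapping.map.rep_eq when_def)

lemma keys_pm_scale: "Poly_Mapping.keys (pm_scale c p) \<subseteq> Poly_Mapping.keys p"
  by (auto simp: in_keys_iff)

lemma pm_scale_single [simp]:
  "pm_scale c (Poly_Mapping.single w d) = Poly_Mapping.single w (c * d)"
  by (rule poly_mapping_eqI) (simp add: lookup_single when_def)

interpretation pm: kmodule "pm_scale :: 'k::{comm_ring,comm_monoid_mult} \<Rightarrow> ('w \<Rightarrow>\<^sub>0 'k) \<Rightarrow> _" UNIV
  by unfold_locales (auto intro!: poly_mapping_eqI simp: lookup_add algebra_simps)

lemma poly_mapping_sum_singles:
  fixes p :: "'w \<Rightarrow>\<^sub>0 'k::comm_monoid_add"
  shows "p = (\<Sum>w\<in>Poly_Mapping.keys p. Poly_Mapping.single w (Poly_Mapping.lookup p w))"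
  by (rule poly_mapping_eqI)
    (auto simp: lookup_sum lookup_single when_def in_keys_iff)

text \<open>Splitting off one monomial at a time never leaves the support of \<open>p\<close>, so
  both summands can be kept inside \<open>K\<close>. Without this control, cancellation in
  \<open>p + q\<close> could hide words on which an extended map is not linear.\<close>

lemma poly_mapping_keys_induct [consumes 1, case_names zero single add]:
  fixes p :: "'w \<Rightarrow>\<^sub>0 'k::comm_monoid_add"
  assumes "Poly_Mapping.keys p \<subseteq> K"
    and zero: "P 0"
    and single: "\<And>w c. w \<in> K \<Longrightarrow> P (Poly_Mapping.single w c)"
    and add: "\<And>p q. Poly_Mapping.keys p \<subseteq> K \<Longrightarrow> Poly_Mapping.keys q \<subseteq> K \<Longrightarrow> P p \<Longrightarrow> P q \<Longrightarrow> P (p + q)"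
  shows "P p"
proof -
  have "Poly_Mapping.keys (\<Sum>w\<in>S. Poly_Mapping.single w (Poly_Mapping.lookup p w)) \<subseteq> K
      \<and> P (\<Sum>w\<in>S. Poly_Mapping.single w (Poly_Mapping.lookup p w))"
    if "finite S" "S \<subseteq> K" for S
    using that
  proof (induction S)
    case (insert x S)
    then show ?case
      using keys_add[of "Poly_Mapping.single x (Poly_Mapping.lookup p x)"
          "\<Sum>w\<in>S. Poly_Mapping.single w (Poly_Mapping.lookup p w)"]
      by (auto intro!: add single split: if_splits)
  qed (simp add: zero)
  from this[of "Poly_Mapping.keys p"] assms(1) show ?thesis
    by (simp flip: poly_mapping_sum_singles)
qed

lemmas poly_mapping_induct = poly_mapping_keys_induct[of _ UNIV, simplified, case_names zero single add]

lemma pm_scale_one [simp]: "pm_scale 1 p = p"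
  and pm_scale_uminus: "pm_scale (- c) p = - pm_scale c p"
  and pm_scale_minus: "pm_scale c (- p) = - pm_scale c p"
  and pm_scale_diff: "pm_scale c (p - q) = pm_scale c p - pm_scale c q"
  and pm_scale_add: "pm_scale c (p + q) = pm_scale c p + pm_scale c q"
  for p :: "'w \<Rightarrow>\<^sub>0 'k::{comm_ring,comm_monoid_mult}"
  by (auto intro!: poly_mapping_eqI simp: lookup_add lookup_minus algebra_simps ksign_def)

abbreviation lin :: "('w \<Rightarrow> ('v \<Rightarrow>\<^sub>0 'k::{comm_ring,comm_monoid_mult})) \<Rightarrow> ('w \<Rightarrow>\<^sub>0 'k) \<Rightarrow> ('v \<Rightarrow>\<^sub>0 'k)" where
  "lin \<equiv> lin_ext pm_scale"

lemma lin_add: "lin f (p + q) = lin f p + lin f q"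
  by (simp add: pm.lin_ext_add)

lemma lin_single: "lin f (Poly_Mapping.single w c) = pm_scale c (f w)"
  by (simp add: pm.lin_ext_single)

lemma lin_word [simp]: "lin f (word w) = f w"
  by (simp add: lin_single)

lemma lin_uminus: "lin f (- p) = - lin f p"
  using lin_add[of f p "- p"] by (simp add: minus_unique)

lemma lin_diff: "lin f (p - q) = lin f p - lin f q"
  using lin_add[of f p "- q"] by (simp add: lin_uminus)

lemma lin_ksign: "lin f (ksign n p) = ksign n (lin f p)"
  by (simp add: ksign_def lin_uminus)

lemma lin_sum: "lin f (sum g A) = (\<Sum>x\<in>A. lin f (g x))"
  by (induction A rule: infinite_finite_induct) (auto simp: lin_add)

lemma lin_pm_scale: "lin f (pm_scale c p) = pm_scale c (lin f p)"
proof (induction p rule: poly_mapping_induct)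
  case (single w d)
  then show ?case by (simp add: lin_single pm.sc_sc)
qed (simp_all add: lin_add pm_scale_add pm.sc_zero_right)

lemma lin_word_id [simp]: "lin word p = p"
proof (induction p rule: poly_mapping_induct)
qed (simp_all add: lin_add lin_single)

lemma lin_lin: "lin f (lin g p) = lin (\<lambda>w. lin f (g w)) p"
proof (induction p rule: poly_mapping_induct)
qed (simp_all add: lin_add lin_single lin_pm_scale)

lemma lin_fun_add: "lin (\<lambda>w. f w + g w) p = lin f p + lin g p"
  by (simp add: lin_ext_def pm_scale_add sum.distrib)

lemma lin_fun_uminus: "lin (\<lambda>w. - f w) p = - lin f p"
  by (simp add: lin_ext_def pm_scale_minus sum_negf)

lemma lin_fun_diff: "lin (\<lambda>w. f w - g w) p = lin f p - lin g p"
  by (simp add: lin_ext_def pm_scale_diff sum_subtractf)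

lemma lin_fun_ksign: "lin (\<lambda>w. ksign n (f w)) p = ksign n (lin f p)"
  by (simp add: ksign_def lin_fun_uminus)

lemma lin_fun_zero [simp]: "lin (\<lambda>w. 0) p = 0"
  by (simp add: lin_ext_def pm.sc_zero_right)

lemma lin_ext_lin:
  assumes "\<And>p q. g (p + q) = g p + g q" "\<And>c p. g (pm_scale c p) = pm_scale c (g p)"
  shows "g (lin f p) = lin (\<lambda>w. g (f w)) p"
proof (induction p rule: poly_mapping_induct)
  case zero
  then show ?case using assms(1)[of 0 0] by simp
qed (simp_all add: lin_add lin_single assms)

section \<open>The free algebra on words\<close>

lemma word_mult_add_left: "word_mult (p + p') q = word_mult p q + word_mult p' q"
  and word_mult_scale_left: "word_mult (pm_scale c p) q = pm_scale c (word_mult p q)"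
  and word_mult_uminus_left: "word_mult (- p) q = - word_mult p q"
  and word_mult_diff_left: "word_mult (p - p') q = word_mult p q - word_mult p' q"
  and word_mult_ksign_left: "word_mult (ksign n p) q = ksign n (word_mult p q)"
  and word_mult_zero_left [simp]: "word_mult 0 q = 0"
  by (simp_all add: word_mult_def lin_add lin_pm_scale lin_uminus lin_diff lin_ksign)

lemma word_mult_add_right: "word_mult p (q + q') = word_mult p q + word_mult p q'"
  and word_mult_scale_right: "word_mult p (pm_scale c q) = pm_scale c (word_mult p q)"
  and word_mult_uminus_right: "word_mult p (- q) = - word_mult p q"
  and word_mult_diff_right: "word_mult p (q - q') = word_mult p q - word_mult p q'"
  and word_mult_ksign_right: "word_mult p (ksign n q) = ksign n (word_mult p q)"
  and word_mult_zero_right [simp]: "word_mult p 0 = 0"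
  by (simp_all add: word_mult_def lin_add lin_pm_scale lin_uminus lin_diff lin_ksign
      lin_fun_add lin_fun_uminus lin_fun_diff lin_fun_ksign)
    (simp add: lin_ext_lin[of "pm_scale c", symmetric] pm_scale_add pm.sc_sc mult.commute)

lemma word_mult_word [simp]: "word_mult (word u) (word v) = word (u @ v)"
  by (simp add: word_mult_def)

lemma word_mult_one_left [simp]: "word_mult (word []) p = p"
  and word_mult_one_right [simp]: "word_mult p (word []) = p"
  by (simp_all add: word_mult_def)

lemma lin_word_mult: "lin f (word_mult p q) = lin (\<lambda>u. lin (\<lambda>v. f (u @ v)) q) p"
  by (simp add: word_mult_def lin_lin)

lemma word_mult_lin_left: "word_mult (lin f p) q = lin (\<lambda>w. word_mult (f w) q) p"
  by (rule lin_ext_lin) (simp_all add: word_mult_add_left word_mult_scale_left)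

lemma word_mult_lin_right: "word_mult q (lin f p) = lin (\<lambda>w. word_mult q (f w)) p"
  by (rule lin_ext_lin) (simp_all add: word_mult_add_right word_mult_scale_right)

lemma word_mult_assoc: "word_mult (word_mult p q) r = word_mult p (word_mult q r)"
proof -
  have "word_mult (word_mult p q) r = lin (\<lambda>u. lin (\<lambda>v. lin (\<lambda>w. word (u @ v @ w)) r) q) p"
    unfolding word_mult_def[of "word_mult p q"] lin_word_mult by simp
  also have "\<dots> = word_mult p (word_mult q r)"
    unfolding word_mult_def[of p] lin_word_mult by simp
  finally show ?thesis .
qed

lemmas word_mult_linear = word_mult_add_left word_mult_add_right word_mult_uminus_left
  word_mult_uminus_right word_mult_diff_left word_mult_diff_right

lemma word_Cons: "word (e # w) = word_mult (word [e]) (word w)"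
  by simp

section \<open>Substitutions and derivations\<close>

text \<open>With \<open>subst\<close> below: the homomorphism of free algebras extending
  \<open>\<phi>\<close> from letters. Functors between free dg categories act on morphisms in this
  way.\<close>

primrec subst_word :: "('e \<Rightarrow> ('f list \<Rightarrow>\<^sub>0 'k::{comm_ring,comm_monoid_mult})) \<Rightarrow> 'e list
    \<Rightarrow> ('f list \<Rightarrow>\<^sub>0 'k)" where
  "subst_word \<phi> [] = word []"
| "subst_word \<phi> (e # w) = word_mult (\<phi> e) (subst_word \<phi> w)"

abbreviation subst :: "('e \<Rightarrow> ('f list \<Rightarrow>\<^sub>0 'k::{comm_ring,comm_monoid_mult}))
    \<Rightarrow> ('e list \<Rightarrow>\<^sub>0 'k) \<Rightarrow> ('f list \<Rightarrow>\<^sub>0 'k)" where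
  "subst \<phi> \<equiv> lin (subst_word \<phi>)"

lemma subst_word_append: "subst_word \<phi> (u @ v) = word_mult (subst_word \<phi> u) (subst_word \<phi> v)"
  by (induction u) (simp_all add: word_mult_assoc)

lemma subst_mult: "subst \<phi> (word_mult p q) = word_mult (subst \<phi> p) (subst \<phi> q)"
proof -
  have "subst \<phi> (word_mult p q) = lin (\<lambda>u. word_mult (subst_word \<phi> u) (subst \<phi> q)) p"
    by (simp add: lin_word_mult subst_word_append word_mult_lin_right)
  then show ?thesis by (simp add: word_mult_lin_left)
qed

lemma subst_word_words: "subst_word (\<lambda>e. word [\<phi> e]) w = word (map \<phi> w)"
  by (induction w) simp_all

lemma subst_subst_word: "subst \<phi> (subst_word \<psi> w) = subst_word (\<lambda>e. subst \<phi> (\<psi> e)) w"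
  by (induction w) (simp_all add: subst_mult)

lemma subst_subst: "subst \<phi> (subst \<psi> p) = subst (\<lambda>e. subst \<phi> (\<psi> e)) p"
  by (simp add: lin_lin subst_subst_word)

lemma subst_word_cong: "(\<And>e. e \<in> set w \<Longrightarrow> \<phi> e = \<psi> e) \<Longrightarrow> subst_word \<phi> w = subst_word \<psi> w"
  by (induction w) simp_all

abbreviation wdeg :: "('e \<Rightarrow> int) \<Rightarrow> 'e list \<Rightarrow> int" where
  "wdeg dg w \<equiv> sum_list (map dg w)"

text \<open>The twisted derivation \<open>t\<close> over a pair of substitutions, of degree \<open>-1\<close>:
  \<open>t(g \<circ> f) = \<phi>(g) \<circ> t(f) + (-1)\<^bsup>|f|\<^esup> t(g) \<circ> \<psi>(f)\<close>.\<close>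

primrec der_word :: "('e \<Rightarrow> int) \<Rightarrow> ('e \<Rightarrow> ('f list \<Rightarrow>\<^sub>0 'k::{comm_ring,comm_monoid_mult}))
    \<Rightarrow> ('e \<Rightarrow> ('f list \<Rightarrow>\<^sub>0 'k)) \<Rightarrow> ('e \<Rightarrow> ('f list \<Rightarrow>\<^sub>0 'k)) \<Rightarrow> 'e list \<Rightarrow> ('f list \<Rightarrow>\<^sub>0 'k)" where
  "der_word dg \<phi> \<psi> h [] = 0"
| "der_word dg \<phi> \<psi> h (e # w) = word_mult (\<phi> e) (der_word dg \<phi> \<psi> h w)
     + ksign (wdeg dg w) (word_mult (h e) (subst_word \<psi> w))"

lemma der_word_append: "der_word dg \<phi> \<psi> h (u @ v) = word_mult (subst_word \<phi> u) (der_word dg \<phi> \<psi> h v)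
     + ksign (wdeg dg v) (word_mult (der_word dg \<phi> \<psi> h u) (subst_word \<psi> v))"
  by (induction u)
    (simp_all add: word_mult_assoc word_mult_add_left word_mult_add_right ksign_add
      word_mult_ksign_left word_mult_ksign_right subst_word_append add_ac)

definition homogeneous :: "('e \<Rightarrow> int) \<Rightarrow> int \<Rightarrow> ('e list \<Rightarrow>\<^sub>0 'k::zero) \<Rightarrow> bool" where
  "homogeneous dg n p \<longleftrightarrow> (\<forall>w\<in>Poly_Mapping.keys p. wdeg dg w = n)"

lemma homogeneous_letter: "homogeneous dg (dg e) (word [e])"
  by (simp add: homogeneous_def)

lemma path_combs_homogeneous: "p \<in> path_combs L s t dg X Y n \<Longrightarrow> homogeneous dg n p"
  by (simp add: path_combs_def homogeneous_def)

text \<open>The sign depends on the degree of the right factor alone, so \<open>q\<close> has to be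
  homogeneous while \<open>p\<close> is arbitrary.\<close>

lemma der_mult:
  assumes "homogeneous dg n q"
  shows "lin (der_word dg \<phi> \<psi> h) (word_mult p q) = word_mult (subst \<phi> p) (lin (der_word dg \<phi> \<psi> h) q)
    + ksign n (word_mult (lin (der_word dg \<phi> \<psi> h) p) (subst \<psi> q))"
proof -
  have "lin (\<lambda>v. der_word dg \<phi> \<psi> h (u @ v)) q = word_mult (subst_word \<phi> u) (lin (der_word dg \<phi> \<psi> h) q)
    + ksign n (word_mult (der_word dg \<phi> \<psi> h u) (subst \<psi> q))" for u
  proof -
    have "lin (\<lambda>v. der_word dg \<phi> \<psi> h (u @ v)) q
      = lin (\<lambda>v. word_mult (subst_word \<phi> u) (der_word dg \<phi> \<psi> h v)
       + ksign n (word_mult (der_word dg \<phi> \<psi> h u) (subst_word \<psi> v))) q"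
      using assms by (intro lin_ext_cong) (simp add: der_word_append homogeneous_def)
    then show ?thesis
      by (simp add: lin_fun_add lin_fun_ksign word_mult_lin_right)
  qed
  then show ?thesis
    by (simp add: lin_word_mult lin_fun_add lin_fun_ksign word_mult_lin_left)
qed

section \<open>Spaces of paths\<close>

lemma is_path_append:
  "is_path L s t X Y (u @ v) \<longleftrightarrow> (\<exists>Z. is_path L s t Z Y u \<and> is_path L s t X Z v)"
  by (induction u arbitrary: Y) auto

lemma is_path_mono: "is_path L s t X Y w \<Longrightarrow> L \<subseteq> L' \<Longrightarrow> is_path L' s t X Y w"
  by (induction w arbitrary: Y) auto

lemma is_path_set: "is_path L s t X Y w \<Longrightarrow> set w \<subseteq> L"
  by (induction w arbitrary: Y) auto

lemma is_path_map:
  "is_path L s t X Y w \<Longrightarrow> (\<And>e. e \<in> L \<Longrightarrow> g e \<in> L' \<and> s' (g e) = fo (s e) \<and> t' (g e) = fo (t e))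
    \<Longrightarrow> is_path L' s' t' (fo X) (fo Y) (map g w)"
  by (induction w arbitrary: Y) auto

lemma path_combs_mono: "L \<subseteq> L' \<Longrightarrow> path_combs L s t dg X Y n \<subseteq> path_combs L' s t dg X Y n"
  by (auto simp: path_combs_def intro: is_path_mono)

lemma path_combs_zero [simp]: "0 \<in> path_combs L s t dg X Y n"
  by (simp add: path_combs_def)

lemma path_combs_add:
  "p \<in> path_combs L s t dg X Y n \<Longrightarrow> q \<in> path_combs L s t dg X Y n \<Longrightarrow> p + q \<in> path_combs L s t dg X Y n"
  using keys_add[of p q] unfolding path_combs_def by blast

lemma path_combs_scale: "p \<in> path_combs L s t dg X Y n \<Longrightarrow> pm_scale c p \<in> path_combs L s t dg X Y n"
  using keys_pm_scale[of c p] unfolding path_combs_def by blast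

lemma kmodule_path_combs: "kmodule pm_scale (path_combs L s t dg X Y n)"
  by unfold_locales
    (simp_all add: path_combs_add path_combs_scale pm.sc_add_right pm.sc_add_left pm.sc_sc)

lemmas path_combs_diff = kmodule.diff_mem[OF kmodule_path_combs]
  and path_combs_uminus = kmodule.uminus_mem[OF kmodule_path_combs]
  and path_combs_ksign = kmodule.ksign_mem[OF kmodule_path_combs]
  and path_combs_lin = kmodule.lin_ext_mem[OF kmodule_path_combs]

lemma path_combs_single:
  "is_path L s t X Y w \<Longrightarrow> wdeg dg w = n \<Longrightarrow> Poly_Mapping.single w c \<in> path_combs L s t dg X Y n"
  by (simp add: path_combs_def)

lemma path_combs_word: "is_path L s t X Y w \<Longrightarrow> wdeg dg w = n \<Longrightarrow> word w \<in> path_combs L s t dg X Y n"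
  by (rule path_combs_single)

lemma path_combsD:
  assumes "p \<in> path_combs L s t dg X Y n" "w \<in> Poly_Mapping.keys p"
  shows "is_path L s t X Y w" "wdeg dg w = n"
  using assms by (auto simp: path_combs_def)

text \<open>The form of induction suited to evaluation in a dg category, which is linear only for
  fixed ends and fixed degree.\<close>

lemma path_combs_induct [consumes 1, case_names zero single add]:
  fixes p :: "'e list \<Rightarrow>\<^sub>0 'k::comm_monoid_add"
  assumes "p \<in> path_combs L s t dg X Y n"
    and "P 0"
    and "\<And>w c. is_path L s t X Y w \<Longrightarrow> wdeg dg w = n \<Longrightarrow> P (Poly_Mapping.single w c)"
    and "\<And>p q. p \<in> path_combs L s t dg X Y n \<Longrightarrow> q \<in> path_combs L s t dg X Y n \<Longrightarrow> P p \<Longrightarrow> P q \<Longrightarrow> P (p + q)"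
  shows "P p"
proof -
  have eq: "Poly_Mapping.keys q \<subseteq> {w. is_path L s t X Y w \<and> wdeg dg w = n}
      \<longleftrightarrow> q \<in> path_combs L s t dg X Y n" for q :: "'e list \<Rightarrow>\<^sub>0 'k"
    by (auto simp: path_combs_def)
  from assms show ?thesis
    by (intro poly_mapping_keys_induct[of p "{w. is_path L s t X Y w \<and> wdeg dg w = n}" P])
      (auto simp: eq)
qed

lemma path_combs_mult:
  assumes "p \<in> path_combs L s t dg Y Z m" "q \<in> path_combs L s t dg X Y n"
  shows "word_mult p q \<in> path_combs L s t dg X Z (m + n)"
  unfolding word_mult_def
proof (intro path_combs_lin path_combs_word)
  fix u v assume u: "u \<in> Poly_Mapping.keys p" and v: "v \<in> Poly_Mapping.keys q"
  show "is_path L s t X Z (u @ v)"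
    using path_combsD(1)[OF assms(1) u] path_combsD(1)[OF assms(2) v] by (auto simp: is_path_append)
  show "wdeg dg (u @ v) = m + n"
    using path_combsD(2)[OF assms(1) u] path_combsD(2)[OF assms(2) v] by simp
qed

section \<open>Dg categories presented by quivers, and functors out of them\<close>

section \<open>Free dg categories\<close>

abbreviation fdiff :: "('k::{comm_ring,comm_monoid_mult}, 'o, 'e) dgquiver \<Rightarrow> ('e list \<Rightarrow>\<^sub>0 'k)
    \<Rightarrow> ('e list \<Rightarrow>\<^sub>0 'k)" where
  "fdiff Q \<equiv> lin (word_diff Q)"

lemma word_diff_append: "word_diff Q (u @ v) = word_mult (word_diff Q u) (word v)
    + ksign (wdeg (edeg Q) u) (word_mult (word u) (word_diff Q v))"
proof (induction u)
  case (Cons e u)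
  have "word_diff Q ((e # u) @ v) = word_mult (ediff Q e) (word_mult (word u) (word v))
     + ksign (edeg Q e) (word_mult (word [e]) (word_mult (word_diff Q u) (word v)
    + ksign (wdeg (edeg Q) u) (word_mult (word u) (word_diff Q v))))"
    by (simp add: Cons)
  also have "\<dots> = word_mult (word_diff Q (e # u)) (word v)
    + ksign (wdeg (edeg Q) (e # u)) (word_mult (word (e # u)) (word_diff Q v))"
    by (simp add: word_mult_add_right word_mult_add_left ksign_add word_mult_ksign_right
      word_mult_ksign_left word_mult_assoc word_Cons[of e u] del: word_mult_word)
  finally show ?case .
qed simp

lemma fdiff_mult:
  assumes "homogeneous (edeg Q) n p"
  shows "fdiff Q (word_mult p q) = word_mult (fdiff Q p) q + ksign n (word_mult p (fdiff Q q))"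
proof -
  have *: "lin (\<lambda>v. word_diff Q (u @ v)) q = word_mult (word_diff Q u) q
    + ksign (wdeg (edeg Q) u) (word_mult (word u) (fdiff Q q))" for u
    by (simp add: word_diff_append lin_fun_add lin_fun_ksign word_mult_lin_right[symmetric])
  have "fdiff Q (word_mult p q) = lin (\<lambda>u. word_mult (word_diff Q u) q
    + ksign n (word_mult (word u) (fdiff Q q))) p"
    unfolding lin_word_mult using assms by (intro lin_ext_cong) (simp add: * homogeneous_def)
  then show ?thesis
    by (simp add: lin_fun_add lin_fun_ksign word_mult_lin_left[symmetric])
qed

text \<open>Only the ends and the degree of the prescribed differential are constrained here. That
  it squares to zero is a separate assumption of \<open>fdiff_fdiff\<close>, because the quiver of
  mixed words used for lifting satisfies it only modulo relations.\<close>

locale wf_quiver =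
  fixes Q :: "('k::{comm_ring,comm_monoid_mult}, 'o, 'e) dgquiver"
  assumes esrc_verts: "e \<in> edges Q \<Longrightarrow> esrc Q e \<in> verts Q"
    and etgt_verts: "e \<in> edges Q \<Longrightarrow> etgt Q e \<in> verts Q"
    and ediff_path_combs: "e \<in> edges Q \<Longrightarrow>
      ediff Q e \<in> path_combs (edges Q) (esrc Q) (etgt Q) (edeg Q) (esrc Q e) (etgt Q e) (edeg Q e + 1)"
begin

abbreviation "paths \<equiv> is_path (edges Q) (esrc Q) (etgt Q)"
abbreviation "combs \<equiv> path_combs (edges Q) (esrc Q) (etgt Q) (edeg Q)"

lemma word_diff_combs: "paths X Y w \<Longrightarrow> word_diff Q w \<in> combs X Y (wdeg (edeg Q) w + 1)"
proof (induction w arbitrary: Y)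
  case (Cons e w)
  then have e: "e \<in> edges Q" "etgt Q e = Y" and w: "paths X (esrc Q e) w" by auto
  have "word_mult (ediff Q e) (word w) \<in> combs X Y ((edeg Q e + 1) + wdeg (edeg Q) w)"
    using e ediff_path_combs[of e] w by (intro path_combs_mult path_combs_word) auto
  moreover have "word_mult (word [e]) (word_diff Q w) \<in> combs X Y (edeg Q e + (wdeg (edeg Q) w + 1))"
    using e w by (intro path_combs_mult path_combs_word Cons.IH) auto
  ultimately show ?case
    by (auto intro!: path_combs_add path_combs_ksign simp: add_ac)
qed simp

lemma fdiff_combs: "p \<in> combs X Y n \<Longrightarrow> fdiff Q p \<in> combs X Y (n + 1)"
  by (rule path_combs_lin) (use word_diff_combs path_combsD in metis)

text \<open>The two cross terms of d(d(e w)) carry the signs of |e| + 1 and |e| and cancel; the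
  outer terms vanish by \<open>sq\<close> and by induction.\<close>

lemma fdiff_fdiff:
  assumes sq: "\<And>e. e \<in> edges Q \<Longrightarrow> fdiff Q (ediff Q e) = 0" and "p \<in> combs X Y n"
  shows "fdiff Q (fdiff Q p) = 0"
proof -
  have "fdiff Q (word_diff Q w) = 0" if "paths X Y w" for w Y
    using that
  proof (induction w arbitrary: Y)
    case (Cons e w)
    then have e: "e \<in> edges Q" and w: "paths X (esrc Q e) w" by auto
    have "homogeneous (edeg Q) (edeg Q e + 1) (ediff Q e)"
      by (rule path_combs_homogeneous[OF ediff_path_combs[OF e]])
    then show ?case
      using sq[OF e] Cons.IH[OF w]
      by (simp add: fdiff_mult[OF homogeneous_letter] fdiff_mult lin_add lin_ksign ksign_add word_mult_ksign_right) (simp add: ksign_def)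
  qed simp
  then have "lin (\<lambda>w. fdiff Q (word_diff Q w)) p = lin (\<lambda>w. 0) p"
    using assms(2) by (intro lin_ext_cong) (metis path_combsD(1))
  then show ?thesis by (simp add: lin_lin)
qed

lemma dg_category_free:
  assumes "\<And>e. e \<in> edges Q \<Longrightarrow> fdiff Q (ediff Q e) = 0"
  shows "dg_category (free_dgcat Q)"
proof (unfold_locales, goal_cases)
  \<comment> \<open>Goals 20 and 21 are d^2 = 0 and the Leibniz rule; the other axioms follow from
    bilinearity of \<open>word_mult\<close> and closure of the spaces of paths.\<close>
  case (20 X Y n f)
  then show ?case using fdiff_fdiff[OF assms] by (simp add: free_dgcat_def)
next
  case (21 X Y Z g m f n)
  have "homogeneous (edeg Q) m g"
    using 21(4) by (auto simp: free_dgcat_def intro: path_combs_homogeneous)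
  then show ?case by (simp add: free_dgcat_def fdiff_mult)
qed (simp_all add: free_dgcat_def path_combs_add path_combs_scale pm_scale_add pm.sc_add_left
    pm.sc_sc path_combs_mult word_mult_linear word_mult_scale_left word_mult_scale_right
    word_mult_assoc path_combs_word fdiff_combs lin_add lin_pm_scale)

end

section \<open>Linear algebra in dg categories\<close>

lemma lin_ext_hom:
  assumes "kmodule sc M" "kmodule sc' M'"
    and g: "\<And>x. x \<in> M \<Longrightarrow> g x \<in> M'" "\<And>x y. x \<in> M \<Longrightarrow> y \<in> M \<Longrightarrow> g (x + y) = g x + g y"
      "\<And>c x. x \<in> M \<Longrightarrow> g (sc c x) = sc' c (g x)"
    and val: "\<And>w. w \<in> Poly_Mapping.keys p \<Longrightarrow> val w \<in> M"
  shows "g (lin_ext sc val p) = lin_ext sc' (\<lambda>w. g (val w)) p"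
proof -
  interpret M: kmodule sc M by fact
  have g0: "g 0 = 0" using g(2)[OF M.zero_mem M.zero_mem] by simp
  have "g (\<Sum>w\<in>S. sc (Poly_Mapping.lookup p w) (val w))
      = (\<Sum>w\<in>S. sc' (Poly_Mapping.lookup p w) (g (val w)))" if "finite S" "S \<subseteq> Poly_Mapping.keys p" for S
    using that
  proof (induction S)
    case (insert x S)
    then have *: "val x \<in> M" "(\<Sum>w\<in>S. sc (Poly_Mapping.lookup p w) (val w)) \<in> M"
      by (auto intro!: M.sum_mem M.sc_mem val)
    with insert show ?case by (simp add: g M.sc_mem)
  qed (simp add: g0)
  then show ?thesis by (simp add: lin_ext_def)
qed

lemma arrows_iff: "e \<in> arrows C \<longleftrightarrow>
    asrc e \<in> Ob C \<and> atgt e \<in> Ob C \<and> amor e \<in> Hom C (asrc e) (atgt e) (adeg e)"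
  unfolding arrows_def mem_Collect_eq by (rule refl)

context dg_category
begin

lemma kmodule_Hom: "X \<in> Ob C \<Longrightarrow> Y \<in> Ob C \<Longrightarrow> kmodule (Scale C) (Hom C X Y n)"
  by unfold_locales (auto intro: zero_Hom add_Hom Scale_Hom Scale_add_right Scale_add_left Scale_Scale Scale_one)

lemmas Scale_zero_right = kmodule.sc_zero_right[OF kmodule_Hom]
  and uminus_Hom = kmodule.uminus_mem[OF kmodule_Hom]
  and diff_Hom = kmodule.diff_mem[OF kmodule_Hom]
  and ksign_Hom = kmodule.ksign_mem[OF kmodule_Hom]
  and sum_Hom = kmodule.sum_mem[OF kmodule_Hom]
  and lin_ext_Hom = kmodule.lin_ext_mem[OF kmodule_Hom]

lemma Scale_uminus: "\<lbrakk>X \<in> Ob C; Y \<in> Ob C; f \<in> Hom C X Y n\<rbrakk> \<Longrightarrow> Scale C a (- f) = - Scale C a f"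
  using Scale_add_right[of X Y f n "- f" a] by (simp add: uminus_Hom Scale_zero_right minus_unique)

lemma Scale_ksign: "\<lbrakk>X \<in> Ob C; Y \<in> Ob C; f \<in> Hom C X Y n\<rbrakk>
    \<Longrightarrow> Scale C a (ksign m f) = ksign m (Scale C a f)"
  by (auto simp: ksign_def Scale_uminus)

lemma Comp_zero_left: "\<lbrakk>X \<in> Ob C; Y \<in> Ob C; Z \<in> Ob C; f \<in> Hom C X Y n\<rbrakk> \<Longrightarrow> Comp C X Y Z 0 f = 0"
  using Comp_add_left[of X Y Z 0 0 0 f n] by (simp add: zero_Hom)

lemma Comp_zero_right: "\<lbrakk>X \<in> Ob C; Y \<in> Ob C; Z \<in> Ob C; g \<in> Hom C Y Z m\<rbrakk> \<Longrightarrow> Comp C X Y Z g 0 = 0"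
  using Comp_add_right[of X Y Z g m 0 0 0] by (simp add: zero_Hom)

lemma Comp_uminus_left: "\<lbrakk>X \<in> Ob C; Y \<in> Ob C; Z \<in> Ob C; g \<in> Hom C Y Z m; f \<in> Hom C X Y n\<rbrakk>
    \<Longrightarrow> Comp C X Y Z (- g) f = - Comp C X Y Z g f"
  using Comp_add_left[of X Y Z g m "- g" f n] by (simp add: uminus_Hom Comp_zero_left minus_unique)

lemma Comp_uminus_right: "\<lbrakk>X \<in> Ob C; Y \<in> Ob C; Z \<in> Ob C; g \<in> Hom C Y Z m; f \<in> Hom C X Y n\<rbrakk>
    \<Longrightarrow> Comp C X Y Z g (- f) = - Comp C X Y Z g f"
  using Comp_add_right[of X Y Z g m f n "- f"] by (simp add: uminus_Hom Comp_zero_right minus_unique)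

lemma Comp_ksign_left: "\<lbrakk>X \<in> Ob C; Y \<in> Ob C; Z \<in> Ob C; g \<in> Hom C Y Z m; f \<in> Hom C X Y n\<rbrakk>
    \<Longrightarrow> Comp C X Y Z (ksign l g) f = ksign l (Comp C X Y Z g f)"
  by (auto simp: ksign_def Comp_uminus_left)

lemma Comp_ksign_right: "\<lbrakk>X \<in> Ob C; Y \<in> Ob C; Z \<in> Ob C; g \<in> Hom C Y Z m; f \<in> Hom C X Y n\<rbrakk>
    \<Longrightarrow> Comp C X Y Z g (ksign l f) = ksign l (Comp C X Y Z g f)"
  by (auto simp: ksign_def Comp_uminus_right)

lemma Diff_zero: "\<lbrakk>X \<in> Ob C; Y \<in> Ob C\<rbrakk> \<Longrightarrow> Diff C X Y n 0 = 0"
  using Diff_add[of X Y 0 n 0] by (simp add: zero_Hom)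

lemma Diff_uminus: "\<lbrakk>X \<in> Ob C; Y \<in> Ob C; f \<in> Hom C X Y n\<rbrakk> \<Longrightarrow> Diff C X Y n (- f) = - Diff C X Y n f"
  using Diff_add[of X Y f n "- f"] by (simp add: uminus_Hom Diff_zero minus_unique)

lemma Diff_diff: "\<lbrakk>X \<in> Ob C; Y \<in> Ob C; f \<in> Hom C X Y n; g \<in> Hom C X Y n\<rbrakk>
    \<Longrightarrow> Diff C X Y n (f - g) = Diff C X Y n f - Diff C X Y n g"
  using Diff_add[of X Y f n "- g"] by (simp add: uminus_Hom Diff_uminus)

lemma Diff_ksign: "\<lbrakk>X \<in> Ob C; Y \<in> Ob C; f \<in> Hom C X Y n\<rbrakk>
    \<Longrightarrow> Diff C X Y n (ksign l f) = ksign l (Diff C X Y n f)"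
  by (auto simp: ksign_def Diff_uminus)

text \<open>d(1) = d(1 \<circ> 1) = d(1) + d(1).\<close>

lemma Diff_Ident:
  assumes X: "X \<in> Ob C"
  shows "Diff C X X 0 (Ident C X) = 0"
proof -
  have I: "Ident C X \<in> Hom C X X 0" "Diff C X X 0 (Ident C X) \<in> Hom C X X 1"
    using Ident_Hom[OF X] Diff_Hom[OF X X Ident_Hom[OF X]] by auto
  have "Diff C X X 0 (Ident C X) + Diff C X X 0 (Ident C X) = Diff C X X 0 (Ident C X) + 0"
    using Diff_Comp[OF X X X I(1) I(1)]
    by (simp only: Comp_Ident_left[OF X X I(1)] Comp_Ident_left[OF X X I(2)]
        Comp_Ident_right[OF X X I(2)] ksign_at_zero add_0_right)
  then show ?thesis by (simp only: add_left_cancel)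
qed

lemma word_val_Hom: "\<lbrakk>is_path (arrows C) asrc atgt X Y w; X \<in> Ob C\<rbrakk>
    \<Longrightarrow> Y \<in> Ob C \<and> word_val C X w \<in> Hom C X Y (wdeg adeg w)"
proof (induction w arbitrary: Y)
  case (Cons e w)
  have p: "e \<in> arrows C" "atgt e = Y" "is_path (arrows C) asrc atgt X (asrc e) w"
    using Cons.prems(1) unfolding is_path.simps by blast+
  have e: "asrc e \<in> Ob C" "atgt e \<in> Ob C" "amor e \<in> Hom C (asrc e) (atgt e) (adeg e)"
    using p(1) unfolding arrows_iff by blast+
  have w: "word_val C X w \<in> Hom C X (asrc e) (wdeg adeg w)"
    using Cons.IH[OF p(3) Cons.prems(2)] by (rule conjunct2)
  have "Comp C X (asrc e) (atgt e) (amor e) (word_val C X w) \<in> Hom C X (atgt e) (adeg e + wdeg adeg w)"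
    by (rule Comp_Hom[OF Cons.prems(2) e(1,2,3) w])
  then show ?case using p(2) e(2) by simp
qed (auto simp: Ident_Hom)

lemma path_ConsE:
  assumes "is_path (arrows C) asrc atgt X Y (e # w)"
  obtains "asrc e \<in> Ob C" "atgt e \<in> Ob C" "amor e \<in> Hom C (asrc e) (atgt e) (adeg e)"
    "atgt e = Y" "is_path (arrows C) asrc atgt X (asrc e) w"
  using assms unfolding is_path.simps arrows_iff by blast

lemma word_val_append:
  assumes "is_path (arrows C) asrc atgt Y Z u" "is_path (arrows C) asrc atgt X Y v" "X \<in> Ob C"
  shows "word_val C X (u @ v) = Comp C X Y Z (word_val C Y u) (word_val C X v)"
  using assms
proof (induction u arbitrary: Z)
  case Nil
  have "Y \<in> Ob C" "word_val C X v \<in> Hom C X Y (wdeg adeg v)"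
    using word_val_Hom[OF Nil.prems(2,3)] by blast+
  from Comp_Ident_left[OF Nil.prems(3) this] show ?case using Nil.prems(1) by simp
next
  case (Cons e u)
  have Y: "Y \<in> Ob C" "word_val C X v \<in> Hom C X Y (wdeg adeg v)"
    using word_val_Hom[OF Cons.prems(2,3)] by blast+
  from Cons.prems(1) show ?case
  proof (rule path_ConsE)
    assume e: "asrc e \<in> Ob C" "atgt e \<in> Ob C" "amor e \<in> Hom C (asrc e) (atgt e) (adeg e)"
      and Z: "atgt e = Z" and u: "is_path (arrows C) asrc atgt Y (asrc e) u"
    have u': "word_val C Y u \<in> Hom C Y (asrc e) (wdeg adeg u)"
      using word_val_Hom[OF u Y(1)] by blast
    show ?thesis
      using Comp_assoc[OF Cons.prems(3) Y(1) e(1,2,3) u' Y(2)] Cons.IH[OF u Cons.prems(2,3)]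
      by (simp add: Z[symmetric])
  qed
qed

end

context dg_functor
begin

lemma FMor_zero: "\<lbrakk>X \<in> Ob C; Y \<in> Ob C\<rbrakk> \<Longrightarrow> FMor F X Y n 0 = 0"
  using FMor_add[of X Y 0 n 0] by (simp add: source.zero_Hom)

lemma FMor_uminus: "\<lbrakk>X \<in> Ob C; Y \<in> Ob C; f \<in> Hom C X Y n\<rbrakk> \<Longrightarrow> FMor F X Y n (- f) = - FMor F X Y n f"
  using FMor_add[of X Y f n "- f"] by (simp add: source.uminus_Hom FMor_zero minus_unique)

lemma FMor_diff: "\<lbrakk>X \<in> Ob C; Y \<in> Ob C; f \<in> Hom C X Y n; g \<in> Hom C X Y n\<rbrakk>
    \<Longrightarrow> FMor F X Y n (f - g) = FMor F X Y n f - FMor F X Y n g"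
  using FMor_add[of X Y f n "- g"] by (simp add: source.uminus_Hom FMor_uminus)

lemma FMor_ksign: "\<lbrakk>X \<in> Ob C; Y \<in> Ob C; f \<in> Hom C X Y n\<rbrakk>
    \<Longrightarrow> FMor F X Y n (ksign l f) = ksign l (FMor F X Y n f)"
  by (auto simp: ksign_def FMor_uminus)

lemma FMor_sum: "\<lbrakk>X \<in> Ob C; Y \<in> Ob C; \<And>i. i \<in> I \<Longrightarrow> f i \<in> Hom C X Y n\<rbrakk>
    \<Longrightarrow> FMor F X Y n (sum f I) = (\<Sum>i\<in>I. FMor F X Y n (f i))"
  by (induction I rule: infinite_finite_induct)
    (auto simp: FMor_zero FMor_add source.sum_Hom)

lemma FMor_lin_ext: "\<lbrakk>X \<in> Ob C; Y \<in> Ob C; \<And>w. w \<in> Poly_Mapping.keys p \<Longrightarrow> val w \<in> Hom C X Y n\<rbrakk>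
    \<Longrightarrow> FMor F X Y n (lin_ext (Scale C) val p) = lin_ext (Scale D) (\<lambda>w. FMor F X Y n (val w)) p"
  by (rule lin_ext_hom[OF source.kmodule_Hom target.kmodule_Hom[OF FOb_Ob FOb_Ob], where g = "FMor F X Y n"])
    (assumption | erule (2) FMor_Hom | simp add: FMor_add FMor_Scale)+

lemma FMor_word_val: "\<lbrakk>is_path (arrows C) asrc atgt X Y w; X \<in> Ob C\<rbrakk>
    \<Longrightarrow> FMor F X Y (wdeg adeg w) (word_val C X w) = word_val D (FOb F X) (map (image_arrow F) w)"
proof (induction w arbitrary: Y)
  case (Cons e w)
  from Cons.prems(1) show ?case
  proof (rule source.path_ConsE)
    assume e: "asrc e \<in> Ob C" "atgt e \<in> Ob C" "amor e \<in> Hom C (asrc e) (atgt e) (adeg e)"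
      and Z: "atgt e = Y" and w: "is_path (arrows C) asrc atgt X (asrc e) w"
    have w': "word_val C X w \<in> Hom C X (asrc e) (wdeg adeg w)"
      using source.word_val_Hom[OF w Cons.prems(2)] by blast
    show ?thesis
      using FMor_Comp[OF Cons.prems(2) e(1,2,3) w'] Cons.IH[OF w Cons.prems(2)]
      by (simp add: Z[symmetric] image_arrow_def)
  qed
qed (auto simp: FMor_Ident)

lemma image_arrow_arrows: "e \<in> arrows C \<Longrightarrow> image_arrow F e \<in> arrows D"
  by (auto simp: arrows_iff image_arrow_def FOb_Ob FMor_Hom)

end

lemma image_arrow_simps [simp]:
  "asrc (image_arrow F e) = FOb F (asrc e)" "atgt (image_arrow F e) = FOb F (atgt e)"
  "adeg (image_arrow F e) = adeg e"
  by (simp_all add: image_arrow_def)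

lemma dg_functor_id: "dg_category C \<Longrightarrow> dg_functor C C id_dgfun"
  by (simp add: dg_functor_def dg_functor_axioms_def id_dgfun_def)

lemma dg_functor_comp:
  assumes "dg_functor C D F" "dg_functor D E G"
  shows "dg_functor C E (G \<circ>\<^sub>d\<^sub>g F)"
proof -
  interpret F: dg_functor C D F by fact
  interpret G: dg_functor D E G by fact
  show ?thesis
    by unfold_locales
      (simp_all add: comp_dgfun_def F.FOb_Ob G.FOb_Ob F.FMor_Hom G.FMor_Hom F.FMor_add G.FMor_add
       F.FMor_Scale G.FMor_Scale F.FMor_Comp G.FMor_Comp F.FMor_Ident G.FMor_Ident
       F.FMor_Diff G.FMor_Diff)
qed

section \<open>Representations of quivers\<close>

lemma word_mult_singles: "word_mult (Poly_Mapping.single u c) (Poly_Mapping.single v d)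
    = Poly_Mapping.single (u @ v) (c * d)"
proof -
  have "word_mult (pm_scale c (word u)) (pm_scale d (word v)) = pm_scale c (pm_scale d (word (u @ v)))"
    unfolding word_mult_scale_left unfolding word_mult_scale_right word_mult_word ..
  then show ?thesis by simp
qed

text \<open>No condition on differentials: \<open>ev\<close> below is the induced functor of graded
  categories. During lifting, combinations have to be evaluated before the values on all generators
  are compatible with d.\<close>

locale quiver_rep = wf_quiver Q + dg_category D
  for Q :: "('k::{comm_ring,comm_monoid_mult}, 'o, 'e) dgquiver"
    and D :: "('k, 'p, 'n::ab_group_add) dgcat" +
  fixes fo :: "'o \<Rightarrow> 'p" and fe :: "'e \<Rightarrow> 'n"
  assumes fo_Ob: "X \<in> verts Q \<Longrightarrow> fo X \<in> Ob D"
    and fe_Hom: "e \<in> edges Q \<Longrightarrow> fe e \<in> Hom D (fo (esrc Q e)) (fo (etgt Q e)) (edeg Q e)"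
begin

abbreviation "arr e \<equiv> Arrow (fo (esrc Q e)) (fo (etgt Q e)) (edeg Q e) (fe e)"

definition ev :: "'o \<Rightarrow> ('e list \<Rightarrow>\<^sub>0 'k) \<Rightarrow> 'n" where
  "ev X = lin_ext (Scale D) (\<lambda>w. word_val D (fo X) (map arr w))"

lemma FMor_free: "FMor (free_dgfun Q D fo fe) X Y n = ev X"
  by (simp add: free_dgfun_def ev_def)

lemma arr_path: "paths X Y w \<Longrightarrow> is_path (arrows D) asrc atgt (fo X) (fo Y) (map arr w)"
  by (erule is_path_map) (auto simp: arrows_iff esrc_verts etgt_verts fo_Ob fe_Hom)

lemma paths_verts: "paths X Y w \<Longrightarrow> X \<in> verts Q \<Longrightarrow> Y \<in> verts Q"
  by (cases w) (auto simp: etgt_verts)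

lemma wdeg_arr: "wdeg adeg (map arr w) = wdeg (edeg Q) w"
  by (induction w) auto

lemma word_Hom: "paths X Y w \<Longrightarrow> X \<in> verts Q \<Longrightarrow>
    word_val D (fo X) (map arr w) \<in> Hom D (fo X) (fo Y) (wdeg (edeg Q) w)"
  using word_val_Hom[OF arr_path fo_Ob] unfolding wdeg_arr by blast

lemma word_append: "paths Y Z u \<Longrightarrow> paths X Y v \<Longrightarrow> X \<in> verts Q \<Longrightarrow>
    word_val D (fo X) (map arr (u @ v))
      = Comp D (fo X) (fo Y) (fo Z) (word_val D (fo Y) (map arr u)) (word_val D (fo X) (map arr v))"
  using word_val_append[OF arr_path arr_path fo_Ob] by simp

lemma ev_single: "paths X Y w \<Longrightarrow> X \<in> verts Q \<Longrightarrow>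
    ev X (Poly_Mapping.single w c) = Scale D c (word_val D (fo X) (map arr w))"
  unfolding ev_def using word_Hom[of X Y w] paths_verts[of X Y w]
  by (intro kmodule.lin_ext_single[OF kmodule_Hom[of "fo X" "fo Y" "wdeg (edeg Q) w"]])
    (auto intro: fo_Ob)

lemma ev_word: "paths X Y w \<Longrightarrow> X \<in> verts Q \<Longrightarrow> ev X (word w) = word_val D (fo X) (map arr w)"
  using Scale_one[OF fo_Ob fo_Ob word_Hom] by (simp add: ev_single paths_verts)

lemma ev_zero [simp]: "ev X 0 = 0"
  by (simp add: ev_def)

lemma keys_Hom:
  assumes "p \<in> combs X Y n" "X \<in> verts Q" "w \<in> Poly_Mapping.keys p"
  shows "word_val D (fo X) (map arr w) \<in> Hom D (fo X) (fo Y) n"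
  using word_Hom[OF path_combsD(1)[OF assms(1,3)] assms(2)] path_combsD(2)[OF assms(1,3)] by simp

lemma ev_Hom: "p \<in> combs X Y n \<Longrightarrow> X \<in> verts Q \<Longrightarrow> Y \<in> verts Q \<Longrightarrow> ev X p \<in> Hom D (fo X) (fo Y) n"
  unfolding ev_def by (rule lin_ext_Hom) (auto intro: fo_Ob keys_Hom)

lemma ev_add: "\<lbrakk>p \<in> combs X Y n; q \<in> combs X Y n; X \<in> verts Q; Y \<in> verts Q\<rbrakk>
    \<Longrightarrow> ev X (p + q) = ev X p + ev X q"
  unfolding ev_def by (rule kmodule.lin_ext_add[OF kmodule_Hom[of "fo X" "fo Y" n]])
    (auto intro: keys_Hom fo_Ob)

lemma ev_scale: "\<lbrakk>p \<in> combs X Y n; X \<in> verts Q; Y \<in> verts Q\<rbrakk> \<Longrightarrow> ev X (pm_scale c p) = Scale D c (ev X p)"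
proof (induction p rule: path_combs_induct)
  case zero
  then show ?case by (simp add: pm.sc_zero_right Scale_zero_right[of "fo X" "fo X"] fo_Ob)
next
  case (single w d)
  then show ?case using word_Hom[of X Y w] by (simp add: ev_single Scale_Scale[of "fo X" "fo Y"] fo_Ob)
next
  case (add p q)
  then show ?case
    using ev_Hom[of p X Y n] ev_Hom[of q X Y n]
    by (simp add: pm_scale_add ev_add[of _ X Y n] path_combs_scale Scale_add_right[of "fo X" "fo Y"] fo_Ob)
qed

lemma ev_uminus: "\<lbrakk>p \<in> combs X Y n; X \<in> verts Q; Y \<in> verts Q\<rbrakk> \<Longrightarrow> ev X (- p) = - ev X p"
  using ev_add[of p X Y n "- p"] by (simp add: path_combs_uminus minus_unique)

lemma ev_diff: "\<lbrakk>p \<in> combs X Y n; q \<in> combs X Y n; X \<in> verts Q; Y \<in> verts Q\<rbrakk>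
    \<Longrightarrow> ev X (p - q) = ev X p - ev X q"
  using ev_add[of p X Y n "- q"] by (simp add: path_combs_uminus ev_uminus)

lemma ev_ksign: "\<lbrakk>p \<in> combs X Y n; X \<in> verts Q; Y \<in> verts Q\<rbrakk> \<Longrightarrow> ev X (ksign l p) = ksign l (ev X p)"
  by (simp add: ksign_def ev_uminus)

lemma ev_one: "X \<in> verts Q \<Longrightarrow> ev X (word []) = Ident D (fo X)"
  by (simp add: ev_word)

text \<open>Bilinearity reduces the claim to two monomials; both inductions stay within fixed homs,
  where \<open>ev\<close> is linear.\<close>

lemma ev_mult: "\<lbrakk>p \<in> combs Y Z m; q \<in> combs X Y n; X \<in> verts Q; Y \<in> verts Q; Z \<in> verts Q\<rbrakk>
    \<Longrightarrow> ev X (word_mult p q) = Comp D (fo X) (fo Y) (fo Z) (ev Y p) (ev X q)"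
proof (induction p rule: path_combs_induct)
  case zero
  then show ?case using ev_Hom by (simp add: Comp_zero_left[OF _ _ _ ev_Hom] fo_Ob)
next
  case (add p p')
  then have "word_mult p q \<in> combs X Z (m + n)" "word_mult p' q \<in> combs X Z (m + n)"
    by (auto intro: path_combs_mult)
  with add show ?case
    by (simp add: word_mult_add_left ev_add[of _ X Z "m + n"] ev_add[of _ Y Z m]
      Comp_add_left[OF _ _ _ ev_Hom ev_Hom ev_Hom] fo_Ob)
next
  case (single u c)
  note u = single(1-2) and [simp] = single(4-6)
  from single(3) show ?case
  proof (induction q rule: path_combs_induct)
    case zero
    then show ?case
      using Comp_zero_right[OF _ _ _ ev_Hom[OF path_combs_single[OF u]]] by (simp add: fo_Ob)
  next
    case (add q q')
    have "word_mult (Poly_Mapping.single u c) q \<in> combs X Z (m + n)"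
      "word_mult (Poly_Mapping.single u c) q' \<in> combs X Z (m + n)"
      using u add(1,2) by (auto intro!: path_combs_mult path_combs_single)
    with add show ?case
      by (simp add: word_mult_add_right ev_add[of _ X Z "m + n"] ev_add[of _ X Y n]
        Comp_add_right[OF _ _ _ ev_Hom[OF path_combs_single[OF u]] ev_Hom ev_Hom] fo_Ob)
  next
    case (single v d)
    let ?u = "word_val D (fo Y) (map arr u)" and ?v = "word_val D (fo X) (map arr v)"
    have H: "?u \<in> Hom D (fo Y) (fo Z) m" "?v \<in> Hom D (fo X) (fo Y) n"
      using word_Hom u single by auto
    have O: "fo X \<in> Ob D" "fo Y \<in> Ob D" "fo Z \<in> Ob D" by (auto simp: fo_Ob)
    have "paths X Z (u @ v)" using u single by (auto simp: is_path_append)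
    then have "ev X (Poly_Mapping.single (u @ v) (c * d)) = Scale D (c * d) (Comp D (fo X) (fo Y) (fo Z) ?u ?v)"
      using word_append[OF u(1) single(1)] by (simp add: ev_single)
    also have "\<dots> = Comp D (fo X) (fo Y) (fo Z) (Scale D c ?u) (Scale D d ?v)"
      using H O by (simp add: Comp_Scale_left[of _ _ _ _ m _ n] Comp_Scale_right[of _ _ _ _ m _ n] Scale_Hom
        Scale_Scale[OF O(1,3) Comp_Hom] mult.commute)
    also have "\<dots> = Comp D (fo X) (fo Y) (fo Z) (ev Y (Poly_Mapping.single u c)) (ev X (Poly_Mapping.single v d))"
      using u single by (simp add: ev_single)
    finally show ?case by (simp add: word_mult_singles)
  qed
qed

lemma ev_letter: "e \<in> edges Q \<Longrightarrow> ev (esrc Q e) (word [e]) = fe e"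
  using Comp_Ident_right[OF fo_Ob fo_Ob fe_Hom] by (simp add: ev_word esrc_verts etgt_verts)

end

text \<open>Compatibility with d is demanded on edges; the Leibniz rules on both sides propagate it
  to words in \<open>ev_word_diff\<close>.\<close>

locale quiver_functor = quiver_rep +
  assumes ev_ediff: "e \<in> edges Q \<Longrightarrow>
    ev (esrc Q e) (ediff Q e) = Diff D (fo (esrc Q e)) (fo (etgt Q e)) (edeg Q e) (fe e)"
begin

lemma ev_word_diff: "\<lbrakk>paths X Y w; X \<in> verts Q\<rbrakk>
    \<Longrightarrow> ev X (word_diff Q w) = Diff D (fo X) (fo Y) (wdeg (edeg Q) w) (word_val D (fo X) (map arr w))"
proof (induction w arbitrary: Y)
  case Nil
  then show ?case by (auto simp: Diff_Ident fo_Ob)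
next
  case (Cons e w)
  let ?n = "wdeg (edeg Q) w" and ?d = "edeg Q e" and ?S = "esrc Q e"
  from Cons.prems have e: "e \<in> edges Q" and w: "paths X ?S w" and [simp]: "etgt Q e = Y" "X \<in> verts Q"
    by auto
  have [simp]: "?S \<in> verts Q" "Y \<in> verts Q" using e esrc_verts etgt_verts[OF e] by auto
  have [simp]: "fo X \<in> Ob D" "fo Y \<in> Ob D" "fo ?S \<in> Ob D" by (auto simp: fo_Ob)
  have c: "ediff Q e \<in> combs ?S Y (?d + 1)" "word w \<in> combs X ?S ?n"
    "word [e] \<in> combs ?S Y ?d" "word_diff Q w \<in> combs X ?S (?n + 1)"
    using ediff_path_combs[OF e] w e word_diff_combs by (auto intro!: path_combs_word)
  have m1: "word_mult (ediff Q e) (word w) \<in> combs X Y (?d + ?n + 1)"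
    using path_combs_mult[OF c(1,2)] by (simp add: add_ac)
  have m2: "word_mult (word [e]) (word_diff Q w) \<in> combs X Y (?d + ?n + 1)"
    using path_combs_mult[OF c(3,4)] by (simp add: add_ac)
  have "ev X (word_diff Q (e # w)) = ev X (word_mult (ediff Q e) (word w))
      + ksign ?d (ev X (word_mult (word [e]) (word_diff Q w)))"
    by (simp add: ev_add[OF m1 path_combs_ksign[OF m2]] ev_ksign[OF m2])
  also have "\<dots> = Comp D (fo X) (fo ?S) (fo Y) (Diff D (fo ?S) (fo Y) ?d (fe e)) (ev X (word w))
      + ksign ?d (Comp D (fo X) (fo ?S) (fo Y) (fe e)
          (Diff D (fo X) (fo ?S) ?n (word_val D (fo X) (map arr w))))"
    using ev_ediff[OF e] ev_letter[OF e]
    by (simp add: ev_mult[OF c(1,2)] ev_mult[OF c(3,4)] Cons.IH[OF w])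
  also have "\<dots> = Diff D (fo X) (fo Y) (?d + ?n) (Comp D (fo X) (fo ?S) (fo Y) (fe e) (word_val D (fo X) (map arr w)))"
    using Diff_Comp[of "fo X" "fo ?S" "fo Y" "fe e" ?d "word_val D (fo X) (map arr w)" ?n]
      fe_Hom[OF e] word_Hom[OF w] by (simp add: ev_word[OF w])
  finally show ?case by simp
qed

lemma ev_fdiff: "\<lbrakk>p \<in> combs X Y n; X \<in> verts Q; Y \<in> verts Q\<rbrakk>
    \<Longrightarrow> ev X (fdiff Q p) = Diff D (fo X) (fo Y) n (ev X p)"
proof (induction p rule: path_combs_induct)
  case zero
  then show ?case by (simp add: Diff_zero fo_Ob)
next
  case (single w c)
  note w = word_diff_combs[OF single(1)] word_Hom[OF single(1,3)]
  have [simp]: "fo X \<in> Ob D" "fo Y \<in> Ob D" using single by (auto simp: fo_Ob)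
  from w show ?case
    using single by (simp add: lin_single ev_scale[OF w(1)] ev_word_diff ev_single Diff_Scale)
next
  case (add p q)
  then show ?case
    by (simp add: lin_add ev_add[OF fdiff_combs fdiff_combs] ev_add[of p X Y n q]
       Diff_add[OF _ _ ev_Hom ev_Hom] fo_Ob)
qed

lemma dg_functor_free:
  assumes "dg_category (free_dgcat Q)"
  shows "dg_functor (free_dgcat Q) D (free_dgfun Q D fo fe)"
proof -
  interpret S: dg_category "free_dgcat Q" by fact
  have FO: "FOb (free_dgfun Q D fo fe) = fo" by (simp add: free_dgfun_def)
  show ?thesis
    by unfold_locales
      (auto simp: FO FMor_free free_dgcat_def fo_Ob ev_Hom ev_add ev_scale ev_mult ev_one ev_fdiff)
qed

end

text \<open>Composition and identities of a free dg category do not refer to the objects, so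
  evaluating a word of arrows there is plain substitution, whatever ends and degrees are
  attached.\<close>

lemma word_val_free: "word_val (free_dgcat Q) X (map (\<lambda>e. Arrow (s e) (t e) (d e) (fe e)) w) = subst_word fe w"
  by (induction w) (simp_all add: free_dgcat_def)

lemma FMor_free_free: "FMor (free_dgfun Q (free_dgcat Q') fo fe) X Y n = subst fe"
  by (simp add: free_dgfun_def word_val_free) (simp add: free_dgcat_def)

section \<open>Functors and homotopies between free dg categories\<close>

lemma subst_word_combs:
  assumes "\<And>e. e \<in> L \<Longrightarrow> \<phi> e \<in> path_combs L' s' t' dg' (fo (s e)) (fo (t e)) (dg e)"
  shows "is_path L s t X Y w \<Longrightarrow> subst_word \<phi> w \<in> path_combs L' s' t' dg' (fo X) (fo Y) (wdeg dg w)"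
proof (induction w arbitrary: Y)
  case (Cons e w)
  then have "\<phi> e \<in> path_combs L' s' t' dg' (fo (s e)) (fo Y) (dg e)"
    "subst_word \<phi> w \<in> path_combs L' s' t' dg' (fo X) (fo (s e)) (wdeg dg w)"
    using assms[of e] by auto
  from path_combs_mult[OF this] show ?case by simp
qed (auto intro!: path_combs_word)

lemma subst_combs:
  assumes "\<And>e. e \<in> L \<Longrightarrow> \<phi> e \<in> path_combs L' s' t' dg' (fo (s e)) (fo (t e)) (dg e)"
    and "p \<in> path_combs L s t dg X Y n"
  shows "subst \<phi> p \<in> path_combs L' s' t' dg' (fo X) (fo Y) n"
proof (rule path_combs_lin)
  fix w assume w: "w \<in> Poly_Mapping.keys p"
  show "subst_word \<phi> w \<in> path_combs L' s' t' dg' (fo X) (fo Y) n"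
    using subst_word_combs[of L \<phi> L' s' t' dg' fo s t dg X Y w, OF assms(1) path_combsD(1)[OF assms(2) w]]
      path_combsD(2)[OF assms(2) w] by simp
qed

lemma der_word_combs:
  assumes "\<And>e. e \<in> L \<Longrightarrow> \<phi> e \<in> path_combs L' s' t' dg' (fb (s e)) (fb (t e)) (dg e)"
    and "\<And>e. e \<in> L \<Longrightarrow> \<psi> e \<in> path_combs L' s' t' dg' (fa (s e)) (fa (t e)) (dg e)"
    and "\<And>e. e \<in> L \<Longrightarrow> h e \<in> path_combs L' s' t' dg' (fa (s e)) (fb (t e)) (dg e - 1)"
  shows "is_path L s t X Y w \<Longrightarrow>
    der_word dg \<phi> \<psi> h w \<in> path_combs L' s' t' dg' (fa X) (fb Y) (wdeg dg w - 1)"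
proof (induction w arbitrary: Y)
  case (Cons e w)
  then have e: "e \<in> L" "t e = Y" and w: "is_path L s t X (s e) w" by auto
  have "word_mult (\<phi> e) (der_word dg \<phi> \<psi> h w)
      \<in> path_combs L' s' t' dg' (fa X) (fb Y) (dg e + (wdeg dg w - 1))"
    using path_combs_mult[OF assms(1) Cons.IH[OF w]] e by simp
  moreover have "word_mult (h e) (subst_word \<psi> w)
      \<in> path_combs L' s' t' dg' (fa X) (fb Y) (dg e - 1 + wdeg dg w)"
    using path_combs_mult[OF assms(3) subst_word_combs[OF assms(2) w]] e by simp
  ultimately show ?case
    by (auto intro!: path_combs_add path_combs_ksign simp: algebra_simps)
qed simp

lemma der_combs:
  assumes "\<And>e. e \<in> L \<Longrightarrow> \<phi> e \<in> path_combs L' s' t' dg' (fb (s e)) (fb (t e)) (dg e)"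
    and "\<And>e. e \<in> L \<Longrightarrow> \<psi> e \<in> path_combs L' s' t' dg' (fa (s e)) (fa (t e)) (dg e)"
    and "\<And>e. e \<in> L \<Longrightarrow> h e \<in> path_combs L' s' t' dg' (fa (s e)) (fb (t e)) (dg e - 1)"
    and p: "p \<in> path_combs L s t dg X Y n"
  shows "lin (der_word dg \<phi> \<psi> h) p \<in> path_combs L' s' t' dg' (fa X) (fb Y) (n - 1)"
proof (rule path_combs_lin)
  fix w assume w: "w \<in> Poly_Mapping.keys p"
  show "der_word dg \<phi> \<psi> h w \<in> path_combs L' s' t' dg' (fa X) (fb Y) (n - 1)"
    using der_word_combs[where L = L and fa = fa and fb = fb and s = s and t = t,
        OF assms(1-3) path_combsD(1)[OF p w]] path_combsD(2)[OF p w] by simp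
qed

context wf_quiver
begin

lemma fdiff_subst:
  assumes hom: "\<And>e. e \<in> edges Q \<Longrightarrow> homogeneous (edeg Q') (edeg Q e) (\<phi> e)"
    and d: "\<And>e. e \<in> edges Q \<Longrightarrow> fdiff Q' (\<phi> e) = subst \<phi> (ediff Q e)"
    and p: "p \<in> combs X Y n"
  shows "fdiff Q' (subst \<phi> p) = subst \<phi> (fdiff Q p)"
proof -
  have "fdiff Q' (subst_word \<phi> w) = subst \<phi> (word_diff Q w)" if "set w \<subseteq> edges Q" for w
    using that
    by (induction w)
      (simp_all add: fdiff_mult[OF hom] d lin_add subst_mult lin_ksign)
  then show ?thesis
    unfolding lin_lin using path_combsD(1)[OF p] by (intro lin_ext_cong) (auto dest!: is_path_set)
qed

text \<open>A \<open>(\<phi>, \<psi>)\<close>-derivation is a homotopy, natural up to the closed degree \<open>0\<close> morphisms \<open>\<eta>\<close>.\<close>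

lemma fdiff_der:
  assumes hom: "\<And>e. e \<in> edges Q \<Longrightarrow> homogeneous (edeg Q') (edeg Q e) (\<phi> e)"
    and hom_h: "\<And>e. e \<in> edges Q \<Longrightarrow> homogeneous (edeg Q') (edeg Q e - 1) (h e)"
    and d\<phi>: "\<And>e. e \<in> edges Q \<Longrightarrow> fdiff Q' (\<phi> e) = subst \<phi> (ediff Q e)"
    and d\<psi>: "\<And>p X Y n. p \<in> combs X Y n \<Longrightarrow> fdiff Q' (subst \<psi> p) = subst \<psi> (fdiff Q p)"
    and dh: "\<And>e. e \<in> edges Q \<Longrightarrow> fdiff Q' (h e)
        = ksign (edeg Q e) (word_mult (\<phi> e) (\<eta> (esrc Q e)) - word_mult (\<eta> (etgt Q e)) (\<psi> e))
          + lin (der_word (edeg Q) \<phi> \<psi> h) (ediff Q e)"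
    and p: "p \<in> combs X Y n"
  shows "fdiff Q' (lin (der_word (edeg Q) \<phi> \<psi> h) p)
      = ksign n (word_mult (subst \<phi> p) (\<eta> X) - word_mult (\<eta> Y) (subst \<psi> p))
        + lin (der_word (edeg Q) \<phi> \<psi> h) (fdiff Q p)"
proof -
  let ?der = "der_word (edeg Q) \<phi> \<psi> h"
  have word: "fdiff Q' (?der w)
      = ksign (wdeg (edeg Q) w) (word_mult (subst_word \<phi> w) (\<eta> X) - word_mult (\<eta> Y) (subst_word \<psi> w))
        + lin ?der (word_diff Q w)" if "paths X Y w" for w Y
    using that
  proof (induction w arbitrary: Y)
    case (Cons e w)
    let ?n = "wdeg (edeg Q) w" and ?m = "edeg Q e"
    from Cons.prems have e: "e \<in> edges Q" and Y: "etgt Q e = Y" and w: "paths X (esrc Q e) w" by auto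
    have \<psi>w: "fdiff Q' (subst_word \<psi> w) = subst \<psi> (word_diff Q w)"
      using d\<psi>[OF path_combs_word[OF w refl]] by simp
    have hw: "homogeneous (edeg Q) (?n + 1) (word_diff Q w)"
      by (rule path_combs_homogeneous[OF word_diff_combs[OF w]])
    have hw': "homogeneous (edeg Q) ?n (word w)" by (simp add: homogeneous_def)
    have L: "fdiff Q' (?der (e # w)) = word_mult (subst \<phi> (ediff Q e)) (?der w)
        + ksign ?m (word_mult (\<phi> e) (ksign ?n (word_mult (subst_word \<phi> w) (\<eta> X)
            - word_mult (\<eta> (esrc Q e)) (subst_word \<psi> w)) + lin ?der (word_diff Q w)))
        + ksign ?n (word_mult (ksign ?m (word_mult (\<phi> e) (\<eta> (esrc Q e)) - word_mult (\<eta> Y) (\<psi> e))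
          + lin ?der (ediff Q e)) (subst_word \<psi> w)
          + ksign (?m - 1) (word_mult (h e) (subst \<psi> (word_diff Q w))))"
      by (simp add: lin_add lin_ksign fdiff_mult[OF hom[OF e]] fdiff_mult[OF hom_h[OF e]] d\<phi>[OF e]
          dh[OF e] Cons.IH[OF w] \<psi>w Y)
    have R: "lin ?der (word_diff Q (e # w)) = word_mult (subst \<phi> (ediff Q e)) (?der w)
          + ksign ?n (word_mult (lin ?der (ediff Q e)) (subst_word \<psi> w))
        + ksign ?m (word_mult (\<phi> e) (lin ?der (word_diff Q w))
            + ksign (?n + 1) (word_mult (h e) (subst \<psi> (word_diff Q w))))"
      by (simp add: lin_add lin_ksign der_mult[OF hw] der_mult[OF hw'])
    \<comment> \<open>The two terms through the intermediate vertex, the product of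
      \<open>\<phi> e\<close>, \<open>\<eta> (esrc Q e)\<close> and
      \<open>subst_word \<psi> w\<close>, have opposite signs; only \<eta> at the ends
      \<open>X\<close> and \<open>Y\<close> survives.\<close>
    show ?case unfolding L R
      by (simp add: ksign_def word_mult_linear word_mult_assoc algebra_simps)
  qed simp
  have "lin (\<lambda>w. fdiff Q' (?der w)) p
      = lin (\<lambda>w. ksign n (word_mult (subst_word \<phi> w) (\<eta> X) - word_mult (\<eta> Y) (subst_word \<psi> w))
        + lin ?der (word_diff Q w)) p"
  proof (rule lin_ext_cong)
    fix w assume w: "w \<in> Poly_Mapping.keys p"
    from word[OF path_combsD(1)[OF p w]] path_combsD(2)[OF p w]
    show "fdiff Q' (?der w)
      = ksign n (word_mult (subst_word \<phi> w) (\<eta> X) - word_mult (\<eta> Y) (subst_word \<psi> w))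
        + lin ?der (word_diff Q w)" by simp
  qed
  then show ?thesis
    by (simp add: lin_lin lin_fun_add lin_fun_ksign lin_fun_diff
        word_mult_lin_left word_mult_lin_right)
qed

end

text \<open>Evaluation is functorial: if the values \<open>fe\<close> are themselves evaluations of
  \<open>\<phi>\<close>, one may substitute first. Through this p and F are computed on words in the
  generators.\<close>

lemma (in quiver_rep) ev_subst:
  assumes "quiver_rep Q' D fo' fe'"
    and \<phi>: "\<And>e. e \<in> edges Q \<Longrightarrow>
      \<phi> e \<in> path_combs (edges Q') (esrc Q') (etgt Q') (edeg Q') (fv (esrc Q e)) (fv (etgt Q e)) (edeg Q e)"
    and fv: "\<And>X. X \<in> verts Q \<Longrightarrow> fv X \<in> verts Q' \<and> fo' (fv X) = fo X"
    and fe: "\<And>e. e \<in> edges Q \<Longrightarrow> fe e = quiver_rep.ev Q' D fo' fe' (fv (esrc Q e)) (\<phi> e)"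
    and p: "p \<in> combs X Y n" and XY: "X \<in> verts Q" "Y \<in> verts Q"
  shows "ev X p = quiver_rep.ev Q' D fo' fe' (fv X) (subst \<phi> p)"
proof -
  interpret Q': quiver_rep Q' D fo' fe' by fact
  note sub = subst_word_combs[where L = "edges Q" and fo = fv and s = "esrc Q" and t = "etgt Q"
      and dg = "edeg Q", OF \<phi>]
  have word: "word_val D (fo X) (map arr w) = Q'.ev (fv X) (subst_word \<phi> w)"
    if "paths X Y w" for w Y
    using that
  proof (induction w arbitrary: Y)
    case Nil
    then show ?case using fv[OF XY(1)] by (simp add: Q'.ev_one)
  next
    case (Cons e w)
    then have e: "e \<in> edges Q" and Y: "etgt Q e = Y" and w: "paths X (esrc Q e) w" by auto
    have v: "esrc Q e \<in> verts Q" "Y \<in> verts Q" using e esrc_verts etgt_verts Y by auto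
    have \<phi>e: "\<phi> e \<in> Q'.combs (fv (esrc Q e)) (fv Y) (edeg Q e)" using \<phi>[OF e] Y by simp
    show ?case
      using Q'.ev_mult[OF \<phi>e sub[OF _ w]] fv[OF v(1)] fv[OF v(2)] fv[OF XY(1)] Cons.IH[OF w] fe[OF e] Y
      by simp
  qed
  from p show ?thesis
  proof (induction p rule: path_combs_induct)
    case (single w c)
    have "subst_word \<phi> w \<in> Q'.combs (fv X) (fv Y) (wdeg (edeg Q) w)" by (rule sub) (use single in auto)
    then show ?case
      using single fv XY word[OF single(1)] by (simp add: ev_single lin_single Q'.ev_scale)
  next
    case (add p q)
    note s = subst_combs[where L = "edges Q" and fo = fv and s = "esrc Q" and t = "etgt Q"
      and dg = "edeg Q", OF \<phi>]
    from add show ?case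
      using Q'.ev_add[OF s[OF _ add(1)] s[OF _ add(2)]] XY fv by (simp add: ev_add lin_add)
  qed simp
qed

section \<open>Semifree dg categories as free dg categories\<close>

text \<open>For semifree \<open>C\<close>, the maps \<open>comb_val\<close> and
  \<open>expand\<close> are mutually inverse between the free dg category on this quiver and
  \<open>C\<close>; the prescribed differential is that of \<open>C\<close>, transported along
  \<open>expand\<close>.\<close>

definition gen_quiver :: "('k::{comm_ring,comm_monoid_mult}, 'o, 'm::ab_group_add) dgcat
    \<Rightarrow> ('o, 'm) arrow set \<Rightarrow> ('k, 'o, ('o, 'm) arrow) dgquiver" where
  "gen_quiver C G = \<lparr>verts = Ob C, edges = G, esrc = asrc, etgt = atgt, edeg = adeg,
     ediff = expand_diff C G\<rparr>"

lemma gen_quiver_simps [simp]: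
  "verts (gen_quiver C G) = Ob C" "edges (gen_quiver C G) = G" "esrc (gen_quiver C G) = asrc"
  "etgt (gen_quiver C G) = atgt" "edeg (gen_quiver C G) = adeg" "ediff (gen_quiver C G) = expand_diff C G"
  by (simp_all add: gen_quiver_def)

locale semifree_dgcat = dg_category C
  for C :: "('k::{comm_ring,comm_monoid_mult}, 'o, 'm::ab_group_add) dgcat" +
  fixes G :: "('o, 'm) arrow set"
  assumes freely: "freely_generated C G"
begin

abbreviation "QG \<equiv> gen_quiver C G"

lemma gen_arrows: "e \<in> G \<Longrightarrow> e \<in> arrows C"
  using freely by (auto simp: freely_generated_def)

lemma gen_Ob: "e \<in> G \<Longrightarrow> asrc e \<in> Ob C" "e \<in> G \<Longrightarrow> atgt e \<in> Ob C"
  and gen_Hom: "e \<in> G \<Longrightarrow> amor e \<in> Hom C (asrc e) (atgt e) (adeg e)"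
  using gen_arrows[of e] by (auto simp: arrows_iff)

lemma comb_val_bij: "X \<in> Ob C \<Longrightarrow> Y \<in> Ob C \<Longrightarrow> bij_betw (comb_val C X) (arrow_combs G X Y n) (Hom C X Y n)"
  using freely by (auto simp: freely_generated_def)

lemma comb_val_Hom: "\<lbrakk>X \<in> Ob C; Y \<in> Ob C; p \<in> arrow_combs G X Y n\<rbrakk> \<Longrightarrow> comb_val C X p \<in> Hom C X Y n"
  using comb_val_bij[of X Y n] by (auto simp: bij_betw_def)

lemma comb_val_inj: "\<lbrakk>X \<in> Ob C; Y \<in> Ob C; p \<in> arrow_combs G X Y n; q \<in> arrow_combs G X Y n;
    comb_val C X p = comb_val C X q\<rbrakk> \<Longrightarrow> p = q"
  using comb_val_bij[of X Y n] by (auto simp: bij_betw_def inj_on_def)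

lemma expand_combs: "\<lbrakk>X \<in> Ob C; Y \<in> Ob C; f \<in> Hom C X Y n\<rbrakk> \<Longrightarrow> expand C G X Y n f \<in> arrow_combs G X Y n"
  and comb_val_expand: "\<lbrakk>X \<in> Ob C; Y \<in> Ob C; f \<in> Hom C X Y n\<rbrakk> \<Longrightarrow> comb_val C X (expand C G X Y n f) = f"
  using comb_val_bij[of X Y n] unfolding expand_def bij_betw_def
  by (auto intro: the_inv_into_into f_the_inv_into_f)

text \<open>Uniqueness of expansions; through it each identity for \<open>expand\<close> below
  becomes an identity of values in \<open>C\<close>.\<close>

lemma expand_eqI: "\<lbrakk>X \<in> Ob C; Y \<in> Ob C; p \<in> arrow_combs G X Y n; comb_val C X p = f\<rbrakk>
    \<Longrightarrow> expand C G X Y n f = p"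
  using comb_val_bij[of X Y n] unfolding expand_def bij_betw_def
  by (auto intro: the_inv_into_f_eq)

lemma expand_diff_combs: "e \<in> G \<Longrightarrow> expand_diff C G e \<in> arrow_combs G (asrc e) (atgt e) (adeg e + 1)"
  and comb_val_expand_diff: "e \<in> G \<Longrightarrow>
    comb_val C (asrc e) (expand_diff C G e) = Diff C (asrc e) (atgt e) (adeg e) (amor e)"
  unfolding expand_diff_def
  by (auto intro!: expand_combs comb_val_expand gen_Ob Diff_Hom gen_Hom)

sublocale QG: quiver_rep QG C "\<lambda>X. X" amor
  by unfold_locales (auto intro: gen_Ob gen_Hom expand_diff_combs)

lemma ev_eq_comb_val: "QG.ev = comb_val C"
  by (intro ext) (simp add: QG.ev_def comb_val_def)

sublocale QG: quiver_functor QG C "\<lambda>X. X" amor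
  by unfold_locales (simp add: ev_eq_comb_val comb_val_expand_diff)

lemma comb_val_zero: "comb_val C X 0 = 0"
  by (simp add: comb_val_def)

lemmas comb_val_add = QG.ev_add[unfolded ev_eq_comb_val gen_quiver_simps]
  and comb_val_scale = QG.ev_scale[unfolded ev_eq_comb_val gen_quiver_simps]
  and comb_val_mult = QG.ev_mult[unfolded ev_eq_comb_val gen_quiver_simps]
  and comb_val_one = QG.ev_one[unfolded ev_eq_comb_val gen_quiver_simps]
  and comb_val_letter = QG.ev_letter[unfolded ev_eq_comb_val gen_quiver_simps]
  and comb_val_fdiff = QG.ev_fdiff[unfolded ev_eq_comb_val gen_quiver_simps]
  and fdiff_arrow_combs = QG.fdiff_combs[unfolded gen_quiver_simps]

text \<open>\<open>comb_val\<close> is injective and turns the formal differential into that of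
  \<open>C\<close>, where d^2 = 0 holds.\<close>

lemma expand_diff_sq:
  assumes e: "e \<in> G"
  shows "fdiff QG (expand_diff C G e) = 0"
proof (rule comb_val_inj)
  show "asrc e \<in> Ob C" "atgt e \<in> Ob C" using e gen_Ob by auto
  show "fdiff QG (expand_diff C G e) \<in> arrow_combs G (asrc e) (atgt e) (adeg e + 1 + 1)"
    by (rule fdiff_arrow_combs[OF expand_diff_combs[OF e]])
  show "comb_val C (asrc e) (fdiff QG (expand_diff C G e)) = comb_val C (asrc e) 0"
    using e by (simp add: comb_val_fdiff[OF expand_diff_combs[OF e]] gen_Ob comb_val_expand_diff
        Diff_Diff gen_Hom comb_val_zero)
qed simp

lemma expand_add: "\<lbrakk>X \<in> Ob C; Y \<in> Ob C; f \<in> Hom C X Y n; g \<in> Hom C X Y n\<rbrakk>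
    \<Longrightarrow> expand C G X Y n (f + g) = expand C G X Y n f + expand C G X Y n g"
  by (rule expand_eqI) (auto simp: comb_val_add[OF expand_combs expand_combs] comb_val_expand intro!: path_combs_add expand_combs)

lemma expand_Scale: "\<lbrakk>X \<in> Ob C; Y \<in> Ob C; f \<in> Hom C X Y n\<rbrakk>
    \<Longrightarrow> expand C G X Y n (Scale C c f) = pm_scale c (expand C G X Y n f)"
  by (rule expand_eqI) (auto simp: comb_val_scale[OF expand_combs] comb_val_expand intro!: path_combs_scale expand_combs)

lemma expand_Comp: "\<lbrakk>X \<in> Ob C; Y \<in> Ob C; Z \<in> Ob C; g \<in> Hom C Y Z m; f \<in> Hom C X Y n\<rbrakk>
    \<Longrightarrow> expand C G X Z (m + n) (Comp C X Y Z g f) = word_mult (expand C G Y Z m g) (expand C G X Y n f)"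
  by (rule expand_eqI)
    (auto simp: comb_val_mult[OF expand_combs expand_combs] comb_val_expand intro!: path_combs_mult expand_combs)

lemma expand_Ident: "X \<in> Ob C \<Longrightarrow> expand C G X X 0 (Ident C X) = word []"
  by (rule expand_eqI) (auto simp: comb_val_one intro!: path_combs_word)

lemma expand_Diff: "\<lbrakk>X \<in> Ob C; Y \<in> Ob C; f \<in> Hom C X Y n\<rbrakk>
    \<Longrightarrow> expand C G X Y (n + 1) (Diff C X Y n f) = fdiff QG (expand C G X Y n f)"
  by (rule expand_eqI)
    (auto simp: comb_val_fdiff[OF expand_combs] comb_val_expand intro!: fdiff_arrow_combs expand_combs)

end

lemma semifree_dgcatI: "semifree C G \<Longrightarrow> semifree_dgcat C G"
  by (simp add: semifree_def semifree_dgcat_def semifree_dgcat_axioms_def)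

section \<open>The cylinder as a dg category, its structure functors and its functoriality\<close>

section \<open>The cylinder is a semifree dg category\<close>

lemma cyl_quiver_simps [simp]:
  "verts (cyl_quiver C G) = Ob C <+> Ob C" "esrc (cyl_quiver C G) = cyl_src"
  "etgt (cyl_quiver C G) = cyl_tgt" "edeg (cyl_quiver C G) = cyl_deg" "ediff (cyl_quiver C G) = cyl_diff C G"
  by (simp_all add: cyl_quiver_def)

lemma cyl_edge_iff [simp]:
  "In1 e \<in> edges (cyl_quiver C G) \<longleftrightarrow> e \<in> G" "In2 e \<in> edges (cyl_quiver C G) \<longleftrightarrow> e \<in> G"
  "TGen e \<in> edges (cyl_quiver C G) \<longleftrightarrow> e \<in> G" "T X \<in> edges (cyl_quiver C G) \<longleftrightarrow> X \<in> Ob C"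
  "T' X \<in> edges (cyl_quiver C G) \<longleftrightarrow> X \<in> Ob C" "That X \<in> edges (cyl_quiver C G) \<longleftrightarrow> X \<in> Ob C"
  "Tcheck X \<in> edges (cyl_quiver C G) \<longleftrightarrow> X \<in> Ob C" "Tbar X \<in> edges (cyl_quiver C G) \<longleftrightarrow> X \<in> Ob C"
  by (auto simp: cyl_quiver_def)

abbreviation "In1w \<equiv> \<lambda>e. word [In1 e]"
abbreviation "In2w \<equiv> \<lambda>e. word [In2 e]"
abbreviation "TGenw \<equiv> \<lambda>e. word [TGen e]"

lemma subst_word_words': "subst_word (\<lambda>e. word [\<phi> e]) = (\<lambda>w. word (map \<phi> w))"
  by (simp add: fun_eq_iff subst_word_words)

lemma in1_comb_eq_subst: "in1_comb = subst In1w"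
  and in2_comb_eq_subst: "in2_comb = subst In2w"
  by (simp_all add: in1_comb_def in2_comb_def subst_word_words')

lemma t_word_Cons: "t_word (e # w) = word_mult (word [In2 e]) (t_word w)
    + ksign (wdeg adeg w) (word (TGen e # map In1 w))"
  by (simp add: t_word_def word_mult_def lin_sum lin_ksign sum.lessThan_Suc_shift del: sum.lessThan_Suc)

text \<open>The explicit sum for t_theta is the derivation over the pair (i_2, i_1) with value t_f
  on f: the sign of a summand comes from the letters to the right of the marked one. The properties
  of t thereby follow from general facts on derivations.\<close>

lemma t_word_eq_der: "t_word w = der_word adeg In2w In1w TGenw w"
  by (induction w) (simp_all add: t_word_Cons subst_word_words, simp add: t_word_def)

lemma t_comb_eq_der: "t_comb = lin (der_word adeg In2w In1w TGenw)"
  by (simp add: t_comb_def t_word_eq_der[abs_def])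

abbreviation "cyl_combs C G \<equiv> path_combs (edges (cyl_quiver C G)) cyl_src cyl_tgt cyl_deg"

lemma in1_comb_combs: "p \<in> arrow_combs G X Y n \<Longrightarrow> in1_comb p \<in> cyl_combs C G (Inl X) (Inl Y) n"
  unfolding in1_comb_eq_subst
  by (rule subst_combs[where L = G and s = asrc and t = atgt and dg = adeg and fo = Inl])
    (auto intro!: path_combs_word)

lemma in2_comb_combs: "p \<in> arrow_combs G X Y n \<Longrightarrow> in2_comb p \<in> cyl_combs C G (Inr X) (Inr Y) n"
  unfolding in2_comb_eq_subst
  by (rule subst_combs[where L = G and s = asrc and t = atgt and dg = adeg and fo = Inr])
    (auto intro!: path_combs_word)

lemma t_comb_combs: "p \<in> arrow_combs G X Y n \<Longrightarrow> t_comb p \<in> cyl_combs C G (Inl X) (Inr Y) (n - 1)"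
  unfolding t_comb_eq_der
  by (rule der_combs[where L = G and s = asrc and t = atgt and dg = adeg and fa = Inl and fb = Inr])
    (auto intro!: path_combs_word)

text \<open>p at the level of words in the generators of \<open>C\<close>. As a substitution between
  free algebras it can be compared with i_1, i_2 and t without evaluating in
  \<open>C\<close>.\<close>

primrec proj_word :: "('o, ('o, 'm) arrow) cylgen
    \<Rightarrow> (('o, 'm) arrow list \<Rightarrow>\<^sub>0 'k::{comm_ring,comm_monoid_mult})" where
  "proj_word (In1 e) = word [e]"
| "proj_word (In2 e) = word [e]"
| "proj_word (T X) = word []"
| "proj_word (T' X) = word []"
| "proj_word (That X) = 0"
| "proj_word (Tcheck X) = 0"
| "proj_word (Tbar X) = 0"
| "proj_word (TGen e) = 0"

lemma subst_words_id: "subst (\<lambda>e. word [e]) p = p"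
  by (simp add: subst_word_words'[of "\<lambda>e. e"])

lemma proj_in1: "subst proj_word (in1_comb p) = p"
  and proj_in2: "subst proj_word (in2_comb p) = p"
  unfolding in1_comb_eq_subst in2_comb_eq_subst subst_subst
  by (simp_all add: subst_words_id)

text \<open>Each summand contains a letter \<open>TGen\<close>, which p kills.\<close>

lemma proj_der_word: "subst proj_word (der_word adeg In2w In1w TGenw w) = 0"
  by (induction w) (simp_all add: lin_add lin_ksign subst_mult)

lemma proj_t: "subst proj_word (t_comb p) = 0"
  by (simp add: t_comb_eq_der lin_lin proj_der_word)

context semifree_dgcat
begin

abbreviation "QC \<equiv> cyl_quiver C G"

lemma cyl_cases [consumes 1, case_names In1 In2 T T' That Tcheck Tbar TGen]:
  assumes "c \<in> edges QC"
    and "\<And>e. c = In1 e \<Longrightarrow> e \<in> G \<Longrightarrow> P" "\<And>e. c = In2 e \<Longrightarrow> e \<in> G \<Longrightarrow> P"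
    "\<And>X. c = T X \<Longrightarrow> X \<in> Ob C \<Longrightarrow> P" "\<And>X. c = T' X \<Longrightarrow> X \<in> Ob C \<Longrightarrow> P"
    "\<And>X. c = That X \<Longrightarrow> X \<in> Ob C \<Longrightarrow> P" "\<And>X. c = Tcheck X \<Longrightarrow> X \<in> Ob C \<Longrightarrow> P"
    "\<And>X. c = Tbar X \<Longrightarrow> X \<in> Ob C \<Longrightarrow> P" "\<And>e. c = TGen e \<Longrightarrow> e \<in> G \<Longrightarrow> P"
  shows P
  using assms by (cases c) auto

lemma cyl_diff_combs:
  assumes "c \<in> edges QC"
  shows "cyl_diff C G c \<in> cyl_combs C G (cyl_src c) (cyl_tgt c) (cyl_deg c + 1)"
  using assms
proof (cases rule: cyl_cases)
  case (TGen e)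
  have "t_comb (expand_diff C G e) \<in> cyl_combs C G (Inl (asrc e)) (Inr (atgt e)) (adeg e)"
    using t_comb_combs[OF expand_diff_combs[OF TGen(2)], where C = C] by simp
  with TGen show ?thesis
    by (auto intro!: path_combs_add path_combs_ksign path_combs_diff path_combs_word simp: gen_Ob)
qed (auto intro!: in1_comb_combs in2_comb_combs path_combs_diff path_combs_word expand_diff_combs)

sublocale QC: wf_quiver QC
  by unfold_locales (auto simp: gen_Ob elim!: cyl_cases intro!: cyl_diff_combs)

lemma homogeneous_In: "homogeneous cyl_deg (adeg e) (word [In1 e])"
  "homogeneous cyl_deg (adeg e) (word [In2 e])" "homogeneous cyl_deg (adeg e - 1) (word [TGen e])"
  by (simp_all add: homogeneous_def)

lemma fdiff_in1: "p \<in> arrow_combs G X Y n \<Longrightarrow> fdiff QC (in1_comb p) = in1_comb (fdiff QG p)"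
  unfolding in1_comb_eq_subst
  by (rule QG.fdiff_subst) (simp_all add: homogeneous_In in1_comb_eq_subst)

lemma fdiff_in2: "p \<in> arrow_combs G X Y n \<Longrightarrow> fdiff QC (in2_comb p) = in2_comb (fdiff QG p)"
  unfolding in2_comb_eq_subst
  by (rule QG.fdiff_subst) (simp_all add: homogeneous_In in2_comb_eq_subst)

text \<open>An instance of \<open>fdiff_der\<close> with \<eta> = t_X: the formula for d t_f
  persists for all combinations of generators, which is what makes d(d t_f) vanish.\<close>

lemma fdiff_t:
  assumes "p \<in> arrow_combs G X Y n"
  shows "fdiff QC (t_comb p) = ksign n (word_mult (in2_comb p) (word [T X]) - word_mult (word [T Y]) (in1_comb p))
    + t_comb (fdiff QG p)"
proof -
  have "fdiff QC (subst In1w p) = subst In1w (fdiff QG p)" if "p \<in> QG.combs X Y n" for p X Y n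
    using fdiff_in1 that by (simp add: in1_comb_eq_subst)
  from QG.fdiff_der[where Q' = QC and \<phi> = In2w and \<psi> = In1w and h = TGenw and \<eta> = "\<lambda>X. word [T X]", OF _ _ _ this]
  show ?thesis using assms
    by (simp add: homogeneous_In t_comb_eq_der in1_comb_eq_subst in2_comb_eq_subst)
qed

lemma cyl_diff_sq:
  assumes "c \<in> edges QC"
  shows "fdiff QC (cyl_diff C G c) = 0"
  using assms
proof (cases rule: cyl_cases)
  case (In1 e)
  then show ?thesis using fdiff_in1[OF expand_diff_combs, of e] expand_diff_sq[of e]
    by (simp add: in1_comb_def)
next
  case (In2 e)
  then show ?thesis using fdiff_in2[OF expand_diff_combs, of e] expand_diff_sq[of e]
    by (simp add: in2_comb_def)
next
  case (TGen e)
  have 1: "word_diff QC [In2 e, T (asrc e)] = word_mult (in2_comb (expand_diff C G e)) (word [T (asrc e)])"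
    "word_diff QC [T (atgt e), In1 e] = word_mult (word [T (atgt e)]) (in1_comb (expand_diff C G e))"
    by simp_all
  \<comment> \<open>Here t_{d(df)} = 0, and since |df| = |f| + 1 the commutator terms in d(t_{df})
    cancel the differential of the commutator in \<open>cyl_diff\<close>.\<close>
  have "t_comb (fdiff QG (expand_diff C G e)) = 0"
    using expand_diff_sq[OF TGen(2)] by (simp add: t_comb_def)
  with fdiff_t[OF expand_diff_combs[OF TGen(2)]] show ?thesis
    unfolding TGen cyl_diff.simps by (simp add: lin_add lin_ksign lin_diff 1 del: word_diff.simps) (simp add: ksign_def)
\<comment> \<open>For \<open>Tbar\<close> the sum is t (1 - t' t) - (1 - t t') t = 0.\<close>
qed (simp_all add: lin_diff word_mult_linear)

lemma dg_category_Cyl: "dg_category (Cyl C G)"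
  unfolding Cyl_def by (rule QC.dg_category_free) (simp add: cyl_diff_sq)

lemma Cyl_simps: "Ob (Cyl C G) = Ob C <+> Ob C" "Hom (Cyl C G) = cyl_combs C G"
  "Scale (Cyl C G) = pm_scale" "Comp (Cyl C G) X Y Z = word_mult" "Ident (Cyl C G) X = word []"
  "Diff (Cyl C G) X Y n = fdiff QC"
  by (simp_all add: Cyl_def free_dgcat_def)

section \<open>The structure functors of the cylinder\<close>

lemma dg_functor_in1: "dg_functor C (Cyl C G) (cyl_in1 C G)"
proof -
  interpret Cyl: dg_category "Cyl C G" by (rule dg_category_Cyl)
  show ?thesis
    by unfold_locales
      (auto simp: Cyl_simps cyl_in1_def expand_Scale expand_Comp expand_Diff expand_Ident
        expand_add
        in1_comb_eq_subst lin_add lin_pm_scale subst_mult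
        fdiff_in1[OF expand_combs, unfolded in1_comb_eq_subst]
        intro!: in1_comb_combs[unfolded in1_comb_eq_subst] expand_combs)
qed

lemma dg_functor_in2: "dg_functor C (Cyl C G) (cyl_in2 C G)"
proof -
  interpret Cyl: dg_category "Cyl C G" by (rule dg_category_Cyl)
  show ?thesis
    by unfold_locales
      (auto simp: Cyl_simps cyl_in2_def expand_Scale expand_Comp expand_Diff expand_Ident expand_add
        in2_comb_eq_subst lin_add lin_pm_scale subst_mult
        fdiff_in2[OF expand_combs, unfolded in2_comb_eq_subst]
        intro!: in2_comb_combs[unfolded in2_comb_eq_subst] expand_combs)
qed

lemma proj_word_combs: "c \<in> edges QC \<Longrightarrow>
    proj_word c \<in> arrow_combs G (untag (cyl_src c)) (untag (cyl_tgt c)) (cyl_deg c)"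
  by (erule cyl_cases) (auto simp: untag_def intro!: path_combs_word)

lemma proj_combs: "p \<in> cyl_combs C G X Y n \<Longrightarrow> subst proj_word p \<in> arrow_combs G (untag X) (untag Y) n"
  by (rule subst_combs[where L = "edges QC" and s = cyl_src and t = cyl_tgt and dg = cyl_deg and fo = untag])
    (auto intro: proj_word_combs)

lemma cyl_proj_gen_eq: "c \<in> edges QC \<Longrightarrow> cyl_proj_gen C c = comb_val C (untag (cyl_src c)) (proj_word c)"
  by (erule cyl_cases) (auto simp: untag_def comb_val_letter comb_val_one comb_val_zero)

lemma untag_Ob: "X \<in> Ob C <+> Ob C \<Longrightarrow> untag X \<in> Ob C"
  by (auto simp: untag_def)

sublocale QP: quiver_rep QC C untag "cyl_proj_gen C"
  by unfold_locales
    (auto simp: untag_Ob untag_def gen_Hom gen_Ob zero_Hom Ident_Hom elim!: cyl_cases)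

lemma QP_ev: "\<lbrakk>p \<in> cyl_combs C G X Y n; X \<in> Ob C <+> Ob C; Y \<in> Ob C <+> Ob C\<rbrakk>
    \<Longrightarrow> QP.ev X p = comb_val C (untag X) (subst proj_word p)"
  unfolding ev_eq_comb_val[symmetric]
  by (rule QP.ev_subst[OF QG.quiver_rep_axioms, where Y = Y and n = n])
    (simp_all add: proj_word_combs untag_Ob cyl_proj_gen_eq ev_eq_comb_val)

sublocale QP: quiver_functor QC C untag "cyl_proj_gen C"
proof
  fix c assume c: "c \<in> edges QC"
  have "QP.ev (cyl_src c) (cyl_diff C G c) = comb_val C (untag (cyl_src c)) (subst proj_word (cyl_diff C G c))"
    using c QC.esrc_verts[OF c] QC.etgt_verts[OF c] by (intro QP_ev[OF cyl_diff_combs]) simp_all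
  also have "\<dots> = Diff C (untag (cyl_src c)) (untag (cyl_tgt c)) (cyl_deg c) (cyl_proj_gen C c)"
    using c by (cases rule: cyl_cases)
      (simp_all add: untag_def proj_in1 proj_in2 proj_t comb_val_expand_diff comb_val_zero Diff_Ident
        Diff_zero lin_add lin_diff lin_ksign gen_Ob)
  finally show "QP.ev (esrc QC c) (ediff QC c) = Diff C (untag (esrc QC c)) (untag (etgt QC c)) (edeg QC c) (cyl_proj_gen C c)"
    by simp
qed

lemma dg_functor_proj: "dg_functor (Cyl C G) C (cyl_proj C G)"
  using QP.dg_functor_free dg_category_Cyl unfolding Cyl_def cyl_proj_def by blast

lemma cyl_proj_simps: "FOb (cyl_proj C G) = untag"
  "\<lbrakk>p \<in> cyl_combs C G X Y n; X \<in> Ob C <+> Ob C; Y \<in> Ob C <+> Ob C\<rbrakk>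
    \<Longrightarrow> FMor (cyl_proj C G) X Y n p = comb_val C (untag X) (subst proj_word p)"
  by (simp_all add: cyl_proj_def QP.FMor_free QP_ev) (simp add: free_dgfun_def)

end

section \<open>Functoriality of the cylinder\<close>

locale semifree_functor = C: semifree_dgcat C G + D: semifree_dgcat D H + F: dg_functor C D F
  for C :: "('k::{comm_ring,comm_monoid_mult}, 'o, 'm::ab_group_add) dgcat" and G
    and D :: "('k, 'p, 'n::ab_group_add) dgcat" and H and F
begin

abbreviation "img \<equiv> expand_image D H F"

lemma img_combs: "e \<in> G \<Longrightarrow> img e \<in> arrow_combs H (FOb F (asrc e)) (FOb F (atgt e)) (adeg e)"
  unfolding expand_image_def by (intro D.expand_combs F.FOb_Ob F.FMor_Hom C.gen_Ob C.gen_Hom)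

lemma comb_val_img: "e \<in> G \<Longrightarrow>
    comb_val D (FOb F (asrc e)) (img e) = FMor F (asrc e) (atgt e) (adeg e) (amor e)"
  unfolding expand_image_def by (intro D.comb_val_expand F.FOb_Ob F.FMor_Hom C.gen_Ob C.gen_Hom)

lemma subst_img_combs: "p \<in> arrow_combs G X Y n \<Longrightarrow> subst img p \<in> arrow_combs H (FOb F X) (FOb F Y) n"
  by (rule subst_combs[where L = G and s = asrc and t = atgt and dg = adeg and fo = "FOb F"])
    (auto intro: img_combs)

lemma FMor_comb_val: "\<lbrakk>p \<in> arrow_combs G X Y n; X \<in> Ob C; Y \<in> Ob C\<rbrakk>
    \<Longrightarrow> FMor F X Y n (comb_val C X p) = comb_val D (FOb F X) (subst img p)"
proof -
  assume p: "p \<in> arrow_combs G X Y n" and X: "X \<in> Ob C" "Y \<in> Ob C"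
  \<comment> \<open>The generators are first sent directly to their images in \<open>D\<close>;
    \<open>ev_subst\<close> then compares this with expanding the images in generators of
    \<open>D\<close>.\<close>
  let ?fe = "\<lambda>e. FMor F (asrc e) (atgt e) (adeg e) (amor e)"
  interpret R: quiver_rep C.QG D "FOb F" ?fe
    by unfold_locales (auto intro: F.FOb_Ob F.FMor_Hom C.gen_Ob C.gen_Hom)
  have path: "is_path (arrows C) asrc atgt X Y w" if "w \<in> Poly_Mapping.keys p" for w
    using path_combsD(1)[OF p that] C.gen_arrows by (auto intro: is_path_mono)
  have "FMor F X Y n (comb_val C X p) = lin_ext (Scale D) (\<lambda>w. FMor F X Y n (word_val C X w)) p"
    unfolding comb_val_def
  proof (rule F.FMor_lin_ext)
    fix w assume w: "w \<in> Poly_Mapping.keys p"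
    show "word_val C X w \<in> Hom C X Y n"
      using C.word_val_Hom[OF path[OF w] X(1)] path_combsD(2)[OF p w] by simp
  qed (use X in auto)
  also have "\<dots> = R.ev X p"
    unfolding R.ev_def
  proof (rule lin_ext_cong)
    fix w assume w: "w \<in> Poly_Mapping.keys p"
    have "image_arrow F = R.arr" by (simp add: image_arrow_def fun_eq_iff)
    then show "FMor F X Y n (word_val C X w) = word_val D (FOb F X) (map R.arr w)"
      using F.FMor_word_val[OF path[OF w] X(1)] path_combsD(2)[OF p w] by simp
  qed
  also have "\<dots> = D.QG.ev (FOb F X) (subst img p)"
    by (rule R.ev_subst[OF D.QG.quiver_rep_axioms, where Y = Y and n = n])
      (use p X in \<open>auto simp: img_combs F.FOb_Ob D.ev_eq_comb_val comb_val_img\<close>)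
  finally show ?thesis by (simp add: D.ev_eq_comb_val)
qed

text \<open>Expansion intertwines \<open>F\<close> with the substitution \<open>img\<close>, so that
  \<open>F\<close> is computed on words.\<close>

lemma expand_FMor: "\<lbrakk>f \<in> Hom C X Y n; X \<in> Ob C; Y \<in> Ob C\<rbrakk>
    \<Longrightarrow> expand D H (FOb F X) (FOb F Y) n (FMor F X Y n f) = subst img (expand C G X Y n f)"
  by (rule D.expand_eqI)
    (auto simp: F.FOb_Ob C.comb_val_expand FMor_comb_val[OF C.expand_combs, symmetric]
      intro!: subst_img_combs C.expand_combs)

lemma fdiff_img:
  assumes e: "e \<in> G"
  shows "fdiff D.QG (img e) = subst img (expand_diff C G e)"
proof -
  note O = C.gen_Ob[OF e] and H = C.gen_Hom[OF e]
  have "fdiff D.QG (img e) = expand D H (FOb F (asrc e)) (FOb F (atgt e)) (adeg e + 1)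
      (Diff D (FOb F (asrc e)) (FOb F (atgt e)) (adeg e) (FMor F (asrc e) (atgt e) (adeg e) (amor e)))"
    unfolding expand_image_def by (rule D.expand_Diff[symmetric]) (intro F.FOb_Ob F.FMor_Hom O H)+
  also have "\<dots> = subst img (expand_diff C G e)"
    unfolding expand_diff_def F.FMor_Diff[OF O H, symmetric]
    by (rule expand_FMor) (intro C.Diff_Hom O H)+
  finally show ?thesis .
qed

abbreviation "cmap \<equiv> cyl_map_gen D H F"

lemma cmap_in1: "subst cmap (in1_comb p) = in1_comb (subst img p)"
  and cmap_in2: "subst cmap (in2_comb p) = in2_comb (subst img p)"
  by (simp_all add: in1_comb_eq_subst in2_comb_eq_subst subst_subst)

text \<open>Both sides obey the same product rule and have the same values on generators. The path
  hypothesis makes the image of a word homogeneous, as \<open>der_mult\<close> requires.\<close>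

lemma cmap_der_word:
  "is_path G asrc atgt X Y w \<Longrightarrow> subst cmap (der_word adeg In2w In1w TGenw w)
    = lin (der_word adeg In2w In1w TGenw) (subst_word img w)"
proof (induction w arbitrary: Y)
  case (Cons e w)
  then have w: "is_path G asrc atgt X (asrc e) w" by auto
  have hom: "homogeneous adeg (wdeg adeg w) (subst_word img w)"
    by (rule path_combs_homogeneous)
      (rule subst_word_combs[where L = G and s = asrc and t = atgt and fo = "FOb F", OF img_combs w])
  have [simp]: "cmap (In2 e) = subst In2w (img e)" "cmap (TGen e) = lin (der_word adeg In2w In1w TGenw) (img e)"
    by (simp_all add: in2_comb_eq_subst t_comb_eq_der)
  have [simp]: "subst cmap (subst_word In1w w) = subst In1w (subst_word img w)"
    by (simp add: subst_subst_word in1_comb_eq_subst)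
  show ?case
    by (simp add: lin_add lin_ksign subst_mult der_mult[OF hom] Cons.IH[OF w] del: cyl_map_gen.simps)
qed simp

lemma cmap_t:
  assumes "p \<in> arrow_combs G X Y n"
  shows "subst cmap (t_comb p) = t_comb (subst img p)"
  unfolding t_comb_eq_der lin_lin
  by (rule lin_ext_cong) (rule cmap_der_word[OF path_combsD(1)[OF assms]])

lemma cmap_combs: "c \<in> edges C.QC \<Longrightarrow>
  cmap c \<in> cyl_combs D H (map_sum (FOb F) (FOb F) (cyl_src c)) (map_sum (FOb F) (FOb F) (cyl_tgt c)) (cyl_deg c)"
  by (erule C.cyl_cases)
    (auto intro!: path_combs_word in1_comb_combs in2_comb_combs t_comb_combs img_combs simp: F.FOb_Ob)

lemma fdiff_cmap:
  assumes "c \<in> edges C.QC"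
  shows "fdiff D.QC (cmap c) = subst cmap (cyl_diff C G c)"
  using assms
proof (cases rule: C.cyl_cases)
  case (In1 e)
  then show ?thesis using D.fdiff_in1[OF img_combs[OF In1(2)]] by (simp add: cmap_in1 fdiff_img)
next
  case (In2 e)
  then show ?thesis using D.fdiff_in2[OF img_combs[OF In2(2)]] by (simp add: cmap_in2 fdiff_img)
next
  case (TGen e)
  then show ?thesis using D.fdiff_t[OF img_combs[OF TGen(2)]]
    by (simp add: cmap_t[OF C.expand_diff_combs] fdiff_img lin_add lin_ksign lin_diff)
qed (simp_all add: lin_diff)

lemma dg_functor_Cyl_map: "dg_functor (Cyl C G) (Cyl D H) (Cyl_map C G D H F)"
proof -
  interpret CD: dg_category "Cyl D H" by (rule D.dg_category_Cyl)
  interpret R: quiver_rep C.QC "Cyl D H" "map_sum (FOb F) (FOb F)" cmap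
    by unfold_locales (auto simp: D.Cyl_simps F.FOb_Ob cmap_combs)
  \<comment> \<open>The target and the degree do not enter the action on words, so arbitrary
    placeholders are supplied for them.\<close>
  have ev: "R.ev X = subst cmap" for X
    using FMor_free_free[of C.QC D.QC "map_sum (FOb F) (FOb F)" cmap X undefined undefined] R.FMor_free
    by (simp add: Cyl_def)
  interpret R: quiver_functor C.QC "Cyl D H" "map_sum (FOb F) (FOb F)" cmap
    by unfold_locales (simp add: ev D.Cyl_simps fdiff_cmap)
  show ?thesis
    using R.dg_functor_free C.dg_category_Cyl unfolding Cyl_map_def Cyl_def by blast
qed

lemma Cyl_map_simps: "FOb (Cyl_map C G D H F) = map_sum (FOb F) (FOb F)"
  "FMor (Cyl_map C G D H F) X Y n = subst cmap"
  unfolding Cyl_map_def Cyl_def FMor_free_free by (simp_all add: free_dgfun_def)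

lemma Cyl_map_in1: "dgfun_eq C (Cyl_map C G D H F \<circ>\<^sub>d\<^sub>g cyl_in1 C G) (cyl_in1 D H \<circ>\<^sub>d\<^sub>g F)"
  and Cyl_map_in2: "dgfun_eq C (Cyl_map C G D H F \<circ>\<^sub>d\<^sub>g cyl_in2 C G) (cyl_in2 D H \<circ>\<^sub>d\<^sub>g F)"
  by (auto simp: dgfun_eq_def comp_dgfun_def Cyl_map_simps cyl_in1_def cyl_in2_def cmap_in1 cmap_in2
      expand_FMor)

lemma subst_eq_on_combs:
  assumes "\<And>e. e \<in> L \<Longrightarrow> \<phi> e = \<psi> e" "p \<in> path_combs L s t dg X Y n"
  shows "subst \<phi> p = subst \<psi> p"
proof (intro lin_ext_cong subst_word_cong)
  fix w e assume "w \<in> Poly_Mapping.keys p" "e \<in> set w"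
  with is_path_set[OF path_combsD(1)[OF assms(2)]] show "\<phi> e = \<psi> e" by (intro assms(1)) auto
qed

text \<open>Both composites are substitutions on words, so generators suffice; p kills t_theta for
  every theta as well as t-hat, t-check and t-bar.\<close>

lemma Cyl_map_proj: "dgfun_eq (Cyl C G) (cyl_proj D H \<circ>\<^sub>d\<^sub>g Cyl_map C G D H F) (F \<circ>\<^sub>d\<^sub>g cyl_proj C G)"
proof -
  interpret M: dg_functor "Cyl C G" "Cyl D H" "Cyl_map C G D H F" by (rule dg_functor_Cyl_map)
  have ob: "untag (map_sum (FOb F) (FOb F) X) = FOb F (untag X)" for X
    by (cases X) (simp_all add: untag_def)
  have "FMor (cyl_proj D H) (map_sum (FOb F) (FOb F) X) (map_sum (FOb F) (FOb F) Y) n (subst cmap p)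
      = FMor F (untag X) (untag Y) n (FMor (cyl_proj C G) X Y n p)"
    if X: "X \<in> Ob C <+> Ob C" "Y \<in> Ob C <+> Ob C" and p: "p \<in> cyl_combs C G X Y n" for X Y n p
  proof -
    have "subst (\<lambda>c. subst proj_word (cmap c)) p = subst (\<lambda>c. subst img (proj_word c)) p"
      by (rule subst_eq_on_combs[OF _ p], erule C.cyl_cases)
        (simp_all add: proj_in1 proj_in2 proj_t)
    then have "comb_val D (FOb F (untag X)) (subst proj_word (subst cmap p))
        = FMor F (untag X) (untag Y) n (comb_val C (untag X) (subst proj_word p))"
      using C.proj_combs[OF p] X by (simp add: FMor_comb_val C.untag_Ob subst_subst)
    moreover have "subst cmap p \<in> cyl_combs D H (map_sum (FOb F) (FOb F) X) (map_sum (FOb F) (FOb F) Y) n"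
      "map_sum (FOb F) (FOb F) X \<in> Ob D <+> Ob D" "map_sum (FOb F) (FOb F) Y \<in> Ob D <+> Ob D"
      using M.FMor_Hom[of X Y p n] M.FOb_Ob X p by (auto simp: C.Cyl_simps D.Cyl_simps Cyl_map_simps)
    ultimately show ?thesis
      using X p by (simp add: C.cyl_proj_simps D.cyl_proj_simps ob)
  qed
  then show ?thesis
    by (auto simp: dgfun_eq_def comp_dgfun_def C.Cyl_simps C.cyl_proj_simps(1) D.cyl_proj_simps(1)
        Cyl_map_simps ob)
qed

end

context semifree_dgcat
begin

lemma semifree_functor_id: "semifree_functor C G C G id_dgfun"
  unfolding semifree_functor_def using semifree_dgcat_axioms dg_functor_id[OF dg_category_axioms] by simp

lemma Cyl_map_id: "dgfun_eq (Cyl C G) (Cyl_map C G C G id_dgfun) id_dgfun"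
proof -
  interpret I: semifree_functor C G C G id_dgfun by (rule semifree_functor_id)
  have "I.cmap c = word [c]" if "c \<in> edges QC" for c
  proof -
    have "I.img e = word [e]" if "e \<in> G" for e
      using that unfolding expand_image_def
      by (intro expand_eqI) (auto simp: id_dgfun_def gen_Ob comb_val_letter intro!: path_combs_word)
    with that show ?thesis
      by (cases rule: cyl_cases)
        (simp_all add: id_dgfun_def in1_comb_def in2_comb_def t_comb_eq_der)
  qed
  then have "subst I.cmap p = p" if "p \<in> cyl_combs C G X Y n" for p X Y n
    using I.subst_eq_on_combs[OF _ that, of "cyl_map_gen C G id_dgfun" "\<lambda>c. word [c]"] by (simp add: subst_words_id)
  then show ?thesis
    by (auto simp: dgfun_eq_def Cyl_simps I.Cyl_map_simps) (simp_all add: id_dgfun_def)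
qed

lemma codiagonal_factors: "dgfun_eq (double C) (cyl_proj C G \<circ>\<^sub>d\<^sub>g copair (cyl_in1 C G) (cyl_in2 C G)) codiagonal"
proof -
  have "FMor (cyl_proj C G) (Inl A) (Inl B) n (in1_comb (expand C G A B n f)) = f"
    "FMor (cyl_proj C G) (Inr A) (Inr B) n (in2_comb (expand C G A B n f)) = f"
    if "A \<in> Ob C" "B \<in> Ob C" "f \<in> Hom C A B n" for A B n f
    using cyl_proj_simps(2)[OF in1_comb_combs[OF expand_combs[OF that]] InlI InlI]
      cyl_proj_simps(2)[OF in2_comb_combs[OF expand_combs[OF that]] InrI InrI] that
    by (simp_all add: proj_in1 proj_in2 comb_val_expand untag_def)
  moreover have "FMor (cyl_proj C G) X Y n 0 = 0" for X Y n
    by (simp add: cyl_proj_def QP.FMor_free)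
  ultimately show ?thesis
    by (auto simp: dgfun_eq_def comp_dgfun_def codiagonal_def copair_def double_def cyl_proj_simps(1)
        cyl_in1_def cyl_in2_def id_dgfun_def untag_def split: if_splits)
qed

end

text \<open>Both sides are substitutions, so generators suffice; for t_f the claim is
  \<open>cmap_t\<close>, the naturality of t_theta in theta.\<close>

lemma Cyl_map_comp:
  assumes "semifree_functor C G D H F" "semifree_functor D H E K F'"
  shows "dgfun_eq (Cyl C G) (Cyl_map C G E K (F' \<circ>\<^sub>d\<^sub>g F)) (Cyl_map D H E K F' \<circ>\<^sub>d\<^sub>g Cyl_map C G D H F)"
proof -
  interpret F: semifree_functor C G D H F by fact
  interpret F': semifree_functor D H E K F' by fact
  interpret FF': semifree_functor C G E K "F' \<circ>\<^sub>d\<^sub>g F"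
    unfolding semifree_functor_def
    using F.C.semifree_dgcat_axioms F'.D.semifree_dgcat_axioms
      dg_functor_comp[OF F.F.dg_functor_axioms F'.F.dg_functor_axioms] by simp
  have img: "FF'.img e = subst F'.img (F.img e)" if "e \<in> G" for e
    using that F'.expand_FMor[OF F.F.FMor_Hom, of "asrc e" "atgt e" "amor e" "adeg e"]
    by (simp add: expand_image_def comp_dgfun_def F.C.gen_Ob F.C.gen_Hom F.F.FOb_Ob)
  have ob: "FOb (F' \<circ>\<^sub>d\<^sub>g F) X = FOb F' (FOb F X)" for X
    by (simp add: comp_dgfun_def)
  have "FF'.cmap c = subst F'.cmap (F.cmap c)" if "c \<in> edges F.C.QC" for c
    using that
    by (cases rule: F.C.cyl_cases)
      (simp_all add: img ob F'.cmap_in1 F'.cmap_in2 F'.cmap_t[OF F.img_combs])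
  then have "subst FF'.cmap p = subst F'.cmap (subst F.cmap p)" if "p \<in> cyl_combs C G X Y n" for p X Y n
    unfolding subst_subst using F.subst_eq_on_combs[OF _ that, of FF'.cmap "\<lambda>c. subst F'.cmap (F.cmap c)"]
    by simp
  then show ?thesis
    by (auto simp: dgfun_eq_def comp_dgfun_def F.C.Cyl_simps F.Cyl_map_simps F'.Cyl_map_simps
        FF'.Cyl_map_simps[unfolded comp_dgfun_def] sum.map_comp o_def)
qed

section \<open>Acyclicity of the kernel of p\<close>

section \<open>The projection of the cylinder is a trivial fibration\<close>

text \<open>On homs this is a surjective quasi-isomorphism, stated so that the primitive stays in
  the kernel: subtracting it corrects a differential without changing the image.\<close>

locale trivial_fibration = dg_functor C D P
  for C :: "('k::{comm_ring,comm_monoid_mult}, 'o, 'm::ab_group_add) dgcat"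
    and D :: "('k, 'p, 'n::ab_group_add) dgcat" and P +
  assumes surj_Ob: "Z \<in> Ob D \<Longrightarrow> \<exists>X\<in>Ob C. FOb P X = Z"
    and surj_Hom: "\<lbrakk>X \<in> Ob C; Y \<in> Ob C; g \<in> Hom D (FOb P X) (FOb P Y) n\<rbrakk>
      \<Longrightarrow> \<exists>f\<in>Hom C X Y n. FMor P X Y n f = g"
    and acyclic_kernel: "\<lbrakk>X \<in> Ob C; Y \<in> Ob C; f \<in> Hom C X Y n; Diff C X Y n f = 0; FMor P X Y n f = 0\<rbrakk>
      \<Longrightarrow> \<exists>h\<in>Hom C X Y (n - 1). FMor P X Y (n - 1) h = 0 \<and> Diff C X Y (n - 1) h = f"

text \<open>The values solve the homotopy formula one generator at a time. For t' the formula reads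
  d tau(t') = t' t - 1, which gives - t-hat; for t-check the right side becomes t t-hat - t-check t,
  which gives t-bar; for t-hat, t-bar and t_f the right side cancels.\<close>

primrec htpy :: "('o, ('o, 'm) arrow) cylgen
    \<Rightarrow> (('o, ('o, 'm) arrow) cylgen list \<Rightarrow>\<^sub>0 'k::{comm_ring,comm_monoid_mult})" where
  "htpy (In1 e) = 0"
| "htpy (In2 e) = word [TGen e]"
| "htpy (T X) = 0"
| "htpy (T' X) = - word [That X]"
| "htpy (That X) = 0"
| "htpy (Tcheck X) = word [Tbar X]"
| "htpy (Tbar X) = 0"
| "htpy (TGen e) = 0"

abbreviation "in1_proj c \<equiv> in1_comb (proj_word c)"

abbreviation "htpy_word \<equiv> der_word cyl_deg (\<lambda>c. word [c]) in1_proj htpy"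

lemma subst_in1_proj: "subst in1_proj p = in1_comb (subst proj_word p)"
  unfolding in1_comb_eq_subst subst_subst ..

lemma subst_word_in1_proj: "subst_word in1_proj w = in1_comb (subst_word proj_word w)"
  using subst_in1_proj[of "word w"] by simp

lemma cyl_deg_comp_In [simp]: "cyl_deg \<circ> In1 = adeg" "cyl_deg \<circ> In2 = adeg"
  by (simp_all add: fun_eq_iff)

lemma ksign_numerals [simp]: "ksign (2 * n) x = x" "ksign (- 1) x = - x" "ksign (- 2) x = x"
  by (simp_all add: ksign_def)

lemma subst_word_proj_In: "subst_word proj_word (map In1 w) = word w"
  "subst_word proj_word (map In2 w) = word w"
  by (induction w) simp_all

lemma in1_comb_word [simp]: "in1_comb (word w) = word (map In1 w)"
  and in2_comb_word [simp]: "in2_comb (word w) = word (map In2 w)"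
  and in1_comb_zero [simp]: "in1_comb 0 = 0"
  by (simp_all add: in1_comb_def in2_comb_def)

lemma htpy_word_In1: "htpy_word (map In1 w) = 0"
  by (induction w) simp_all

lemma htpy_in1: "lin htpy_word (in1_comb p) = 0"
  by (simp add: fun_cong[OF in1_comb_def, of p] lin_lin htpy_word_In1)

lemma htpy_word_In2: "htpy_word (map In2 w) = t_word w"
proof (induction w)
  case Nil
  then show ?case by (simp add: t_word_def)
next
  case (Cons e w)
  then show ?case by (simp add: t_word_Cons subst_word_in1_proj subst_word_proj_In)
qed

lemma htpy_in2: "lin htpy_word (in2_comb p) = t_comb p"
  by (simp add: fun_cong[OF in2_comb_def, of p] t_comb_def lin_lin htpy_word_In2)

lemma proj_htpy_letter: "subst proj_word (htpy c) = 0"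
  by (cases c) (simp_all add: lin_uminus)

lemma proj_htpy_word: "subst proj_word (htpy_word w) = 0"
  by (induction w) (simp_all add: lin_add lin_ksign subst_mult proj_htpy_letter)

text \<open>Keeps the primitives built from tau inside the kernel of p.\<close>

lemma proj_htpy: "subst proj_word (lin htpy_word p) = 0"
  by (simp add: lin_lin proj_htpy_word)

context semifree_dgcat
begin

lemma t_word_homogeneous:
  assumes "is_path G asrc atgt X Y w"
  shows "homogeneous cyl_deg (wdeg adeg w - 1) (t_word w)"
  using path_combs_homogeneous[OF t_comb_combs[OF path_combs_word[OF assms refl]]]
  by (simp add: t_comb_def)

lemma in1_proj_t_word: "subst in1_proj (t_word w) = 0"
  by (simp add: subst_in1_proj t_word_eq_der proj_der_word)

text \<open>If tau acts on a letter to the left of \<open>TGen\<close>, then \<open>TGen\<close>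
  lies in the part to which i_1 p is applied and vanishes; on \<open>TGen\<close> itself and on the
  letters \<open>In1\<close> tau is 0.\<close>

lemma htpy_t_word: "is_path G asrc atgt X Y w \<Longrightarrow> lin htpy_word (t_word w) = 0"
proof (induction w arbitrary: Y)
  case Nil
  then show ?case by (simp add: t_word_def)
next
  case (Cons e w)
  then have w: "is_path G asrc atgt X (asrc e) w" by auto
  show ?case
    using Cons.IH[OF w] by (simp add: t_word_Cons lin_add lin_ksign der_mult[OF t_word_homogeneous[OF w]]
        htpy_word_In1 in1_proj_t_word)
qed

lemma htpy_t:
  assumes "p \<in> arrow_combs G X Y n"
  shows "lin htpy_word (t_comb p) = 0"
proof -
  have "lin htpy_word (t_comb p) = lin (\<lambda>w. 0) p"
    unfolding t_comb_def lin_lin by (rule lin_ext_cong, rule htpy_t_word, rule path_combsD(1)[OF assms])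
  then show ?thesis by simp
qed

lemma fdiff_proj:
  assumes "p \<in> cyl_combs C G X Y n"
  shows "fdiff QG (subst proj_word p) = subst proj_word (fdiff QC p)"
proof (rule QC.fdiff_subst)
  show "p \<in> QC.combs X Y n" using assms by simp
  fix c assume c: "c \<in> edges QC"
  show "homogeneous (edeg QG) (edeg QC c) (proj_word c)"
    using path_combs_homogeneous[OF proj_word_combs[OF c]] by simp
  show "fdiff QG (proj_word c) = subst proj_word (ediff QC c)"
    using c by (cases rule: cyl_cases)
      (simp_all add: proj_in1 proj_in2 proj_t lin_add lin_diff lin_ksign)
qed

abbreviation "cyl_eta X \<equiv> (case X of Inl A \<Rightarrow> word [] | Inr A \<Rightarrow> word [T A])"

lemma fdiff_htpy:
  assumes p: "p \<in> cyl_combs C G X Y n"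
  shows "fdiff QC (lin htpy_word p)
    = ksign n (word_mult p (cyl_eta X) - word_mult (cyl_eta Y) (in1_comb (subst proj_word p)))
      + lin htpy_word (fdiff QC p)"
proof -
  have hom: "homogeneous (edeg QC) (edeg QC c) (word [c])" for c
    by (simp add: homogeneous_def)
  have hom_h: "homogeneous (edeg QC) (edeg QC c - 1) (htpy c)" if "c \<in> edges QC" for c
    using that by (cases rule: cyl_cases) (simp_all add: homogeneous_def)
  have d\<phi>: "fdiff QC (word [c]) = subst (\<lambda>c. word [c]) (ediff QC c)" for c
    by (simp add: subst_words_id)
  have d\<psi>: "fdiff QC (subst in1_proj p) = subst in1_proj (fdiff QC p)" if "p \<in> QC.combs X Y n" for p X Y n
    unfolding subst_in1_proj using that fdiff_in1[OF proj_combs] fdiff_proj by simp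
  have dh: "fdiff QC (htpy c) = ksign (edeg QC c) (word_mult (word [c]) (cyl_eta (esrc QC c))
      - word_mult (cyl_eta (etgt QC c)) (in1_proj c)) + lin (der_word (edeg QC) (\<lambda>c. word [c]) in1_proj htpy) (ediff QC c)"
    if "c \<in> edges QC" for c
    using that
  proof (cases rule: cyl_cases)
    \<comment> \<open>Applied to i_2(f) t_A, tau reproduces t_f, with the sign that cancels the term
      t_f \<eta>; the part t_{df} is killed by \<open>htpy_t\<close>.\<close>
    case (TGen e)
    have "htpy_word [In2 e, T (asrc e)] = word [TGen e]" "htpy_word [T (atgt e), In1 e] = 0"
      by simp_all
    then show ?thesis
      unfolding TGen by (simp add: htpy_t[OF expand_diff_combs[OF TGen(2)]] lin_add lin_ksign lin_diff del: der_word.simps)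
        (simp add: ksign_def)
  qed (simp_all add: htpy_in1 htpy_in2 lin_diff lin_uminus word_mult_linear)
  have p': "p \<in> QC.combs X Y n" using p by simp
  show ?thesis
    using QC.fdiff_der[where Q' = QC and \<phi> = "\<lambda>c. word [c]" and \<psi> = in1_proj and h = htpy and \<eta> = "\<lambda>X. cyl_eta X",
        OF hom hom_h d\<phi> d\<psi> dh p']
    by (simp add: subst_words_id subst_in1_proj)
qed

text \<open>The part to the right of the differentiated letter is sent through i_1 p, which moves
  the source to the first end.\<close>

lemma htpy_combs:
  assumes "p \<in> cyl_combs C G X Y n"
  shows "lin htpy_word p \<in> cyl_combs C G (Inl (untag X)) Y (n - 1)"
proof (rule der_combs[where fa = "\<lambda>X. Inl (untag X)" and fb = "\<lambda>X. X", OF _ _ _ assms])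
  fix c assume c: "c \<in> edges QC"
  show "word [c] \<in> cyl_combs C G (cyl_src c) (cyl_tgt c) (cyl_deg c)"
    using c by (intro path_combs_word) auto
  show "in1_proj c \<in> cyl_combs C G (Inl (untag (cyl_src c))) (Inl (untag (cyl_tgt c))) (cyl_deg c)"
    by (intro in1_comb_combs proj_word_combs c)
  show "htpy c \<in> cyl_combs C G (Inl (untag (cyl_src c))) (cyl_tgt c) (cyl_deg c - 1)"
    using c by (cases rule: cyl_cases) (auto simp: untag_def intro!: path_combs_word path_combs_uminus)
qed

lemma Cyl_acyclic_kernel:
  assumes x: "x \<in> cyl_combs C G X Y n" and dx: "fdiff QC x = 0" and px: "subst proj_word x = 0"
    and X: "X \<in> Ob C <+> Ob C"
  shows "\<exists>y\<in>cyl_combs C G X Y (n - 1). subst proj_word y = 0 \<and> fdiff QC y = x"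
proof -
  have d: "fdiff QC (lin htpy_word x) = ksign n (word_mult x (cyl_eta X))"
    using fdiff_htpy[OF x] dx px by simp
  show ?thesis
  proof (cases X)
    case (Inl A)
    then show ?thesis
      using d htpy_combs[OF x] proj_htpy[of x]
      by (intro bexI[of _ "ksign n (lin htpy_word x)"])
        (auto simp: lin_ksign untag_def intro: path_combs_ksign)
  next
    case (Inr A)
    have A: "A \<in> Ob C" using X Inr by auto
    \<comment> \<open>d of the first summand is (-1)^n x t t', and d(x t-check) = (-1)^n (x - x t
      t'); the terms with t t' cancel and \<open>ksign n\<close> removes the common sign.\<close>
    let ?k = "word_mult (lin htpy_word x) (word [T' A])"
    let ?y = "ksign n (?k + word_mult x (word [Tcheck A]))"
    have h: "lin htpy_word x \<in> cyl_combs C G (Inl A) Y (n - 1)"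
      using htpy_combs[OF x] Inr by (simp add: untag_def)
    have "?k \<in> cyl_combs C G X Y (n - 1 + 0)"
      using A Inr by (intro path_combs_mult[OF h] path_combs_word) auto
    moreover have "word_mult x (word [Tcheck A]) \<in> cyl_combs C G X Y (n + - 1)"
      using A Inr by (intro path_combs_mult[OF x] path_combs_word) auto
    ultimately have y: "?y \<in> cyl_combs C G X Y (n - 1)"
      by (auto intro!: path_combs_ksign path_combs_add)
    have "homogeneous (edeg QC) (n - 1) (lin htpy_word x)" "homogeneous (edeg QC) n x"
      using path_combs_homogeneous[OF h] path_combs_homogeneous[OF x] by simp_all
    note m = this[THEN fdiff_mult]
    have "fdiff QC ?y = x"
      using Inr by (simp add: lin_ksign lin_add m d dx word_mult_ksign_left word_mult_assoc
          word_mult_diff_right ksign_add[symmetric] del: word_mult_word)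
        (simp add: word_mult_diff_right)
    moreover have "subst proj_word ?y = 0"
      by (simp add: lin_ksign lin_add subst_mult proj_htpy px)
    ultimately show ?thesis using y by blast
  qed
qed

lemma trivial_fibration_proj: "trivial_fibration (Cyl C G) C (cyl_proj C G)"
proof -
  interpret P: dg_functor "Cyl C G" C "cyl_proj C G" by (rule dg_functor_proj)
  show ?thesis
  proof
    fix Y assume "Y \<in> Ob C"
    then show "\<exists>X\<in>Ob (Cyl C G). FOb (cyl_proj C G) X = Y"
      by (intro bexI[of _ "Inl Y"]) (auto simp: cyl_proj_simps(1) untag_def Cyl_simps)
  next
    fix X Y g n
    assume X: "X \<in> Ob (Cyl C G)" "Y \<in> Ob (Cyl C G)"
      and g: "g \<in> Hom C (FOb (cyl_proj C G) X) (FOb (cyl_proj C G) Y) n"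
    let ?q = "expand C G (untag X) (untag Y) n g"
    have X': "X \<in> Ob C <+> Ob C" "Y \<in> Ob C <+> Ob C" using X by (simp_all add: Cyl_simps)
    have g': "g \<in> Hom C (untag X) (untag Y) n" using g by (simp add: cyl_proj_simps(1))
    have q: "?q \<in> arrow_combs G (untag X) (untag Y) n" "comb_val C (untag X) ?q = g"
      using g' X' by (auto intro!: expand_combs comb_val_expand untag_Ob)
    \<comment> \<open>Between different ends a morphism is lifted to the end of its source and then
      transported by t or t', which p sends to the identity.\<close>
    define f where "f = (case (X, Y) of (Inl A, Inl B) \<Rightarrow> in1_comb ?q
      | (Inr A, Inr B) \<Rightarrow> in2_comb ?q
      | (Inl A, Inr B) \<Rightarrow> word_mult (word [T B]) (in1_comb ?q)
      | (Inr A, Inl B) \<Rightarrow> word_mult (word [T' B]) (in2_comb ?q))"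
    have "f \<in> cyl_combs C G X Y n"
    proof (cases X; cases Y)
      fix A B assume [simp]: "X = Inl A" "Y = Inr B"
      have "word_mult (word [T B]) (in1_comb ?q) \<in> cyl_combs C G X Y (0 + n)"
        using X' q in1_comb_combs[OF q(1)]
        by (intro path_combs_mult[OF path_combs_word]) (auto simp: untag_def)
      then show ?thesis by (simp add: f_def)
    next
      fix A B assume [simp]: "X = Inr A" "Y = Inl B"
      have "word_mult (word [T' B]) (in2_comb ?q) \<in> cyl_combs C G X Y (0 + n)"
        using X' q in2_comb_combs[OF q(1)]
        by (intro path_combs_mult[OF path_combs_word]) (auto simp: untag_def)
      then show ?thesis by (simp add: f_def)
    qed (use in1_comb_combs[OF q(1)] in2_comb_combs[OF q(1)] in \<open>auto simp: f_def untag_def\<close>)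
    moreover have "subst proj_word f = ?q"
      by (simp add: f_def proj_in1 proj_in2 subst_mult split: sum.split)
    ultimately show "\<exists>f\<in>Hom (Cyl C G) X Y n. FMor (cyl_proj C G) X Y n f = g"
      using X' q by (intro bexI[of _ f]) (auto simp: cyl_proj_simps(2) Cyl_simps)
  next
    fix X Y f n
    assume X: "X \<in> Ob (Cyl C G)" "Y \<in> Ob (Cyl C G)" and f: "f \<in> Hom (Cyl C G) X Y n"
      and df: "Diff (Cyl C G) X Y n f = 0" and pf: "FMor (cyl_proj C G) X Y n f = 0"
    have X': "X \<in> Ob C <+> Ob C" "Y \<in> Ob C <+> Ob C" and f': "f \<in> cyl_combs C G X Y n"
      using X f by (simp_all add: Cyl_simps)
    \<comment> \<open>By freeness, vanishing in \<open>C\<close> is vanishing as a combination of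
      words.\<close>
    have "subst proj_word f = 0"
    proof (rule comb_val_inj[where Y = "untag Y" and n = n])
      show "comb_val C (untag X) (subst proj_word f) = comb_val C (untag X) 0"
        using pf cyl_proj_simps(2)[OF f' X'] by (simp add: comb_val_zero)
    qed (use proj_combs[OF f'] untag_Ob X' in simp_all)
    then obtain y where "y \<in> cyl_combs C G X Y (n - 1)" "subst proj_word y = 0" "fdiff QC y = f"
      using Cyl_acyclic_kernel[OF f' _ _ X'(1)] df by (auto simp: Cyl_simps)
    then show "\<exists>h\<in>Hom (Cyl C G) X Y (n - 1). FMor (cyl_proj C G) X Y (n - 1) h = 0
        \<and> Diff (Cyl C G) X Y (n - 1) h = f"
      using X' by (intro bexI[of _ y]) (auto simp: Cyl_simps cyl_proj_simps(2) comb_val_zero)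
  qed
qed

end

section \<open>Semifreeness of the cylinder and the cofibration condition\<close>

section \<open>The generators of the cylinder are well-ordered\<close>

lemma well_order_on_inv_image:
  assumes "wf s" "trans s" "inj_on f A"
    and total: "\<And>a b. a \<in> A \<Longrightarrow> b \<in> A \<Longrightarrow> f a \<noteq> f b \<Longrightarrow> (f a, f b) \<in> s \<or> (f b, f a) \<in> s"
  shows "well_order_on A {(a, b). a \<in> A \<and> b \<in> A \<and> (a = b \<or> (f a, f b) \<in> s)}" (is "well_order_on A ?r")
proof -
  have irr: "(x, x) \<notin> s" for x using assms(1) by simp
  have asym: "(x, y) \<in> s \<Longrightarrow> (y, x) \<notin> s" for x y using irr transD[OF assms(2)] by blast
  have "?r - Id \<subseteq> inv_image s f" by auto
  then have "wf (?r - Id)" using wf_subset[OF wf_inv_image[OF assms(1)]] by blast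
  moreover have "trans ?r" using transD[OF assms(2)] by (auto simp: trans_def)
  moreover have "antisym ?r" using asym by (auto simp: antisym_def)
  moreover have "total_on A ?r"
    using total assms(3) by (auto simp: total_on_def inj_on_def)
  ultimately show ?thesis
    by (auto simp: well_order_on_def linear_order_on_def partial_order_on_def preorder_on_def refl_on_def)
qed

text \<open>The first component orders the kinds of generators so that differentials only use
  smaller ranks: t-hat and t-check after t and t', t-bar after these, t_f last. The other two
  compare generators of one kind, with \<open>undefined\<close> in the slot that does not
  apply.\<close>

primrec cyl_rank :: "('o, 'e) cylgen \<Rightarrow> nat \<times> 'o \<times> 'e" where
  "cyl_rank (In1 e) = (0, undefined, e)"
| "cyl_rank (In2 e) = (1, undefined, e)"
| "cyl_rank (T X) = (2, X, undefined)"
| "cyl_rank (T' X) = (3, X, undefined)"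
| "cyl_rank (That X) = (4, X, undefined)"
| "cyl_rank (Tcheck X) = (5, X, undefined)"
| "cyl_rank (Tbar X) = (6, X, undefined)"
| "cyl_rank (TGen e) = (7, undefined, e)"

lemma inj_cyl_rank: "inj cyl_rank"
proof (rule injI)
  fix x y :: "('o, 'e) cylgen"
  assume "cyl_rank x = cyl_rank y"
  then show "x = y" by (cases x; cases y) auto
qed

text \<open>Over the zero ring all combinations coincide; this settles the ordering conditions in
  the case where distinct generators can collapse.\<close>

lemma degenerate_ring:
  assumes "(1 :: 'k::{comm_ring,comm_monoid_mult}) = 0"
  shows "(p :: 'w \<Rightarrow>\<^sub>0 'k) = q"
proof -
  have "a = (0::'k)" for a using assms by (metis mult_1 mult_zero_left)
  then show ?thesis by (intro poly_mapping_eqI) metis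
qed

lemma edge_arrow_simps [simp]:
  "asrc (edge_arrow Q c) = esrc Q c" "atgt (edge_arrow Q c) = etgt Q c"
  "adeg (edge_arrow Q c) = edeg Q c" "amor (edge_arrow Q c) = word [c]"
  by (simp_all add: edge_arrow_def)

lemma inj_edge_arrow: "(1 :: 'k::{comm_ring,comm_monoid_mult}) \<noteq> 0 \<Longrightarrow>
    inj (edge_arrow (Q :: ('k, 'o, 'e) dgquiver))"
  by (rule injI, drule arg_cong[of _ _ "\<lambda>a. Poly_Mapping.keys (amor a)"]) simp

locale ordered_semifree_dgcat = semifree_dgcat +
  fixes r
  assumes wo: "well_order_on G r"
    and lower: "e \<in> G \<Longrightarrow> Diff C (asrc e) (atgt e) (adeg e) (amor e)
      \<in> comb_val C (asrc e) ` arrow_combs (underS r e) (asrc e) (atgt e) (adeg e + 1)"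
begin

lemma underS_gen: "underS r e \<subseteq> G"
  using wo by (auto simp: underS_def well_order_on_def linear_order_on_def partial_order_on_def
      preorder_on_def refl_on_def)

lemma expand_diff_lower: "e \<in> G \<Longrightarrow>
    expand_diff C G e \<in> arrow_combs (underS r e) (asrc e) (atgt e) (adeg e + 1)"
proof -
  assume e: "e \<in> G"
  from lower[OF this] obtain p where p: "p \<in> arrow_combs (underS r e) (asrc e) (atgt e) (adeg e + 1)"
    "comb_val C (asrc e) p = Diff C (asrc e) (atgt e) (adeg e) (amor e)" by auto
  have "expand_diff C G e = p"
    unfolding expand_diff_def
    by (rule expand_eqI) (use e gen_Ob p subsetD[OF path_combs_mono[OF underS_gen] p(1)] in simp_all)
  with p show ?thesis by simp
qed

text \<open>Objects come without an order; any well-order of their type serves for the generators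
  indexed by objects.\<close>

definition "ro = (SOME s :: 'b rel. well_order_on UNIV s)"

definition "rank_order = less_than <*lex*> (ro - Id) <*lex*> (r - Id)"

lemma ro: "well_order_on UNIV ro"
  unfolding ro_def by (rule someI_ex) (rule well_order_on)

lemma well_order_on_strict:
  assumes "well_order_on A s"
  shows "wf (s - Id)" "trans (s - Id)" "\<And>a b. a \<in> A \<Longrightarrow> b \<in> A \<Longrightarrow> a \<noteq> b \<Longrightarrow> (a, b) \<in> s - Id \<or> (b, a) \<in> s - Id"
  using assms unfolding well_order_on_def linear_order_on_def partial_order_on_def preorder_on_def
    total_on_def trans_def antisym_def by blast+

lemma rank_order: "wf rank_order" "trans rank_order"
  using well_order_on_strict[OF ro] well_order_on_strict[OF wo]
  unfolding rank_order_def by (auto intro!: wf_lex_prod trans_lex_prod simp: trans_less_than)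

lemma rank_order_total:
  assumes "a \<in> edges QC" "b \<in> edges QC" "cyl_rank a \<noteq> cyl_rank b"
  shows "(cyl_rank a, cyl_rank b) \<in> rank_order \<or> (cyl_rank b, cyl_rank a) \<in> rank_order"
  using assms(3) well_order_on_strict(3)[OF ro] well_order_on_strict(3)[OF wo]
  by (cases rule: cyl_cases[OF assms(1)]; cases rule: cyl_cases[OF assms(2)])
    (simp_all add: rank_order_def)

abbreviation "lower_edges c \<equiv> {c' \<in> edges QC. (cyl_rank c', cyl_rank c) \<in> rank_order}"

lemma cyl_diff_lower:
  assumes "c \<in> edges QC"
  shows "cyl_diff C G c \<in> path_combs (lower_edges c) cyl_src cyl_tgt cyl_deg (cyl_src c) (cyl_tgt c) (cyl_deg c + 1)"
    (is "_ \<in> path_combs ?L _ _ _ _ _ _")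
  using assms
proof (cases rule: cyl_cases)
  case (In1 e)
  have "in1_comb (expand_diff C G e) \<in> path_combs ?L cyl_src cyl_tgt cyl_deg (Inl (asrc e)) (Inl (atgt e)) (adeg e + 1)"
    unfolding in1_comb_eq_subst using underS_gen In1
    by (intro subst_combs[OF _ expand_diff_lower[OF In1(2)]] path_combs_word) (auto simp: rank_order_def underS_def)
  with In1 show ?thesis by simp
next
  case (In2 e)
  have "in2_comb (expand_diff C G e) \<in> path_combs ?L cyl_src cyl_tgt cyl_deg (Inr (asrc e)) (Inr (atgt e)) (adeg e + 1)"
    unfolding in2_comb_eq_subst using underS_gen In2
    by (intro subst_combs[OF _ expand_diff_lower[OF In2(2)]] path_combs_word) (auto simp: rank_order_def underS_def)
  with In2 show ?thesis by simp
next
  case (TGen e)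
  have "t_comb (expand_diff C G e) \<in> path_combs ?L cyl_src cyl_tgt cyl_deg (Inl (asrc e)) (Inr (atgt e)) (adeg e + 1 - 1)"
    unfolding t_comb_eq_der using underS_gen TGen
    by (intro der_combs[OF _ _ _ expand_diff_lower[OF TGen(2)], where fa = Inl and fb = Inr] path_combs_word)
      (auto simp: rank_order_def underS_def)
  with TGen show ?thesis
    by (auto intro!: path_combs_add path_combs_ksign path_combs_diff path_combs_word simp: gen_Ob rank_order_def)
qed (auto intro!: path_combs_diff path_combs_word simp: rank_order_def)

text \<open>Over the zero ring \<open>edge_arrow\<close> is not injective, hence the detour through \<open>inv_into\<close>.\<close>

lemma edge_arrow_order:
  assumes N: "N \<subseteq> edges QC"
  shows "\<exists>s. well_order_on (edge_arrow QC ` N) s \<and>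
    ((1 :: 'a) \<noteq> 0 \<longrightarrow> (\<forall>c\<in>N. edge_arrow QC ` (N \<inter> lower_edges c) \<subseteq> underS s (edge_arrow QC c)))"
proof -
  let ?A = "edge_arrow QC ` N"
  let ?g = "inv_into N (edge_arrow QC)"
  let ?f = "cyl_rank \<circ> ?g"
  let ?s = "{(a, b). a \<in> ?A \<and> b \<in> ?A \<and> (a = b \<or> (?f a, ?f b) \<in> rank_order)}"
  have g: "a \<in> ?A \<Longrightarrow> ?g a \<in> N" for a by (rule inv_into_into)
  have "inj_on ?f ?A"
    by (intro comp_inj_on inj_on_inv_into subset_refl inj_on_subset[OF inj_cyl_rank]) simp
  then have "well_order_on ?A ?s"
  proof (rule well_order_on_inv_image[OF rank_order])
    fix a b assume "a \<in> ?A" "b \<in> ?A" "?f a \<noteq> ?f b"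
    then show "(?f a, ?f b) \<in> rank_order \<or> (?f b, ?f a) \<in> rank_order"
      using rank_order_total[of "?g a" "?g b"] g[of a] g[of b] N by (simp add: subset_iff)
  qed
  moreover have "edge_arrow QC ` (N \<inter> lower_edges c) \<subseteq> underS ?s (edge_arrow QC c)"
    if "(1 :: 'a) \<noteq> 0" "c \<in> N" for c
  proof -
    have inj: "inj_on (edge_arrow QC) N" using inj_edge_arrow[OF that(1)] by (rule inj_on_subset) simp
    have irr: "(cyl_rank c, cyl_rank c) \<notin> rank_order" using wf_not_refl[OF rank_order(1)] .
    have "xa = c" if "xa \<in> N" "edge_arrow QC xa = edge_arrow QC c" for xa
      using inj_onD[OF inj that(2) that(1) \<open>c \<in> N\<close>] .
    with that inj irr show ?thesis by (auto simp: underS_def inv_into_f_f)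
  qed
  ultimately show ?thesis by blast
qed

text \<open>Inverse to \<open>comb_val\<close> on the cylinder: each edge is replaced by the
  generating arrow that it represents.\<close>

abbreviation "relabel \<equiv> subst (\<lambda>c. word [edge_arrow QC c])"

lemma word_val_Cyl: "word_val (Cyl C G) X w = subst_word amor w"
  by (induction w) (simp_all add: Cyl_simps)

lemma comb_val_Cyl: "comb_val (Cyl C G) X p = subst amor p"
  by (simp add: comb_val_def Cyl_simps word_val_Cyl[abs_def])

lemma comb_val_relabel: "comb_val (Cyl C G) X (relabel p) = p"
  by (simp add: comb_val_Cyl subst_subst subst_words_id)

lemma relabel_combs: "p \<in> path_combs L cyl_src cyl_tgt cyl_deg X Y n \<Longrightarrow>
    relabel p \<in> arrow_combs (edge_arrow QC ` L) X Y n"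
  by (rule subst_combs[where fo = "\<lambda>X. X"]) (auto intro!: path_combs_word)

lemma comb_val_Cyl_combs: "p \<in> arrow_combs (cyl_gens C G) X Y n \<Longrightarrow> comb_val (Cyl C G) X p \<in> cyl_combs C G X Y n"
  unfolding comb_val_Cyl
  by (rule subst_combs[where fo = "\<lambda>X. X" and L = "cyl_gens C G"])
    (auto simp: cyl_gens_def intro!: path_combs_word)

lemma relabel_comb_val: "p \<in> arrow_combs (cyl_gens C G) X Y n \<Longrightarrow> relabel (comb_val (Cyl C G) X p) = p"
proof (induction p rule: path_combs_induct)
  case (single w c)
  have "set w \<subseteq> cyl_gens C G" using is_path_set[OF single(1)] .
  then have "relabel (subst_word amor w) = word w"
    by (induction w) (auto simp: subst_mult cyl_gens_def)
  then show ?case by (simp add: comb_val_Cyl lin_single lin_pm_scale)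
qed (simp_all add: comb_val_Cyl lin_add)

lemma semifree_Cyl: "semifree (Cyl C G) (cyl_gens C G)"
  unfolding semifree_def
proof (intro conjI)
  show "dg_category (Cyl C G)" by (rule dg_category_Cyl)
  show "freely_generated (Cyl C G) (cyl_gens C G)"
    unfolding freely_generated_def
  proof (intro conjI ballI allI)
    show "cyl_gens C G \<subseteq> arrows (Cyl C G)"
      using QC.esrc_verts QC.etgt_verts
      by (auto simp: cyl_gens_def arrows_iff Cyl_simps intro!: path_combs_word)
    show "bij_betw (comb_val (Cyl C G) X) (arrow_combs (cyl_gens C G) X Y n) (Hom (Cyl C G) X Y n)" for X Y n
      using relabel_combs[of _ "edges QC" X Y n]
      by (intro bij_betw_byWitness[where f' = relabel])
        (auto simp: relabel_comb_val comb_val_relabel comb_val_Cyl_combs Cyl_simps cyl_gens_def[symmetric])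
  qed
  obtain s where s: "well_order_on (cyl_gens C G) s"
    "(1 :: 'a) \<noteq> 0 \<Longrightarrow> c \<in> edges QC \<Longrightarrow> edge_arrow QC ` (edges QC \<inter> lower_edges c) \<subseteq> underS s (edge_arrow QC c)" for c
    using edge_arrow_order[of "edges QC"] unfolding cyl_gens_def by auto
  have "fdiff QC (word [c]) \<in> comb_val (Cyl C G) (cyl_src c)
      ` arrow_combs (underS s (edge_arrow QC c)) (cyl_src c) (cyl_tgt c) (cyl_deg c + 1)"
    if c: "c \<in> edges QC" for c
  proof (cases "(1 :: 'a) = 0")
    case True
    show ?thesis by (rule image_eqI[of _ _ 0]) (rule degenerate_ring[OF True], simp)
  next
    case False
    have "relabel (cyl_diff C G c) \<in> arrow_combs (underS s (edge_arrow QC c)) (cyl_src c) (cyl_tgt c) (cyl_deg c + 1)"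
      by (rule subsetD[OF path_combs_mono relabel_combs[OF cyl_diff_lower[OF c]]])
        (use s(2)[OF False c] in auto)
    then show ?thesis by (intro image_eqI[of _ _ "relabel (cyl_diff C G c)"]) (simp_all add: comb_val_relabel)
  qed
  then show "\<exists>r. well_order_on (cyl_gens C G) r \<and>
      (\<forall>e\<in>cyl_gens C G. Diff (Cyl C G) (asrc e) (atgt e) (adeg e) (amor e)
         \<in> comb_val (Cyl C G) (asrc e) ` arrow_combs (underS r e) (asrc e) (atgt e) (adeg e + 1))"
    using s(1) by (intro exI[of _ s]) (auto simp: cyl_gens_def Cyl_simps)
qed

end

section \<open>The inclusion of the ends of the cylinder is a cofibration\<close>

text \<open>The homs are those of \<open>C\<close> or {0}, so the equations restrict from
  \<open>C\<close>. The point to check is closure under composition: a composite whose ends lie in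
  different copies has a zero factor.\<close>

lemma dg_category_double:
  assumes "dg_category C"
  shows "dg_category (double C)"
proof -
  interpret dg_category C by fact
  have dsimps: "Scale (double C) = Scale C" "Comp (double C) X Y Z = Comp C (untag X) (untag Y) (untag Z)"
    "Ident (double C) X = Ident C (untag X)" "Diff (double C) X Y = Diff C (untag X) (untag Y)" for X Y Z
    by (simp_all add: double_def)
  have Ob: "X \<in> Ob (double C) \<Longrightarrow> untag X \<in> Ob C" for X
    by (auto simp: double_def untag_def)
  have mem: "f \<in> Hom (double C) X Y n \<longleftrightarrow> f \<in> Hom C (untag X) (untag Y) n \<and> (isl X \<noteq> isl Y \<longrightarrow> f = 0)"
    if "X \<in> Ob (double C)" "Y \<in> Ob (double C)" for f X Y n
    using zero_Hom[OF Ob[OF that(1)] Ob[OF that(2)]] by (auto simp: double_def)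
  have Hom: "f \<in> Hom C (untag X) (untag Y) n"
    if "X \<in> Ob (double C)" "Y \<in> Ob (double C)" "f \<in> Hom (double C) X Y n" for f X Y n
    using that(3) mem[OF that(1,2)] by simp
  show ?thesis
  proof (unfold_locales, goal_cases)
    case (8 X Y Z g m f n)
    note H = Hom[OF 8(2,3,4)] Hom[OF 8(1,2,5)] and O = Ob[OF 8(1)] Ob[OF 8(2)] Ob[OF 8(3)]
    have "Comp C (untag X) (untag Y) (untag Z) g f = 0" if "isl X \<noteq> isl Z"
    proof (cases "isl X = isl Y")
      case True
      then have "g = 0" using 8 mem that by auto
      then show ?thesis using Comp_zero_left[OF O H(2)] by simp
    next
      case False
      then have "f = 0" using 8 mem by auto
      then show ?thesis using Comp_zero_right[OF O H(1)] by simp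
    qed
    with 8(1,3) Comp_Hom[OF O H] show ?case by (simp add: mem dsimps)
  next
    case (4 X Y f n g a)
    then show ?case unfolding dsimps by (intro Scale_add_right[OF Ob[of X] Ob[of Y] Hom[of X Y f n] Hom[of X Y g n]])
  next
    case (5 X Y f n a b)
    then show ?case unfolding dsimps by (intro Scale_add_left[OF Ob[of X] Ob[of Y] Hom[of X Y f n]])
  next
    case (6 X Y f n a b)
    then show ?case unfolding dsimps by (intro Scale_Scale[OF Ob[of X] Ob[of Y] Hom[of X Y f n]])
  next
    case (7 X Y f n)
    then show ?case unfolding dsimps by (intro Scale_one[OF Ob[of X] Ob[of Y] Hom[of X Y f n]])
  next
    case (9 X Y Z g m g' f n)
    then show ?case unfolding dsimps by (intro Comp_add_left[OF Ob[of X] Ob[of Y] Ob[of Z] Hom[of Y Z g m] Hom[of Y Z g' m] Hom[of X Y f n]])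
  next
    case (10 X Y Z g m f n f')
    then show ?case unfolding dsimps by (intro Comp_add_right[OF Ob[of X] Ob[of Y] Ob[of Z] Hom[of Y Z g m] Hom[of X Y f n] Hom[of X Y f' n]])
  next
    case (11 X Y Z g m f n a)
    then show ?case unfolding dsimps by (intro Comp_Scale_left[OF Ob[of X] Ob[of Y] Ob[of Z] Hom[of Y Z g m] Hom[of X Y f n]])
  next
    case (12 X Y Z g m f n a)
    then show ?case unfolding dsimps by (intro Comp_Scale_right[OF Ob[of X] Ob[of Y] Ob[of Z] Hom[of Y Z g m] Hom[of X Y f n]])
  next
    case (13 W X Y Z h l g m f n)
    then show ?case unfolding dsimps by (intro Comp_assoc[OF Ob[of W] Ob[of X] Ob[of Y] Ob[of Z] Hom[of Y Z h l] Hom[of X Y g m] Hom[of W X f n]])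
  next
    case (15 X Y f n)
    then show ?case unfolding dsimps by (intro Comp_Ident_left[OF Ob[of X] Ob[of Y] Hom[of X Y f n]])
  next
    case (16 X Y f n)
    then show ?case unfolding dsimps by (intro Comp_Ident_right[OF Ob[of X] Ob[of Y] Hom[of X Y f n]])
  next
    case (18 X Y f n g)
    then show ?case unfolding dsimps by (intro Diff_add[OF Ob[of X] Ob[of Y] Hom[of X Y f n] Hom[of X Y g n]])
  next
    case (19 X Y f n a)
    then show ?case unfolding dsimps by (intro Diff_Scale[OF Ob[of X] Ob[of Y] Hom[of X Y f n]])
  next
    case (20 X Y f n)
    then show ?case unfolding dsimps by (intro Diff_Diff[OF Ob[of X] Ob[of Y] Hom[of X Y f n]])
  next
    case (21 X Y Z g m f n)
    then show ?case unfolding dsimps by (intro Diff_Comp[OF Ob[of X] Ob[of Y] Ob[of Z] Hom[of Y Z g m] Hom[of X Y f n]])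
  qed (auto simp: mem dsimps zero_Hom add_Hom Scale_Hom Ident_Hom Diff_Hom
      Scale_zero_right[OF Ob Ob] Diff_zero Ob)
qed

lemma dg_functor_copair:
  assumes "dg_functor C E F" "dg_functor C E F'"
  shows "dg_functor (double C) E (copair F F')"
proof -
  interpret F: dg_functor C E F by fact
  interpret F': dg_functor C E F' by fact
  interpret CC: dg_category "double C" by (rule dg_category_double) unfold_locales
  have FOb: "FOb (copair F F') X = (case X of Inl A \<Rightarrow> FOb F A | Inr A \<Rightarrow> FOb F' A)" for X
    by (simp add: copair_def)
  have FMor: "FMor (copair F F') (Inl A) (Inl B) = FMor F A B" "FMor (copair F F') (Inr A) (Inr B) = FMor F' A B"
    "FMor (copair F F') (Inl A) (Inr B) = (\<lambda>n f. 0)" "FMor (copair F F') (Inr A) (Inl B) = (\<lambda>n f. 0)" for A B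
    by (auto simp: copair_def fun_eq_iff)
  have dsimps: "Scale (double C) = Scale C" "Comp (double C) X Y Z = Comp C (untag X) (untag Y) (untag Z)"
    "Ident (double C) X = Ident C (untag X)" "Diff (double C) X Y = Diff C (untag X) (untag Y)"
    "untag (Inl A) = A" "untag (Inr A) = A" for X Y Z A
    by (simp_all add: double_def untag_def)
  have Hom: "Hom (double C) (Inl A) (Inl B) n = Hom C A B n" "Hom (double C) (Inr A) (Inr B) n = Hom C A B n"
    "Hom (double C) (Inl A) (Inr B) n = {0}" "Hom (double C) (Inr A) (Inl B) n = {0}" for A B n
    by (simp_all add: double_def untag_def)
  have Ob: "Ob (double C) = Ob C <+> Ob C" by (simp add: double_def)
  have [simp]: "Inl A \<in> Ob C <+> Ob C \<longleftrightarrow> A \<in> Ob C" "Inr A \<in> Ob C <+> Ob C \<longleftrightarrow> A \<in> Ob C" for A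
    by auto
  note O = F.FOb_Ob F'.FOb_Ob
  show ?thesis
  proof (unfold_locales, goal_cases)
    case (5 X Y Z g m f n)
    note H = F.FMor_Hom F'.FMor_Hom
    note 1 = F.source.Comp_zero_left F.source.Comp_zero_right
      F.target.Comp_zero_left F.target.Comp_zero_right
    consider (a) A B C' where "X = Inl A" "Y = Inl B" "Z = Inl C'" | (b) A B C' where "X = Inr A" "Y = Inr B" "Z = Inr C'"
      | (c) A B C' where "X = Inl A" "Y = Inl B" "Z = Inr C'" | (d) A B C' where "X = Inr A" "Y = Inr B" "Z = Inl C'"
      | (e) A B C' where "X = Inl A" "Y = Inr B" "Z = Inl C'" | (f) A B C' where "X = Inr A" "Y = Inl B" "Z = Inr C'"
      | (g) A B C' where "X = Inl A" "Y = Inr B" "Z = Inr C'" | (h) A B C' where "X = Inr A" "Y = Inl B" "Z = Inl C'"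
      by (cases X; cases Y; cases Z) blast+
    then show ?case
    proof cases
      case a
      with 5 show ?thesis by (simp add: FMor FOb dsimps Hom Ob F.FMor_Comp)
    next
      case b
      with 5 show ?thesis by (simp add: FMor FOb dsimps Hom Ob F'.FMor_Comp)
    next
      case c
      with 5 show ?thesis by (simp add: FMor FOb Hom Ob F.target.Comp_zero_left[OF O(1) O(1) O(2) H(1)])
    next
      case d
      with 5 show ?thesis by (simp add: FMor FOb Hom Ob F.target.Comp_zero_left[OF O(2) O(2) O(1) H(2)])
    next
      \<comment> \<open>The path leaves its copy and returns: both factors are 0, so the composite
        is 0 and so is its image.\<close>
      case e
      with 5 show ?thesis using F.source.Comp_zero_left[of A B C' 0] F.source.zero_Hom[of A B]
          F.target.Comp_zero_left[OF O(1)[of A] O(2)[of B] O(1)[of C'] F.target.zero_Hom[OF O(1)[of A] O(2)[of B]]]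
        by (simp add: FMor FOb Hom Ob dsimps F.FMor_zero)
    next
      case f
      with 5 show ?thesis using F.source.Comp_zero_left[of A B C' 0] F.source.zero_Hom[of A B]
          F.target.Comp_zero_left[OF O(2)[of A] O(1)[of B] O(2)[of C'] F.target.zero_Hom[OF O(2)[of A] O(1)[of B]]]
        by (simp add: FMor FOb Hom Ob dsimps F'.FMor_zero)
    next
      case g
      with 5 show ?thesis by (simp add: FMor FOb Hom Ob F.target.Comp_zero_right[OF O(1) O(2) O(2) H(2)])
    next
      case h
      with 5 show ?thesis by (simp add: FMor FOb Hom Ob F.target.Comp_zero_right[OF O(2) O(1) O(1) H(1)])
    qed
  qed (auto simp: Ob Hom FOb FMor dsimps O F.FMor_Hom F'.FMor_Hom F.FMor_add F'.FMor_add
      F.FMor_Scale F'.FMor_Scale F.FMor_Ident F'.FMor_Ident F.FMor_Diff F'.FMor_Diff F.target.zero_Hom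
      F.target.Diff_zero F.target.Scale_zero_right[OF O(1) O(2)] F.target.Scale_zero_right[OF O(2) O(1)])
qed

lemma mixed_relations_uminus: "p \<in> mixed_relations C F G X Y \<Longrightarrow> - p \<in> mixed_relations C F G X Y"
  using mixed_relations.scale[of p C F G X Y "- 1"] by (simp add: pm_scale_uminus)

lemma mixed_relations_sum: "(\<And>i. i \<in> I \<Longrightarrow> f i \<in> mixed_relations C F G X Y) \<Longrightarrow> sum f I \<in> mixed_relations C F G X Y"
  by (induction I rule: infinite_finite_induct) (auto intro: mixed_relations.zero mixed_relations.add)

lemma mixed_relations_lin:
  "(\<And>w. w \<in> Poly_Mapping.keys p \<Longrightarrow> f w \<in> mixed_relations C F G X Y) \<Longrightarrow> lin f p \<in> mixed_relations C F G X Y"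
  unfolding lin_ext_def by (intro mixed_relations_sum mixed_relations.scale)

text \<open>The generating relations already carry contexts \<open>u\<close> and \<open>v\<close>,
  so multiplication by a word only lengthens a context. Together with
  \<open>mixed_relations_right\<close> this makes the relations a two-sided ideal.\<close>

lemma mixed_relations_left:
  assumes "p \<in> mixed_relations C F G X Y" and u': "mixed_path C F G Y Z u'"
  shows "word_mult (word u') p \<in> mixed_relations C F G X Z"
  using assms(1)
proof induction
  case (letter_add A B f n g u v)
  have "mixed_path C F G X Z ((u' @ u) @ Inl (Arrow A B n (f + g)) # v)"
    using letter_add(5) u' unfolding is_path_append by blast
  from mixed_relations.letter_add[OF letter_add(1-4) this] show ?case
    by (simp add: word_mult_linear)
next
  case (letter_scale A B f n u c v)
  have "mixed_path C F G X Z ((u' @ u) @ Inl (Arrow A B n (Scale C c f)) # v)"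
    using letter_scale(4) u' unfolding is_path_append by blast
  from mixed_relations.letter_scale[OF letter_scale(1-3) this] show ?case
    by (simp add: word_mult_linear word_mult_singles)
next
  case (letter_Comp A B B' g m f n u v)
  have "mixed_path C F G X Z ((u' @ u) @ Inl (Arrow A B' (m + n) (Comp C A B B' g f)) # v)"
    using letter_Comp(6) u' unfolding is_path_append by blast
  from mixed_relations.letter_Comp[OF letter_Comp(1-5) this] show ?case
    by (simp add: word_mult_linear)
next
  case (letter_Ident A u v)
  have "mixed_path C F G X Z ((u' @ u) @ Inl (Arrow A A 0 (Ident C A)) # v)"
    using letter_Ident(2) u' unfolding is_path_append by blast
  from mixed_relations.letter_Ident[OF letter_Ident(1) this] show ?case
    by (simp add: word_mult_linear)
qed (auto simp: word_mult_add_right word_mult_scale_right intro: mixed_relations.intros)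

lemma mixed_relations_right:
  assumes "p \<in> mixed_relations C F G Y Z" and v': "mixed_path C F G X Y v'"
  shows "word_mult p (word v') \<in> mixed_relations C F G X Z"
  using assms(1)
proof induction
  case (letter_add A B f n g u v)
  have "mixed_path C F G X Z (u @ Inl (Arrow A B n (f + g)) # (v @ v'))"
    using letter_add(5) v' unfolding is_path_append is_path.simps by blast
  from mixed_relations.letter_add[OF letter_add(1-4) this] show ?case
    by (simp add: word_mult_linear)
next
  case (letter_scale A B f n u c v)
  have "mixed_path C F G X Z (u @ Inl (Arrow A B n (Scale C c f)) # (v @ v'))"
    using letter_scale(4) v' unfolding is_path_append is_path.simps by blast
  from mixed_relations.letter_scale[OF letter_scale(1-3) this] show ?case
    by (simp add: word_mult_linear word_mult_singles)
next
  case (letter_Comp A B B' g m f n u v)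
  have "mixed_path C F G X Z (u @ Inl (Arrow A B' (m + n) (Comp C A B B' g f)) # (v @ v'))"
    using letter_Comp(6) v' unfolding is_path_append is_path.simps by blast
  from mixed_relations.letter_Comp[OF letter_Comp(1-5) this] show ?case
    by (simp add: word_mult_linear)
next
  case (letter_Ident A u v)
  have "mixed_path C F G X Z (u @ Inl (Arrow A A 0 (Ident C A)) # (v @ v'))"
    using letter_Ident(2) v' unfolding is_path_append is_path.simps by blast
  from mixed_relations.letter_Ident[OF letter_Ident(1) this] show ?case
    by (simp add: word_mult_linear)
qed (auto simp: word_mult_add_left word_mult_scale_left intro: mixed_relations.intros)

lemma mixed_relations_right_comb:
  assumes "p \<in> mixed_relations C F G Y Z" and q: "q \<in> mixed_combs C F G X Y n"
  shows "word_mult p q \<in> mixed_relations C F G X Z"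
proof -
  have "lin (\<lambda>v. word_mult p (word v)) q \<in> mixed_relations C F G X Z"
    by (intro mixed_relations_lin mixed_relations_right[OF assms(1)]) (rule path_combsD(1)[OF q])
  then show ?thesis by (simp add: word_mult_lin_right[symmetric])
qed

lemma subst_word_map: "subst_word \<phi> (map g w) = subst_word (\<lambda>e. \<phi> (g e)) w"
  by (induction w) simp_all

context ordered_semifree_dgcat
begin

abbreviation "DC \<equiv> double C"
abbreviation "ends \<equiv> copair (cyl_in1 C G) (cyl_in2 C G)"

lemma dg_functor_ends: "dg_functor DC (Cyl C G) ends"
  by (intro dg_functor_copair dg_functor_in1 dg_functor_in2)

lemma FOb_ends [simp]: "FOb ends X = X"
  by (cases X) (simp_all add: copair_def cyl_in1_def cyl_in2_def)

lemma FMor_ends: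
  "FMor ends (Inl A) (Inl B) n f = in1_comb (expand C G A B n f)"
  "FMor ends (Inr A) (Inr B) n f = in2_comb (expand C G A B n f)"
  "FMor ends (Inl A) (Inr B) n f = 0" "FMor ends (Inr A) (Inl B) n f = 0"
  by (simp_all add: copair_def cyl_in1_def cyl_in2_def)

definition "new_edges = {c \<in> edges QC. \<forall>e. c \<noteq> In1 e \<and> c \<noteq> In2 e}"

definition "new_gens = edge_arrow QC ` new_edges"

abbreviation "letter_val l \<equiv> amor (letter_arrow ends l)"

lemma mixed_val_eq: "mixed_val (Cyl C G) ends X = subst letter_val"
  by (rule ext) (simp add: mixed_val_def Cyl_simps word_val_Cyl subst_word_map[abs_def])

definition "inj_letter i e = Inl (Arrow (i (asrc e)) (i (atgt e)) (adeg e) (amor e))"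

text \<open>Generators of the two ends become letters from \<open>double C\<close>, all others
  become new generators. The induced \<open>normal_form\<close> is a section of
  \<open>mixed_val\<close>.\<close>

definition "normal_letter c = (case c of In1 e \<Rightarrow> inj_letter Inl e | In2 e \<Rightarrow> inj_letter Inr e
   | _ \<Rightarrow> Inr (edge_arrow QC c))"

abbreviation "normal_form \<equiv> subst (\<lambda>c. word [normal_letter c])"

abbreviation "mixed_letters \<equiv> letters DC new_gens"

lemma double_simps:
  "Inl A \<in> Ob DC \<longleftrightarrow> A \<in> Ob C" "Inr A \<in> Ob DC \<longleftrightarrow> A \<in> Ob C"
  "Hom DC (Inl A) (Inl B) n = Hom C A B n" "Hom DC (Inr A) (Inr B) n = Hom C A B n"
  "Hom DC (Inl A) (Inr B) n = {0}" "Hom DC (Inr A) (Inl B) n = {0}"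
  "Scale DC = Scale C" "Comp DC (Inl A) (Inl B) (Inl B') = Comp C A B B'"
  "Comp DC (Inr A) (Inr B) (Inr B') = Comp C A B B'"
  "Ident DC (Inl A) = Ident C A" "Ident DC (Inr A) = Ident C A"
  by (auto simp: double_def untag_def)

lemma expand_gen: "e \<in> G \<Longrightarrow> expand C G (asrc e) (atgt e) (adeg e) (amor e) = word [e]"
  by (intro expand_eqI) (auto simp: gen_Ob comb_val_letter intro!: path_combs_word)

lemma normal_letter:
  assumes "c \<in> edges QC"
  shows "normal_letter c \<in> mixed_letters" "asrc (letter_arrow ends (normal_letter c)) = cyl_src c"
    "atgt (letter_arrow ends (normal_letter c)) = cyl_tgt c"
    "adeg (letter_arrow ends (normal_letter c)) = cyl_deg c" "letter_val (normal_letter c) = word [c]"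
proof -
  have *: "normal_letter c \<in> mixed_letters \<and> asrc (letter_arrow ends (normal_letter c)) = cyl_src c \<and>
    atgt (letter_arrow ends (normal_letter c)) = cyl_tgt c \<and>
    adeg (letter_arrow ends (normal_letter c)) = cyl_deg c \<and> letter_val (normal_letter c) = word [c]"
    using assms
    by (cases rule: cyl_cases)
      (auto simp: normal_letter_def inj_letter_def letters_def letter_arrow_def image_arrow_def FMor_ends
        expand_gen new_gens_def new_edges_def arrows_iff double_simps gen_Ob gen_Hom)
  then show "normal_letter c \<in> mixed_letters" "asrc (letter_arrow ends (normal_letter c)) = cyl_src c"
    "atgt (letter_arrow ends (normal_letter c)) = cyl_tgt c"
    "adeg (letter_arrow ends (normal_letter c)) = cyl_deg c" "letter_val (normal_letter c) = word [c]"
    by blast+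
qed

text \<open>\<open>L\<close> and \<open>S\<close> are kept general because the order condition on
  differentials requires the statement with \<open>S\<close> an initial segment of the new
  generators.\<close>

lemma normal_form_combs:
  assumes p: "p \<in> path_combs L cyl_src cyl_tgt cyl_deg X Y n" and L: "L \<subseteq> edges QC"
    and S: "edge_arrow QC ` (L \<inter> new_edges) \<subseteq> S"
  shows "normal_form p \<in> mixed_combs DC ends S X Y n"
proof (rule subst_combs[where fo = "\<lambda>X. X", OF _ p])
  fix c assume c: "c \<in> L"
  then have c': "c \<in> edges QC" using L by auto
  have "normal_letter c \<in> letters DC S"
  proof (cases "c \<in> new_edges")
    case True
    then have "normal_letter c = Inr (edge_arrow QC c)"
      by (cases c) (auto simp: normal_letter_def new_edges_def)
    then show ?thesis using S c True by (auto simp: letters_def)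
  next
    case False
    then show ?thesis using normal_letter(1)[OF c'] c'
      by (cases c) (auto simp: new_edges_def normal_letter_def letters_def inj_letter_def)
  qed
  then show "word [normal_letter c]
      \<in> mixed_combs DC ends S (cyl_src c) (cyl_tgt c) (cyl_deg c)"
    using normal_letter[OF c'] by (intro path_combs_word) auto
qed

lemma mixed_val_normal_form:
  assumes "p \<in> path_combs L cyl_src cyl_tgt cyl_deg X Y n" "L \<subseteq> edges QC"
  shows "mixed_val (Cyl C G) ends Z (normal_form p) = p"
proof -
  have "mixed_val (Cyl C G) ends Z (normal_form p) = lin word p"
    unfolding mixed_val_eq lin_lin
  proof (rule lin_ext_cong)
    fix w assume "w \<in> Poly_Mapping.keys p"
    then have "set w \<subseteq> edges QC" using is_path_set[OF path_combsD(1)[OF assms(1)]] assms(2) by auto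
    then show "subst letter_val (subst_word (\<lambda>c. word [normal_letter c]) w) = word w"
      by (induction w) (simp_all add: subst_mult normal_letter)
  qed
  then show ?thesis by simp
qed

lemma edge_arrow_arrows: "c \<in> edges QC \<Longrightarrow> edge_arrow QC c \<in> arrows (Cyl C G)"
  using QC.esrc_verts[of c] QC.etgt_verts[of c]
  by (auto simp: arrows_iff Cyl_simps intro!: path_combs_word)

lemma letter_val_combs:
  assumes "l \<in> mixed_letters"
  shows "letter_val l \<in> cyl_combs C G (asrc (letter_arrow ends l)) (atgt (letter_arrow ends l)) (adeg (letter_arrow ends l))"
proof -
  interpret J: dg_functor DC "Cyl C G" ends by (rule dg_functor_ends)
  have "letter_arrow ends l \<in> arrows (Cyl C G)"
    using assms J.image_arrow_arrows edge_arrow_arrows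
    by (auto simp: letters_def letter_arrow_def new_gens_def new_edges_def)
  then show ?thesis by (simp add: arrows_iff Cyl_simps)
qed

lemma mixed_val_combs: "p \<in> mixed_combs DC ends new_gens X Y n \<Longrightarrow> mixed_val (Cyl C G) ends Z p \<in> cyl_combs C G X Y n"
  unfolding mixed_val_eq
  by (rule subst_combs[where fo = "\<lambda>X. X" and L = mixed_letters]) (use letter_val_combs in auto)

abbreviation "mrel \<equiv> mixed_relations DC ends new_gens"

text \<open>\<open>letter_add\<close> for 0 + 0 reads [0] - [0] - [0], the negative of the
  claim.\<close>

lemma zero_letter_relation:
  assumes "A \<in> Ob DC" "B \<in> Ob DC"
  shows "word [Inl (Arrow A B n 0)] \<in> mrel A B"
proof -
  interpret DC: dg_category DC by (rule dg_category_double) unfold_locales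
  have z: "0 \<in> Hom DC A B n" using assms by (rule DC.zero_Hom)
  have "mixed_path DC ends new_gens A B ([] @ Inl (Arrow A B n (0 + 0)) # [])"
    using assms z by (auto simp: letters_def arrows_iff letter_arrow_def)
  from mixed_relations.letter_add[OF assms z z this] show ?thesis
    using mixed_relations_uminus by fastforce
qed

text \<open>A letter holding a composite is unrolled by \<open>letter_Comp\<close>, one generator at
  a time, down to \<open>letter_Ident\<close>.\<close>

lemma word_val_relation:
  assumes i: "i = Inl \<or> i = Inr" and A: "A \<in> Ob C"
  shows "is_path G asrc atgt A B w \<Longrightarrow>
    word [Inl (Arrow (i A) (i B) (wdeg adeg w) (word_val C A w))] - word (map (inj_letter i) w) \<in> mrel (i A) (i B)"
proof (induction w arbitrary: B)
  case Nil
  have "mixed_path DC ends new_gens (i A) (i A) ([] @ Inl (Arrow (i A) (i A) 0 (Ident DC (i A))) # [])"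
    using A i by (auto simp: letters_def arrows_iff letter_arrow_def double_simps Ident_Hom)
  from mixed_relations.letter_Ident[OF _ this] show ?case
    using i A Nil by (auto simp: double_simps)
next
  case (Cons e w)
  then have e: "e \<in> G" and B: "atgt e = B" and w: "is_path G asrc atgt A (asrc e) w" by auto
  note O = gen_Ob[OF e] and H = gen_Hom[OF e]
  have wv: "word_val C A w \<in> Hom C A (asrc e) (wdeg adeg w)"
    using word_val_Hom[OF is_path_mono[OF w] A] gen_arrows by blast
  note cmp = Comp_Hom[OF A O H wv]
  have "mixed_path DC ends new_gens (i A) (i (atgt e)) ([] @ Inl (Arrow (i A) (i (atgt e)) (adeg e + wdeg adeg w)
      (Comp DC (i A) (i (asrc e)) (i (atgt e)) (amor e) (word_val C A w))) # [])"
    using A O cmp i by (auto simp: letters_def arrows_iff letter_arrow_def double_simps)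
  from mixed_relations.letter_Comp[OF _ _ _ _ _ this]
  have 1: "word [Inl (Arrow (i A) (i (atgt e)) (adeg e + wdeg adeg w)
      (Comp C A (asrc e) (atgt e) (amor e) (word_val C A w)))]
      - word [inj_letter i e, Inl (Arrow (i A) (i (asrc e)) (wdeg adeg w) (word_val C A w))] \<in> mrel (i A) (i B)"
    using i A O H wv B by (auto simp: double_simps inj_letter_def)
  have "mixed_path DC ends new_gens (i (asrc e)) (i B) [inj_letter i e]"
    using i O H B by (auto simp: letters_def arrows_iff letter_arrow_def double_simps inj_letter_def)
  from mixed_relations_left[OF Cons.IH[OF w] this]
  have 2: "word [inj_letter i e, Inl (Arrow (i A) (i (asrc e)) (wdeg adeg w) (word_val C A w))]
     - word (inj_letter i e # map (inj_letter i) w) \<in> mrel (i A) (i B)"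
    by (simp add: word_mult_linear)
  from mixed_relations.add[OF 1 2] show ?case using B by simp
qed

lemma comb_val_relation:
  assumes i: "i = Inl \<or> i = Inr" and A: "A \<in> Ob C" and B: "B \<in> Ob C" and q: "q \<in> arrow_combs G A B n"
  shows "word [Inl (Arrow (i A) (i B) n (comb_val C A q))] - subst (\<lambda>e. word [inj_letter i e]) q \<in> mrel (i A) (i B)"
  using q
proof (induction q rule: path_combs_induct)
  case zero
  then show ?case using i A B zero_letter_relation[of "i A" "i B" n] by (auto simp: comb_val_zero double_simps)
next
  case (single w c)
  have wv: "word_val C A w \<in> Hom C A B n"
    using word_val_Hom[OF is_path_mono[OF single(1)] A] gen_arrows single(2) by blast
  have "mixed_path DC ends new_gens (i A) (i B) ([] @ Inl (Arrow (i A) (i B) n (Scale DC c (word_val C A w))) # [])"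
    using A B wv i by (auto simp: letters_def arrows_iff letter_arrow_def double_simps Scale_Hom)
  from mixed_relations.letter_scale[OF _ _ _ this]
  have "word [Inl (Arrow (i A) (i B) n (Scale C c (word_val C A w)))]
      - Poly_Mapping.single [Inl (Arrow (i A) (i B) n (word_val C A w))] c \<in> mrel (i A) (i B)"
    using i A B wv by (auto simp: double_simps)
  from mixed_relations.add[OF this mixed_relations.scale[OF word_val_relation[OF i A single(1)], of c]]
  have "word [Inl (Arrow (i A) (i B) n (Scale C c (word_val C A w)))]
      - pm_scale c (word (map (inj_letter i) w)) \<in> mrel (i A) (i B)"
    using single(2) by (simp add: pm_scale_diff)
  moreover have "comb_val C A (Poly_Mapping.single w c) = Scale C c (word_val C A w)"
    using QG.ev_single[of A B w c] single(1) A by (simp add: ev_eq_comb_val)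
  ultimately show ?case by (simp add: lin_single subst_word_words)
next
  case (add p q)
  note H = comb_val_Hom[OF A B add(1)] comb_val_Hom[OF A B add(2)]
  have "mixed_path DC ends new_gens (i A) (i B) ([] @ Inl (Arrow (i A) (i B) n (comb_val C A p + comb_val C A q)) # [])"
    using A B H i by (auto simp: letters_def arrows_iff letter_arrow_def double_simps add_Hom)
  from mixed_relations.letter_add[OF _ _ _ _ this]
  have "word [Inl (Arrow (i A) (i B) n (comb_val C A p + comb_val C A q))]
      - word [Inl (Arrow (i A) (i B) n (comb_val C A p))] - word [Inl (Arrow (i A) (i B) n (comb_val C A q))]
      \<in> mrel (i A) (i B)"
    using i A B H by (auto simp: double_simps)
  from mixed_relations.add[OF this mixed_relations.add[OF add(3,4)]]
  show ?case by (simp add: comb_val_add[OF add(1,2) A B] lin_add algebra_simps)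
qed

lemma normal_form_in:
  "normal_form (in1_comb q) = subst (\<lambda>e. word [inj_letter Inl e]) q"
  "normal_form (in2_comb q) = subst (\<lambda>e. word [inj_letter Inr e]) q"
  unfolding in1_comb_eq_subst in2_comb_eq_subst subst_subst by (simp_all add: normal_letter_def)

lemma letter_relation:
  assumes "l \<in> mixed_letters"
  shows "word [l] - normal_form (letter_val l) \<in> mrel (asrc (letter_arrow ends l)) (atgt (letter_arrow ends l))"
proof (cases l)
  case (Inr g)
  then obtain c where "c \<in> new_edges" "g = edge_arrow QC c" using assms by (auto simp: letters_def new_gens_def)
  then have "normal_form (letter_val l) = word [l]"
    using Inr by (cases c) (auto simp: letter_arrow_def normal_letter_def new_edges_def)
  then show ?thesis by (simp add: mixed_relations.zero)
next
  case (Inl a)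
  obtain s t n f where a: "a = Arrow s t n f" by (cases a)
  then have st: "s \<in> Ob DC" "t \<in> Ob DC" "f \<in> Hom DC s t n"
    using assms Inl by (auto simp: letters_def arrows_iff)
  have v: "letter_val l = FMor ends s t n f" and ends: "asrc (letter_arrow ends l) = s" "atgt (letter_arrow ends l) = t"
    by (simp_all add: Inl a letter_arrow_def image_arrow_def)
  have "word [l] - normal_form (FMor ends s t n f) \<in> mrel s t"
  proof (cases s; cases t)
    fix A B assume "s = Inl A" "t = Inl B"
    with st show ?thesis using comb_val_relation[OF disjI1[OF refl] _ _ expand_combs, of A B f n]
      by (simp add: Inl a FMor_ends normal_form_in double_simps comb_val_expand)
  next
    fix A B assume "s = Inr A" "t = Inr B"
    with st show ?thesis using comb_val_relation[OF disjI2[OF refl] _ _ expand_combs, of A B f n]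
      by (simp add: Inl a FMor_ends normal_form_in double_simps comb_val_expand)
  qed (use zero_letter_relation[OF st(1,2), of n] st in \<open>auto simp: Inl a FMor_ends double_simps\<close>)
  then show ?thesis unfolding v ends .
qed

lemma word_relation:
  "mixed_path DC ends new_gens X Y w \<Longrightarrow> word w - normal_form (subst_word letter_val w) \<in> mrel X Y"
proof (induction w arbitrary: Y)
  case Nil
  then show ?case by (simp add: mixed_relations.zero)
next
  case (Cons l w)
  let ?S = "asrc (letter_arrow ends l)"
  let ?\<nu> = "\<lambda>w. normal_form (subst_word letter_val w)"
  from Cons.prems have l: "l \<in> mixed_letters" "atgt (letter_arrow ends l) = Y"
    and w: "mixed_path DC ends new_gens X ?S w" unfolding is_path.simps o_apply by blast+
  have "subst_word letter_val w \<in> cyl_combs C G X ?S (wdeg (adeg \<circ> letter_arrow ends) w)"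
    using mixed_val_combs[OF path_combs_word[OF w refl]] by (simp add: mixed_val_eq)
  then have \<nu>: "?\<nu> w \<in> mixed_combs DC ends new_gens X ?S (wdeg (adeg \<circ> letter_arrow ends) w)"
    by (rule normal_form_combs) (auto simp: new_gens_def)
  \<comment> \<open>First the tail is replaced by its normal form, then the head letter; the two
    differences telescope.\<close>
  have "word_mult (word [l]) (word w - ?\<nu> w) \<in> mrel X Y"
    using l by (intro mixed_relations_left[OF Cons.IH[OF w]]) simp
  moreover have "word_mult (word [l] - normal_form (letter_val l)) (?\<nu> w) \<in> mrel X Y"
    using mixed_relations_right_comb[OF letter_relation[OF l(1)] \<nu>] l(2) by simp
  ultimately have "word_mult (word [l]) (word w - ?\<nu> w) + word_mult (word [l] - normal_form (letter_val l)) (?\<nu> w) \<in> mrel X Y"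
    by (rule mixed_relations.add)
  then show ?case by (simp add: word_mult_linear subst_mult)
qed

text \<open>Modulo relations a combination depends only on its value. In particular a combination of
  value 0 is a relation, which is the injectivity half of \<open>free_extension\<close>.\<close>

lemma comb_relation:
  assumes p: "p \<in> mixed_combs DC ends new_gens X Y n"
  shows "p - normal_form (subst letter_val p) \<in> mrel X Y"
proof -
  have "lin (\<lambda>w. word w - normal_form (subst_word letter_val w)) p \<in> mrel X Y"
    by (rule mixed_relations_lin, rule word_relation, rule path_combsD(1)[OF p])
  then show ?thesis by (simp add: lin_fun_diff lin_lin)
qed

lemma semifree_extension_ends: "semifree_extension DC (Cyl C G) ends"
  unfolding semifree_extension_def
proof (intro exI)
  interpret J: dg_functor DC "Cyl C G" ends by (rule dg_functor_ends)
  have new: "new_edges \<subseteq> edges QC" unfolding new_edges_def by blast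
  have free: "free_extension DC (Cyl C G) ends new_gens"
    unfolding free_extension_def
  proof (intro conjI ballI allI impI)
    show "new_gens \<subseteq> arrows (Cyl C G)"
      using edge_arrow_arrows new by (auto simp: new_gens_def)
    fix X Y n
    show "mixed_val (Cyl C G) ends X ` mixed_combs DC ends new_gens X Y n = Hom (Cyl C G) X Y n"
    proof (intro subset_antisym subsetI)
      fix p assume "p \<in> Hom (Cyl C G) X Y n"
      then have p: "p \<in> cyl_combs C G X Y n" by (simp add: Cyl_simps)
      have "normal_form p \<in> mixed_combs DC ends new_gens X Y n"
        using p by (rule normal_form_combs) (auto simp: new_gens_def)
      then show "p \<in> mixed_val (Cyl C G) ends X ` mixed_combs DC ends new_gens X Y n"
        by (rule image_eqI[where f = "mixed_val (Cyl C G) ends X", OF mixed_val_normal_form[OF p subset_refl, symmetric]])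
    qed (auto simp: Cyl_simps mixed_val_combs)
    fix p assume p: "p \<in> mixed_combs DC ends new_gens X Y n" "mixed_val (Cyl C G) ends X p = 0"
    then show "p \<in> mrel X Y" using comb_relation[OF p(1)] by (simp add: mixed_val_eq)
  qed
  obtain s where s: "well_order_on new_gens s"
    "(1 :: 'a) \<noteq> 0 \<Longrightarrow> c \<in> new_edges \<Longrightarrow> edge_arrow QC ` (new_edges \<inter> lower_edges c) \<subseteq> underS s (edge_arrow QC c)" for c
    using edge_arrow_order[OF new] unfolding new_gens_def by auto
  have "fdiff QC (word [c]) \<in> mixed_val (Cyl C G) ends (cyl_src c)
      ` mixed_combs DC ends (underS s (edge_arrow QC c)) (cyl_src c) (cyl_tgt c) (cyl_deg c + 1)"
    if c: "c \<in> new_edges" for c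
  proof (cases "(1 :: 'a) = 0")
    case True
    show ?thesis by (rule image_eqI[of _ _ 0]) (rule degenerate_ring[OF True], simp)
  next
    case False
    note d = cyl_diff_lower[OF subsetD[OF new c]]
    have "normal_form (cyl_diff C G c)
        \<in> mixed_combs DC ends (underS s (edge_arrow QC c)) (cyl_src c) (cyl_tgt c) (cyl_deg c + 1)"
      using d by (rule normal_form_combs) (use s(2)[OF False c] in auto)
    then show ?thesis using mixed_val_normal_form[OF d, of "cyl_src c"]
      by (intro image_eqI[of _ _ "normal_form (cyl_diff C G c)"]) simp_all
  qed
  then have lower: "\<forall>e\<in>new_gens. Diff (Cyl C G) (asrc e) (atgt e) (adeg e) (amor e)
         \<in> mixed_val (Cyl C G) ends (asrc e) ` mixed_combs DC ends (underS s e) (asrc e) (atgt e) (adeg e + 1)"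
    by (auto simp: new_gens_def Cyl_simps)
  \<comment> \<open>p is a left inverse of both ends.\<close>
  have inj: "inj_on (FMor ends X Y n) (Hom DC X Y n)" if "X \<in> Ob DC" "Y \<in> Ob DC" for X Y n
  proof (rule inj_on_inverseI[where g = "\<lambda>q. comb_val C (untag X) (subst proj_word q)"])
    fix f assume "f \<in> Hom DC X Y n"
    with that show "comb_val C (untag X) (subst proj_word (FMor ends X Y n f)) = f"
      by (cases X; cases Y) (auto simp: double_simps FMor_ends proj_in1 proj_in2 comb_val_expand comb_val_zero untag_def)
  qed
  \<comment> \<open>The two ends already contain all objects of the cylinder, so the set of new
    objects is empty.\<close>
  show "semifree_extension_by DC (Cyl C G) ends {} new_gens"
    unfolding semifree_extension_by_def
  proof (intro conjI ballI allI exI[of _ s])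
    show "dg_functor DC (Cyl C G) ends" by (rule dg_functor_ends)
    show "inj_on (FOb ends) (Ob DC)" by (simp add: inj_on_def)
    show "Ob (Cyl C G) = FOb ends ` Ob DC \<union> {}" by (simp add: Cyl_simps double_def)
  qed (simp_all add: inj free s(1) lower)
qed

lemma cofibration_ends: "cofibration DC (Cyl C G) ends"
proof -
  have 1: "dgfun_eq X F F" for X and F :: "('x, 'y, 'z, 'w) dgfun" by (simp add: dgfun_eq_def)
  have "retract_of DC (Cyl C G) ends DC (Cyl C G) ends"
    unfolding retract_of_def
    using dg_functor_ends dg_functor_id[OF dg_category_Cyl] dg_functor_id[OF dg_category_double[OF dg_category_axioms]]
    by (intro conjI exI[of _ id_dgfun]) (auto simp: dgfun_eq_def comp_dgfun_def id_dgfun_def)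
  with semifree_extension_ends show ?thesis unfolding cofibration_def by blast
qed

end

section \<open>Lifting trivial fibrations against semifree extensions and their retracts\<close>

section \<open>Trivial fibrations have the right lifting property against cofibrations\<close>

lemma (in quiver_rep) FMor_ev:
  assumes "dg_functor D E F" and p: "p \<in> combs X Y n" and XY: "X \<in> verts Q" "Y \<in> verts Q"
  shows "FMor F (fo X) (fo Y) n (ev X p)
    = lin_ext (Scale E) (\<lambda>w. word_val E (FOb F (fo X)) (map (\<lambda>e. image_arrow F (arr e)) w)) p"
proof -
  interpret F: dg_functor D E F by fact
  show ?thesis
    unfolding ev_def
  proof (subst F.FMor_lin_ext)
    show "lin_ext (Scale E) (\<lambda>w. FMor F (fo X) (fo Y) n (word_val D (fo X) (map arr w))) p
      = lin_ext (Scale E) (\<lambda>w. word_val E (FOb F (fo X)) (map (\<lambda>e. image_arrow F (arr e)) w)) p"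
    proof (rule lin_ext_cong)
      fix w assume w: "w \<in> Poly_Mapping.keys p"
      note path = path_combsD[OF p w]
      from F.FMor_word_val[OF arr_path[OF path(1)] fo_Ob[OF XY(1)]]
      have "FMor F (fo X) (fo Y) n (word_val D (fo X) (map arr w))
          = word_val E (FOb F (fo X)) (map (image_arrow F) (map arr w))"
        unfolding wdeg_arr path(2) .
      then show "FMor F (fo X) (fo Y) n (word_val D (fo X) (map arr w))
          = word_val E (FOb F (fo X)) (map (\<lambda>e. image_arrow F (arr e)) w)" by (simp add: o_def)
    qed
  qed (use fo_Ob XY keys_Hom[OF p] in auto)
qed

locale semifree_ext = J: dg_functor X Y J
  for X :: "('k::{comm_ring,comm_monoid_mult}, 'o, 'm::ab_group_add) dgcat"
    and Y :: "('k, 'p, 'n::ab_group_add) dgcat" and J +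
  fixes R and G and r
  assumes inj_Ob: "inj_on (FOb J) (Ob X)"
    and Ob_Y: "Ob Y = FOb J ` Ob X \<union> R"
    and free: "free_extension X Y J G"
    and wo: "well_order_on G r"
    and lower: "e \<in> G \<Longrightarrow> Diff Y (asrc e) (atgt e) (adeg e) (amor e)
         \<in> mixed_val Y J (asrc e) ` mixed_combs X J (underS r e) (asrc e) (atgt e) (adeg e + 1)"
begin

text \<open>A formal expression for de is determined only modulo relations, so one with letters
  below \<open>e\<close> is chosen once and for all.\<close>

definition "diff_comb e = (SOME p. p \<in> mixed_combs X J (underS r e) (asrc e) (atgt e) (adeg e + 1)
  \<and> mixed_val Y J (asrc e) p = Diff Y (asrc e) (atgt e) (adeg e) (amor e))"

lemma diff_comb:
  assumes "e \<in> G"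
  shows "diff_comb e \<in> mixed_combs X J (underS r e) (asrc e) (atgt e) (adeg e + 1)"
    "mixed_val Y J (asrc e) (diff_comb e) = Diff Y (asrc e) (atgt e) (adeg e) (amor e)"
proof -
  have "\<exists>p. p \<in> mixed_combs X J (underS r e) (asrc e) (atgt e) (adeg e + 1)
      \<and> mixed_val Y J (asrc e) p = Diff Y (asrc e) (atgt e) (adeg e) (amor e)"
    using lower[OF assms] by (metis (no_types, lifting) imageE)
  from someI_ex[OF this] show "diff_comb e \<in> mixed_combs X J (underS r e) (asrc e) (atgt e) (adeg e + 1)"
    "mixed_val Y J (asrc e) (diff_comb e) = Diff Y (asrc e) (atgt e) (adeg e) (amor e)"
    unfolding diff_comb_def by blast+
qed

text \<open>A model of \<open>Y\<close> before dividing by relations. Its differential is not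
  expected to square to zero: a letter from \<open>X\<close> goes to the letter of its differential
  and then to the letter of 0, which is not formally 0.\<close>

definition mixed_quiver :: "('p, 'n) arrow set \<Rightarrow> ('k, 'p, ('o, 'm, 'p, 'n) letter) dgquiver" where
  "mixed_quiver S = \<lparr>verts = Ob Y, edges = letters X S, esrc = asrc \<circ> letter_arrow J,
     etgt = atgt \<circ> letter_arrow J, edeg = adeg \<circ> letter_arrow J,
     ediff = case_sum (\<lambda>a. word [Inl (Arrow (asrc a) (atgt a) (adeg a + 1)
         (Diff X (asrc a) (atgt a) (adeg a) (amor a)))]) diff_comb\<rparr>"

lemma mixed_quiver_simps [simp]:
  "verts (mixed_quiver S) = Ob Y" "edges (mixed_quiver S) = letters X S"
  "esrc (mixed_quiver S) = asrc \<circ> letter_arrow J" "etgt (mixed_quiver S) = atgt \<circ> letter_arrow J"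
  "edeg (mixed_quiver S) = adeg \<circ> letter_arrow J"
  "ediff (mixed_quiver S) = case_sum (\<lambda>a. word [Inl (Arrow (asrc a) (atgt a) (adeg a + 1)
         (Diff X (asrc a) (atgt a) (adeg a) (amor a)))]) diff_comb"
  by (simp_all add: mixed_quiver_def)

lemma letter_arrow_simps [simp]: "letter_arrow J (Inl a) = image_arrow J a" "letter_arrow J (Inr g) = g"
  by (simp_all add: letter_arrow_def)

lemma letters_cases [consumes 1, case_names Inl Inr]:
  assumes "l \<in> letters X S"
    "\<And>a. l = Inl a \<Longrightarrow> asrc a \<in> Ob X \<Longrightarrow> atgt a \<in> Ob X \<Longrightarrow> amor a \<in> Hom X (asrc a) (atgt a) (adeg a) \<Longrightarrow> P"
    "\<And>g. l = Inr g \<Longrightarrow> g \<in> S \<Longrightarrow> P"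
  shows P
  using assms by (auto simp: letters_def arrows_iff)

lemma Inl_letters: "Inl a \<in> letters X S \<longleftrightarrow> asrc a \<in> Ob X \<and> atgt a \<in> Ob X \<and> amor a \<in> Hom X (asrc a) (atgt a) (adeg a)"
  by (auto simp: letters_def arrows_iff)

lemma gen_Ob: "e \<in> G \<Longrightarrow> asrc e \<in> Ob Y" "e \<in> G \<Longrightarrow> atgt e \<in> Ob Y"
  and gen_Hom: "e \<in> G \<Longrightarrow> amor e \<in> Hom Y (asrc e) (atgt e) (adeg e)"
  using free by (auto simp: free_extension_def arrows_iff)

text \<open>Initial segments of the generators: the chosen differentials stay inside
  \<open>S\<close>, so \<open>mixed_quiver S\<close> is well formed. The stages of the lifting are
  of this kind.\<close>

definition "closed_gens S \<longleftrightarrow> S \<subseteq> G \<and> (\<forall>g\<in>S. underS r g \<subseteq> S)"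

lemma closed_gens_G: "closed_gens G"
  using wo by (auto simp: closed_gens_def underS_def well_order_on_def linear_order_on_def
      partial_order_on_def preorder_on_def refl_on_def)

lemma closed_gens_underS: "closed_gens (underS r e)"
proof -
  have "trans r" "antisym r"
    using wo by (auto simp: well_order_on_def linear_order_on_def partial_order_on_def preorder_on_def)
  then show ?thesis
    using closed_gens_G wo unfolding closed_gens_def underS_def trans_def antisym_def
      well_order_on_def linear_order_on_def partial_order_on_def preorder_on_def by blast
qed

lemma wf_mixed_quiver:
  assumes S: "closed_gens S"
  shows "wf_quiver (mixed_quiver S)"
proof
  fix l assume "l \<in> edges (mixed_quiver S)"
  then have l: "l \<in> letters X S" by simp
  have SG: "S \<subseteq> G" using S by (simp add: closed_gens_def)
  show "esrc (mixed_quiver S) l \<in> verts (mixed_quiver S)" "etgt (mixed_quiver S) l \<in> verts (mixed_quiver S)"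
    using l SG gen_Ob by (auto simp: J.FOb_Ob elim!: letters_cases)
  show "ediff (mixed_quiver S) l \<in> path_combs (edges (mixed_quiver S)) (esrc (mixed_quiver S)) (etgt (mixed_quiver S))
      (edeg (mixed_quiver S)) (esrc (mixed_quiver S) l) (etgt (mixed_quiver S) l) (edeg (mixed_quiver S) l + 1)"
    using l
  proof (cases rule: letters_cases)
    case (Inl a)
    then show ?thesis by (auto simp: Inl_letters J.source.Diff_Hom intro!: path_combs_word)
  next
    case (Inr g)
    then have "letters X (underS r g) \<subseteq> letters X S"
      using S by (auto simp: letters_def closed_gens_def)
    from subsetD[OF path_combs_mono[OF this] diff_comb(1)] Inr SG show ?thesis by auto
  qed
qed

lemma quiver_rep_val:
  assumes "closed_gens S"
  shows "quiver_rep (mixed_quiver S) Y (\<lambda>A. A) (\<lambda>l. amor (letter_arrow J l))"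
proof -
  interpret Q: wf_quiver "mixed_quiver S" by (rule wf_mixed_quiver[OF assms])
  have "S \<subseteq> G" using assms by (simp add: closed_gens_def)
  then show ?thesis
    by unfold_locales (auto simp: image_arrow_def J.FMor_Hom gen_Hom elim!: letters_cases)
qed

lemma ev_eq_mixed_val:
  assumes "closed_gens S"
  shows "quiver_rep.ev (mixed_quiver S) Y (\<lambda>A. A) (\<lambda>l. amor (letter_arrow J l)) = mixed_val Y J"
  unfolding quiver_rep.ev_def[OF quiver_rep_val[OF assms]] mixed_val_def by (simp add: fun_eq_iff)

lemma quiver_functor_val:
  assumes "closed_gens S"
  shows "quiver_functor (mixed_quiver S) Y (\<lambda>A. A) (\<lambda>l. amor (letter_arrow J l))"
proof -
  interpret V: quiver_rep "mixed_quiver S" Y "\<lambda>A. A" "\<lambda>l. amor (letter_arrow J l)"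
    by (rule quiver_rep_val[OF assms])
  show ?thesis
  proof
    fix l assume "l \<in> edges (mixed_quiver S)"
    then have "l \<in> letters X S" by simp
    then show "V.ev (esrc (mixed_quiver S) l) (ediff (mixed_quiver S) l)
      = Diff Y (esrc (mixed_quiver S) l) (etgt (mixed_quiver S) l) (edeg (mixed_quiver S) l) (amor (letter_arrow J l))"
    proof (cases rule: letters_cases)
      case (Inl a)
      let ?d = "Arrow (asrc a) (atgt a) (adeg a + 1) (Diff X (asrc a) (atgt a) (adeg a) (amor a))"
      have "Inl ?d \<in> edges (mixed_quiver S)" using Inl by (simp add: Inl_letters J.source.Diff_Hom)
      from V.ev_letter[OF this] show ?thesis
        using Inl by (simp add: image_arrow_def J.FMor_Diff)
    next
      case (Inr g)
      then have "g \<in> G" using assms by (auto simp: closed_gens_def)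
      with Inr show ?thesis by (simp add: ev_eq_mixed_val[OF assms] diff_comb)
    qed
  qed
qed

end

text \<open>Arbitrary values of the right degree on the generators; compatibility with d is
  established for initial segments, in \<open>quiver_functor_hl\<close>.\<close>

locale extended_functor = semifree_ext X Y J R G r + U: dg_functor X C U
  for X :: "('k::{comm_ring,comm_monoid_mult}, 'o, 'm::ab_group_add) dgcat"
    and Y :: "('k, 'p, 'n::ab_group_add) dgcat" and J R G r
    and C :: "('k, 'x, 'y::ab_group_add) dgcat" and U +
  fixes ho and hh
  assumes ho_Ob: "A \<in> Ob Y \<Longrightarrow> ho A \<in> Ob C"
    and ho_J: "A' \<in> Ob X \<Longrightarrow> ho (FOb J A') = FOb U A'"
    and hh_Hom: "g \<in> G \<Longrightarrow> hh g \<in> Hom C (ho (asrc g)) (ho (atgt g)) (adeg g)"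
begin

definition "hl = case_sum (\<lambda>a. FMor U (asrc a) (atgt a) (adeg a) (amor a)) hh"

lemma quiver_rep_hl:
  assumes "closed_gens S"
  shows "quiver_rep (mixed_quiver S) C ho hl"
proof -
  interpret Q: wf_quiver "mixed_quiver S" by (rule wf_mixed_quiver[OF assms])
  have "S \<subseteq> G" using assms by (simp add: closed_gens_def)
  then show ?thesis
    by unfold_locales (auto simp: ho_Ob ho_J hl_def U.FMor_Hom hh_Hom elim!: letters_cases)
qed

sublocale H: quiver_rep "mixed_quiver G" C ho hl
  by (rule quiver_rep_hl[OF closed_gens_G])

abbreviation "restrict n \<equiv> lin (\<lambda>w. if wdeg (adeg \<circ> letter_arrow J) w = n then word w else 0)"

lemma restrict_homogeneous:
  assumes "homogeneous (adeg \<circ> letter_arrow J) m p"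
  shows "restrict n p = (if m = n then p else 0)"
proof -
  have "restrict n p = lin (\<lambda>w. if m = n then word w else 0) p"
    using assms by (intro lin_ext_cong) (auto simp: homogeneous_def)
  then show ?thesis by simp
qed

abbreviation "mcombs \<equiv> mixed_combs X J G"

text \<open>Evaluation is multiplicative, so a middle factor of value 0 kills the product; if the
  total degree differs from \<open>n\<close>, already \<open>restrict n\<close> gives 0.\<close>

lemma killed_in_context:
  assumes "mixed_path X J G B' B u" "mixed_path X J G A A' v" "mid \<in> mcombs A' B' d" "H.ev A' mid = 0"
    "A \<in> Ob Y" "B \<in> Ob Y"
  shows "restrict n (word_mult (word u) (word_mult mid (word v))) \<in> mcombs A B n
    \<and> H.ev A (restrict n (word_mult (word u) (word_mult mid (word v)))) = 0"
proof -
  have V: "A' \<in> Ob Y" using H.paths_verts[of A A' v] assms(2,5) by simp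
  \<comment> \<open>For nonempty \<open>u\<close> the object \<open>B'\<close> is the source of its
    last letter, hence a vertex.\<close>
  have V': "B' \<in> Ob Y"
  proof (cases u)
    case Nil
    then show ?thesis using assms(1,6) by simp
  next
    case (Cons l u')
    have "B' \<in> Ob Y" if "mixed_path X J G B' B2 u" "u \<noteq> []" for B2 u
      using that
    proof (induction u arbitrary: B2)
      case (Cons l u)
      show ?case
      proof (cases "u = []")
        case True
        then have "esrc (mixed_quiver G) l = B'" "l \<in> edges (mixed_quiver G)" using Cons.prems by auto
        then show ?thesis using H.esrc_verts[of l] by auto
      next
        case False
        then show ?thesis using Cons by auto
      qed
    qed simp
    then show ?thesis using assms(1) Cons by blast
  qed
  let ?u = "wdeg (adeg \<circ> letter_arrow J) u" and ?v = "wdeg (adeg \<circ> letter_arrow J) v"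
  have u: "word u \<in> mcombs B' B ?u" and v: "word v \<in> mcombs A A' ?v"
    using assms(1,2) by (auto intro: path_combs_word)
  note mv = path_combs_mult[OF assms(3) v] and all = path_combs_mult[OF u path_combs_mult[OF assms(3) v]]
  have E: "H.ev A (word_mult mid (word v)) = 0"
    using H.ev_mult[of mid A' B' d "word v" A ?v] assms(3-5) v V V' H.ev_Hom[of "word v" A A' ?v]
      U.target.Comp_zero_left[of "ho A" "ho A'" "ho B'" "H.ev A (word v)" ?v] by (simp add: ho_Ob)
  have "H.ev A (word_mult (word u) (word_mult mid (word v))) = 0"
    using H.ev_mult[of "word u" B' B ?u "word_mult mid (word v)" A] mv assms(5,6) u V' E
      U.target.Comp_zero_right[of "ho A" "ho B'" "ho B" "H.ev B' (word u)" ?u] H.ev_Hom[of "word u" B' B ?u]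
    by (simp add: ho_Ob)
  then show ?thesis
    using all by (auto simp: restrict_homogeneous[OF path_combs_homogeneous[OF all]])
qed

text \<open>Elements of \<open>mixed_relations\<close> need not be homogeneous, whereas \<open>ev\<close> is linear only on
  homogeneous elements.\<close>

lemma relations_killed:
  assumes "p \<in> mixed_relations X J G A B" and AB: "A \<in> Ob Y" "B \<in> Ob Y"
  shows "restrict n p \<in> mcombs A B n \<and> H.ev A (restrict n p) = 0"
  using assms(1)
proof induction
  case zero
  then show ?case by simp
next
  case (add p q)
  note p = conjunct1[OF add.IH(1)] conjunct2[OF add.IH(1)] and q = conjunct1[OF add.IH(2)] conjunct2[OF add.IH(2)]
  have "H.ev A (restrict n p + restrict n q) = H.ev A (restrict n p) + H.ev A (restrict n q)"
    by (rule H.ev_add[unfolded mixed_quiver_simps, OF p(1) q(1) AB])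
  also have "\<dots> = 0" by (simp only: p(2) q(2) add_0_left)
  finally show ?case unfolding lin_add by (rule conjI[OF path_combs_add[OF p(1) q(1)]])
next
  case (scale p c)
  note p = conjunct1[OF scale.IH] conjunct2[OF scale.IH]
  have "H.ev A (pm_scale c (restrict n p)) = Scale C c (H.ev A (restrict n p))"
    by (rule H.ev_scale[unfolded mixed_quiver_simps, OF p(1) AB])
  also have "\<dots> = 0"
    unfolding p(2) by (rule U.target.Scale_zero_right[OF ho_Ob[OF AB(1)] ho_Ob[OF AB(2)]])
  finally show ?case unfolding lin_pm_scale by (rule conjI[OF path_combs_scale[OF p(1)]])
next
  case (letter_add S T f m g u v)
  let ?l = "\<lambda>x. Inl (Arrow S T m x)"
  have l: "word [?l x] \<in> mcombs (FOb J S) (FOb J T) m" "H.ev (FOb J S) (word [?l x]) = FMor U S T m x"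
    if "x \<in> Hom X S T m" for x
    using that letter_add(1,2) H.ev_letter[of "?l x"] by (auto intro!: path_combs_word simp: Inl_letters hl_def)
  note fg = letter_add(3,4) J.source.add_Hom[OF letter_add(1-4)]
  have O: "FOb J S \<in> Ob Y" "FOb J T \<in> Ob Y" using letter_add(1,2) J.FOb_Ob by auto
  have mid1: "word [?l (f + g)] - word [?l f] - word [?l g] \<in> mcombs (FOb J S) (FOb J T) m"
    using fg l by (intro path_combs_diff) auto
  have mid2: "H.ev (FOb J S) (word [?l (f + g)] - word [?l f] - word [?l g]) = 0"
    using fg l O letter_add(1-4)
    by (simp add: H.ev_diff[of _ _ "FOb J T" m] path_combs_diff U.FMor_add)
  have paths: "mixed_path X J G (FOb J T) B u" "mixed_path X J G A (FOb J S) v"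
    using letter_add(5) by (auto simp: is_path_append)
  have eq: "word (u @ ?l (f + g) # v) - word (u @ ?l f # v) - word (u @ ?l g # v) = word_mult (word u) (word_mult (word [?l (f + g)] - word [?l f] - word [?l g]) (word v))"
    by (simp add: word_mult_linear word_mult_singles)
  show ?case unfolding eq by (rule killed_in_context[OF paths mid1 mid2 AB])
next
  case (letter_scale S T f m u c v)
  let ?l = "\<lambda>x. Inl (Arrow S T m x)"
  have l: "word [?l x] \<in> mcombs (FOb J S) (FOb J T) m" "H.ev (FOb J S) (word [?l x]) = FMor U S T m x"
    if "x \<in> Hom X S T m" for x
    using that letter_scale(1,2) H.ev_letter[of "?l x"] by (auto intro!: path_combs_word simp: Inl_letters hl_def)
  note fg = letter_scale(3) J.source.Scale_Hom[OF letter_scale(1-3)]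
  have O: "FOb J S \<in> Ob Y" "FOb J T \<in> Ob Y" using letter_scale(1,2) J.FOb_Ob by auto
  have mid1: "word [?l (Scale X c f)] - pm_scale c (word [?l f]) \<in> mcombs (FOb J S) (FOb J T) m"
    using fg l by (intro path_combs_diff path_combs_scale) auto
  have mid2: "H.ev (FOb J S) (word [?l (Scale X c f)] - pm_scale c (word [?l f])) = 0"
    using fg l O letter_scale(1-3)
    by (simp add: H.ev_diff[of _ _ "FOb J T" m] H.ev_scale[of _ _ "FOb J T" m] path_combs_scale U.FMor_Scale
        del: pm_scale_single)
  have paths: "mixed_path X J G (FOb J T) B u" "mixed_path X J G A (FOb J S) v"
    using letter_scale(4) by (auto simp: is_path_append)
  have eq: "word (u @ ?l (Scale X c f) # v) - Poly_Mapping.single (u @ ?l f # v) c = word_mult (word u) (word_mult (word [?l (Scale X c f)] - pm_scale c (word [?l f])) (word v))"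
    by (simp add: word_mult_linear word_mult_singles)
  show ?case unfolding eq by (rule killed_in_context[OF paths mid1 mid2 AB])
next
  case (letter_Comp S T T' g m f k u v)
  let ?l = "\<lambda>S T m x. Inl (Arrow S T m x)"
  have l: "word [?l S T m x] \<in> mcombs (FOb J S) (FOb J T) m" "H.ev (FOb J S) (word [?l S T m x]) = FMor U S T m x"
    if "x \<in> Hom X S T m" "S \<in> Ob X" "T \<in> Ob X" for x S T m
    using that H.ev_letter[of "?l S T m x"] by (auto intro!: path_combs_word simp: Inl_letters hl_def)
  note fg = letter_Comp(4,5) J.source.Comp_Hom[OF letter_Comp(1-5)]
  have O: "FOb J S \<in> Ob Y" "FOb J T \<in> Ob Y" "FOb J T' \<in> Ob Y" using letter_Comp(1-3) J.FOb_Ob by auto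
  note lg = l[OF fg(1) letter_Comp(2,3)] and lf = l[OF fg(2) letter_Comp(1,2)]
    and lc = l[OF fg(3) letter_Comp(1,3)]
  let ?gf = "word_mult (word [?l T T' m g]) (word [?l S T k f])"
  have gf: "?gf \<in> mcombs (FOb J S) (FOb J T') (m + k)"
    by (rule path_combs_mult[OF lg(1) lf(1)])
  have "H.ev (FOb J S) ?gf = Comp C (FOb U S) (FOb U T) (FOb U T') (FMor U T T' m g) (FMor U S T k f)"
    using H.ev_mult[of "word [?l T T' m g]" "FOb J T" "FOb J T'" m "word [?l S T k f]" "FOb J S" k]
      lg lf O letter_Comp(1-3) by (simp add: ho_J)
  then have mid2: "H.ev (FOb J S) (word [?l S T' (m + k) (Comp X S T T' g f)] - ?gf) = 0"
    using lc gf O letter_Comp(1-5)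
    by (simp add: H.ev_diff[of _ _ "FOb J T'" "m + k"] U.FMor_Comp[of S T T' g m f k] del: word_mult_word)
  have mid1: "word [?l S T' (m + k) (Comp X S T T' g f)] - ?gf \<in> mcombs (FOb J S) (FOb J T') (m + k)"
    using lc gf by (intro path_combs_diff)
  have paths: "mixed_path X J G (FOb J T') B u" "mixed_path X J G A (FOb J S) v"
    using letter_Comp(6) by (auto simp: is_path_append)
  have eq: "word (u @ ?l S T' (m + k) (Comp X S T T' g f) # v) - word (u @ ?l T T' m g # ?l S T k f # v) = word_mult (word u) (word_mult (word [?l S T' (m + k) (Comp X S T T' g f)] - ?gf) (word v))"
    by (simp add: word_mult_linear word_mult_singles)
  show ?case unfolding eq by (rule killed_in_context[OF paths mid1 mid2 AB])
next
  case (letter_Ident S u v)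
  let ?l = "Inl (Arrow S S 0 (Ident X S))"
  have O: "FOb J S \<in> Ob Y" using letter_Ident(1) J.FOb_Ob by auto
  have l: "word [?l] \<in> mcombs (FOb J S) (FOb J S) 0" "H.ev (FOb J S) (word [?l]) = Ident C (FOb U S)"
    using letter_Ident(1) H.ev_letter[of ?l]
    by (auto intro!: path_combs_word simp: Inl_letters hl_def J.source.Ident_Hom U.FMor_Ident)
  have i: "word [] \<in> mcombs (FOb J S) (FOb J S) 0" by (auto intro!: path_combs_word)
  have mid2: "H.ev (FOb J S) (word [?l] - word []) = 0"
    using l i O letter_Ident(1) by (simp add: H.ev_diff[of _ _ "FOb J S" 0] H.ev_one ho_J)
  have mid1: "word [?l] - word [] \<in> mcombs (FOb J S) (FOb J S) 0"
    using l i by (intro path_combs_diff)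
  have paths: "mixed_path X J G (FOb J S) B u" "mixed_path X J G A (FOb J S) v"
    using letter_Ident(2) by (auto simp: is_path_append)
  have eq: "word (u @ ?l # v) - word (u @ v) = word_mult (word u) (word_mult (word [?l] - word []) (word v))"
    by (simp add: word_mult_linear word_mult_singles)
  show ?case unfolding eq by (rule killed_in_context[OF paths mid1 mid2 AB])
qed

text \<open>By freeness a combination of value 0 in \<open>Y\<close> is a relation, and relations
  evaluate to 0. This makes the extended functor well defined and takes the place of d^2 = 0 on
  mixed words.\<close>

lemma ev_kernel:
  assumes p: "p \<in> mcombs A B n" and AB: "A \<in> Ob Y" "B \<in> Ob Y" and z: "mixed_val Y J A p = 0"
  shows "H.ev A p = 0"
proof -
  have "p \<in> mixed_relations X J G A B" using free p AB z by (auto simp: free_extension_def)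
  from relations_killed[OF this AB, of n] show ?thesis
    by (simp add: restrict_homogeneous[OF path_combs_homogeneous[OF p]])
qed

end

context semifree_ext
begin

text \<open>The evaluation \<open>H.ev\<close>, but for arbitrary \<open>hh\<close>: the condition
  on a single generator must be expressible before the values on all others are known to have the
  right degree.\<close>

definition ext_val :: "('k, 'x, 'y::ab_group_add) dgcat \<Rightarrow> ('o, 'm, 'x, 'y) dgfun \<Rightarrow> ('p \<Rightarrow> 'x)
    \<Rightarrow> (('p, 'n) arrow \<Rightarrow> 'y) \<Rightarrow> 'p \<Rightarrow> (('o, 'm, 'p, 'n) letter list \<Rightarrow>\<^sub>0 'k) \<Rightarrow> 'y" where
  "ext_val C U ho hh A = lin_ext (Scale C) (\<lambda>w. word_val C (ho A) (map (\<lambda>l.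
     Arrow (ho (asrc (letter_arrow J l))) (ho (atgt (letter_arrow J l))) (adeg (letter_arrow J l))
       (case l of Inl a \<Rightarrow> FMor U (asrc a) (atgt a) (adeg a) (amor a) | Inr g \<Rightarrow> hh g)) w))"

text \<open>Only values on letters that occur matter. This is the locality that well-founded
  recursion demands.\<close>

lemma ext_val_cong:
  assumes p: "p \<in> mixed_combs X J S A B n" and "\<And>g. g \<in> S \<Longrightarrow> hh g = hh' g"
  shows "ext_val C U ho hh A p = ext_val C U ho hh' A p"
  unfolding ext_val_def
proof (intro lin_ext_cong arg_cong[where f = "word_val C (ho A)"] map_cong refl, goal_cases)
  case (1 w l)
  then have "l \<in> letters X S" using is_path_set[OF path_combsD(1)[OF p]] by auto
  then show ?case using assms(2) by (cases rule: letters_cases) auto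
qed

end

context extended_functor
begin

lemma ext_val_eq:
  assumes S: "closed_gens S"
  shows "quiver_rep.ev (mixed_quiver S) C ho hl = ext_val C U ho hh"
  unfolding quiver_rep.ev_def[OF quiver_rep_hl[OF S]] ext_val_def by (simp add: fun_eq_iff hl_def)

lemma quiver_functor_hl:
  assumes S: "closed_gens S" and d: "\<And>g. g \<in> S \<Longrightarrow>
    Diff C (ho (asrc g)) (ho (atgt g)) (adeg g) (hh g) = ext_val C U ho hh (asrc g) (diff_comb g)"
  shows "quiver_functor (mixed_quiver S) C ho hl"
proof -
  interpret Q: quiver_rep "mixed_quiver S" C ho hl by (rule quiver_rep_hl[OF S])
  show ?thesis
  proof
    fix l assume "l \<in> edges (mixed_quiver S)"
    then have "l \<in> letters X S" by simp
    then show "Q.ev (esrc (mixed_quiver S) l) (ediff (mixed_quiver S) l)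
      = Diff C (ho (esrc (mixed_quiver S) l)) (ho (etgt (mixed_quiver S) l)) (edeg (mixed_quiver S) l) (hl l)"
    proof (cases rule: letters_cases)
      case (Inl a)
      let ?d = "Arrow (asrc a) (atgt a) (adeg a + 1) (Diff X (asrc a) (atgt a) (adeg a) (amor a))"
      have "Inl ?d \<in> edges (mixed_quiver S)" using Inl by (simp add: Inl_letters J.source.Diff_Hom)
      from Q.ev_letter[OF this] show ?thesis
        using Inl by (simp add: hl_def U.FMor_Diff ho_J)
    next
      case (Inr g)
      have "hl (Inr g) = hh g" by (simp add: hl_def)
      then show ?thesis using d[OF Inr(2)] Inr(1) by (simp add: ext_val_eq[OF S])
    qed
  qed
qed

text \<open>Both sides evaluate the same words in \<open>D\<close>, and the arrows agree letter by
  letter.\<close>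

lemma FMor_ext_val:
  assumes S: "closed_gens S" and P: "dg_functor C D P" and V: "dg_functor Y D V"
    and ob: "\<And>A. A \<in> Ob Y \<Longrightarrow> FOb P (ho A) = FOb V A"
    and sq: "\<And>A B n f. \<lbrakk>A \<in> Ob X; B \<in> Ob X; f \<in> Hom X A B n\<rbrakk> \<Longrightarrow>
      FMor P (FOb U A) (FOb U B) n (FMor U A B n f) = FMor V (FOb J A) (FOb J B) n (FMor J A B n f)"
    and gen: "\<And>g. g \<in> S \<Longrightarrow> FMor P (ho (asrc g)) (ho (atgt g)) (adeg g) (hh g)
      = FMor V (asrc g) (atgt g) (adeg g) (amor g)"
    and p: "p \<in> mixed_combs X J S A B n" and AB: "A \<in> Ob Y" "B \<in> Ob Y"
  shows "FMor P (ho A) (ho B) n (ext_val C U ho hh A p) = FMor V A B n (mixed_val Y J A p)"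
proof -
  interpret Q: quiver_rep "mixed_quiver S" C ho hl by (rule quiver_rep_hl[OF S])
  interpret W: quiver_rep "mixed_quiver S" Y "\<lambda>A. A" "\<lambda>l. amor (letter_arrow J l)"
    by (rule quiver_rep_val[OF S])
  have SG: "S \<subseteq> G" using S by (simp add: closed_gens_def)
  have p': "p \<in> path_combs (edges (mixed_quiver S)) (esrc (mixed_quiver S)) (etgt (mixed_quiver S)) (edeg (mixed_quiver S)) A B n"
    using p by simp
  have eq: "image_arrow P (Q.arr l) = image_arrow V (W.arr l)" if "l \<in> letters X S" for l
    using that
  proof (cases rule: letters_cases)
    case (Inl a)
    then show ?thesis using ob[OF J.FOb_Ob[of "asrc a"]] ob[OF J.FOb_Ob[of "atgt a"]]
        sq[of "asrc a" "atgt a" "amor a" "adeg a"]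
      by (simp add: image_arrow_def hl_def ho_J)
  next
    case (Inr g)
    then have "g \<in> G" using SG by auto
    with Inr show ?thesis using ob[OF gen_Ob(1)[of g]] ob[OF gen_Ob(2)[of g]] gen[of g]
      by (simp add: image_arrow_def hl_def)
  qed
  have "lin_ext (Scale D) (\<lambda>w. word_val D (FOb P (ho A)) (map (\<lambda>e. image_arrow P (Q.arr e)) w)) p
      = lin_ext (Scale D) (\<lambda>w. word_val D (FOb V A) (map (\<lambda>e. image_arrow V (W.arr e)) w)) p"
  proof (rule lin_ext_cong)
    fix w assume "w \<in> Poly_Mapping.keys p"
    then have "map (\<lambda>e. image_arrow P (Q.arr e)) w = map (\<lambda>e. image_arrow V (W.arr e)) w"
      using is_path_set[OF path_combsD(1)[OF p]] eq by (intro map_cong refl) blast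
    then show "word_val D (FOb P (ho A)) (map (\<lambda>e. image_arrow P (Q.arr e)) w)
      = word_val D (FOb V A) (map (\<lambda>e. image_arrow V (W.arr e)) w)"
      unfolding ob[OF AB(1)] by (rule arg_cong)
  qed
  then show ?thesis
    using Q.FMor_ev[OF P p'] W.FMor_ev[OF V p'] AB
    by (simp add: ext_val_eq[OF S] ev_eq_mixed_val[OF S])
qed

end

locale lifting_problem = semifree_ext X Y J R G r + P: trivial_fibration C D P
    + U: dg_functor X C U + V: dg_functor Y D V
  for X :: "('k::{comm_ring,comm_monoid_mult}, 'o, 'm::ab_group_add) dgcat"
    and Y :: "('k, 'p, 'n::ab_group_add) dgcat" and J R G r
    and C :: "('k, 'x, 'y::ab_group_add) dgcat"
    and D :: "('k, 'z, 'w::ab_group_add) dgcat" and P U V +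
  assumes square: "dgfun_eq X (P \<circ>\<^sub>d\<^sub>g U) (V \<circ>\<^sub>d\<^sub>g J)"
begin

lemma square_Ob: "A \<in> Ob X \<Longrightarrow> FOb P (FOb U A) = FOb V (FOb J A)"
  and square_Hom: "\<lbrakk>A \<in> Ob X; B \<in> Ob X; f \<in> Hom X A B n\<rbrakk> \<Longrightarrow>
      FMor P (FOb U A) (FOb U B) n (FMor U A B n f) = FMor V (FOb J A) (FOb J B) n (FMor J A B n f)"
  using square by (auto simp: dgfun_eq_def comp_dgfun_def)

definition "ho A = (if A \<in> FOb J ` Ob X then FOb U (inv_into (Ob X) (FOb J) A)
  else (SOME c. c \<in> Ob C \<and> FOb P c = FOb V A))"

lemma ho: "A \<in> Ob Y \<Longrightarrow> ho A \<in> Ob C \<and> FOb P (ho A) = FOb V A"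
proof (cases "A \<in> FOb J ` Ob X")
  case True
  then show ?thesis using inv_into_into[OF True] f_inv_into_f[OF True]
    by (simp add: ho_def U.FOb_Ob square_Ob)
next
  case False
  assume "A \<in> Ob Y"
  then have "\<exists>c. c \<in> Ob C \<and> FOb P c = FOb V A" using P.surj_Ob[OF V.FOb_Ob] by blast
  from someI_ex[OF this] show ?thesis using False by (simp add: ho_def)
qed

lemma ho_J: "A \<in> Ob X \<Longrightarrow> ho (FOb J A) = FOb U A"
  using inj_Ob by (simp add: ho_def inv_into_f_f)

lemma extended_functorI:
  assumes "\<And>g. g \<in> G \<Longrightarrow> hh g \<in> Hom C (ho (asrc g)) (ho (atgt g)) (adeg g)"
  shows "extended_functor X Y J R G r C U ho hh"
  using assms ho ho_J by unfold_locales auto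

text \<open>The invariant of the recursion: right hom, right image under \<open>P\<close>, right
  differential. The guard makes it trivial outside \<open>G\<close>, so that choice can range over
  the whole type.\<close>

definition "good hh e m \<longleftrightarrow> (e \<in> G \<longrightarrow> m \<in> Hom C (ho (asrc e)) (ho (atgt e)) (adeg e) \<and>
  FMor P (ho (asrc e)) (ho (atgt e)) (adeg e) m = FMor V (asrc e) (atgt e) (adeg e) (amor e) \<and>
  Diff C (ho (asrc e)) (ho (atgt e)) (adeg e) m = ext_val C U ho hh (asrc e) (diff_comb e))"

text \<open>Any lift of V(e) has a differential that differs from the required value z by a closed
  element of the kernel of \<open>P\<close>; a primitive inside the kernel corrects the
  lift.\<close>

lemma extend_lift:
  assumes e: "e \<in> G" and hyp: "\<And>g. g \<in> underS r e \<Longrightarrow> good hh g (hh g)"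
  shows "\<exists>m. good hh e m"
proof -
  let ?S = "underS r e" and ?s = "asrc e" and ?t = "atgt e" and ?d = "adeg e"
  \<comment> \<open>\<open>extended_functor\<close> asks for values on all of \<open>G\<close>.
    Those outside the segment below \<open>e\<close> are not yet under control and are set to 0,
    which leaves the value on \<open>diff_comb e\<close> unchanged.\<close>
  define hh' where "hh' g = (if g \<in> ?S then hh g else 0)" for g
  have S: "closed_gens ?S" by (rule closed_gens_underS)
  then have SG: "?S \<subseteq> G" and down: "\<And>g. g \<in> ?S \<Longrightarrow> underS r g \<subseteq> ?S" by (auto simp: closed_gens_def)
  have O: "ho ?s \<in> Ob C" "ho ?t \<in> Ob C" "?s \<in> Ob Y" "?t \<in> Ob Y" using ho e gen_Ob by auto
  interpret E: extended_functor X Y J R G r C U ho hh'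
    using hyp SG by (intro extended_functorI)
      (auto simp: hh'_def good_def gen_Ob ho intro!: P.source.zero_Hom)
  note dc = diff_comb[OF e]
  have ev: "ext_val C U ho hh ?s (diff_comb e) = ext_val C U ho hh' ?s (diff_comb e)"
    by (rule ext_val_cong[OF dc(1)]) (simp add: hh'_def)
  have "quiver_functor (mixed_quiver ?S) C ho E.hl"
  proof (rule E.quiver_functor_hl[OF S])
    fix g assume g: "g \<in> ?S"
    have "ext_val C U ho hh (asrc g) (diff_comb g) = ext_val C U ho hh' (asrc g) (diff_comb g)"
      by (rule ext_val_cong[OF diff_comb(1)]) (use g SG down in \<open>auto simp: hh'_def\<close>)
    then show "Diff C (ho (asrc g)) (ho (atgt g)) (adeg g) (hh' g) = ext_val C U ho hh' (asrc g) (diff_comb g)"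
      using hyp[OF g] g SG by (auto simp: good_def hh'_def)
  qed
  then interpret Q: quiver_functor "mixed_quiver ?S" C ho E.hl .
  interpret W: quiver_functor "mixed_quiver ?S" Y "\<lambda>A. A" "\<lambda>l. amor (letter_arrow J l)"
    by (rule quiver_functor_val[OF S])
  let ?z = "ext_val C U ho hh' ?s (diff_comb e)"
  have dc': "diff_comb e \<in> Q.combs ?s ?t (?d + 1)" using dc(1) by simp
  have z: "?z \<in> Hom C (ho ?s) (ho ?t) (?d + 1)"
    using Q.ev_Hom[OF dc'] O by (simp add: E.ext_val_eq[OF S])
  \<comment> \<open>The formal differential of \<open>diff_comb e\<close> has value d(de) = 0 in
    \<open>Y\<close>; \<open>ev_kernel\<close> turns this into dz = 0.\<close>
  have "mixed_val Y J ?s (fdiff (mixed_quiver ?S) (diff_comb e)) = 0"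
    using W.ev_fdiff[OF dc'] O dc(2) by (simp add: ev_eq_mixed_val[OF S] J.target.Diff_Diff gen_Hom e)
  moreover have "fdiff (mixed_quiver ?S) (diff_comb e) \<in> mixed_combs X J G ?s ?t (?d + 1 + 1)"
  proof (rule subsetD[OF path_combs_mono])
    show "letters X ?S \<subseteq> letters X G" using SG by (auto simp: letters_def)
    show "fdiff (mixed_quiver ?S) (diff_comb e) \<in> mixed_combs X J ?S ?s ?t (?d + 1 + 1)"
      using Q.fdiff_combs[OF dc'] by simp
  qed
  ultimately have "ext_val C U ho hh' ?s (fdiff (mixed_quiver ?S) (diff_comb e)) = 0"
    using E.ev_kernel O by (simp add: E.ext_val_eq[OF closed_gens_G])
  then have dz: "Diff C (ho ?s) (ho ?t) (?d + 1) ?z = 0"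
    using Q.ev_fdiff[OF dc'] O by (simp add: E.ext_val_eq[OF S])
  have "FMor P (ho ?s) (ho ?t) (?d + 1) ?z = FMor V ?s ?t (?d + 1) (mixed_val Y J ?s (diff_comb e))"
    using hyp SG ho square_Hom dc(1) O
    by (intro E.FMor_ext_val[OF S P.dg_functor_axioms V.dg_functor_axioms]) (auto simp: hh'_def good_def)
  then have Pz: "FMor P (ho ?s) (ho ?t) (?d + 1) ?z
      = Diff D (FOb V ?s) (FOb V ?t) ?d (FMor V ?s ?t ?d (amor e))"
    using V.FMor_Diff[OF O(3,4) gen_Hom[OF e]] dc(2) by simp
  have "FMor V ?s ?t ?d (amor e) \<in> Hom D (FOb P (ho ?s)) (FOb P (ho ?t)) ?d"
    using V.FMor_Hom[OF O(3,4) gen_Hom[OF e]] ho O by simp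
  from P.surj_Hom[OF O(1,2) this] obtain m0 where
    m0: "m0 \<in> Hom C (ho ?s) (ho ?t) ?d" "FMor P (ho ?s) (ho ?t) ?d m0 = FMor V ?s ?t ?d (amor e)" by auto
  note dm0 = P.source.Diff_Hom[OF O(1,2) m0(1)]
  \<comment> \<open>The discrepancy has degree |e| + 1, whence the degree \<open>?d + 1 - 1\<close>
    of its primitive.\<close>
  have "\<exists>h\<in>Hom C (ho ?s) (ho ?t) (?d + 1 - 1). FMor P (ho ?s) (ho ?t) (?d + 1 - 1) h = 0
      \<and> Diff C (ho ?s) (ho ?t) (?d + 1 - 1) h = Diff C (ho ?s) (ho ?t) ?d m0 - ?z"
  proof (rule P.acyclic_kernel[OF O(1,2)])
    show "Diff C (ho ?s) (ho ?t) ?d m0 - ?z \<in> Hom C (ho ?s) (ho ?t) (?d + 1)"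
      by (rule P.source.diff_Hom[OF O(1,2) dm0 z])
    show "Diff C (ho ?s) (ho ?t) (?d + 1) (Diff C (ho ?s) (ho ?t) ?d m0 - ?z) = 0"
      using P.source.Diff_Diff[OF O(1,2) m0(1)] dz by (simp add: P.source.Diff_diff[OF O(1,2) dm0 z])
    show "FMor P (ho ?s) (ho ?t) (?d + 1) (Diff C (ho ?s) (ho ?t) ?d m0 - ?z) = 0"
      using O ho by (simp add: P.FMor_diff[OF O(1,2) dm0 z] Pz P.FMor_Diff[OF O(1,2) m0(1)] m0(2))
  qed
  then obtain k where k: "k \<in> Hom C (ho ?s) (ho ?t) ?d" "FMor P (ho ?s) (ho ?t) ?d k = 0"
    "Diff C (ho ?s) (ho ?t) ?d k = Diff C (ho ?s) (ho ?t) ?d m0 - ?z" by auto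
  have "good hh e (m0 - k)"
    using m0 k P.source.diff_Hom[OF O(1,2) m0(1) k(1)]
    by (simp add: good_def ev P.FMor_diff[OF O(1,2) m0(1) k(1)] P.source.Diff_diff[OF O(1,2) m0(1) k(1)])
  then show ?thesis ..
qed

lemma lift_gens: "\<exists>hh. \<forall>e. good hh e (hh e)"
proof (rule dependent_wf_choice[where R = "{(g, e). e \<in> G \<and> g \<in> underS r e}"])
  show "wf {(g, e). e \<in> G \<and> g \<in> underS r e}"
    by (rule wf_subset[of "r - Id"]) (use wo in \<open>auto simp: well_order_on_def underS_def\<close>)
  show "good f e m = good g e m" if "\<And>z. (z, e) \<in> {(g, e). e \<in> G \<and> g \<in> underS r e} \<Longrightarrow> f z = g z" for f g e m
  proof (cases "e \<in> G")
    case True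
    have "ext_val C U ho f (asrc e) (diff_comb e) = ext_val C U ho g (asrc e) (diff_comb e)"
      by (rule ext_val_cong[OF diff_comb(1)[OF True]]) (use that True in auto)
    then show ?thesis by (simp add: good_def)
  qed (simp add: good_def)
  show "\<exists>m. good f e m" if "\<And>g. (g, e) \<in> {(g, e). e \<in> G \<and> g \<in> underS r e} \<Longrightarrow> good f g (f g)" for e f
  proof (cases "e \<in> G")
    case True
    then show ?thesis using that by (intro extend_lift) auto
  qed (simp add: good_def)
qed

lemma lift:
  "\<exists>H. dg_functor Y C H \<and> dgfun_eq X (H \<circ>\<^sub>d\<^sub>g J) U \<and> dgfun_eq Y (P \<circ>\<^sub>d\<^sub>g H) V"
proof -
  obtain hh where good: "\<And>e. good hh e (hh e)" using lift_gens by blast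
  interpret E: extended_functor X Y J R G r C U ho hh
    using good by (intro extended_functorI) (auto simp: good_def)
  note G = closed_gens_G
  interpret Q: quiver_functor "mixed_quiver G" C ho E.hl
    by (rule E.quiver_functor_hl[OF G]) (use good in \<open>auto simp: good_def\<close>)
  interpret W: quiver_functor "mixed_quiver G" Y "\<lambda>A. A" "\<lambda>l. amor (letter_arrow J l)"
    by (rule quiver_functor_val[OF G])
  let ?M = "mixed_combs X J G"
  note val [simp] = ev_eq_mixed_val[OF G]
  \<comment> \<open>A morphism of \<open>Y\<close> is evaluated through any formal expression for
    it; \<open>Hval\<close> shows independence of the choice by means of
    \<open>ev_kernel\<close>.\<close>
  define H where "H = \<lparr>FOb = ho, FMor = (\<lambda>A B n f. E.H.ev A (SOME p. p \<in> ?M A B n \<and> mixed_val Y J A p = f))\<rparr>"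
  have HO: "FOb H = ho" by (simp add: H_def)
  have Hval: "FMor H A B n (mixed_val Y J A p) = E.H.ev A p"
    if p: "p \<in> ?M A B n" and AB: "A \<in> Ob Y" "B \<in> Ob Y" for A B n p
  proof -
    let ?q = "SOME q. q \<in> ?M A B n \<and> mixed_val Y J A q = mixed_val Y J A p"
    have q: "?q \<in> ?M A B n" "mixed_val Y J A ?q = mixed_val Y J A p"
      using someI[of "\<lambda>q. q \<in> ?M A B n \<and> mixed_val Y J A q = mixed_val Y J A p" p] p by auto
    have "mixed_val Y J A (?q - p) = 0"
      using W.ev_diff[of ?q A B n p] p q AB by simp
    then have "E.H.ev A (?q - p) = 0"
      using E.ev_kernel[OF path_combs_diff[OF q(1) p] AB] by simp
    then have "E.H.ev A ?q = E.H.ev A p" using E.H.ev_diff[of ?q A B n p] p q AB by simp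
    then show ?thesis by (simp add: H_def)
  qed
  have ex: "\<exists>p. p \<in> ?M A B n \<and> f = mixed_val Y J A p" if "A \<in> Ob Y" "B \<in> Ob Y" "f \<in> Hom Y A B n" for A B n f
    using free that unfolding free_extension_def by blast
  have "dg_functor Y C H"
  proof (unfold_locales, goal_cases)
    case (1 A)
    then show ?case using ho by (simp add: HO)
  next
    case (2 A B f n)
    then obtain p where "p \<in> ?M A B n" "f = mixed_val Y J A p" using ex by blast
    then show ?case using 2 Hval[of p A B n] E.H.ev_Hom[of p A B n] by (simp add: HO)
  next
    case (3 A B f n g)
    then obtain p q where p: "p \<in> ?M A B n" "f = mixed_val Y J A p"
      and q: "q \<in> ?M A B n" "g = mixed_val Y J A q" using ex by metis
    have "f + g = mixed_val Y J A (p + q)" using W.ev_add[of p A B n q] p q 3 by simp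
    then show ?case using Hval[OF path_combs_add[OF p(1) q(1)]] Hval[OF p(1)] Hval[OF q(1)] 3 p q
        E.H.ev_add[of p A B n q] by simp
  next
    case (4 A B f n a)
    then obtain p where p: "p \<in> ?M A B n" "f = mixed_val Y J A p" using ex by blast
    have "Scale Y a f = mixed_val Y J A (pm_scale a p)" using W.ev_scale[of p A B n a] p 4 by simp
    then show ?case using Hval[OF path_combs_scale[OF p(1)]] Hval[OF p(1)] 4 p
        E.H.ev_scale[of p A B n a] by simp
  next
    case (5 A B Z g m f n)
    obtain p where p: "p \<in> ?M B Z m" "g = mixed_val Y J B p" using ex 5 by blast
    obtain q where q: "q \<in> ?M A B n" "f = mixed_val Y J A q" using ex 5 by blast
    have "Comp Y A B Z g f = mixed_val Y J A (word_mult p q)"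
      using W.ev_mult[of p B Z m q A n] p q 5 by simp
    then show ?case using Hval[OF path_combs_mult[OF p(1) q(1)]] Hval[OF p(1)] Hval[OF q(1)] 5 p q
        E.H.ev_mult[of p B Z m q A n] by (simp add: HO)
  next
    case (6 A)
    have "Ident Y A = mixed_val Y J A (word [])" using W.ev_one[of A] 6 by simp
    moreover have "word [] \<in> ?M A A 0" by (auto intro!: path_combs_word)
    ultimately show ?case using Hval[of "word []" A A 0] E.H.ev_one[of A] 6 by (simp add: HO)
  next
    case (7 A B f n)
    then obtain p where p: "p \<in> ?M A B n" "f = mixed_val Y J A p" using ex by blast
    have p': "p \<in> E.H.combs A B n" using p by simp
    have "Diff Y A B n f = mixed_val Y J A (fdiff (mixed_quiver G) p)" using W.ev_fdiff[OF p'] p 7 by simp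
    moreover have "fdiff (mixed_quiver G) p \<in> ?M A B (n + 1)" using E.H.fdiff_combs[OF p'] by simp
    ultimately show ?case using Hval[of "fdiff (mixed_quiver G) p" A B "n + 1"] Hval[OF p(1)] 7 p
        Q.ev_fdiff[OF p'] by (simp add: HO)
  qed
  moreover have "dgfun_eq X (H \<circ>\<^sub>d\<^sub>g J) U"
  proof -
    have "FMor H (FOb J A) (FOb J B) n (FMor J A B n f) = FMor U A B n f"
      if A: "A \<in> Ob X" "B \<in> Ob X" and f: "f \<in> Hom X A B n" for A B n f
    proof -
      let ?l = "Inl (Arrow A B n f)"
      have l: "?l \<in> edges (mixed_quiver G)" using A f by (simp add: Inl_letters)
      have "word [?l] \<in> ?M (FOb J A) (FOb J B) n" using l by (auto intro!: path_combs_word)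
      then show ?thesis
        using Hval[of "word [?l]" "FOb J A" "FOb J B" n] W.ev_letter[OF l] E.H.ev_letter[OF l] A J.FOb_Ob
        by (simp add: image_arrow_def E.hl_def)
    qed
    then show ?thesis by (simp add: dgfun_eq_def comp_dgfun_def HO ho_J)
  qed
  moreover have "dgfun_eq Y (P \<circ>\<^sub>d\<^sub>g H) V"
  proof -
    have "FMor P (ho A) (ho B) n (FMor H A B n f) = FMor V A B n f"
      if A: "A \<in> Ob Y" "B \<in> Ob Y" and f: "f \<in> Hom Y A B n" for A B n f
    proof -
      obtain p where p: "p \<in> ?M A B n" "f = mixed_val Y J A p" using ex[OF A f] by blast
      have "FMor P (ho A) (ho B) n (ext_val C U ho hh A p) = FMor V A B n (mixed_val Y J A p)"
        using good ho square_Hom p(1) A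
        by (intro E.FMor_ext_val[OF G P.dg_functor_axioms V.dg_functor_axioms]) (auto simp: good_def)
      then show ?thesis using Hval[OF p(1) A] p(2) by (simp add: E.ext_val_eq[OF G])
    qed
    then show ?thesis using ho by (simp add: dgfun_eq_def comp_dgfun_def HO)
  qed
  ultimately show ?thesis by blast
qed

end

lemma (in trivial_fibration) has_rlp_semifree_extension:
  assumes "semifree_extension X Y J"
  shows "has_rlp C D P X Y J"
proof -
  obtain R G where RG: "semifree_extension_by X Y J R G"
    using assms by (auto simp: semifree_extension_def)
  then obtain r where wo: "well_order_on G r" and lower: "\<forall>e\<in>G. Diff Y (asrc e) (atgt e) (adeg e) (amor e)
           \<in> mixed_val Y J (asrc e) ` mixed_combs X J (underS r e) (asrc e) (atgt e) (adeg e + 1)"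
    unfolding semifree_extension_by_def by (elim conjE exE)
  have "dg_functor X Y J" "inj_on (FOb J) (Ob X)" "Ob Y = FOb J ` Ob X \<union> R" "free_extension X Y J G"
    using RG by (simp_all only: semifree_extension_by_def)
  then have "semifree_ext X Y J R G r"
    using wo bspec[OF lower] by (intro semifree_ext.intro semifree_ext_axioms.intro)
  note ext = this
  show ?thesis
    unfolding has_rlp_def
  proof (intro allI impI, elim conjE)
    fix u v assume "dg_functor X C u" "dg_functor Y D v" "dgfun_eq X (P \<circ>\<^sub>d\<^sub>g u) (v \<circ>\<^sub>d\<^sub>g J)"
    then have "lifting_problem X Y J R G r C D P u v"
      by (intro lifting_problem.intro ext trivial_fibration_axioms lifting_problem_axioms.intro)
    then show "\<exists>h. dg_functor Y C h \<and> dgfun_eq X (h \<circ>\<^sub>d\<^sub>g J) u \<and> dgfun_eq Y (P \<circ>\<^sub>d\<^sub>g h) v"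
      by (rule lifting_problem.lift)
  qed
qed

text \<open>The lifting problem is transferred to \<open>J\<close> along \<open>s'\<close> and
  \<open>t'\<close>, solved there, and the solution is precomposed with \<open>t\<close>.\<close>

lemma has_rlp_retract:
  assumes rlp: "has_rlp C D P X Y J" and ret: "retract_of A B F X Y J" and P: "dg_functor C D P"
  shows "has_rlp C D P A B F"
  unfolding has_rlp_def
proof (intro allI impI, elim conjE)
  fix u v assume u: "dg_functor A C u" and v: "dg_functor B D v" and sq: "dgfun_eq A (P \<circ>\<^sub>d\<^sub>g u) (v \<circ>\<^sub>d\<^sub>g F)"
  obtain s s' t t' where st: "dg_functor A X s" "dg_functor X A s'" "dg_functor B Y t" "dg_functor Y B t'"
    and s: "dgfun_eq A (s' \<circ>\<^sub>d\<^sub>g s) id_dgfun" and t: "dgfun_eq B (t' \<circ>\<^sub>d\<^sub>g t) id_dgfun"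
    and Js: "dgfun_eq A (J \<circ>\<^sub>d\<^sub>g s) (t \<circ>\<^sub>d\<^sub>g F)" and Fs': "dgfun_eq X (F \<circ>\<^sub>d\<^sub>g s') (t' \<circ>\<^sub>d\<^sub>g J)"
    using ret unfolding retract_of_def by blast
  interpret F: dg_functor A B F using ret by (simp add: retract_of_def)
  interpret s: dg_functor A X s by fact
  interpret s': dg_functor X A s' by fact
  interpret t: dg_functor B Y t by fact
  interpret t': dg_functor Y B t' by fact
  have "dgfun_eq X (P \<circ>\<^sub>d\<^sub>g (u \<circ>\<^sub>d\<^sub>g s')) ((v \<circ>\<^sub>d\<^sub>g t') \<circ>\<^sub>d\<^sub>g J)"
    using sq Fs' s'.FOb_Ob s'.FMor_Hom unfolding dgfun_eq_def comp_dgfun_def by simp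
  with rlp dg_functor_comp[OF st(2) u] dg_functor_comp[OF st(4) v] obtain h where
    h: "dg_functor Y C h" "dgfun_eq X (h \<circ>\<^sub>d\<^sub>g J) (u \<circ>\<^sub>d\<^sub>g s')" "dgfun_eq Y (P \<circ>\<^sub>d\<^sub>g h) (v \<circ>\<^sub>d\<^sub>g t')"
    unfolding has_rlp_def by blast
  have 1: "dgfun_eq A ((h \<circ>\<^sub>d\<^sub>g t) \<circ>\<^sub>d\<^sub>g F) u"
  proof -
    have "FOb h (FOb t (FOb F x)) = FOb u x" if "x \<in> Ob A" for x
    proof -
      have "FOb h (FOb t (FOb F x)) = FOb h (FOb J (FOb s x))"
        using Js that by (simp add: dgfun_eq_def comp_dgfun_def)
      also have "\<dots> = FOb u (FOb s' (FOb s x))"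
        using h(2) s.FOb_Ob[OF that] by (simp add: dgfun_eq_def comp_dgfun_def)
      finally show ?thesis using s that by (simp add: dgfun_eq_def comp_dgfun_def id_dgfun_def)
    qed
    moreover have "FMor h (FOb t (FOb F x)) (FOb t (FOb F y)) n
        (FMor t (FOb F x) (FOb F y) n (FMor F x y n f)) = FMor u x y n f"
      if x: "x \<in> Ob A" "y \<in> Ob A" and f: "f \<in> Hom A x y n" for x y n f
    proof -
      have o: "FOb t (FOb F z) = FOb J (FOb s z)" "FOb s' (FOb s z) = z" if "z \<in> Ob A" for z
        using Js s that by (simp_all add: dgfun_eq_def comp_dgfun_def id_dgfun_def)
      have "FMor t (FOb F x) (FOb F y) n (FMor F x y n f) = FMor J (FOb s x) (FOb s y) n (FMor s x y n f)"
        using Js x f by (simp add: dgfun_eq_def comp_dgfun_def)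
      moreover have "FMor h (FOb J (FOb s x)) (FOb J (FOb s y)) n (FMor J (FOb s x) (FOb s y) n (FMor s x y n f))
          = FMor u (FOb s' (FOb s x)) (FOb s' (FOb s y)) n (FMor s' (FOb s x) (FOb s y) n (FMor s x y n f))"
        using h(2) s.FOb_Ob x s.FMor_Hom[OF x f] by (simp add: dgfun_eq_def comp_dgfun_def)
      moreover have "FMor s' (FOb s x) (FOb s y) n (FMor s x y n f) = f"
        using s x f by (simp add: dgfun_eq_def comp_dgfun_def id_dgfun_def)
      ultimately show ?thesis using o x by simp
    qed
    ultimately show ?thesis by (simp add: dgfun_eq_def comp_dgfun_def)
  qed
  have 2: "dgfun_eq B (P \<circ>\<^sub>d\<^sub>g (h \<circ>\<^sub>d\<^sub>g t)) v"
    using h(3) t t.FOb_Ob t.FMor_Hom unfolding dgfun_eq_def comp_dgfun_def id_dgfun_def by simp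
  from 1 2 dg_functor_comp[OF st(3) h(1)]
  show "\<exists>h. dg_functor B C h \<and> dgfun_eq A (h \<circ>\<^sub>d\<^sub>g F) u \<and> dgfun_eq B (P \<circ>\<^sub>d\<^sub>g h) v" by blast
qed

text \<open>Lifts exist against all cofibrations, so the three model structures are treated
  alike.\<close>

lemma (in trivial_fibration) fibration: "fibration U M C D P"
  unfolding fibration_def cofibration_def
  using dg_functor_axioms has_rlp_retract[OF has_rlp_semifree_extension] by blast

section \<open>Matrices, twisting by Maurer-Cartan elements, and twisted complexes\<close>

section \<open>Matrix categories\<close>

abbreviation ob_at :: "'o shifted_sum \<Rightarrow> nat \<Rightarrow> 'o" where "ob_at a i \<equiv> fst (the (a i))"
abbreviation sh_at :: "'o shifted_sum \<Rightarrow> nat \<Rightarrow> int" where "sh_at a i \<equiv> snd (the (a i))"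

text \<open>Formal sums without a twist. Twisted complexes arise from this dg category by
  \<open>twist\<close>, which separates the matrix computations from the Maurer-Cartan
  equation.\<close>

definition matrices :: "('k, 'o, 'm::ab_group_add) dgcat \<Rightarrow> ('k, 'o shifted_sum, 'm mat) dgcat" where
  "matrices C = \<lparr>Ob = {a. fst ` ran a \<subseteq> Ob C}, Hom = mat_Hom C, Scale = mat_Scale C, Comp = mat_Comp C,
     Ident = mat_Ident C, Diff = mat_Diff C\<rparr>"

text \<open>Trades the case distinction over options for \<open>ob_at\<close> and
  \<open>sh_at\<close>, in which form degrees can be added up.\<close>

lemma mat_Hom_iff: "f \<in> mat_Hom C a b n \<longleftrightarrow>
    (\<forall>j\<in>dom a. \<forall>i\<in>dom b. f i j \<in> Hom C (ob_at a j) (ob_at b i) (n + sh_at b i - sh_at a j)) \<and>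
    (\<forall>i j. j \<notin> dom a \<or> i \<notin> dom b \<longrightarrow> f i j = 0) \<and> (\<forall>j. finite {i. f i j \<noteq> 0})"
proof -
  have eq: "(case (a j, b i) of (Some (A, s), Some (B, t)) \<Rightarrow> f i j \<in> Hom C A B (n + t - s) | _ \<Rightarrow> f i j = 0)
    \<longleftrightarrow> (j \<in> dom a \<longrightarrow> i \<in> dom b \<longrightarrow> f i j \<in> Hom C (ob_at a j) (ob_at b i) (n + sh_at b i - sh_at a j))
      \<and> (j \<notin> dom a \<or> i \<notin> dom b \<longrightarrow> f i j = 0)" for i j
    by (auto simp: dom_def split: option.splits prod.splits)
  show ?thesis unfolding mat_Hom_def mem_Collect_eq eq by blast
qed

lemma mat_Comp_eq: "mat_Comp C a b c g f i j = (if j \<in> dom a \<and> i \<in> dom c then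
    (\<Sum>l\<in>{l \<in> dom b. f l j \<noteq> 0}. Comp C (ob_at a j) (ob_at b l) (ob_at c i) (g i l) (f l j)) else 0)"
  by (auto simp: mat_Comp_def dom_def split: option.splits prod.splits)

lemma mat_Diff_eq: "mat_Diff C a b n f i j = (if j \<in> dom a \<and> i \<in> dom b then
    ksign (sh_at b i) (Diff C (ob_at a j) (ob_at b i) (n + sh_at b i - sh_at a j) (f i j)) else 0)"
  by (auto simp: mat_Diff_def dom_def split: option.splits prod.splits)

lemma mat_Ident_eq: "mat_Ident C a i j = (if i = j \<and> i \<in> dom a then Ident C (ob_at a i) else 0)"
  by (auto simp: mat_Ident_def dom_def split: option.splits prod.splits)

lemma mat_fun_eq: "mat_fun F a b n f i j = (if j \<in> dom a \<and> i \<in> dom b then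
    FMor F (ob_at a j) (ob_at b i) (n + sh_at b i - sh_at a j) (f i j) else 0)"
  by (auto simp: mat_fun_def dom_def split: option.splits prod.splits)

context dg_category
begin

abbreviation "sums \<equiv> {a. fst ` ran a \<subseteq> Ob C}"

lemma sums_Ob: "a \<in> sums \<Longrightarrow> i \<in> dom a \<Longrightarrow> ob_at a i \<in> Ob C"
  by (force simp: ran_def dom_def)

lemma mat_entry: "\<lbrakk>f \<in> mat_Hom C a b n; j \<in> dom a; i \<in> dom b\<rbrakk>
    \<Longrightarrow> f i j \<in> Hom C (ob_at a j) (ob_at b i) (n + sh_at b i - sh_at a j)"
  and mat_outside: "\<lbrakk>f \<in> mat_Hom C a b n; j \<notin> dom a \<or> i \<notin> dom b\<rbrakk> \<Longrightarrow> f i j = 0"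
  and mat_finite: "f \<in> mat_Hom C a b n \<Longrightarrow> finite {i. f i j \<noteq> 0}"
  unfolding mat_Hom_iff by blast+

lemma mat_HomI:
  assumes "\<And>i j. j \<in> dom a \<Longrightarrow> i \<in> dom b \<Longrightarrow> f i j \<in> Hom C (ob_at a j) (ob_at b i) (n + sh_at b i - sh_at a j)"
    and "\<And>i j. j \<notin> dom a \<or> i \<notin> dom b \<Longrightarrow> f i j = 0"
    and "\<And>j. finite {i. f i j \<noteq> 0}"
  shows "f \<in> mat_Hom C a b n"
  unfolding mat_Hom_iff using assms by blast

lemma mat_eqI:
  assumes "\<And>i j. j \<in> dom a \<Longrightarrow> i \<in> dom b \<Longrightarrow> f i j = g i j"
    and "\<And>i j. j \<notin> dom a \<or> i \<notin> dom b \<Longrightarrow> f i j = 0" "\<And>i j. j \<notin> dom a \<or> i \<notin> dom b \<Longrightarrow> g i j = 0"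
  shows "f = g"
proof (intro ext)
  fix i j show "f i j = g i j" using assms by (cases "j \<in> dom a \<and> i \<in> dom b") auto
qed

text \<open>Between objects of \<open>C\<close> scaling fixes 0, so the guard in
  \<open>mat_Scale\<close> can be replaced by one on the index sets.\<close>

lemma mat_Scale_eq:
  assumes "a \<in> sums" "b \<in> sums" "f \<in> mat_Hom C a b n"
  shows "mat_Scale C c f i j = (if j \<in> dom a \<and> i \<in> dom b then Scale C c (f i j) else 0)"
  using assms mat_outside[OF assms(3), of j i] Scale_zero_right[of "ob_at a j" "ob_at b i" c] sums_Ob
  by (auto simp: mat_Scale_def)

text \<open>A composite sums over the support of a column of \<open>f\<close>; further indices
  contribute 0, so columns of several matrices can be summed over one finite set.\<close>

lemma mat_Comp_superset:
  assumes "a \<in> sums" "b \<in> sums" "c \<in> sums" "g \<in> mat_Hom C b c m" "j \<in> dom a" "i \<in> dom c"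
    and S: "finite S" "S \<subseteq> dom b" "{l \<in> dom b. f l j \<noteq> 0} \<subseteq> S"
  shows "mat_Comp C a b c g f i j
    = (\<Sum>l\<in>S. Comp C (ob_at a j) (ob_at b l) (ob_at c i) (g i l) (f l j))"
proof -
  have "Comp C (ob_at a j) (ob_at b l) (ob_at c i) (g i l) 0 = 0" if "l \<in> S" for l
    using assms that by (intro Comp_zero_right[OF _ _ _ mat_entry[OF assms(4)]]) (auto intro: sums_Ob)
  then show ?thesis
    using assms by (auto simp: mat_Comp_eq intro!: sum.mono_neutral_left)
qed

lemma mat_column:
  assumes "f \<in> mat_Hom C a b n"
  shows "finite {l \<in> dom b. f l j \<noteq> 0}" "{l \<in> dom b. f l j \<noteq> 0} \<subseteq> dom b"
  using mat_finite[OF assms, of j] by (auto intro: finite_subset[rotated])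

lemma entry_Comp_Hom:
  assumes "a \<in> sums" "b \<in> sums" "c \<in> sums" "g \<in> mat_Hom C b c m" "f \<in> mat_Hom C a b n"
    "j \<in> dom a" "i \<in> dom c" "l \<in> dom b"
  shows "Comp C (ob_at a j) (ob_at b l) (ob_at c i) (g i l) (f l j)
    \<in> Hom C (ob_at a j) (ob_at c i) (m + n + sh_at c i - sh_at a j)"
proof -
  have "(m + sh_at c i - sh_at b l) + (n + sh_at b l - sh_at a j) = m + n + sh_at c i - sh_at a j" by simp
  from Comp_Hom[OF sums_Ob[OF assms(1,6)] sums_Ob[OF assms(2,8)] sums_Ob[OF assms(3,7)]
        mat_entry[OF assms(4,8,7)] mat_entry[OF assms(5,6,8)], unfolded this]
  show ?thesis .
qed

lemma sum_entry_Hom: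
  assumes "a \<in> sums" "b \<in> sums" "c \<in> sums" "g \<in> mat_Hom C b c m" "f \<in> mat_Hom C a b n"
    "j \<in> dom a" "i \<in> dom c"
  shows "(\<Sum>l | l \<in> dom b \<and> f l j \<noteq> 0. Comp C (ob_at a j) (ob_at b l) (ob_at c i) (g i l) (f l j))
    \<in> Hom C (ob_at a j) (ob_at c i) (m + n + sh_at c i - sh_at a j)"
  by (rule sum_Hom[OF sums_Ob[OF assms(1,6)] sums_Ob[OF assms(3,7)]]) (simp add: entry_Comp_Hom[OF assms])

lemmas Scale_sum = kmodule.sc_sum[OF kmodule_Hom]

lemma Comp_sum_left:
  assumes "X \<in> Ob C" "Y \<in> Ob C" "Z \<in> Ob C" "f \<in> Hom C X Y n" "\<And>k. k \<in> K \<Longrightarrow> u k \<in> Hom C Y Z m"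
  shows "Comp C X Y Z (sum u K) f = (\<Sum>k\<in>K. Comp C X Y Z (u k) f)"
  using assms(5)
proof (induction K rule: infinite_finite_induct)
  case (insert x K)
  have "sum u K \<in> Hom C Y Z m" by (rule sum_Hom[OF assms(2,3)]) (use insert in auto)
  with insert show ?case using Comp_add_left[OF assms(1-3) _ _ assms(4), of "u x" m "sum u K"] by simp
qed (simp_all add: Comp_zero_left[OF assms(1-4)])

lemma Comp_sum_right:
  assumes "X \<in> Ob C" "Y \<in> Ob C" "Z \<in> Ob C" "g \<in> Hom C Y Z m" "\<And>k. k \<in> K \<Longrightarrow> u k \<in> Hom C X Y n"
  shows "Comp C X Y Z g (sum u K) = (\<Sum>k\<in>K. Comp C X Y Z g (u k))"
  using assms(5)
proof (induction K rule: infinite_finite_induct)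
  case (insert x K)
  have "sum u K \<in> Hom C X Y n" by (rule sum_Hom[OF assms(1,2)]) (use insert in auto)
  with insert show ?case using Comp_add_right[OF assms(1-4), of "u x" n "sum u K"] by simp
qed (simp_all add: Comp_zero_right[OF assms(1-4)])

lemma mat_Comp_zero:
  assumes "a \<in> sums" "b \<in> sums" "c \<in> sums" "f \<in> mat_Hom C a b n" "\<And>l. l \<in> dom b \<Longrightarrow> f l j \<noteq> 0 \<Longrightarrow> g i l = 0"
  shows "mat_Comp C a b c g f i j = 0"
proof (cases "j \<in> dom a \<and> i \<in> dom c")
  case True
  have "Comp C (ob_at a j) (ob_at b l) (ob_at c i) (g i l) (f l j) = 0" if "l \<in> {l \<in> dom b. f l j \<noteq> 0}" for l
    using that True assms(5)[of l] Comp_zero_left[OF sums_Ob[OF assms(1), of j] sums_Ob[OF assms(2), of l]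
        sums_Ob[OF assms(3), of i] mat_entry[OF assms(4), of j l]] by simp
  then show ?thesis by (simp add: mat_Comp_eq)
qed (auto simp: mat_Comp_eq)

lemma mat_Comp_nonzero:
  assumes "a \<in> sums" "b \<in> sums" "c \<in> sums" "f \<in> mat_Hom C a b n" "mat_Comp C a b c g f i j \<noteq> 0"
  obtains l where "l \<in> dom b" "f l j \<noteq> 0" "g i l \<noteq> 0"
  using mat_Comp_zero[OF assms(1-4), of j g i] assms(5) that by metis

lemma mat_Comp_Hom:
  assumes "a \<in> sums" "b \<in> sums" "c \<in> sums" "g \<in> mat_Hom C b c m" "f \<in> mat_Hom C a b n"
  shows "mat_Comp C a b c g f \<in> mat_Hom C a c (m + n)"
proof (rule mat_HomI)
  fix i j assume "j \<in> dom a" "i \<in> dom c"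
  then show "mat_Comp C a b c g f i j \<in> Hom C (ob_at a j) (ob_at c i) (m + n + sh_at c i - sh_at a j)"
    by (simp add: mat_Comp_eq sum_entry_Hom[OF assms])
next
  fix j
  have "{i. mat_Comp C a b c g f i j \<noteq> 0} \<subseteq> (\<Union>l\<in>{l \<in> dom b. f l j \<noteq> 0}. {i. g i l \<noteq> 0})"
    by (auto elim!: mat_Comp_nonzero[OF assms(1-3,5)])
  then show "finite {i. mat_Comp C a b c g f i j \<noteq> 0}"
    by (rule finite_subset) (intro finite_UN_I mat_column[OF assms(5)] mat_finite[OF assms(4)])
qed (auto simp: mat_Comp_eq)

lemma mat_Comp_assoc:
  assumes "a \<in> sums" "b \<in> sums" "c \<in> sums" "d \<in> sums"
    and h: "h \<in> mat_Hom C c d l" and g: "g \<in> mat_Hom C b c m" and f: "f \<in> mat_Hom C a b n"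
  shows "mat_Comp C a b d (mat_Comp C b c d h g) f = mat_Comp C a c d h (mat_Comp C a b c g f)"
proof (rule mat_eqI[of a d])
  fix i j assume ij: "j \<in> dom a" "i \<in> dom d"
  let ?L = "{l \<in> dom b. f l j \<noteq> 0}"
  \<comment> \<open>All indices that columns of \<open>g\<close> reach from the support of column
    \<open>j\<close> of \<open>f\<close>. Finiteness of columns makes this set finite, so the two
    summations can be exchanged.\<close>
  let ?M = "\<Union>l\<in>?L. {m \<in> dom c. g m l \<noteq> 0}"
  have M: "finite ?M" "?M \<subseteq> dom c" using mat_column[OF f] mat_column[OF g] by auto
  have gf: "{k \<in> dom c. mat_Comp C a b c g f k j \<noteq> 0} \<subseteq> ?M"
    by (auto elim!: mat_Comp_nonzero[OF assms(1-3) f])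
  have "mat_Comp C a b d (mat_Comp C b c d h g) f i j
      = (\<Sum>p\<in>?L. Comp C (ob_at a j) (ob_at b p) (ob_at d i)
          (\<Sum>k\<in>?M. Comp C (ob_at b p) (ob_at c k) (ob_at d i) (h i k) (g k p)) (f p j))"
  proof -
    have "mat_Comp C b c d h g i p = (\<Sum>k\<in>?M. Comp C (ob_at b p) (ob_at c k) (ob_at d i) (h i k) (g k p))"
      if "p \<in> ?L" for p
      by (rule mat_Comp_superset[OF assms(2-4) h _ ij(2) M]) (use that in auto)
    then show ?thesis using ij by (simp add: mat_Comp_eq[of C a b d])
  qed
  also have "\<dots> = (\<Sum>p\<in>?L. \<Sum>k\<in>?M. Comp C (ob_at a j) (ob_at b p) (ob_at d i)
          (Comp C (ob_at b p) (ob_at c k) (ob_at d i) (h i k) (g k p)) (f p j))"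
  proof (rule sum.cong[OF refl])
    fix p assume "p \<in> ?L"
    then have p: "p \<in> dom b" by simp
    show "Comp C (ob_at a j) (ob_at b p) (ob_at d i)
          (\<Sum>k\<in>?M. Comp C (ob_at b p) (ob_at c k) (ob_at d i) (h i k) (g k p)) (f p j)
        = (\<Sum>k\<in>?M. Comp C (ob_at a j) (ob_at b p) (ob_at d i)
          (Comp C (ob_at b p) (ob_at c k) (ob_at d i) (h i k) (g k p)) (f p j))"
    proof (rule Comp_sum_left[OF sums_Ob[OF assms(1) ij(1)] sums_Ob[OF assms(2) p] sums_Ob[OF assms(4) ij(2)]
          mat_entry[OF f ij(1) p]])
      fix k assume "k \<in> ?M"
      then have "k \<in> dom c" by auto
      then show "Comp C (ob_at b p) (ob_at c k) (ob_at d i) (h i k) (g k p)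
          \<in> Hom C (ob_at b p) (ob_at d i) (l + m + sh_at d i - sh_at b p)"
        by (rule entry_Comp_Hom[OF assms(2-4) h g p ij(2)])
    qed
  qed
  also have "\<dots> = (\<Sum>k\<in>?M. \<Sum>p\<in>?L. Comp C (ob_at a j) (ob_at c k) (ob_at d i) (h i k)
          (Comp C (ob_at a j) (ob_at b p) (ob_at c k) (g k p) (f p j)))"
  proof (subst sum.swap, intro sum.cong refl)
    fix k p assume "k \<in> ?M" "p \<in> ?L"
    then have k: "k \<in> dom c" and p: "p \<in> dom b" by auto
    show "Comp C (ob_at a j) (ob_at b p) (ob_at d i)
          (Comp C (ob_at b p) (ob_at c k) (ob_at d i) (h i k) (g k p)) (f p j)
        = Comp C (ob_at a j) (ob_at c k) (ob_at d i) (h i k)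
          (Comp C (ob_at a j) (ob_at b p) (ob_at c k) (g k p) (f p j))"
      by (rule Comp_assoc[OF sums_Ob[OF assms(1) ij(1)] sums_Ob[OF assms(2) p] sums_Ob[OF assms(3) k]
          sums_Ob[OF assms(4) ij(2)] mat_entry[OF h k ij(2)] mat_entry[OF g p k] mat_entry[OF f ij(1) p]])
  qed
  also have "\<dots> = (\<Sum>k\<in>?M. Comp C (ob_at a j) (ob_at c k) (ob_at d i) (h i k) (mat_Comp C a b c g f k j))"
  proof (rule sum.cong[OF refl])
    fix k assume "k \<in> ?M"
    then have k: "k \<in> dom c" by auto
    show "(\<Sum>p\<in>?L. Comp C (ob_at a j) (ob_at c k) (ob_at d i) (h i k)
          (Comp C (ob_at a j) (ob_at b p) (ob_at c k) (g k p) (f p j)))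
        = Comp C (ob_at a j) (ob_at c k) (ob_at d i) (h i k) (mat_Comp C a b c g f k j)"
    proof -
      have "Comp C (ob_at a j) (ob_at b p) (ob_at c k) (g k p) (f p j)
          \<in> Hom C (ob_at a j) (ob_at c k) (m + n + sh_at c k - sh_at a j)" if "p \<in> ?L" for p
        using that by (intro entry_Comp_Hom[OF assms(1-3) g f ij(1) k]) simp
      from Comp_sum_right[where K = ?L and u = "\<lambda>p. Comp C (ob_at a j) (ob_at b p) (ob_at c k) (g k p) (f p j)",
          OF sums_Ob[OF assms(1) ij(1)] sums_Ob[OF assms(3) k] sums_Ob[OF assms(4) ij(2)]
          mat_entry[OF h k ij(2)] this]
      show ?thesis using ij k by (simp add: mat_Comp_eq)
    qed
  qed
  also have "\<dots> = mat_Comp C a c d h (mat_Comp C a b c g f) i j"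
    using mat_Comp_superset[where f = "mat_Comp C a b c g f", OF assms(1,3,4) h ij M gf] by simp
  finally show "mat_Comp C a b d (mat_Comp C b c d h g) f i j = mat_Comp C a c d h (mat_Comp C a b c g f) i j" .
qed (auto simp: mat_Comp_eq)

lemma mat_Diff_Comp:
  assumes "a \<in> sums" "b \<in> sums" "c \<in> sums" and g: "g \<in> mat_Hom C b c m" and f: "f \<in> mat_Hom C a b n"
  shows "mat_Diff C a c (m + n) (mat_Comp C a b c g f)
    = mat_Comp C a b c (mat_Diff C b c m g) f + ksign m (mat_Comp C a b c g (mat_Diff C a b n f))"
proof (rule mat_eqI[of a c])
  fix i j assume ij: "j \<in> dom a" "i \<in> dom c"
  let ?L = "{l \<in> dom b. f l j \<noteq> 0}"
  let ?A = "ob_at a j" and ?C = "ob_at c i" and ?u = "sh_at c i" and ?s = "sh_at a j"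
  let ?e = "m + n + ?u - ?s"
  have O: "?A \<in> Ob C" "?C \<in> Ob C" using sums_Ob assms ij by auto
  have D: "Diff C ?A ?C ?e (sum x K) = (\<Sum>l\<in>K. Diff C ?A ?C ?e (x l))"
    if "finite K" "\<And>l. l \<in> K \<Longrightarrow> x l \<in> Hom C ?A ?C ?e" for K x
    using that by (induction K) (auto simp: Diff_zero Diff_add sum_Hom O)
  have "mat_Diff C a c (m + n) (mat_Comp C a b c g f) i j
      = (\<Sum>l\<in>?L. ksign ?u (Diff C ?A ?C ?e (Comp C ?A (ob_at b l) ?C (g i l) (f l j))))"
    using ij D[OF mat_column(1)[OF f], of j "\<lambda>l. Comp C ?A (ob_at b l) ?C (g i l) (f l j)"]
      entry_Comp_Hom[OF assms ij]
    by (simp add: mat_Diff_eq mat_Comp_eq ksign_sum[symmetric])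
  also have "\<dots> = (\<Sum>l\<in>?L. Comp C ?A (ob_at b l) ?C (mat_Diff C b c m g i l) (f l j)
      + ksign m (Comp C ?A (ob_at b l) ?C (g i l) (mat_Diff C a b n f l j)))"
  proof (rule sum.cong[OF refl])
    fix l assume "l \<in> ?L"
    then have l: "l \<in> dom b" by auto
    let ?B = "ob_at b l" and ?t = "sh_at b l"
    have B: "?B \<in> Ob C" using sums_Ob assms l by auto
    note G = mat_entry[OF g l ij(2)] and Fm = mat_entry[OF f ij(1) l]
    have deg: "(m + ?u - ?t) + (n + ?t - ?s) = ?e" by simp
    have "ksign ?u (Diff C ?A ?C ?e (Comp C ?A ?B ?C (g i l) (f l j)))
        = ksign ?u (Comp C ?A ?B ?C (Diff C ?B ?C (m + ?u - ?t) (g i l)) (f l j))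
          + ksign (?u + (m + ?u - ?t)) (Comp C ?A ?B ?C (g i l) (Diff C ?A ?B (n + ?t - ?s) (f l j)))"
      using Diff_Comp[OF O(1) B O(2) G Fm] unfolding deg by (simp add: ksign_add)
    \<comment> \<open>The shift of the target enters twice, so \<open>?u + (m + ?u - ?t)\<close> and
      \<open>m + ?t\<close> have the same parity.\<close>
    also have "ksign (?u + (m + ?u - ?t)) (Comp C ?A ?B ?C (g i l) (Diff C ?A ?B (n + ?t - ?s) (f l j)))
        = ksign m (ksign ?t (Comp C ?A ?B ?C (g i l) (Diff C ?A ?B (n + ?t - ?s) (f l j))))"
      unfolding ksign_ksign by (rule ksign_cong) simp
    finally show "ksign ?u (Diff C ?A ?C ?e (Comp C ?A ?B ?C (g i l) (f l j)))
        = Comp C ?A ?B ?C (mat_Diff C b c m g i l) (f l j)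
          + ksign m (Comp C ?A ?B ?C (g i l) (mat_Diff C a b n f l j))"
      using ij l by (simp add: mat_Diff_eq Comp_ksign_left[OF O(1) B O(2) Diff_Hom[OF B O(2) G] Fm]
          Comp_ksign_right[OF O(1) B O(2) G Diff_Hom[OF O(1) B Fm]])
  qed
  also have "\<dots> = mat_Comp C a b c (mat_Diff C b c m g) f i j
      + ksign m (\<Sum>l\<in>?L. Comp C ?A (ob_at b l) ?C (g i l) (mat_Diff C a b n f l j))"
    using ij by (simp add: sum.distrib ksign_sum mat_Comp_eq)
  also have "(\<Sum>l\<in>?L. Comp C ?A (ob_at b l) ?C (g i l) (mat_Diff C a b n f l j))
      = mat_Comp C a b c g (mat_Diff C a b n f) i j"
  proof (rule mat_Comp_superset[OF assms(1-3) g ij mat_column[OF f], symmetric])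
    show "{l \<in> dom b. mat_Diff C a b n f l j \<noteq> 0} \<subseteq> ?L"
    proof (intro subsetI CollectI conjI notI)
      fix l assume l: "l \<in> {l \<in> dom b. mat_Diff C a b n f l j \<noteq> 0}"
      then show "l \<in> dom b" by simp
      assume "f l j = 0"
      then have "mat_Diff C a b n f l j = 0"
        by (simp add: mat_Diff_eq Diff_zero[OF sums_Ob[OF assms(1)] sums_Ob[OF assms(2)]])
      with l show False by simp
    qed
  qed
  finally show "mat_Diff C a c (m + n) (mat_Comp C a b c g f) i j
    = (mat_Comp C a b c (mat_Diff C b c m g) f + ksign m (mat_Comp C a b c g (mat_Diff C a b n f))) i j"
    by (simp add: ksign_def)
qed (auto simp: mat_Comp_eq mat_Diff_eq ksign_def)

lemma mat_Diff_Hom: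
  assumes "a \<in> sums" "b \<in> sums" "f \<in> mat_Hom C a b n"
  shows "mat_Diff C a b n f \<in> mat_Hom C a b (n + 1)"
proof (rule mat_HomI)
  fix i j assume ij: "j \<in> dom a" "i \<in> dom b"
  note O = sums_Ob[OF assms(1) ij(1)] sums_Ob[OF assms(2) ij(2)]
  have deg: "n + 1 + sh_at b i - sh_at a j = n + sh_at b i - sh_at a j + 1" by simp
  show "mat_Diff C a b n f i j \<in> Hom C (ob_at a j) (ob_at b i) (n + 1 + sh_at b i - sh_at a j)"
    unfolding deg using ij ksign_Hom[OF O Diff_Hom[OF O mat_entry[OF assms(3) ij]]]
    by (simp add: mat_Diff_eq)
next
  fix j
  have "mat_Diff C a b n f i j = 0" if "f i j = 0" for i
    using that by (simp add: mat_Diff_eq Diff_zero[OF sums_Ob[OF assms(1)] sums_Ob[OF assms(2)]])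
  then have "{i. mat_Diff C a b n f i j \<noteq> 0} \<subseteq> {i. f i j \<noteq> 0}" by blast
  then show "finite {i. mat_Diff C a b n f i j \<noteq> 0}" using mat_finite[OF assms(3)] by (rule finite_subset)
qed (auto simp: mat_Diff_eq)

lemma mat_zero_Hom: "a \<in> sums \<Longrightarrow> b \<in> sums \<Longrightarrow> 0 \<in> mat_Hom C a b n"
  by (rule mat_HomI) (simp_all add: zero_Hom[OF sums_Ob sums_Ob])

lemma mat_add_Hom:
  assumes "a \<in> sums" "b \<in> sums" "f \<in> mat_Hom C a b n" "g \<in> mat_Hom C a b n"
  shows "f + g \<in> mat_Hom C a b n"
proof (rule mat_HomI)
  fix j
  have "{i. (f + g) i j \<noteq> 0} \<subseteq> {i. f i j \<noteq> 0} \<union> {i. g i j \<noteq> 0}" by auto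
  then show "finite {i. (f + g) i j \<noteq> 0}"
    using mat_finite[OF assms(3)] mat_finite[OF assms(4)] by (meson finite_UnI finite_subset)
qed (simp_all add: mat_outside[OF assms(3)] mat_outside[OF assms(4)]
    add_Hom[OF sums_Ob[OF assms(1)] sums_Ob[OF assms(2)] mat_entry[OF assms(3)] mat_entry[OF assms(4)]])

lemma mat_Scale_Hom:
  assumes "a \<in> sums" "b \<in> sums" "f \<in> mat_Hom C a b n"
  shows "mat_Scale C c f \<in> mat_Hom C a b n"
proof (rule mat_HomI)
  fix j
  have "{i. mat_Scale C c f i j \<noteq> 0} \<subseteq> {i. f i j \<noteq> 0}" by (auto simp: mat_Scale_def)
  then show "finite {i. mat_Scale C c f i j \<noteq> 0}" using mat_finite[OF assms(3)] by (rule finite_subset)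
qed (auto simp: mat_Scale_eq[OF assms] simp del: domIff
    intro: Scale_Hom[OF sums_Ob[OF assms(1)] sums_Ob[OF assms(2)] mat_entry[OF assms(3)]])

lemma dg_category_matrices: "dg_category (matrices C)"
proof (unfold_locales, unfold matrices_def dgcat.simps, goal_cases)
  case (1 a b n)
  then show ?case by (rule mat_zero_Hom)
next
  case (2 a b f n g)
  then show ?case by (rule mat_add_Hom)
next
  case (3 a b f n c)
  then show ?case by (rule mat_Scale_Hom)
next
  case (4 a b f n g c)
  show ?case
    by (rule mat_eqI[of a b])
      (simp_all add: mat_Scale_eq[OF 4(1,2) mat_add_Hom[OF 4]] mat_Scale_eq[OF 4(1,2,3)] mat_Scale_eq[OF 4(1,2,4)]
        Scale_add_right[OF sums_Ob[OF 4(1)] sums_Ob[OF 4(2)] mat_entry[OF 4(3)] mat_entry[OF 4(4)]], (auto)?)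
next
  case (5 a b f n c d)
  show ?case
    by (rule mat_eqI[of a b])
      (simp_all add: mat_Scale_eq[OF 5] Scale_add_left[OF sums_Ob[OF 5(1)] sums_Ob[OF 5(2)] mat_entry[OF 5(3)]], (auto)?)
next
  case (6 a b f n c d)
  show ?case
    by (rule mat_eqI[of a b])
      (simp_all add: mat_Scale_eq[OF 6] mat_Scale_eq[OF 6(1,2) mat_Scale_Hom[OF 6]]
        Scale_Scale[OF sums_Ob[OF 6(1)] sums_Ob[OF 6(2)] mat_entry[OF 6(3)]], (auto)?)
next
  case (7 a b f n)
  show ?case
    by (rule mat_eqI[of a b])
      (simp_all add: mat_Scale_eq[OF 7] mat_outside[OF 7(3)]
        Scale_one[OF sums_Ob[OF 7(1)] sums_Ob[OF 7(2)] mat_entry[OF 7(3)]], (auto)?)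
next
  case (8 a b c g m f n)
  then show ?case by (rule mat_Comp_Hom)
next
  case (9 a b c g m g' f n)
  show ?case
    by (rule mat_eqI[of a c])
      (auto simp: mat_Comp_eq sum.distrib[symmetric] intro!: sum.cong
        Comp_add_left[OF sums_Ob[OF 9(1)] sums_Ob[OF 9(2)] sums_Ob[OF 9(3)] mat_entry[OF 9(4)] mat_entry[OF 9(5)] mat_entry[OF 9(6)]])
next
  case (10 a b c g m f n f')
  show ?case
  proof (rule mat_eqI[of a c])
    fix i j assume ij: "j \<in> dom a" "i \<in> dom c"
    let ?S = "{l \<in> dom b. f l j \<noteq> 0} \<union> {l \<in> dom b. f' l j \<noteq> 0}"
    have S: "finite ?S" "?S \<subseteq> dom b" using mat_column[OF 10(5)] mat_column[OF 10(6)] by auto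
    note sup = mat_Comp_superset[OF 10(1-4) ij S]
    have "mat_Comp C a b c g (f + f') i j
        = (\<Sum>l\<in>?S. Comp C (ob_at a j) (ob_at b l) (ob_at c i) (g i l) ((f + f') l j))"
      by (rule sup) auto
    also have "\<dots> = (\<Sum>l\<in>?S. Comp C (ob_at a j) (ob_at b l) (ob_at c i) (g i l) (f l j)
        + Comp C (ob_at a j) (ob_at b l) (ob_at c i) (g i l) (f' l j))"
      using ij by (intro sum.cong refl)
        (auto intro!: Comp_add_right[OF sums_Ob[OF 10(1)] sums_Ob[OF 10(2)] sums_Ob[OF 10(3)]
           mat_entry[OF 10(4)] mat_entry[OF 10(5)] mat_entry[OF 10(6)]])
    also have "\<dots> = mat_Comp C a b c g f i j + mat_Comp C a b c g f' i j"
      using sup[of f] sup[of f'] by (simp add: sum.distrib)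
    finally show "mat_Comp C a b c g (f + f') i j = (mat_Comp C a b c g f + mat_Comp C a b c g f') i j" by simp
  qed (auto simp: mat_Comp_eq)
next
  case (11 a b c g m f n k)
  show ?case
  proof (rule mat_eqI[of a c])
    fix i j assume ij: "j \<in> dom a" "i \<in> dom c"
    have H: "Comp C (ob_at a j) (ob_at b l) (ob_at c i) (g i l) (f l j)
        \<in> Hom C (ob_at a j) (ob_at c i) (m + n + sh_at c i - sh_at a j)" if "l \<in> {l \<in> dom b. f l j \<noteq> 0}" for l
      using entry_Comp_Hom[OF 11 ij] that by simp
    have "mat_Comp C a b c (mat_Scale C k g) f i j
        = (\<Sum>l\<in>{l \<in> dom b. f l j \<noteq> 0}. Scale C k (Comp C (ob_at a j) (ob_at b l) (ob_at c i) (g i l) (f l j)))"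
      using ij by (auto simp: mat_Comp_eq mat_Scale_eq[OF 11(2,3,4)] intro!: sum.cong
        Comp_Scale_left[OF sums_Ob[OF 11(1)] sums_Ob[OF 11(2)] sums_Ob[OF 11(3)] mat_entry[OF 11(4)] mat_entry[OF 11(5)]])
    also have "\<dots> = Scale C k (mat_Comp C a b c g f i j)"
      using ij Scale_sum[where I = "{l \<in> dom b. f l j \<noteq> 0}" and a = k
          and f = "\<lambda>l. Comp C (ob_at a j) (ob_at b l) (ob_at c i) (g i l) (f l j)", OF sums_Ob[OF 11(1) ij(1)] sums_Ob[OF 11(3) ij(2)] H] by (simp add: mat_Comp_eq)
    finally show "mat_Comp C a b c (mat_Scale C k g) f i j = mat_Scale C k (mat_Comp C a b c g f) i j"
      using ij by (simp add: mat_Scale_eq[OF 11(1,3) mat_Comp_Hom[OF 11]])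
  qed (auto simp: mat_Comp_eq mat_Scale_def)
next
  case (12 a b c g m f n k)
  show ?case
  proof (rule mat_eqI[of a c])
    fix i j assume ij: "j \<in> dom a" "i \<in> dom c"
    let ?L = "{l \<in> dom b. f l j \<noteq> 0}"
    have H: "Comp C (ob_at a j) (ob_at b l) (ob_at c i) (g i l) (f l j)
        \<in> Hom C (ob_at a j) (ob_at c i) (m + n + sh_at c i - sh_at a j)" if "l \<in> {l \<in> dom b. f l j \<noteq> 0}" for l
      using entry_Comp_Hom[OF 12 ij] that by simp
    have "mat_Comp C a b c g (mat_Scale C k f) i j
        = (\<Sum>l\<in>?L. Comp C (ob_at a j) (ob_at b l) (ob_at c i) (g i l) (mat_Scale C k f l j))"
      by (rule mat_Comp_superset[OF 12(1-4) ij mat_column[OF 12(5)]]) (auto simp: mat_Scale_def)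
    also have "\<dots> = (\<Sum>l\<in>?L. Scale C k (Comp C (ob_at a j) (ob_at b l) (ob_at c i) (g i l) (f l j)))"
      using ij by (auto simp: mat_Scale_eq[OF 12(1,2,5)] intro!: sum.cong
        Comp_Scale_right[OF sums_Ob[OF 12(1)] sums_Ob[OF 12(2)] sums_Ob[OF 12(3)] mat_entry[OF 12(4)] mat_entry[OF 12(5)]])
    also have "\<dots> = Scale C k (mat_Comp C a b c g f i j)"
      using ij Scale_sum[where I = "{l \<in> dom b. f l j \<noteq> 0}" and a = k
          and f = "\<lambda>l. Comp C (ob_at a j) (ob_at b l) (ob_at c i) (g i l) (f l j)", OF sums_Ob[OF 12(1) ij(1)] sums_Ob[OF 12(3) ij(2)] H] by (simp add: mat_Comp_eq)
    finally show "mat_Comp C a b c g (mat_Scale C k f) i j = mat_Scale C k (mat_Comp C a b c g f) i j"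
      using ij by (simp add: mat_Scale_eq[OF 12(1,3) mat_Comp_Hom[OF 12]])
  qed (auto simp: mat_Comp_eq mat_Scale_def)
next
  case (13 a b c d h l g m f n)
  then show ?case by (rule mat_Comp_assoc)
next
  case (14 a)
  show ?case
  proof (rule mat_HomI)
    fix j
    have "{i. mat_Ident C a i j \<noteq> 0} \<subseteq> {j}" by (auto simp: mat_Ident_eq)
    then show "finite {i. mat_Ident C a i j \<noteq> 0}" by (rule finite_subset) simp
  next
    fix i j assume "j \<in> dom a" "i \<in> dom a"
    then show "mat_Ident C a i j \<in> Hom C (ob_at a j) (ob_at a i) (0 + sh_at a i - sh_at a j)"
      using sums_Ob[OF 14] by (simp add: mat_Ident_eq zero_Hom Ident_Hom)
  qed (auto simp: mat_Ident_eq)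
next
  case (15 a b f n)
  show ?case
  proof (rule mat_eqI[of a b])
    fix i j assume ij: "j \<in> dom a" "i \<in> dom b"
    have "Comp C (ob_at a j) (ob_at b l) (ob_at b i) (mat_Ident C b i l) (f l j) = (if l = i then f l j else 0)"
      if l: "l \<in> dom b" for l
      using ij Comp_zero_left[OF sums_Ob[OF 15(1) ij(1)] sums_Ob[OF 15(2) l] sums_Ob[OF 15(2) ij(2)] mat_entry[OF 15(3) ij(1) l]]
        Comp_Ident_left[OF sums_Ob[OF 15(1) ij(1)] sums_Ob[OF 15(2) l] mat_entry[OF 15(3) ij(1) l]]
      by (cases "l = i") (simp_all add: mat_Ident_eq)
    then have "mat_Comp C a b b (mat_Ident C b) f i j = (\<Sum>l\<in>{l \<in> dom b. f l j \<noteq> 0}. if l = i then f l j else 0)"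
      using ij by (simp add: mat_Comp_eq)
    also have "\<dots> = f i j" using mat_column[OF 15(3)] ij by (simp add: sum.delta)
    finally show "mat_Comp C a b b (mat_Ident C b) f i j = f i j" .
  qed (auto simp: mat_Comp_eq mat_outside[OF 15(3)])
next
  case (16 a b f n)
  show ?case
  proof (rule mat_eqI[of a b])
    fix i j assume ij: "j \<in> dom a" "i \<in> dom b"
    have "mat_Comp C a a b f (mat_Ident C a) i j
        = (\<Sum>l\<in>{j}. Comp C (ob_at a j) (ob_at a l) (ob_at b i) (f i l) (mat_Ident C a l j))"
      by (rule mat_Comp_superset[OF 16(1,1,2,3) ij]) (use ij in \<open>auto simp: mat_Ident_eq\<close>)
    also have "\<dots> = f i j"
      using ij by (simp add: mat_Ident_eq Comp_Ident_right[OF sums_Ob[OF 16(1)] sums_Ob[OF 16(2)] mat_entry[OF 16(3)]])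
    finally show "mat_Comp C a a b f (mat_Ident C a) i j = f i j" .
  qed (auto simp: mat_Comp_eq mat_outside[OF 16(3)])
next
  case (17 a b f n)
  then show ?case by (rule mat_Diff_Hom)
next
  case (18 a b f n g)
  show ?case
    by (rule mat_eqI[of a b])
      (simp_all add: mat_Diff_eq ksign_add
        Diff_add[OF sums_Ob[OF 18(1)] sums_Ob[OF 18(2)] mat_entry[OF 18(3)] mat_entry[OF 18(4)]], (auto)?)
next
  case (19 a b f n c)
  show ?case
    by (rule mat_eqI[of a b])
      (simp_all add: mat_Diff_eq mat_Scale_eq[OF 19] mat_Scale_eq[OF 19(1,2) mat_Diff_Hom[OF 19]]
        Diff_Scale[OF sums_Ob[OF 19(1)] sums_Ob[OF 19(2)] mat_entry[OF 19(3)]]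
        Scale_ksign[OF sums_Ob[OF 19(1)] sums_Ob[OF 19(2)] Diff_Hom[OF sums_Ob[OF 19(1)] sums_Ob[OF 19(2)] mat_entry[OF 19(3)]]], (auto)?)
next
  case (20 a b f n)
  show ?case
  proof (rule mat_eqI[of a b])
    fix i j assume ij: "j \<in> dom a" "i \<in> dom b"
    let ?e = "n + sh_at b i - sh_at a j"
    have e: "n + 1 + sh_at b i - sh_at a j = ?e + 1" by simp
    note O = sums_Ob[OF 20(1) ij(1)] sums_Ob[OF 20(2) ij(2)] and H = mat_entry[OF 20(3) ij]
    show "mat_Diff C a b (n + 1) (mat_Diff C a b n f) i j = 0 i j"
      using ij unfolding mat_Diff_eq e
      by (simp add: Diff_ksign[OF O Diff_Hom[OF O H]] Diff_Diff[OF O H])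
  qed (auto simp: mat_Diff_eq)
next
  case (21 a b c g m f n)
  then show ?case by (rule mat_Diff_Comp)
qed

end

section \<open>Twisting\<close>

text \<open>Formulated for an arbitrary dg category \<open>M\<close>, so that d^2 = 0 and the
  Leibniz rule of twisted complexes are checked without matrix indices.\<close>

definition twist :: "('k, 'o, 'm::ab_group_add) dgcat \<Rightarrow> 't set \<Rightarrow> ('t \<Rightarrow> 'o) \<Rightarrow> ('t \<Rightarrow> 'm) \<Rightarrow> ('k, 't, 'm) dgcat" where
  "twist M S ob q = \<lparr>Ob = S, Hom = (\<lambda>X Y. Hom M (ob X) (ob Y)), Scale = Scale M,
     Comp = (\<lambda>X Y Z. Comp M (ob X) (ob Y) (ob Z)), Ident = (\<lambda>X. Ident M (ob X)),
     Diff = (\<lambda>X Y n f. Diff M (ob X) (ob Y) n f + Comp M (ob X) (ob Y) (ob Y) (q Y) f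
        - ksign n (Comp M (ob X) (ob X) (ob Y) f (q X)))\<rparr>"

lemma twist_simps:
  "Ob (twist M S ob q) = S" "Hom (twist M S ob q) X Y n = Hom M (ob X) (ob Y) n" "Scale (twist M S ob q) = Scale M"
  "Comp (twist M S ob q) X Y Z = Comp M (ob X) (ob Y) (ob Z)" "Ident (twist M S ob q) X = Ident M (ob X)"
  "Diff (twist M S ob q) X Y n f = Diff M (ob X) (ob Y) n f + Comp M (ob X) (ob Y) (ob Y) (q Y) f
        - ksign n (Comp M (ob X) (ob X) (ob Y) f (q X))"
  by (simp_all add: twist_def)

lemma dg_category_twist:
  assumes "dg_category M" and ob: "\<And>X. X \<in> S \<Longrightarrow> ob X \<in> Ob M"
    and q: "\<And>X. X \<in> S \<Longrightarrow> q X \<in> Hom M (ob X) (ob X) 1"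
    and mc: "\<And>X. X \<in> S \<Longrightarrow> Diff M (ob X) (ob X) 1 (q X) + Comp M (ob X) (ob X) (ob X) (q X) (q X) = 0"
  shows "dg_category (twist M S ob q)"
proof -
  interpret M: dg_category M by fact
  note tw = twist_simps
  have qf: "Comp M (ob X) (ob Y) (ob Y) (q Y) f \<in> Hom M (ob X) (ob Y) (n + 1)"
    and fq: "Comp M (ob X) (ob X) (ob Y) f (q X) \<in> Hom M (ob X) (ob Y) (n + 1)"
    if "X \<in> S" "Y \<in> S" "f \<in> Hom M (ob X) (ob Y) n" for X Y f n
    using M.Comp_Hom[OF ob[OF that(1)] ob[OF that(2)] ob[OF that(2)] q[OF that(2)] that(3)]
      M.Comp_Hom[OF ob[OF that(1)] ob[OF that(1)] ob[OF that(2)] that(3) q[OF that(1)]]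
    by (simp_all add: add.commute)
  show ?thesis
  proof (unfold_locales, unfold tw, goal_cases)
    case (1 X Y n)
    then show ?case by (rule M.zero_Hom[OF ob[of X] ob[of Y]])
  next
    case (2 X Y f n g)
    then show ?case by (rule M.add_Hom[OF ob[of X] ob[of Y]])
  next
    case (3 X Y f n a)
    then show ?case by (rule M.Scale_Hom[OF ob[of X] ob[of Y]])
  next
    case (4 X Y f n g a)
    then show ?case by (rule M.Scale_add_right[OF ob[of X] ob[of Y]])
  next
    case (5 X Y f n a b)
    then show ?case by (rule M.Scale_add_left[OF ob[of X] ob[of Y]])
  next
    case (6 X Y f n a b)
    then show ?case by (rule M.Scale_Scale[OF ob[of X] ob[of Y]])
  next
    case (7 X Y f n)
    then show ?case by (rule M.Scale_one[OF ob[of X] ob[of Y]])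
  next
    case (8 X Y Z g m f n)
    then show ?case by (rule M.Comp_Hom[OF ob[of X] ob[of Y] ob[of Z]])
  next
    case (9 X Y Z g m g' f n)
    then show ?case by (rule M.Comp_add_left[OF ob[of X] ob[of Y] ob[of Z]])
  next
    case (10 X Y Z g m f n f')
    then show ?case by (rule M.Comp_add_right[OF ob[of X] ob[of Y] ob[of Z]])
  next
    case (11 X Y Z g m f n a)
    then show ?case by (rule M.Comp_Scale_left[OF ob[of X] ob[of Y] ob[of Z]])
  next
    case (12 X Y Z g m f n a)
    then show ?case by (rule M.Comp_Scale_right[OF ob[of X] ob[of Y] ob[of Z]])
  next
    case (13 W X Y Z h l g m f n)
    then show ?case by (rule M.Comp_assoc[OF ob[of W] ob[of X] ob[of Y] ob[of Z]])
  next
    case (14 X)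
    then show ?case by (rule M.Ident_Hom[OF ob[of X]])
  next
    case (15 X Y f n)
    then show ?case by (rule M.Comp_Ident_left[OF ob[of X] ob[of Y]])
  next
    case (16 X Y f n)
    then show ?case by (rule M.Comp_Ident_right[OF ob[of X] ob[of Y]])
  next
    case (17 X Y f n)
    note O = ob[OF 17(1)] ob[OF 17(2)]
    show ?case
      by (intro M.diff_Hom[OF O] M.add_Hom[OF O] M.ksign_Hom[OF O] M.Diff_Hom[OF O] qf fq 17)
  next
    case (18 X Y f n g)
    note O = ob[OF 18(1)] ob[OF 18(2)]
    show ?case
      by (simp add: M.Diff_add[OF O 18(3,4)] M.Comp_add_right[OF O(1,2,2) q[OF 18(2)] 18(3,4)]
          M.Comp_add_left[OF O(1,1,2) 18(3,4) q[OF 18(1)]] ksign_add)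
  next
    case (19 X Y f n a)
    note O = ob[OF 19(1)] ob[OF 19(2)]
    note F = M.Diff_Hom[OF O 19(3)] qf[OF 19] fq[OF 19]
    have "Scale M a (Diff M (ob X) (ob Y) n f + Comp M (ob X) (ob Y) (ob Y) (q Y) f
        - ksign n (Comp M (ob X) (ob X) (ob Y) f (q X)))
      = Scale M a (Diff M (ob X) (ob Y) n f) + Scale M a (Comp M (ob X) (ob Y) (ob Y) (q Y) f)
        - ksign n (Scale M a (Comp M (ob X) (ob X) (ob Y) f (q X)))"
      using M.Scale_add_right[OF O M.add_Hom[OF O F(1,2)] M.uminus_Hom[OF O M.ksign_Hom[OF O F(3)]], of a n]
      by (simp add: M.Scale_add_right[OF O F(1,2)] M.Scale_uminus[OF O M.ksign_Hom[OF O F(3)]] M.Scale_ksign[OF O F(3)])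
    then show ?case
      by (simp add: M.Diff_Scale[OF O 19(3)] M.Comp_Scale_right[OF O(1,2,2) q[OF 19(2)] 19(3)]
          M.Comp_Scale_left[OF O(1,1,2) 19(3) q[OF 19(1)]])
  next
    case (20 X Y f n)
    note O = ob[OF 20(1)] ob[OF 20(2)] and Q = q[OF 20(1)] q[OF 20(2)]
    note d = M.Diff_Hom[OF O 20(3)] and qf' = qf[OF 20] and fq' = fq[OF 20]
    let ?d = "Diff M (ob X) (ob Y)" and ?x = "ob X" and ?y = "ob Y"
    let ?df = "?d n f" and ?qf = "Comp M ?x ?y ?y (q Y) f" and ?fq = "Comp M ?x ?x ?y f (q X)"
    have mcX: "Comp M ?x ?x ?y f (Diff M ?x ?x 1 (q X)) = - Comp M ?x ?x ?y f (Comp M ?x ?x ?x (q X) (q X))"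
    proof -
      have "Diff M ?x ?x 1 (q X) = - Comp M ?x ?x ?x (q X) (q X)" using mc[OF 20(1)] by (simp add: eq_neg_iff_add_eq_0)
      then show ?thesis
        using M.Comp_uminus_right[OF O(1,1,2) 20(3) M.Comp_Hom[OF O(1,1,1) Q(1) Q(1)]] by simp
    qed
    have mcY: "Comp M ?x ?y ?y (Diff M ?y ?y 1 (q Y)) f = - Comp M ?x ?y ?y (Comp M ?y ?y ?y (q Y) (q Y)) f"
    proof -
      have "Diff M ?y ?y 1 (q Y) = - Comp M ?y ?y ?y (q Y) (q Y)" using mc[OF 20(2)] by (simp add: eq_neg_iff_add_eq_0)
      then show ?thesis
        using M.Comp_uminus_left[OF O(1,2,2) M.Comp_Hom[OF O(2,2,2) Q(2) Q(2)] 20(3)] by simp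
    qed
    have s: "?df + ?qf \<in> Hom M ?x ?y (n + 1)" by (rule M.add_Hom[OF O d qf'])
    note kfq = M.ksign_Hom[OF O fq', of n]
    have dqf: "?d (n + 1) ?qf = - Comp M ?x ?y ?y (Comp M ?y ?y ?y (q Y) (q Y)) f - Comp M ?x ?y ?y (q Y) ?df"
      using M.Diff_Comp[OF O(1,2,2) Q(2) 20(3)] mcY by (simp add: add.commute[of 1] ksign_def)
    have dfq: "?d (n + 1) ?fq = Comp M ?x ?x ?y ?df (q X) - ksign n (Comp M ?x ?x ?y f (Comp M ?x ?x ?x (q X) (q X)))"
      using M.Diff_Comp[OF O(1,1,2) 20(3) Q(1)] mcX by (simp add: ksign_uminus)
    have e1: "?d (n + 1) (?df + ?qf - ksign n ?fq) = ?d (n + 1) ?qf - ksign n (?d (n + 1) ?fq)"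
      by (simp add: M.Diff_diff[OF O s kfq] M.Diff_add[OF O d qf'] M.Diff_ksign[OF O fq'] M.Diff_Diff[OF O 20(3)])
    have e2: "Comp M ?x ?y ?y (q Y) (?df + ?qf - ksign n ?fq) = Comp M ?x ?y ?y (q Y) ?df
        + Comp M ?x ?y ?y (q Y) ?qf - ksign n (Comp M ?x ?y ?y (q Y) ?fq)"
      using M.Comp_add_right[OF O(1,2,2) Q(2) s M.uminus_Hom[OF O kfq]]
      by (simp add: M.Comp_add_right[OF O(1,2,2) Q(2) d qf'] M.Comp_uminus_right[OF O(1,2,2) Q(2) kfq]
          M.Comp_ksign_right[OF O(1,2,2) Q(2) fq'])
    have e3: "Comp M ?x ?x ?y (?df + ?qf - ksign n ?fq) (q X) = Comp M ?x ?x ?y ?df (q X)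
        + Comp M ?x ?x ?y ?qf (q X) - ksign n (Comp M ?x ?x ?y ?fq (q X))"
      using M.Comp_add_left[OF O(1,1,2) s M.uminus_Hom[OF O kfq] Q(1)]
      by (simp add: M.Comp_add_left[OF O(1,1,2) d qf' Q(1)] M.Comp_uminus_left[OF O(1,1,2) kfq Q(1)]
          M.Comp_ksign_left[OF O(1,1,2) fq' Q(1)])
    have a: "Comp M ?x ?y ?y (q Y) ?qf = Comp M ?x ?y ?y (Comp M ?y ?y ?y (q Y) (q Y)) f"
      "Comp M ?x ?x ?y ?qf (q X) = Comp M ?x ?y ?y (q Y) ?fq"
      "Comp M ?x ?x ?y ?fq (q X) = Comp M ?x ?x ?y f (Comp M ?x ?x ?x (q X) (q X))"
      using M.Comp_assoc[OF O(1,2,2,2) Q(2) Q(2) 20(3)] M.Comp_assoc[OF O(1,1,2,2) Q(2) 20(3) Q(1)]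
        M.Comp_assoc[OF O(1,1,1,2) 20(3) Q(1) Q(1)] by simp_all
    \<comment> \<open>The terms in q df, df q and q f q cancel in pairs; those in q q f and f q q
      cancel because dq = - q q.\<close>
    show ?case unfolding e1 e2 e3 a dqf dfq by (simp add: ksign_def)
  next
    case (21 X Y Z g m f n)
    note O = ob[OF 21(1)] ob[OF 21(2)] ob[OF 21(3)] and Q = q[OF 21(1)] q[OF 21(2)] q[OF 21(3)]
    let ?x = "ob X" and ?y = "ob Y" and ?z = "ob Z"
    note H = 21(4) 21(5)
    note dg = M.Diff_Hom[OF O(2,3) H(1)] and qg = qf[OF 21(2,3) H(1)] and gq = fq[OF 21(2,3) H(1)]
    note df = M.Diff_Hom[OF O(1,2) H(2)] and qf' = qf[OF 21(1,2) H(2)] and fq' = fq[OF 21(1,2) H(2)]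
    have L: "Comp M ?x ?y ?z (Diff M ?y ?z m g + Comp M ?y ?z ?z (q Z) g - ksign m (Comp M ?y ?y ?z g (q Y))) f
      = Comp M ?x ?y ?z (Diff M ?y ?z m g) f + Comp M ?x ?z ?z (q Z) (Comp M ?x ?y ?z g f)
        - ksign m (Comp M ?x ?y ?z g (Comp M ?x ?y ?y (q Y) f))"
      using M.Comp_add_left[OF O M.add_Hom[OF O(2,3) dg qg] M.uminus_Hom[OF O(2,3) M.ksign_Hom[OF O(2,3) gq]] H(2), of m]
      by (simp add: M.Comp_add_left[OF O dg qg H(2)] M.Comp_uminus_left[OF O M.ksign_Hom[OF O(2,3) gq] H(2)]
          M.Comp_ksign_left[OF O gq H(2)] M.Comp_assoc[OF O(1,2,3,3) Q(3) H] M.Comp_assoc[OF O(1,2,2,3) H(1) Q(2) H(2)])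
    have R: "Comp M ?x ?y ?z g (Diff M ?x ?y n f + Comp M ?x ?y ?y (q Y) f - ksign n (Comp M ?x ?x ?y f (q X)))
      = Comp M ?x ?y ?z g (Diff M ?x ?y n f) + Comp M ?x ?y ?z g (Comp M ?x ?y ?y (q Y) f)
        - ksign n (Comp M ?x ?x ?z (Comp M ?x ?y ?z g f) (q X))"
      using M.Comp_add_right[OF O H(1) M.add_Hom[OF O(1,2) df qf'] M.uminus_Hom[OF O(1,2) M.ksign_Hom[OF O(1,2) fq']], of n]
      by (simp add: M.Comp_add_right[OF O H(1) df qf'] M.Comp_uminus_right[OF O H(1) M.ksign_Hom[OF O(1,2) fq']]
          M.Comp_ksign_right[OF O H(1) fq'] M.Comp_assoc[OF O(1,1,2,3) H Q(1)])
    \<comment> \<open>The inner terms g q_Y f from the two factors have opposite signs.\<close>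
    show ?case unfolding L R M.Diff_Comp[OF O H] by (simp add: ksign_def)
  qed
qed

lemma dg_functor_twist:
  assumes F: "dg_functor M N F" and "dg_category (twist M S ob q)" "dg_category (twist N S' ob' q')"
    and fo: "\<And>X. X \<in> S \<Longrightarrow> fo X \<in> S'"
    and ob': "\<And>X. X \<in> S \<Longrightarrow> ob' (fo X) = FOb F (ob X)"
    and q': "\<And>X. X \<in> S \<Longrightarrow> q' (fo X) = FMor F (ob X) (ob X) 1 (q X)"
    and ob: "\<And>X. X \<in> S \<Longrightarrow> ob X \<in> Ob M" and q: "\<And>X. X \<in> S \<Longrightarrow> q X \<in> Hom M (ob X) (ob X) 1"
  shows "dg_functor (twist M S ob q) (twist N S' ob' q') \<lparr>FOb = fo, FMor = (\<lambda>X Y. FMor F (ob X) (ob Y))\<rparr>"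
proof -
  interpret F: dg_functor M N F by fact
  interpret A: dg_category "twist M S ob q" by fact
  interpret B: dg_category "twist N S' ob' q'" by fact
  show ?thesis
  proof (unfold_locales, unfold twist_simps dgfun.simps, goal_cases)
    case (7 X Y f n)
    note O = ob[OF 7(1)] ob[OF 7(2)] and Q = q[OF 7(1)] q[OF 7(2)]
    have qf: "Comp M (ob X) (ob Y) (ob Y) (q Y) f \<in> Hom M (ob X) (ob Y) (n + 1)"
      and fq: "Comp M (ob X) (ob X) (ob Y) f (q X) \<in> Hom M (ob X) (ob Y) (n + 1)"
      using F.source.Comp_Hom[OF O(1,2,2) Q(2) 7(3)] F.source.Comp_Hom[OF O(1,1,2) 7(3) Q(1)]
      by (simp_all add: add.commute)
    note d = F.source.Diff_Hom[OF O 7(3)]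
    have "FMor F (ob X) (ob Y) (n + 1) (Comp M (ob X) (ob Y) (ob Y) (q Y) f)
        = Comp N (FOb F (ob X)) (FOb F (ob Y)) (FOb F (ob Y)) (FMor F (ob Y) (ob Y) 1 (q Y)) (FMor F (ob X) (ob Y) n f)"
      using F.FMor_Comp[OF O(1,2,2) Q(2) 7(3)] by (simp add: add.commute)
    moreover have "FMor F (ob X) (ob Y) (n + 1) (Comp M (ob X) (ob X) (ob Y) f (q X))
        = Comp N (FOb F (ob X)) (FOb F (ob X)) (FOb F (ob Y)) (FMor F (ob X) (ob Y) n f) (FMor F (ob X) (ob X) 1 (q X))"
      using F.FMor_Comp[OF O(1,1,2) 7(3) Q(1)] by simp
    ultimately show ?case
      using 7 by (simp add: F.FMor_diff[OF O F.source.add_Hom[OF O d qf] F.source.ksign_Hom[OF O fq]]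
          F.FMor_add[OF O d qf] F.FMor_ksign[OF O fq] F.FMor_Diff[OF O 7(3)] ob' q')
  qed (auto simp: fo ob' ob F.FMor_Hom F.FMor_add F.FMor_Scale F.FMor_Comp F.FMor_Ident)
qed

section \<open>Twisted complexes\<close>

text \<open>\<open>Tw\<close> and \<open>Perf\<close> differ from \<open>all_twisted\<close> in the
  set of objects only, so one statement with a variable object set serves both.\<close>

lemma all_twisted_eq_twist: "all_twisted C\<lparr>Ob := S\<rparr> = twist (matrices C) S tw_sum tw_q"
  by (simp add: all_twisted_def twist_def matrices_def)

lemma matrices_simps: "Ob (matrices C) = {a. fst ` ran a \<subseteq> Ob C}" "Hom (matrices C) = mat_Hom C"
  "Scale (matrices C) = mat_Scale C" "Comp (matrices C) = mat_Comp C" "Ident (matrices C) = mat_Ident C"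
  "Diff (matrices C) = mat_Diff C"
  by (simp_all add: matrices_def)

context dg_category
begin

lemma twistedD:
  assumes "X \<in> twisted_complexes C"
  shows "tw_sum X \<in> sums" "tw_q X \<in> mat_Hom C (tw_sum X) (tw_sum X) 1"
    "tw_q X i j \<noteq> 0 \<Longrightarrow> i < j"
    "mat_Diff C (tw_sum X) (tw_sum X) 1 (tw_q X) + mat_Comp C (tw_sum X) (tw_sum X) (tw_sum X) (tw_q X) (tw_q X) = 0"
proof -
  obtain a q where "X = Twc a q" and *: "fst ` ran a \<subseteq> Ob C" "q \<in> mat_Hom C a a 1"
    "\<forall>i j. q i j \<noteq> 0 \<longrightarrow> i < j" "mat_Diff C a a 1 q + mat_Comp C a a a q q = 0"
    using assms unfolding twisted_complexes_def by blast
  then have X: "tw_sum X = a" "tw_q X = q" by simp_all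
  show "tw_sum X \<in> sums" "tw_q X \<in> mat_Hom C (tw_sum X) (tw_sum X) 1" "tw_q X i j \<noteq> 0 \<Longrightarrow> i < j"
    "mat_Diff C (tw_sum X) (tw_sum X) 1 (tw_q X) + mat_Comp C (tw_sum X) (tw_sum X) (tw_sum X) (tw_q X) (tw_q X) = 0"
    unfolding X using * by blast+
qed

lemma dg_category_twisted:
  assumes "S \<subseteq> twisted_complexes C"
  shows "dg_category (all_twisted C\<lparr>Ob := S\<rparr>)"
  unfolding all_twisted_eq_twist
  by (rule dg_category_twist[OF dg_category_matrices])
    (simp_all only: matrices_simps, (rule twistedD[OF subsetD[OF assms]], assumption)+)

end

abbreviation map_sums :: "('o, 'm, 'p, 'n) dgfun \<Rightarrow> 'o shifted_sum \<Rightarrow> 'p shifted_sum" where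
  "map_sums F a \<equiv> map_option (apfst (FOb F)) \<circ> a"

lemma map_sums_simps: "dom (map_sums F a) = dom a"
  "i \<in> dom a \<Longrightarrow> ob_at (map_sums F a) i = FOb F (ob_at a i)"
  "i \<in> dom a \<Longrightarrow> sh_at (map_sums F a) i = sh_at a i"
  by (auto simp: dom_def)

context dg_functor
begin

lemma map_sums_Ob: "a \<in> source.sums \<Longrightarrow> map_sums F a \<in> target.sums"
  by (force simp: ran_def FOb_Ob)

lemma mat_fun_Hom:
  assumes a: "a \<in> source.sums" "b \<in> source.sums" and f: "f \<in> mat_Hom C a b n"
  shows "mat_fun F a b n f \<in> mat_Hom D (map_sums F a) (map_sums F b) n"
proof (rule target.mat_HomI, unfold map_sums_simps(1))
  fix i j assume ij: "j \<in> dom a" "i \<in> dom b"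
  then show "mat_fun F a b n f i j \<in> Hom D (ob_at (map_sums F a) j) (ob_at (map_sums F b) i)
      (n + sh_at (map_sums F b) i - sh_at (map_sums F a) j)"
    using FMor_Hom[OF source.sums_Ob[OF a(1) ij(1)] source.sums_Ob[OF a(2) ij(2)] source.mat_entry[OF f ij]]
    by (simp add: mat_fun_eq map_sums_simps del: comp_apply)
next
  fix j
  have "mat_fun F a b n f i j = 0" if "f i j = 0" for i
    using that by (simp add: mat_fun_eq FMor_zero[OF source.sums_Ob[OF a(1)] source.sums_Ob[OF a(2)]])
  then have "{i. mat_fun F a b n f i j \<noteq> 0} \<subseteq> {i. f i j \<noteq> 0}" by blast
  then show "finite {i. mat_fun F a b n f i j \<noteq> 0}" using source.mat_finite[OF f] by (rule finite_subset)
qed (auto simp: mat_fun_eq)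

lemma mat_fun_Comp:
  assumes a: "a \<in> source.sums" "b \<in> source.sums" "c \<in> source.sums"
    and g: "g \<in> mat_Hom C b c m" and f: "f \<in> mat_Hom C a b n"
  shows "mat_fun F a c (m + n) (mat_Comp C a b c g f)
    = mat_Comp D (map_sums F a) (map_sums F b) (map_sums F c) (mat_fun F b c m g) (mat_fun F a b n f)"
proof (rule target.mat_eqI[of a c])
  fix i j assume ij: "j \<in> dom a" "i \<in> dom c"
  let ?L = "{l \<in> dom b. f l j \<noteq> 0}" and ?e = "m + n + sh_at c i - sh_at a j"
  note O = source.sums_Ob[OF a(1) ij(1)] source.sums_Ob[OF a(3) ij(2)]
  have H: "Comp C (ob_at a j) (ob_at b l) (ob_at c i) (g i l) (f l j) \<in> Hom C (ob_at a j) (ob_at c i) ?e"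
    if "l \<in> ?L" for l using source.entry_Comp_Hom[OF a g f ij] that by simp
  have "mat_fun F a c (m + n) (mat_Comp C a b c g f) i j
      = (\<Sum>l\<in>?L. FMor F (ob_at a j) (ob_at c i) ?e (Comp C (ob_at a j) (ob_at b l) (ob_at c i) (g i l) (f l j)))"
    using ij FMor_sum[where I = ?L and f = "\<lambda>l. Comp C (ob_at a j) (ob_at b l) (ob_at c i) (g i l) (f l j)", OF O H]
    by (simp add: mat_fun_eq mat_Comp_eq)
  also have "\<dots> = (\<Sum>l\<in>?L. Comp D (ob_at (map_sums F a) j) (ob_at (map_sums F b) l) (ob_at (map_sums F c) i)
      (mat_fun F b c m g i l) (mat_fun F a b n f l j))"
  proof (rule sum.cong[OF refl])
    fix l assume "l \<in> ?L"
    then have l: "l \<in> dom b" by simp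
    have deg: "(m + sh_at c i - sh_at b l) + (n + sh_at b l - sh_at a j) = ?e" by simp
    from FMor_Comp[OF O(1) source.sums_Ob[OF a(2) l] O(2) source.mat_entry[OF g l ij(2)] source.mat_entry[OF f ij(1) l]]
    show "FMor F (ob_at a j) (ob_at c i) ?e (Comp C (ob_at a j) (ob_at b l) (ob_at c i) (g i l) (f l j))
      = Comp D (ob_at (map_sums F a) j) (ob_at (map_sums F b) l) (ob_at (map_sums F c) i)
      (mat_fun F b c m g i l) (mat_fun F a b n f l j)"
      unfolding deg using ij l by (simp add: mat_fun_eq map_sums_simps del: comp_apply)
  qed
  also have "\<dots> = mat_Comp D (map_sums F a) (map_sums F b) (map_sums F c) (mat_fun F b c m g) (mat_fun F a b n f) i j"
  proof (rule target.mat_Comp_superset[OF map_sums_Ob[OF a(1)] map_sums_Ob[OF a(2)] map_sums_Ob[OF a(3)]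
        mat_fun_Hom[OF a(2,3) g], symmetric])
    show "{l \<in> dom (map_sums F b). mat_fun F a b n f l j \<noteq> 0} \<subseteq> ?L"
    proof (intro subsetI CollectI conjI notI)
      fix l assume l: "l \<in> {l \<in> dom (map_sums F b). mat_fun F a b n f l j \<noteq> 0}"
      then show "l \<in> dom b" by (simp only: map_sums_simps(1) mem_Collect_eq)
      assume "f l j = 0"
      then have "mat_fun F a b n f l j = 0"
        by (simp add: mat_fun_eq FMor_zero[OF source.sums_Ob[OF a(1)] source.sums_Ob[OF a(2)]])
      with l show False by simp
    qed
  qed (use ij source.mat_column[OF f] in \<open>simp_all only: map_sums_simps(1)\<close>)
  finally show "mat_fun F a c (m + n) (mat_Comp C a b c g f) i j
    = mat_Comp D (map_sums F a) (map_sums F b) (map_sums F c) (mat_fun F b c m g) (mat_fun F a b n f) i j" .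
qed (auto simp: mat_fun_eq mat_Comp_eq map_sums_simps(1) simp del: comp_apply)

abbreviation "mat_dgfun \<equiv> \<lparr>FOb = map_sums F, FMor = mat_fun F\<rparr>"

lemma dg_functor_matrices: "dg_functor (matrices C) (matrices D) mat_dgfun"
proof -
  interpret MC: dg_category "matrices C" by (rule source.dg_category_matrices)
  interpret MD: dg_category "matrices D" by (rule target.dg_category_matrices)
  show ?thesis
  proof (unfold_locales, unfold matrices_simps dgfun.simps, goal_cases)
    case (1 a)
    then show ?case by (rule map_sums_Ob)
  next
    case (2 a b f n)
    then show ?case by (rule mat_fun_Hom)
  next
    case (3 a b f n g)
    show ?case
      by (rule target.mat_eqI[of a b])
        (simp_all add: mat_fun_eq FMor_add[OF source.sums_Ob[OF 3(1)] source.sums_Ob[OF 3(2)]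
            source.mat_entry[OF 3(3)] source.mat_entry[OF 3(4)]], (auto)?)
  next
    case (4 a b f n c)
    show ?case
    proof (rule target.mat_eqI[of a b])
      fix i j assume ij: "j \<in> dom a" "i \<in> dom b"
      then show "mat_fun F a b n (mat_Scale C c f) i j = mat_Scale D c (mat_fun F a b n f) i j"
        using target.mat_Scale_eq[OF map_sums_Ob[OF 4(1)] map_sums_Ob[OF 4(2)] mat_fun_Hom[OF 4], of c i j]
          FMor_Scale[OF source.sums_Ob[OF 4(1) ij(1)] source.sums_Ob[OF 4(2) ij(2)] source.mat_entry[OF 4(3) ij]]
        unfolding map_sums_simps(1) by (simp add: mat_fun_eq source.mat_Scale_eq[OF 4])
    qed (auto simp: mat_fun_eq mat_Scale_def)
  next
    case (5 a b c g m f n)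
    then show ?case by (rule mat_fun_Comp)
  next
    case (6 a)
    show ?case
    proof (rule target.mat_eqI[of a a])
      fix i j assume ij: "j \<in> dom a" "i \<in> dom a"
      then show "mat_fun F a a 0 (mat_Ident C a) i j = mat_Ident D (map_sums F a) i j"
        unfolding mat_fun_eq mat_Ident_eq map_sums_simps(1)
        using FMor_Ident[OF source.sums_Ob[OF 6]] FMor_zero[OF source.sums_Ob[OF 6] source.sums_Ob[OF 6]]
        by (simp add: map_sums_simps(2) del: comp_apply)
    qed (auto simp: mat_fun_eq mat_Ident_eq)
  next
    case (7 a b f n)
    show ?case
    proof (rule target.mat_eqI[of a b])
      fix i j assume ij: "j \<in> dom a" "i \<in> dom b"
      have deg: "n + 1 + sh_at b i - sh_at a j = n + sh_at b i - sh_at a j + 1" by simp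
      note O = source.sums_Ob[OF 7(1) ij(1)] source.sums_Ob[OF 7(2) ij(2)] and H = source.mat_entry[OF 7(3) ij]
      show "mat_fun F a b (n + 1) (mat_Diff C a b n f) i j
          = mat_Diff D (map_sums F a) (map_sums F b) n (mat_fun F a b n f) i j"
        using ij unfolding mat_fun_eq mat_Diff_eq map_sums_simps(1) deg
        by (simp add: map_sums_simps(2,3) FMor_ksign[OF O source.Diff_Hom[OF O H]] FMor_Diff[OF O H] del: comp_apply)
    qed (auto simp: mat_fun_eq mat_Diff_eq)
  qed
qed

lemma tw_fun_simps: "tw_sum (FOb (tw_fun F) X) = map_sums F (tw_sum X)"
  "tw_q (FOb (tw_fun F) X) = mat_fun F (tw_sum X) (tw_sum X) 1 (tw_q X)"
  "FMor (tw_fun F) X Y = mat_fun F (tw_sum X) (tw_sum Y)"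
  by (simp_all add: tw_fun_def)

text \<open>The Maurer-Cartan equation is the image of that in \<open>C\<close> under the functor on
  matrices; zero entries go to zero, so the matrix stays strictly triangular.\<close>

lemma tw_fun_Ob:
  assumes X: "X \<in> twisted_complexes C"
  shows "FOb (tw_fun F) X \<in> twisted_complexes D"
proof -
  interpret M: dg_functor "matrices C" "matrices D" mat_dgfun by (rule dg_functor_matrices)
  let ?a = "tw_sum X" and ?q = "tw_q X" and ?a' = "map_sums F (tw_sum X)" and ?q' = "mat_fun F (tw_sum X) (tw_sum X) 1 (tw_q X)"
  note t = source.twistedD[OF X]
  have "mat_Diff D ?a' ?a' 1 ?q' + mat_Comp D ?a' ?a' ?a' ?q' ?q'
      = mat_fun F ?a ?a (1 + 1) (mat_Diff C ?a ?a 1 ?q + mat_Comp C ?a ?a ?a ?q ?q)"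
    using M.FMor_Diff[of ?a ?a ?q 1] M.FMor_Comp[of ?a ?a ?a ?q 1 ?q 1] t
      M.FMor_add[of ?a ?a "mat_Diff C ?a ?a 1 ?q" "1 + 1" "mat_Comp C ?a ?a ?a ?q ?q"]
      source.mat_Diff_Hom[OF t(1,1,2)] source.mat_Comp_Hom[OF t(1,1,1,2,2)]
    by (simp add: matrices_simps)
  also have "\<dots> = 0" using t M.FMor_zero[of ?a ?a 2] by (simp add: matrices_simps)
  finally have mc: "mat_Diff D ?a' ?a' 1 ?q' + mat_Comp D ?a' ?a' ?a' ?q' ?q' = 0" .
  have up: "i < j" if "?q' i j \<noteq> 0" for i j
  proof (rule t(3), rule notI)
    assume "?q i j = 0"
    with that show False
      by (simp add: mat_fun_eq FMor_zero[OF source.sums_Ob[OF t(1)] source.sums_Ob[OF t(1)]] split: if_splits)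
  qed
  show ?thesis
    unfolding twisted_complexes_def mem_Collect_eq
    using map_sums_Ob[OF t(1)] mat_fun_Hom[OF t(1,1,2)] up mc
    by (intro exI[of _ ?a'] exI[of _ ?q']) (simp add: tw_fun_def)
qed

lemma dg_functor_tw_fun:
  assumes S: "S \<subseteq> twisted_complexes C" "S' \<subseteq> twisted_complexes D"
    and maps: "\<And>X. X \<in> S \<Longrightarrow> FOb (tw_fun F) X \<in> S'"
  shows "dg_functor (all_twisted C\<lparr>Ob := S\<rparr>) (all_twisted D\<lparr>Ob := S'\<rparr>) (tw_fun F)"
proof -
  have eq: "tw_fun F = \<lparr>FOb = FOb (tw_fun F), FMor = (\<lambda>X Y. FMor mat_dgfun (tw_sum X) (tw_sum Y))\<rparr>"
    by (simp add: tw_fun_def)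
  have "dg_functor (twist (matrices C) S tw_sum tw_q) (twist (matrices D) S' tw_sum tw_q)
    \<lparr>FOb = FOb (tw_fun F), FMor = (\<lambda>X Y. FMor mat_dgfun (tw_sum X) (tw_sum Y))\<rparr>"
    by (rule dg_functor_twist[OF dg_functor_matrices source.dg_category_twisted[OF S(1), unfolded all_twisted_eq_twist]
        target.dg_category_twisted[OF S(2), unfolded all_twisted_eq_twist]])
      (simp_all only: tw_fun_simps matrices_simps dgfun.simps maps source.twistedD(1,2)[OF subsetD[OF S(1)]])
  then show ?thesis unfolding all_twisted_eq_twist using eq by simp
qed

end

section \<open>Trivial fibrations are weak equivalences in all three model structures\<close>

section \<open>Trivial fibrations are quasi-equivalences\<close>

context dg_category
begin

lemma equiv_cohomologous:
  assumes "X \<in> Ob C" "Y \<in> Ob C"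
  shows "equiv (cocycles C X Y n) (cohomologous C X Y n)"
proof (rule equivI)
  note O = assms
  show "cohomologous C X Y n \<subseteq> cocycles C X Y n \<times> cocycles C X Y n"
    by (auto simp: cohomologous_def)
  show "refl_on (cocycles C X Y n) (cohomologous C X Y n)"
    using Diff_zero[OF O] zero_Hom[OF O] by (auto simp: refl_on_def cohomologous_def intro!: bexI[of _ 0])
  show "sym (cohomologous C X Y n)"
  proof (rule symI)
    fix f g assume "(f, g) \<in> cohomologous C X Y n"
    then obtain h where h: "f \<in> cocycles C X Y n" "g \<in> cocycles C X Y n" "h \<in> Hom C X Y (n - 1)"
      "f - g = Diff C X Y (n - 1) h" by (auto simp: cohomologous_def)
    have "g - f = - (f - g)" by simp
    also have "\<dots> = Diff C X Y (n - 1) (- h)" unfolding h(4) Diff_uminus[OF O h(3)] ..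
    finally have "g - f = Diff C X Y (n - 1) (- h)" .
    then show "(g, f) \<in> cohomologous C X Y n"
      using h uminus_Hom[OF O h(3)] by (auto simp: cohomologous_def)
  qed
  show "trans (cohomologous C X Y n)"
  proof (rule transI)
    fix f g k assume "(f, g) \<in> cohomologous C X Y n" "(g, k) \<in> cohomologous C X Y n"
    then obtain h h' where h: "f \<in> cocycles C X Y n" "k \<in> cocycles C X Y n" "h \<in> Hom C X Y (n - 1)"
      "h' \<in> Hom C X Y (n - 1)" "f - g = Diff C X Y (n - 1) h" "g - k = Diff C X Y (n - 1) h'"
      by (auto simp: cohomologous_def)
    have "f - k = (f - g) + (g - k)" by simp
    also have "\<dots> = Diff C X Y (n - 1) (h + h')" by (simp add: Diff_add[OF O h(3,4)] h(5,6))
    finally show "(f, k) \<in> cohomologous C X Y n"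
      using h(1,2) add_Hom[OF O h(3,4)] by (auto simp: cohomologous_def)
  qed
qed

lemma H0_isomorphic_refl:
  assumes X: "X \<in> Ob C"
  shows "H0_isomorphic C X X"
proof -
  have I: "Ident C X \<in> cocycles C X X 0" using Ident_Hom[OF X] Diff_Ident[OF X] by (simp add: cocycles_def)
  have "(Comp C X X X (Ident C X) (Ident C X), Ident C X) \<in> cohomologous C X X 0"
    using equiv_class_self[OF equiv_cohomologous[OF X X] I] by (simp add: Comp_Ident_left[OF X X Ident_Hom[OF X]])
  with I show ?thesis unfolding H0_isomorphic_def by blast
qed

end

context dg_functor
begin

lemma FMor_cocycles: "\<lbrakk>X \<in> Ob C; Y \<in> Ob C; f \<in> cocycles C X Y n\<rbrakk> \<Longrightarrow> FMor F X Y n f \<in> cocycles D (FOb F X) (FOb F Y) n"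
  using FMor_Diff[of X Y f n] by (simp add: cocycles_def FMor_Hom FMor_zero)

lemma FMor_cohomologous: "\<lbrakk>X \<in> Ob C; Y \<in> Ob C; (f, g) \<in> cohomologous C X Y n\<rbrakk>
    \<Longrightarrow> (FMor F X Y n f, FMor F X Y n g) \<in> cohomologous D (FOb F X) (FOb F Y) n"
proof -
  assume O: "X \<in> Ob C" "Y \<in> Ob C" and fg: "(f, g) \<in> cohomologous C X Y n"
  then obtain h where h: "f \<in> cocycles C X Y n" "g \<in> cocycles C X Y n" "h \<in> Hom C X Y (n - 1)"
    "f - g = Diff C X Y (n - 1) h" by (auto simp: cohomologous_def)
  have "FMor F X Y n f - FMor F X Y n g = Diff D (FOb F X) (FOb F Y) (n - 1) (FMor F X Y (n - 1) h)"
    using FMor_Diff[OF O h(3)] h(1,2,4) FMor_diff[OF O, of f n g] by (simp add: cocycles_def)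
  then show ?thesis
    using FMor_cocycles[OF O] h FMor_Hom[OF O h(3)] by (auto simp: cohomologous_def)
qed

text \<open>\<open>cohomology_map\<close> saturates the image of a class; as functors preserve
  cohomologous pairs, the result is a single class.\<close>

lemma cohomology_map_class:
  assumes O: "X \<in> Ob C" "Y \<in> Ob C" and f: "f \<in> cocycles C X Y n"
  shows "cohomology_map D F X Y n (cohomologous C X Y n `` {f}) = cohomologous D (FOb F X) (FOb F Y) n `` {FMor F X Y n f}"
proof -
  have tr: "trans (cohomologous D (FOb F X) (FOb F Y) n)"
    using target.equiv_cohomologous[OF FOb_Ob[OF O(1)] FOb_Ob[OF O(2)], of n] by (rule equivE)
  show ?thesis
    unfolding cohomology_map_def
  proof (intro subset_antisym subsetI)
    fix x assume "x \<in> cohomologous D (FOb F X) (FOb F Y) n `` (FMor F X Y n ` (cohomologous C X Y n `` {f}))"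
    then obtain g where "(f, g) \<in> cohomologous C X Y n" "(FMor F X Y n g, x) \<in> cohomologous D (FOb F X) (FOb F Y) n"
      by (elim ImageE imageE) simp
    then show "x \<in> cohomologous D (FOb F X) (FOb F Y) n `` {FMor F X Y n f}"
      using transD[OF tr FMor_cohomologous[OF O]] by (intro ImageI[OF _ singletonI])
  next
    fix x assume "x \<in> cohomologous D (FOb F X) (FOb F Y) n `` {FMor F X Y n f}"
    then have "(FMor F X Y n f, x) \<in> cohomologous D (FOb F X) (FOb F Y) n" by simp
    moreover have "f \<in> cohomologous C X Y n `` {f}"
      by (rule equiv_class_self[OF source.equiv_cohomologous[OF O] f])
    ultimately show "x \<in> cohomologous D (FOb F X) (FOb F Y) n `` (FMor F X Y n ` (cohomologous C X Y n `` {f}))"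
      by (rule ImageI[OF _ imageI])
  qed
qed

lemma H0_retract_image:
  assumes O: "X \<in> Ob C" "Y \<in> Ob C" and r: "H0_retract C X Y"
  shows "H0_retract D (FOb F X) (FOb F Y)"
proof -
  obtain s r where s: "s \<in> cocycles C X Y 0" and r: "r \<in> cocycles C Y X 0"
    and rs: "(Comp C X Y X r s, Ident C X) \<in> cohomologous C X X 0"
    using r by (auto simp: H0_retract_def)
  have "FMor F X X 0 (Comp C X Y X r s) = Comp D (FOb F X) (FOb F Y) (FOb F X) (FMor F Y X 0 r) (FMor F X Y 0 s)"
    using FMor_Comp[OF O(1,2,1), of r 0 s 0] r s by (simp add: cocycles_def)
  with FMor_cohomologous[OF O(1,1) rs] FMor_cocycles[OF O s] FMor_cocycles[OF O(2,1) r]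
  show ?thesis unfolding H0_retract_def using FMor_Ident[OF O(1)] by auto
qed

end

text \<open>Injectivity corrects a lifted primitive for the image of f - g, surjectivity corrects a
  lift of a cocycle; both corrections come from the acyclic kernel.\<close>

lemma (in trivial_fibration) quasi_equivalence: "quasi_equivalence C D P"
  unfolding quasi_equivalence_def
proof (intro conjI ballI allI)
  show "dg_functor C D P" by unfold_locales
next
  fix Y assume Y: "Y \<in> Ob D"
  from surj_Ob[OF Y] obtain X where "X \<in> Ob C" "FOb P X = Y" ..
  then show "\<exists>X\<in>Ob C. H0_isomorphic D (FOb P X) Y" using target.H0_isomorphic_refl[OF Y] by auto
next
  fix X Y n assume O: "X \<in> Ob C" "Y \<in> Ob C"
  note O' = FOb_Ob[OF O(1)] FOb_Ob[OF O(2)]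
  note eC = source.equiv_cohomologous[OF O, of n] and eD = target.equiv_cohomologous[OF O', of n]
  have "inj_on (cohomology_map D P X Y n) (cohomology C X Y n)"
  proof (rule inj_onI, unfold cohomology_def, elim quotientE, hypsubst)
    fix f g assume f: "f \<in> cocycles C X Y n" and g: "g \<in> cocycles C X Y n"
      and eq: "cohomology_map D P X Y n (cohomologous C X Y n `` {f}) = cohomology_map D P X Y n (cohomologous C X Y n `` {g})"
    from f g have fg: "f \<in> Hom C X Y n" "g \<in> Hom C X Y n" "Diff C X Y n f = 0" "Diff C X Y n g = 0"
      by (auto simp: cocycles_def)
    have "(FMor P X Y n f, FMor P X Y n g) \<in> cohomologous D (FOb P X) (FOb P Y) n"
      using eq unfolding cohomology_map_class[OF O f] cohomology_map_class[OF O g]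
      by (simp add: eq_equiv_class_iff[OF eD FMor_cocycles[OF O f] FMor_cocycles[OF O g]])
    then obtain h' where h': "h' \<in> Hom D (FOb P X) (FOb P Y) (n - 1)"
      "FMor P X Y n f - FMor P X Y n g = Diff D (FOb P X) (FOb P Y) (n - 1) h'" by (auto simp: cohomologous_def)
    from surj_Hom[OF O h'(1)] obtain h0 where h0: "h0 \<in> Hom C X Y (n - 1)" "FMor P X Y (n - 1) h0 = h'" ..
    have dh0: "Diff C X Y (n - 1) h0 \<in> Hom C X Y n" using source.Diff_Hom[OF O h0(1)] by simp
    have fgH: "f - g \<in> Hom C X Y n" by (rule source.diff_Hom[OF O fg(1,2)])
    have "\<exists>k\<in>Hom C X Y (n - 1). FMor P X Y (n - 1) k = 0 \<and> Diff C X Y (n - 1) k = f - g - Diff C X Y (n - 1) h0"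
    proof (rule acyclic_kernel[OF O source.diff_Hom[OF O fgH dh0]])
      show "Diff C X Y n (f - g - Diff C X Y (n - 1) h0) = 0"
        using source.Diff_Diff[OF O h0(1)] fg
        by (simp add: source.Diff_diff[OF O fgH dh0] source.Diff_diff[OF O fg(1,2)])
      show "FMor P X Y n (f - g - Diff C X Y (n - 1) h0) = 0"
        using FMor_Diff[OF O h0(1)] h0(2) h'(2)
        by (simp add: FMor_diff[OF O fgH dh0] FMor_diff[OF O fg(1,2)])
    qed
    then obtain k where k: "k \<in> Hom C X Y (n - 1)" "Diff C X Y (n - 1) k = f - g - Diff C X Y (n - 1) h0" by blast
    have "f - g = Diff C X Y (n - 1) (h0 + k)" by (simp add: source.Diff_add[OF O h0(1) k(1)] k(2))
    then have "(f, g) \<in> cohomologous C X Y n"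
      using f g source.add_Hom[OF O h0(1) k(1)] by (auto simp: cohomologous_def)
    then show "cohomologous C X Y n `` {f} = cohomologous C X Y n `` {g}" by (rule equiv_class_eq[OF eC])
  qed
  moreover have "cohomology_map D P X Y n ` cohomology C X Y n = cohomology D (FOb P X) (FOb P Y) n"
  proof (intro subset_antisym subsetI)
    fix c assume "c \<in> cohomology_map D P X Y n ` cohomology C X Y n"
    then obtain f where f: "f \<in> cocycles C X Y n" "c = cohomology_map D P X Y n (cohomologous C X Y n `` {f})"
      unfolding cohomology_def by (auto elim!: quotientE)
    then show "c \<in> cohomology D (FOb P X) (FOb P Y) n"
      unfolding cohomology_def using quotientI[OF FMor_cocycles[OF O f(1)]] by (simp add: cohomology_map_class[OF O f(1)])
  next
    fix c assume "c \<in> cohomology D (FOb P X) (FOb P Y) n"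
    then obtain g where g: "g \<in> cocycles D (FOb P X) (FOb P Y) n" "c = cohomologous D (FOb P X) (FOb P Y) n `` {g}"
      unfolding cohomology_def by (auto elim!: quotientE)
    then have g': "g \<in> Hom D (FOb P X) (FOb P Y) n" "Diff D (FOb P X) (FOb P Y) n g = 0" by (auto simp: cocycles_def)
    from surj_Hom[OF O g'(1)] obtain f0 where f0: "f0 \<in> Hom C X Y n" "FMor P X Y n f0 = g" ..
    have "\<exists>k\<in>Hom C X Y (n + 1 - 1). FMor P X Y (n + 1 - 1) k = 0 \<and> Diff C X Y (n + 1 - 1) k = Diff C X Y n f0"
      using source.Diff_Hom[OF O f0(1)] source.Diff_Diff[OF O f0(1)] FMor_Diff[OF O f0(1)] f0(2) g'(2)
      by (intro acyclic_kernel[OF O]) simp_all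
    then obtain k where k: "k \<in> Hom C X Y n" "FMor P X Y n k = 0" "Diff C X Y n k = Diff C X Y n f0" by auto
    have "f0 - k \<in> cocycles C X Y n"
      using k source.diff_Hom[OF O f0(1) k(1)] by (simp add: cocycles_def source.Diff_diff[OF O f0(1) k(1)])
    moreover have "FMor P X Y n (f0 - k) = g" using k f0 by (simp add: FMor_diff[OF O f0(1) k(1)])
    ultimately show "c \<in> cohomology_map D P X Y n ` cohomology C X Y n"
      using cohomology_map_class[OF O] g(2) unfolding cohomology_def
      by (intro image_eqI[of _ _ "cohomologous C X Y n `` {f0 - k}"] quotientI) simp_all
  qed
  ultimately show "bij_betw (cohomology_map D P X Y n) (cohomology C X Y n) (cohomology D (FOb P X) (FOb P Y) n)"
    by (simp add: bij_betw_def)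
qed

section \<open>Trivial fibrations on twisted complexes\<close>

text \<open>Two fixed twisted complexes; their hom complex, with differential \<open>td\<close>, is
  the same in \<open>Tw\<close> and in \<open>Perf\<close>.\<close>

locale twisted_pair = trivial_fibration +
  fixes X Y
  assumes X: "X \<in> twisted_complexes C" and Y: "Y \<in> twisted_complexes C"
begin

abbreviation "a \<equiv> tw_sum X"
abbreviation "b \<equiv> tw_sum Y"
abbreviation "MH \<equiv> mat_Hom C a b"
abbreviation "MP \<equiv> mat_fun P a b"
abbreviation "td n f \<equiv> mat_Diff C a b n f + mat_Comp C a b b (tw_q Y) f - ksign n (mat_Comp C a a b f (tw_q X))"

abbreviation "AT \<equiv> all_twisted C\<lparr>Ob := twisted_complexes C\<rparr>"
abbreviation "AT' \<equiv> all_twisted D\<lparr>Ob := twisted_complexes D\<rparr>"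

lemma AT_simps: "Ob AT = twisted_complexes C" "Hom AT X Y = MH" "Diff AT X Y n f = td n f"
  by (simp_all add: all_twisted_def)

sublocale T: dg_functor AT AT' "tw_fun P"
  by (rule dg_functor_tw_fun) (auto intro: tw_fun_Ob)

lemmas td_Hom = T.source.Diff_Hom[of X Y, unfolded AT_simps, OF X Y]
  and td_diff = T.source.Diff_diff[of X Y, unfolded AT_simps, OF X Y]
  and td_add = T.source.Diff_add[of X Y, unfolded AT_simps, OF X Y]
  and td_zero = T.source.Diff_zero[of X Y, unfolded AT_simps, OF X Y]
  and td_td = T.source.Diff_Diff[of X Y, unfolded AT_simps, OF X Y]
  and MH_diff = T.source.diff_Hom[of X Y, unfolded AT_simps, OF X Y]
  and MH_add = T.source.add_Hom[of X Y, unfolded AT_simps, OF X Y]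
  and MH_zero = T.source.zero_Hom[of X Y, unfolded AT_simps, OF X Y]
  and MP_diff = T.FMor_diff[of X Y, unfolded AT_simps tw_fun_simps, OF X Y]
  and MP_add = T.FMor_add[of X Y, unfolded AT_simps tw_fun_simps, OF X Y]
  and MP_zero = T.FMor_zero[of X Y, unfolded AT_simps tw_fun_simps, OF X Y]
  and MP_td = T.FMor_Diff[of X Y, unfolded AT_simps tw_fun_simps, OF X Y]

lemmas a_sums = source.twistedD(1)[OF X] and b_sums = source.twistedD(1)[OF Y]
lemmas a_Ob = source.sums_Ob[OF a_sums] and b_Ob = source.sums_Ob[OF b_sums]

lemma MP_zero_iff: "MP n f = 0 \<longleftrightarrow> (\<forall>j\<in>dom a. \<forall>i\<in>dom b. FMor P (ob_at a j) (ob_at b i) (n + sh_at b i - sh_at a j) (f i j) = 0)"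
proof
  assume "MP n f = 0"
  then have "MP n f i j = 0" for i j by simp
  then show "\<forall>j\<in>dom a. \<forall>i\<in>dom b. FMor P (ob_at a j) (ob_at b i) (n + sh_at b i - sh_at a j) (f i j) = 0"
    unfolding mat_fun_eq by meson
next
  assume "\<forall>j\<in>dom a. \<forall>i\<in>dom b. FMor P (ob_at a j) (ob_at b i) (n + sh_at b i - sh_at a j) (f i j) = 0"
  then show "MP n f = 0" by (intro ext) (simp add: mat_fun_eq)
qed

text \<open>Strict triangularity: row \<open>i\<close> of q_Y f involves only rows
  \<open>l > i\<close> of \<open>f\<close>, and, in the next lemma, column \<open>j\<close> of f q_X
  only columns \<open>l < j\<close>. These two facts drive the elimination.\<close>

lemma Comp_qY_zero: "f \<in> MH n \<Longrightarrow> (\<And>l. i < l \<Longrightarrow> f l j = 0) \<Longrightarrow> mat_Comp C a b b (tw_q Y) f i j = 0"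
  by (rule source.mat_Comp_zero[OF a_sums b_sums b_sums]) (use source.twistedD(3)[OF Y, of i] in blast)+

lemma Comp_qX_zero: "f \<in> MH n \<Longrightarrow> (\<And>l. l < j \<Longrightarrow> f i l = 0) \<Longrightarrow> mat_Comp C a a b f (tw_q X) i j = 0"
  by (rule source.mat_Comp_zero[OF a_sums a_sums b_sums source.twistedD(2)[OF X]])
    (use source.twistedD(3)[OF X, of _ j] in blast)

lemma td_entry_zero:
  assumes z: "z \<in> MH n" and "\<And>i j'. j' \<le> j \<Longrightarrow> z i j' = 0"
  shows "td n z i j = 0"
  using assms Comp_qY_zero[OF z, of i j] Comp_qX_zero[OF z, of j i]
  by (simp add: mat_Diff_eq source.Diff_zero[OF a_Ob b_Ob] ksign_def)

lemma MP_td_zero: "y \<in> MH (n - 1) \<Longrightarrow> MP (n - 1) y = 0 \<Longrightarrow> MP n (td (n - 1) y) = 0"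
  using MP_td[of y "n - 1"] T.target.Diff_zero[OF T.FOb_Ob T.FOb_Ob, unfolded AT_simps, OF X Y]
  by (simp only: diff_add_cancel)

text \<open>Elimination in column \<open>j\<close>, starting from its last nonzero row. Once the
  earlier columns are cleared, that entry is closed in \<open>C\<close> and in the kernel of
  \<open>P\<close>; a primitive placed at the same position clears it and otherwise disturbs only
  rows of smaller index in column \<open>j\<close>, and later columns.\<close>

lemma column_step:
  "\<lbrakk>r \<in> MH n; MP n r = 0; td n r = 0; \<And>i j'. j' < j \<Longrightarrow> r i j' = 0; \<And>i. N \<le> i \<Longrightarrow> r i j = 0\<rbrakk>
    \<Longrightarrow> \<exists>y\<in>MH (n - 1). MP (n - 1) y = 0 \<and> (\<forall>i j'. j' \<noteq> j \<longrightarrow> y i j' = 0)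
      \<and> (\<forall>i. \<forall>j'\<le>j. (r - td (n - 1) y) i j' = 0)"
proof (induction N arbitrary: r)
  case 0
  then have "r i j' = 0" if "j' \<le> j" for i j' using that by (cases "j' = j") auto
  then have z: "(r - td (n - 1) 0) i j' = 0" if "j' \<le> j" for i j' using that unfolding td_zero by simp
  show ?case
    by (rule bexI[OF _ MH_zero], intro conjI MP_zero allI impI) (simp, rule z)
next
  case (Suc N)
  show ?case
  proof (cases "j \<in> dom a \<and> N \<in> dom b")
    case False
    then have "r N j = 0" using source.mat_outside[OF Suc.prems(1)] by blast
    then have N: "r i j = 0" if "N \<le> i" for i using Suc.prems(5)[of i] that by (cases "i = N") auto
    show ?thesis by (rule Suc.IH) (fact Suc.prems N)+
  next
    case True
    then have ij: "j \<in> dom a" "N \<in> dom b" by auto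
    let ?A = "ob_at a j" and ?B = "ob_at b N" and ?t = "sh_at b N" and ?e = "n + sh_at b N - sh_at a j"
    note O = a_Ob[OF ij(1)] b_Ob[OF ij(2)]
    have "mat_Comp C a b b (tw_q Y) r N j = 0" by (rule Comp_qY_zero[OF Suc.prems(1)]) (simp add: Suc.prems(5))
    moreover have "mat_Comp C a a b r (tw_q X) N j = 0" by (rule Comp_qX_zero[OF Suc.prems(1)]) (simp add: Suc.prems(4))
    moreover have "td n r N j = 0" using fun_cong[OF fun_cong[OF Suc.prems(3), of N], of j] by simp
    ultimately have "Diff C ?A ?B ?e (r N j) = 0" using ij by (simp add: mat_Diff_eq ksign_def split: if_splits)
    moreover have "FMor P ?A ?B ?e (r N j) = 0" using Suc.prems(2)[unfolded MP_zero_iff] ij by blast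
    ultimately obtain k where k: "k \<in> Hom C ?A ?B (?e - 1)" "FMor P ?A ?B (?e - 1) k = 0" "Diff C ?A ?B (?e - 1) k = r N j"
      using acyclic_kernel[OF O source.mat_entry[OF Suc.prems(1) ij]] by blast
    have e: "n - 1 + sh_at b N - sh_at a j = ?e - 1" by simp
    \<comment> \<open>The sign compensates the factor (-1)^t in \<open>mat_Diff\<close>.\<close>
    define y where "y i j' = (if i = N \<and> j' = j then ksign ?t k else 0)" for i j'
    have yH: "y \<in> MH (n - 1)"
    proof (rule source.mat_HomI)
      fix i j' assume "j' \<in> dom a" "i \<in> dom b"
      then show "y i j' \<in> Hom C (ob_at a j') (ob_at b i) (n - 1 + sh_at b i - sh_at a j')"
        using source.ksign_Hom[OF O k(1), of ?t] source.zero_Hom[OF a_Ob b_Ob]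
        by (cases "i = N \<and> j' = j") (auto simp: y_def e)
    next
      fix j'
      show "finite {i. y i j' \<noteq> 0}" by (rule finite_subset[of _ "{N}"]) (auto simp: y_def)
    qed (use ij in \<open>auto simp: y_def\<close>)
    have yP: "MP (n - 1) y = 0"
      unfolding MP_zero_iff
    proof (intro ballI)
      fix j' i assume "j' \<in> dom a" "i \<in> dom b"
      then show "FMor P (ob_at a j') (ob_at b i) (n - 1 + sh_at b i - sh_at a j') (y i j') = 0"
        using k(2) FMor_zero[OF a_Ob b_Ob] FMor_ksign[OF O k(1), of ?t]
        by (cases "i = N \<and> j' = j") (auto simp: y_def e)
    qed
    have td0: "td (n - 1) y i j' = 0" if "j' < j" for i j'
      by (rule td_entry_zero[OF yH]) (use that in \<open>auto simp: y_def\<close>)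
    have tdj: "td (n - 1) y i j = (if i = N then r N j else 0)" if i: "N \<le> i" for i
    proof -
      have "mat_Comp C a b b (tw_q Y) y i j = 0" by (rule Comp_qY_zero[OF yH]) (use i in \<open>auto simp: y_def\<close>)
      moreover have "mat_Comp C a a b y (tw_q X) i j = 0" by (rule Comp_qX_zero[OF yH]) (simp add: y_def)
      moreover have "mat_Diff C a b (n - 1) y i j = (if i = N then r N j else 0)"
      proof (cases "i = N")
        case True
        then show ?thesis
          using ij k(3) source.Diff_ksign[OF O k(1), of ?t] unfolding mat_Diff_eq True e by (simp add: y_def)
      qed (simp add: mat_Diff_eq y_def source.Diff_zero[OF a_Ob b_Ob])
      ultimately show ?thesis by (simp add: ksign_def)
    qed
    let ?r = "r - td (n - 1) y"
    have tyH: "td (n - 1) y \<in> MH n" using td_Hom[OF yH] by simp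
    have "\<exists>z\<in>MH (n - 1). MP (n - 1) z = 0 \<and> (\<forall>i j'. j' \<noteq> j \<longrightarrow> z i j' = 0)
      \<and> (\<forall>i. \<forall>j'\<le>j. (?r - td (n - 1) z) i j' = 0)"
    proof (rule Suc.IH)
      show "?r \<in> MH n" by (rule MH_diff[OF Suc.prems(1) tyH])
      show "MP n ?r = 0"
        unfolding MP_diff[OF Suc.prems(1) tyH] Suc.prems(2) MP_td_zero[OF yH yP] by (rule diff_0_right)
      show "td n ?r = 0"
        unfolding td_diff[OF Suc.prems(1) tyH] Suc.prems(3)
        using td_td[OF yH] by (simp only: diff_add_cancel diff_0_right)
      show "?r i j' = 0" if "j' < j" for i j' using Suc.prems(4)[OF that, of i] td0[OF that, of i] by simp
      show "?r i j = 0" if "N \<le> i" for i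
        using tdj[OF that] Suc.prems(5)[of i] that by (cases "i = N") auto
    qed
    then obtain z where z1: "z \<in> MH (n - 1)" and zz: "MP (n - 1) z = 0 \<and> (\<forall>i j'. j' \<noteq> j \<longrightarrow> z i j' = 0)
      \<and> (\<forall>i. \<forall>j'\<le>j. (?r - td (n - 1) z) i j' = 0)" by (rule bexE)
    note z = z1 conjunct1[OF zz] conjunct1[OF conjunct2[OF zz], rule_format] conjunct2[OF conjunct2[OF zz], rule_format]
    have eq: "r - td (n - 1) (y + z) = ?r - td (n - 1) z"
      unfolding td_add[OF yH z(1)] by (simp only: diff_diff_eq)
    show ?thesis
    proof (rule bexI[OF _ MH_add[OF yH z(1)]], intro conjI allI impI)
      show "MP (n - 1) (y + z) = 0" unfolding MP_add[OF yH z(1)] yP z(2) by (rule add_0_left)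
      show "(y + z) i j' = 0" if "j' \<noteq> j" for i j' using z(3)[OF that, of i] that by (simp add: y_def)
      show "(r - td (n - 1) (y + z)) i j' = 0" if "j' \<le> j" for i j' unfolding eq by (rule z(4)[OF that])
    qed
  qed
qed

text \<open>Stage \<open>j\<close> changes only column \<open>j\<close> of the partial primitive, so
  every column is eventually constant: the limit exists entrywise and its columns are finite, even
  with infinitely many columns.\<close>

lemma acyclic:
  assumes x: "x \<in> MH n" and px: "MP n x = 0" and dx: "td n x = 0"
  shows "\<exists>y\<in>MH (n - 1). MP (n - 1) y = 0 \<and> td (n - 1) y = x"
proof -
  let ?P = "\<lambda>j y. y \<in> MH (n - 1) \<and> MP (n - 1) y = 0 \<and> (\<forall>i. \<forall>j'<j. (x - td (n - 1) y) i j' = 0)"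
  have "\<exists>f. \<forall>j. ?P j (f j) \<and> (\<forall>i j'. j' \<noteq> j \<longrightarrow> f (Suc j) i j' = f j i j')"
  proof (rule dependent_nat_choice)
    show "\<exists>y. ?P 0 y" by (intro exI[of _ 0] conjI MH_zero MP_zero) simp
    fix y j assume y: "?P j y"
    note yH = conjunct1[OF y]
    have tyH: "td (n - 1) y \<in> MH n" using td_Hom[OF yH] by simp
    let ?r = "x - td (n - 1) y"
    have rH: "?r \<in> MH n" by (rule MH_diff[OF x tyH])
    have "finite {i. ?r i j \<noteq> 0}" by (rule source.mat_finite[OF rH])
    then obtain N where bound: "\<forall>i\<in>{i. ?r i j \<noteq> 0}. i < N" unfolding finite_nat_set_iff_bounded ..
    have N: "?r i j = 0" if "N \<le> i" for i
    proof (rule ccontr)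
      assume "?r i j \<noteq> 0"
      then have "i < N" using bound by blast
      with that show False by simp
    qed
    have "\<exists>z\<in>MH (n - 1). MP (n - 1) z = 0 \<and> (\<forall>i j'. j' \<noteq> j \<longrightarrow> z i j' = 0)
      \<and> (\<forall>i. \<forall>j'\<le>j. (?r - td (n - 1) z) i j' = 0)"
    proof (rule column_step[where r = ?r and N = N and j = j and n = n])
      show "?r \<in> MH n" by (rule rH)
      show "?r i j = 0" if "N \<le> i" for i using that by (rule N)
      show "MP n ?r = 0"
        unfolding MP_diff[OF x tyH] px MP_td_zero[OF yH conjunct1[OF conjunct2[OF y]]] by (rule diff_0_right)
      show "td n ?r = 0" unfolding td_diff[OF x tyH] dx
        using td_td[OF yH] by (simp only: diff_add_cancel diff_0_right)
      show "?r i j' = 0" if "j' < j" for i j' using conjunct2[OF conjunct2[OF y]] that by blast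
    qed
    then obtain z where z1: "z \<in> MH (n - 1)" and zz: "MP (n - 1) z = 0 \<and> (\<forall>i j'. j' \<noteq> j \<longrightarrow> z i j' = 0)
      \<and> (\<forall>i. \<forall>j'\<le>j. (?r - td (n - 1) z) i j' = 0)" by (rule bexE)
    note z = z1 conjunct1[OF zz] conjunct1[OF conjunct2[OF zz], rule_format] conjunct2[OF conjunct2[OF zz], rule_format]
    have eq: "x - td (n - 1) (y + z) = ?r - td (n - 1) z"
      unfolding td_add[OF yH z(1)] by (simp only: diff_diff_eq)
    show "\<exists>y'. ?P (Suc j) y' \<and> (\<forall>i j'. j' \<noteq> j \<longrightarrow> y' i j' = y i j')"
    proof (rule exI[of _ "y + z"], intro conjI allI impI)
      show "y + z \<in> MH (n - 1)" by (rule MH_add[OF yH z(1)])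
      show "MP (n - 1) (y + z) = 0"
        unfolding MP_add[OF yH z(1)] conjunct1[OF conjunct2[OF y]] z(2) by (rule add_0_left)
      show "(x - td (n - 1) (y + z)) i j' = 0" if "j' < Suc j" for i j'
        unfolding eq by (rule z(4)) (use that in simp)
      show "(y + z) i j' = y i j'" if "j' \<noteq> j" for i j' using z(3)[OF that, of i] by simp
    qed
  qed
  then obtain f where F: "\<forall>j. ?P j (f j) \<and> (\<forall>i j'. j' \<noteq> j \<longrightarrow> f (Suc j) i j' = f j i j')" ..
  have f: "f j \<in> MH (n - 1)" "MP (n - 1) (f j) = 0" "j' < j \<Longrightarrow> (x - td (n - 1) (f j)) i j' = 0"
    and step: "j' \<noteq> j \<Longrightarrow> f (Suc j) i j' = f j i j'" for i j j'
    using spec[OF F, of j] by blast+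
  have stable: "f (Suc j + m) i j = f (Suc j) i j" for j m i
    by (induction m) (simp_all add: step)
  have stable': "f k i j = f (Suc j) i j" if "j < k" for i j k
    using stable[of j "k - Suc j" i] that by simp
  \<comment> \<open>\<open>f (Suc j)\<close> is the first stage at which column \<open>j\<close> is
    final.\<close>
  define y where "y i j = f (Suc j) i j" for i j
  have yH: "y \<in> MH (n - 1)"
    by (rule source.mat_HomI)
      (simp_all add: y_def source.mat_entry[OF f(1)] source.mat_outside[OF f(1)] source.mat_finite[OF f(1)])
  have "MP (n - 1) y = 0"
    unfolding MP_zero_iff y_def using f(2)[unfolded MP_zero_iff] by blast
  moreover have "td (n - 1) y = x"
  proof (intro ext)
    fix i j
    \<comment> \<open>Column \<open>j\<close> of \<open>td\<close> depends on columns up to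
      \<open>j\<close> only, and there \<open>y\<close> agrees with
      \<open>f (Suc j)\<close>.\<close>
    have z: "td (n - 1) (y - f (Suc j)) i j = 0"
    proof (rule td_entry_zero[where n = "n - 1" and j = j and z = "y - f (Suc j)"])
      show "y - f (Suc j) \<in> MH (n - 1)" by (rule MH_diff[OF yH f(1)])
      show "(y - f (Suc j)) i j' = 0" if "j' \<le> j" for i j'
        using stable'[of j' "Suc j" i] that by (simp add: y_def)
    qed
    have 1: "td (n - 1) y i j = td (n - 1) (f (Suc j)) i j"
      using z unfolding td_diff[OF yH f(1)] by (simp only: minus_apply right_minus_eq)
    have 2: "x i j = td (n - 1) (f (Suc j)) i j"
      using f(3)[of j "Suc j" i, OF lessI] by (simp only: minus_apply right_minus_eq)
    show "td (n - 1) y i j = x i j" unfolding 1 2 ..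
  qed
  ultimately show ?thesis using yH by blast
qed

lemma surjective:
  assumes g: "g \<in> mat_Hom D (map_sums P a) (map_sums P b) n"
  shows "\<exists>f\<in>MH n. MP n f = g"
proof -
  have gH: "g i j \<in> Hom D (FOb P (ob_at a j)) (FOb P (ob_at b i)) (n + sh_at b i - sh_at a j)"
    if "j \<in> dom a" "i \<in> dom b" for i j
    using target.mat_entry[OF g, of j i] that unfolding map_sums_simps(1)
    by (simp add: map_sums_simps del: comp_apply)
  \<comment> \<open>Zero entries are lifted by 0, so that columns stay finite.\<close>
  define f where "f i j = (if g i j = 0 then 0 else (SOME h. h \<in> Hom C (ob_at a j) (ob_at b i) (n + sh_at b i - sh_at a j)
    \<and> FMor P (ob_at a j) (ob_at b i) (n + sh_at b i - sh_at a j) h = g i j))" for i j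
  have f: "f i j \<in> Hom C (ob_at a j) (ob_at b i) (n + sh_at b i - sh_at a j)
      \<and> FMor P (ob_at a j) (ob_at b i) (n + sh_at b i - sh_at a j) (f i j) = g i j"
    if ij: "j \<in> dom a" "i \<in> dom b" for i j
  proof (cases "g i j = 0")
    case True
    then show ?thesis using source.zero_Hom[OF a_Ob b_Ob] FMor_zero[OF a_Ob b_Ob] ij by (simp add: f_def)
  next
    case False
    have "\<exists>h. h \<in> Hom C (ob_at a j) (ob_at b i) (n + sh_at b i - sh_at a j)
        \<and> FMor P (ob_at a j) (ob_at b i) (n + sh_at b i - sh_at a j) h = g i j"
      using surj_Hom[OF a_Ob[OF ij(1)] b_Ob[OF ij(2)] gH[OF ij]] by blast
    from someI_ex[OF this] show ?thesis using False by (simp add: f_def)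
  qed
  have out: "g i j = 0" if "j \<notin> dom a \<or> i \<notin> dom b" for i j
    using target.mat_outside[OF g, of j i] that unfolding map_sums_simps(1) .
  have "f \<in> MH n"
  proof (rule source.mat_HomI)
    fix j
    have "{i. f i j \<noteq> 0} \<subseteq> {i. g i j \<noteq> 0}" by (auto simp: f_def)
    then show "finite {i. f i j \<noteq> 0}" using target.mat_finite[OF g] by (rule finite_subset)
  qed (use f out in \<open>simp_all add: f_def\<close>)
  moreover have "MP n f = g"
    by (rule target.mat_eqI[of a b]) (use f out in \<open>auto simp: mat_fun_eq simp del: domIff\<close>)
  ultimately show ?thesis by blast
qed

end

context trivial_fibration
begin

lemma trivial_fibration_tw_fun:
  assumes S: "S \<subseteq> twisted_complexes C" "S' \<subseteq> twisted_complexes D"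
    and maps: "\<And>X. X \<in> S \<Longrightarrow> FOb (tw_fun P) X \<in> S'"
    and surj: "\<And>Y. Y \<in> S' \<Longrightarrow> \<exists>X\<in>S. FOb (tw_fun P) X = Y"
  shows "trivial_fibration (all_twisted C\<lparr>Ob := S\<rparr>) (all_twisted D\<lparr>Ob := S'\<rparr>) (tw_fun P)"
proof -
  interpret T: dg_functor "all_twisted C\<lparr>Ob := S\<rparr>" "all_twisted D\<lparr>Ob := S'\<rparr>" "tw_fun P"
    by (rule dg_functor_tw_fun[OF S maps])
  have pair: "twisted_pair C D P X Y" if "X \<in> S" "Y \<in> S" for X Y
    using that S(1) by unfold_locales auto
  show ?thesis
  proof (unfold_locales, goal_cases)
    case (1 Z)
    then show ?case using surj by simp
  next
    case (2 X Y g n)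
    then show ?case using twisted_pair.surjective[OF pair, of X Y g n]
      by (simp add: all_twisted_def tw_fun_simps)
  next
    case (3 X Y f n)
    then show ?case using twisted_pair.acyclic[OF pair, of X Y f n]
      by (simp add: all_twisted_def tw_fun_simps)
  qed
qed

end

lemma (in dg_functor) tw_fun_Tw:
  assumes "X \<in> Ob (Tw C)"
  shows "FOb (tw_fun F) X \<in> Ob (Tw D)"
  using assms tw_fun_Ob[of X] by (simp add: Tw_def tw_fun_simps map_sums_simps(1) del: dom_map_option_comp)

text \<open>Perfectness is a retract condition in cohomology, which every dg functor
  preserves.\<close>

lemma (in dg_functor) tw_fun_Perf:
  assumes "X \<in> Ob (Perf C)"
  shows "FOb (tw_fun F) X \<in> Ob (Perf D)"
proof -
  interpret T: dg_functor "all_twisted C\<lparr>Ob := twisted_complexes C\<rparr>" "all_twisted D\<lparr>Ob := twisted_complexes D\<rparr>" "tw_fun F"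
    by (rule dg_functor_tw_fun) (auto intro: tw_fun_Ob)
  have eq: "all_twisted E\<lparr>Ob := twisted_complexes E\<rparr> = all_twisted E" for E :: "('x, 'y, 'z::ab_group_add) dgcat"
    by (simp add: all_twisted_def)
  from assms obtain X0 where X: "X \<in> twisted_complexes C" "X0 \<in> Ob (Tw C)" "H0_retract (all_twisted C) X X0"
    by (auto simp: Perf_def)
  have Ob: "Ob (all_twisted E) = twisted_complexes E" for E :: "('x, 'y, 'z::ab_group_add) dgcat"
    by (simp add: all_twisted_def)
  have "X0 \<in> twisted_complexes C" using X(2) by (simp add: Tw_def)
  with X T.H0_retract_image[of X X0, unfolded eq Ob] have "H0_retract (all_twisted D) (FOb (tw_fun F) X) (FOb (tw_fun F) X0)"
    by blast
  with tw_fun_Ob[OF X(1)] tw_fun_Tw[OF X(2)] show ?thesis by (auto simp: Perf_def)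
qed

text \<open>Surjectivity on objects asks for an equality of twisted complexes; a strict one-sided
  inverse provides it entry by entry.\<close>

lemma (in dg_functor) tw_fun_retraction:
  assumes P: "dg_functor D C P" and ret: "dgfun_eq C (P \<circ>\<^sub>d\<^sub>g F) id_dgfun" and X: "X \<in> twisted_complexes C"
  shows "FOb (tw_fun P) (FOb (tw_fun F) X) = X"
proof (rule twc.expand)
  interpret P: dg_functor D C P by fact
  have ob: "FOb P (FOb F A) = A" if "A \<in> Ob C" for A
    using ret that by (simp add: dgfun_eq_def comp_dgfun_def id_dgfun_def)
  have mor: "FMor P (FOb F A) (FOb F B) n (FMor F A B n f) = f" if "A \<in> Ob C" "B \<in> Ob C" "f \<in> Hom C A B n" for A B n f
    using ret that by (simp add: dgfun_eq_def comp_dgfun_def id_dgfun_def)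
  let ?a = "tw_sum X"
  note t = source.twistedD[OF X]
  have sum: "map_sums P (map_sums F ?a) = ?a"
  proof
    fix j show "map_sums P (map_sums F ?a) j = ?a j"
    proof (cases "?a j")
      case (Some z)
      then have "fst z \<in> Ob C" using source.sums_Ob[OF t(1), of j] by auto
      with Some show ?thesis by (cases z) (simp add: ob)
    qed simp
  qed
  have "mat_fun P (map_sums F ?a) (map_sums F ?a) 1 (mat_fun F ?a ?a 1 (tw_q X)) = tw_q X"
  proof (rule source.mat_eqI[of ?a ?a])
    fix i j assume ij: "j \<in> dom ?a" "i \<in> dom ?a"
    then show "mat_fun P (map_sums F ?a) (map_sums F ?a) 1 (mat_fun F ?a ?a 1 (tw_q X)) i j = tw_q X i j"
      unfolding mat_fun_eq map_sums_simps(1)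
      by (simp add: map_sums_simps(2,3) mor[OF source.sums_Ob[OF t(1) ij(1)] source.sums_Ob[OF t(1) ij(2)]
            source.mat_entry[OF t(2) ij]] del: comp_apply)
  next
    fix i j assume ij: "j \<notin> dom ?a \<or> i \<notin> dom ?a"
    then show "mat_fun P (map_sums F ?a) (map_sums F ?a) 1 (mat_fun F ?a ?a 1 (tw_q X)) i j = 0"
      unfolding mat_fun_eq map_sums_simps(1) by auto
    show "tw_q X i j = 0" by (rule source.mat_outside[OF t(2) ij])
  qed
  with sum show "tw_sum (FOb (tw_fun P) (FOb (tw_fun F) X)) = tw_sum X \<and> tw_q (FOb (tw_fun P) (FOb (tw_fun F) X)) = tw_q X"
    unfolding tw_fun_simps P.tw_fun_simps by blast
qed

text \<open>The section \<open>i\<close> preserves finite and perfect twisted complexes, so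
  \<open>tw_fun P\<close> is surjective on objects and again a trivial fibration; one argument thus
  covers all three notions of weak equivalence.\<close>

lemma (in trivial_fibration) weak_equivalence:
  assumes i: "dg_functor D C i" and ret: "dgfun_eq D (P \<circ>\<^sub>d\<^sub>g i) id_dgfun"
  shows "weak_equivalence M C D P"
proof -
  interpret i: dg_functor D C i by fact
  have "quasi_equivalence (Tw C) (Tw D) (tw_fun P)"
    unfolding Tw_def
  proof (rule trivial_fibration.quasi_equivalence[OF trivial_fibration_tw_fun])
    show "FOb (tw_fun P) X \<in> {X \<in> twisted_complexes D. finite (dom (tw_sum X))}"
      if "X \<in> {X \<in> twisted_complexes C. finite (dom (tw_sum X))}" for X
      using tw_fun_Tw[of X] that by (simp add: Tw_def)
    show "\<exists>X\<in>{X \<in> twisted_complexes C. finite (dom (tw_sum X))}. FOb (tw_fun P) X = Y"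
      if "Y \<in> {X \<in> twisted_complexes D. finite (dom (tw_sum X))}" for Y
      using i.tw_fun_Tw[of Y] i.tw_fun_retraction[OF dg_functor_axioms ret, of Y] that
      by (intro bexI[of _ "FOb (tw_fun i) Y"]) (simp_all add: Tw_def)
  qed auto
  moreover have "quasi_equivalence (Perf C) (Perf D) (tw_fun P)"
    unfolding Perf_def
  proof (rule trivial_fibration.quasi_equivalence[OF trivial_fibration_tw_fun])
    show "FOb (tw_fun P) X \<in> {Q \<in> twisted_complexes D. \<exists>X\<in>Ob (Tw D). H0_retract (all_twisted D) Q X}"
      if "X \<in> {Q \<in> twisted_complexes C. \<exists>X\<in>Ob (Tw C). H0_retract (all_twisted C) Q X}" for X
      using tw_fun_Perf[of X] that by (simp add: Perf_def)
    show "\<exists>X\<in>{Q \<in> twisted_complexes C. \<exists>X\<in>Ob (Tw C). H0_retract (all_twisted C) Q X}. FOb (tw_fun P) X = Y"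
      if "Y \<in> {Q \<in> twisted_complexes D. \<exists>X\<in>Ob (Tw D). H0_retract (all_twisted D) Q X}" for Y
      using i.tw_fun_Perf[of Y] i.tw_fun_retraction[OF dg_functor_axioms ret, of Y] that
      by (intro bexI[of _ "FOb (tw_fun i) Y"]) (simp_all add: Perf_def)
  qed auto
  ultimately show ?thesis
    using dg_functor_axioms quasi_equivalence by (cases M) (simp_all add: weak_equivalence_def)
qed

lemma (in semifree_dgcat) proj_in1_retraction: "dgfun_eq C (cyl_proj C G \<circ>\<^sub>d\<^sub>g cyl_in1 C G) id_dgfun"
proof -
  have "FMor (cyl_proj C G) (Inl A) (Inl B) n (in1_comb (expand C G A B n f)) = f"
    if "A \<in> Ob C" "B \<in> Ob C" "f \<in> Hom C A B n" for A B n f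
    using cyl_proj_simps(2)[OF in1_comb_combs[OF expand_combs[OF that]] InlI InlI] that
    by (simp add: proj_in1 comb_val_expand untag_def)
  then show ?thesis
    by (simp add: dgfun_eq_def comp_dgfun_def id_dgfun_def cyl_in1_def cyl_proj_simps(1) untag_def)
qed

section \<open>The cylinder functor and its axioms\<close>

section \<open>The cylinder functor\<close>

lemma semifree_functorI:
  "\<lbrakk>semifree C G; semifree D H; dg_functor C D F\<rbrakk> \<Longrightarrow> semifree_functor C G D H F"
  by (simp add: semifree_functor_def semifree_dgcatI)

lemma semifree_ordered:
  assumes "semifree C G"
  obtains r where "ordered_semifree_dgcat C G r"
proof -
  from assms obtain r where wo: "well_order_on G r"
    and low: "\<forall>e\<in>G. Diff C (asrc e) (atgt e) (adeg e) (amor e)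
       \<in> comb_val C (asrc e) ` arrow_combs (underS r e) (asrc e) (atgt e) (adeg e + 1)"
    unfolding semifree_def by (elim conjE exE)
  have "ordered_semifree_dgcat C G r"
    by (intro ordered_semifree_dgcat.intro semifree_dgcatI[OF assms] ordered_semifree_dgcat_axioms.intro
        wo bspec[OF low])
  then show ?thesis by (rule that)
qed

theorem theorem1:
  fixes C :: "('k::{comm_ring,comm_monoid_mult}, 'o1, 'm1::ab_group_add) dgcat"
    and D :: "('k, 'o2, 'm2::ab_group_add) dgcat"
    and E :: "('k, 'o3, 'm3::ab_group_add) dgcat"
    and GC :: "('o1, 'm1) arrow set"
    and GD :: "('o2, 'm2) arrow set"
    and GE :: "('o3, 'm3) arrow set"
    and F :: "('o1, 'm1, 'o2, 'm2) dgfun"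
    and F' :: "('o2, 'm2, 'o3, 'm3) dgfun"
    and M :: model_structure
  assumes C: "semifree C GC"
    and D: "semifree D GD"
    and E: "semifree E GE"
    and F: "dg_functor C D F"
    and F': "dg_functor D E F'"
  shows
    \<comment> \<open>Cyl is a functor\<close>
    "semifree (Cyl C GC) (cyl_gens C GC) \<and>
     dg_functor (Cyl C GC) (Cyl D GD) (Cyl_map C GC D GD F) \<and>
     dgfun_eq (Cyl C GC) (Cyl_map C GC C GC id_dgfun) id_dgfun \<and>
     dgfun_eq (Cyl C GC) (Cyl_map C GC E GE (F' \<circ>\<^sub>d\<^sub>g F))
       (Cyl_map D GD E GE F' \<circ>\<^sub>d\<^sub>g Cyl_map C GC D GD F) \<and>
     \<comment> \<open>\<open>i\<^sub>1\<close>, \<open>i\<^sub>2\<close>, \<open>p\<close> are natural transformations\<close>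
     dg_functor C (Cyl C GC) (cyl_in1 C GC) \<and>
     dg_functor C (Cyl C GC) (cyl_in2 C GC) \<and>
     dg_functor (Cyl C GC) C (cyl_proj C GC) \<and>
     dgfun_eq C (Cyl_map C GC D GD F \<circ>\<^sub>d\<^sub>g cyl_in1 C GC) (cyl_in1 D GD \<circ>\<^sub>d\<^sub>g F) \<and>
     dgfun_eq C (Cyl_map C GC D GD F \<circ>\<^sub>d\<^sub>g cyl_in2 C GC) (cyl_in2 D GD \<circ>\<^sub>d\<^sub>g F) \<and>
     dgfun_eq (Cyl C GC) (cyl_proj D GD \<circ>\<^sub>d\<^sub>g Cyl_map C GC D GD F) (F \<circ>\<^sub>d\<^sub>g cyl_proj C GC) \<and>
     \<comment> \<open>(1)\<close>
     dgfun_eq (double C) (cyl_proj C GC \<circ>\<^sub>d\<^sub>g copair (cyl_in1 C GC) (cyl_in2 C GC)) codiagonal \<and>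
     \<comment> \<open>(2)\<close>
     cofibration (double C) (Cyl C GC) (copair (cyl_in1 C GC) (cyl_in2 C GC)) \<and>
     \<comment> \<open>(3)\<close>
     weak_equivalence M (Cyl C GC) C (cyl_proj C GC) \<and>
     fibration TYPE('u \<times> 'v::ab_group_add) M (Cyl C GC) C (cyl_proj C GC)"
proof -
  interpret F: semifree_functor C GC D GD F by (rule semifree_functorI[OF C D F])
  interpret F': semifree_functor D GD E GE F' by (rule semifree_functorI[OF D E F'])
  obtain r where "ordered_semifree_dgcat C GC r" using C by (rule semifree_ordered)
  then interpret O: ordered_semifree_dgcat C GC r .
  interpret P: trivial_fibration "Cyl C GC" C "cyl_proj C GC" by (rule F.C.trivial_fibration_proj)
  show ?thesis
    by (intro conjI O.semifree_Cyl F.dg_functor_Cyl_map F.C.Cyl_map_id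
        Cyl_map_comp[OF F.semifree_functor_axioms F'.semifree_functor_axioms]
        F.C.dg_functor_in1 F.C.dg_functor_in2 F.C.dg_functor_proj F.Cyl_map_in1 F.Cyl_map_in2 F.Cyl_map_proj
        F.C.codiagonal_factors O.cofibration_ends P.fibration
        P.weak_equivalence[OF F.C.dg_functor_in1 F.C.proj_in1_retraction])
qed

end
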